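(* Let $d\in\mathbb{N}$, $\gamma\in\mathbb{R}$ and $\alpha\in\mathbb{R}$ satisfy $\gamma>-\min(2,d)$ and $\alpha>\alpha_F(d,\gamma):=1+\frac{2+\gamma}{d}$. Let $\tilde s\in\mathbb{R}$ be such that $$\max\left\{-\frac d\alpha,\ \frac{\gamma}{\alpha-1}\right\}<\tilde s<\frac{2+\gamma}{\alpha-1}.$$ Let $q\in[1,\infty]$ be such that $$\alpha\le q\le\infty\quad\text{and}\quad-\frac{\tilde s}{d}<\frac1q<\min\left\{\frac{2}{d(\alpha-1)},\ \frac1\alpha\left(1-\frac{\tilde s}{d}\right),\ \frac1d\left(\frac{2+\gamma}{\alpha-1}-\tilde s\right)\right\}$$ and let $s\in\mathbb{R}$ be such that $$\frac{\tilde s+\gamma}{\alpha}\le s\quad\text{and}\quad-\frac dq<s<\min\left\{\frac{d+\gamma}{\alpha}-\frac dq,\ \tilde s\right\}.$$ Then the Cauchy problem $\partial_tu-\Delta u=|x|^\gamma|u|^{\alpha-1}u$, $u(0)=u_0$, is locally well-posed in $L^q_{\tilde s}(\mathbb{R}^d)$ for arbitrary data $u_0\in L^q_{\tilde s}(\mathbb{R}^d)$. More precisely: (i) (Existence) For any $u_0\in L^q_{\tilde s}(\mathbb{R}^d)$, there exist a positive number $T$ depending only on $\|u_0\|_{L^q_{\tilde s}}$ and an $L^q_{\tilde s}(\mathbb{R}^d)$-mild solution $u$ satisfying $\|u\|_{\tilde{\mathcal{K}}^s(T)}\le2\|e^{t\Delta}u_0\|_{\tilde{\mathcal{K}}^s(T)}$.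 Moreover, the solution can be extended to the maximal interval $[0,T_m)$. (ii) (Uniqueness in $\tilde{\mathcal{K}}^s(T)$) Let $T>0$. If $u,v\in\tilde{\mathcal{K}}^s(T)$ satisfy the integral equation with $u(0)=v(0)=u_0$, then $u=v$ on $[0,T]$. (iii) (Continuous dependence on initial data) For any initial data $u_0$ and $v_0$ in $L^q_{\tilde s}(\mathbb{R}^d)$, let $T(u_0)$ and $T(v_0)$ be the corresponding existence times given by (i). Then there exists a constant $C$ depending on $u_0$ and $v_0$ such that the corresponding solutions $u$ and $v$ satisfy $$\|u-v\|_{L^\infty(0,T;L^q_{\tilde s})\cap\tilde{\mathcal{K}}^s(T)}\le C\|u_0-v_0\|_{L^q_{\tilde s}}$$ for some $T\le\min\{T(u_0),T(v_0)\}$. (iv) (Blow-up criterion) If $T_m<\infty$, then $\lim_{t\to T_m-0}\|u(t)\|_{L^q_{\tilde s}}=\infty$. Moreover, there exists a positive constant $C$ independent of $t$ such that, with $s_c:=\frac{2+\gamma}{\alpha-1}-\frac dq$, $$\|u(t)\|_{L^q_{\tilde s}}\ge\frac{C}{(T_m-t)^{\frac{s_c-\tilde s}{2}}}\quad\text{for }t\in(0,T_m).$$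
   Context: Functions are real- or complex-valued. For $s\in\mathbb{R}$, $q\in[1,\infty]$, $L^q_s(\mathbb{R}^d)$ is the space of Lebesgue measurable $f$ on $\mathbb{R}^d$ with $\|f\|_{L^q_s}:=\||x|^sf\|_{L^q}<\infty$. $e^{t\Delta}\varphi:=g_t*\varphi$ with $g_t(x)=(4\pi t)^{-d/2}e^{-|x|^2/(4t)}$. For $T\in(0,\infty]$, $s<\tilde s<s_c$, $\|u\|_{\tilde{\mathcal{K}}^s(T)}:=\sup_{0\le t\le T}t^{\frac{\tilde s-s}{2}}\|u(t)\|_{L^q_s}$ (the term $t=0$ is understood as $0$, and the supremum is over $t$ in the domain of $u$). $\tilde{\mathcal{K}}^s(T)$ is the set of $u\in\mathscr{D}'([0,T)\times\mathbb{R}^d)$ with $\|u\|_{\tilde{\mathcal{K}}^s(T')}<\infty$ for any $T'\in(0,T)$, endowed with the norm $\|\cdot\|_{\tilde{\mathcal{K}}^s(T)}$. The integral equation is $$u(t,x)=e^{t\Delta}u_0(x)+\int_0^te^{(t-\tau)\Delta}\left\{|\cdot|^\gamma|u(\tau,\cdot)|^{\alpha-1}u(\tau,\cdot)\right\}(x)\,d\tau.$$ For $u_0\in L^q_{\tilde s}(\mathbb{R}^d)$, $u$ on $[0,T]\times\mathbb{R}^d$ is an $L^q_{\tilde s}(\mathbb{R}^d)$-mild solution with $u(0)=u_0$ if $u\in C([0,T];L^q_{\tilde s}(\mathbb{R}^d))\cap\tilde{\mathcal{K}}^s(T)$ and the integral equation holds for any $t\in[0,T]$ and almost every $x\in\mathbb{R}^d$.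 The maximal existence time $T_m=T_m(u_0)$ is the supremum of all $T>0$ such that there exists a unique solution in $C([0,T];L^q_{\tilde s}(\mathbb{R}^d))\cap\tilde{\mathcal{K}}^s(T)$ with initial data $u_0$.
   Formalization: For q=∞, continuity in C([0,T];L^∞_{s̃}) at t=0 is taken weak-* (against L^1_{-s̃}), norm continuity being kept for t>0; with norm continuity at t=0 existence fails, e.g. d=3, γ=0, α=3, s̃=1/2, s=1/4, u_0=|x|^{-1/2}1_{x_1>0}. *)

theory Defs
  imports "HOL-Probability.Essential_Supremum"
begin

text \<open>Space is a Euclidean space \<^typ>\<open>'a\<close>, so that \<open>d = DIM('a)\<close>. Functions on space are
  represented by functions \<open>'a \<Rightarrow> 'k\<close>, identified when they agree almost everywhere.
  Space-time functions are curried, with the time variable first. Lebesgue exponents in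
  \<open>[1,\<infinity>]\<close> have type \<^typ>\<open>ereal\<close>.\<close>

definition recip :: "ereal \<Rightarrow> real"
  where "recip q = real_of_ereal (1 / q)"

definition wnorm :: "ereal \<Rightarrow> real \<Rightarrow> ('a::euclidean_space \<Rightarrow> 'k::euclidean_space) \<Rightarrow> ennreal"
  where "wnorm q s f =
    (if q = \<infinity> then esssup lebesgue (\<lambda>x. ennreal (norm x powr s * norm (f x)))
     else let p = real_of_ereal q;
              I = \<integral>\<^sup>+ x. ennreal ((norm x powr s * norm (f x)) powr p) \<partial>lebesgue
          in if I = \<infinity> then \<infinity> else ennreal (enn2real I powr (1 / p)))"

definition wLq :: "ereal \<Rightarrow> real \<Rightarrow> ('a::euclidean_space \<Rightarrow> 'k::euclidean_space) set"
  where "wLq q s = {f \<in> borel_measurable lebesgue. wnorm q s f < \<infinity>}"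

definition heat_kernel :: "real \<Rightarrow> 'a::euclidean_space \<Rightarrow> real"
  where "heat_kernel t x =
    (4 * pi * t) powr (- (real DIM('a) / 2)) * exp (- ((norm x)\<^sup>2 / (4 * t)))"

definition heat :: "real \<Rightarrow> ('a::euclidean_space \<Rightarrow> 'k::euclidean_space) \<Rightarrow> 'a \<Rightarrow> 'k"
  where "heat t f x =
    (if t = 0 then f x else (LINT y|lebesgue. heat_kernel t (x - y) *\<^sub>R f y))"

definition nonlinearity ::
  "real \<Rightarrow> real \<Rightarrow> ('a::euclidean_space \<Rightarrow> 'k::euclidean_space) \<Rightarrow> 'a \<Rightarrow> 'k"
  where "nonlinearity \<gamma> \<alpha> f x = (norm x powr \<gamma> * norm (f x) powr (\<alpha> - 1)) *\<^sub>R f x"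

text \<open>The integral equation at time \<open>t\<close> and point \<open>x\<close>. A Bochner integral that does not converge
  has the value \<open>0\<close> in the library, so the convergence of all integrals is part of the
  equation.\<close>

definition integral_equation_at :: "real \<Rightarrow> real \<Rightarrow> ('a::euclidean_space \<Rightarrow> 'k::euclidean_space)
    \<Rightarrow> (real \<Rightarrow> 'a \<Rightarrow> 'k) \<Rightarrow> real \<Rightarrow> 'a \<Rightarrow> bool"
  where "integral_equation_at \<gamma> \<alpha> u0 u t x \<longleftrightarrow>
    (t > 0 \<longrightarrow> integrable lebesgue (\<lambda>y. heat_kernel t (x - y) *\<^sub>R u0 y)) \<and>
    (AE \<tau> in lebesgue. \<tau> \<in> {0<..<t} \<longrightarrow>
       integrable lebesgue (\<lambda>y. heat_kernel (t - \<tau>) (x - y) *\<^sub>R nonlinearity \<gamma> \<alpha> (u \<tau>) y)) \<and>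
    set_integrable lebesgue {0..t} (\<lambda>\<tau>. heat (t - \<tau>) (nonlinearity \<gamma> \<alpha> (u \<tau>)) x) \<and>
    u t x = heat t u0 x + (LINT \<tau>:{0..t}|lebesgue. heat (t - \<tau>) (nonlinearity \<gamma> \<alpha> (u \<tau>)) x)"

definition solves_integral_equation :: "real \<Rightarrow> real \<Rightarrow> real
    \<Rightarrow> ('a::euclidean_space \<Rightarrow> 'k::euclidean_space) \<Rightarrow> (real \<Rightarrow> 'a \<Rightarrow> 'k) \<Rightarrow> bool"
  where "solves_integral_equation \<gamma> \<alpha> T u0 u \<longleftrightarrow>
    (\<forall>t\<in>{0..T}. AE x in lebesgue. integral_equation_at \<gamma> \<alpha> u0 u t x)"

definition kato_norm :: "ereal \<Rightarrow> real \<Rightarrow> real \<Rightarrow> real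
    \<Rightarrow> (real \<Rightarrow> 'a::euclidean_space \<Rightarrow> 'k::euclidean_space) \<Rightarrow> ennreal"
  where "kato_norm q s s' T u =
    (SUP t\<in>{0<..T}. ennreal (t powr ((s' - s) / 2)) * wnorm q s (u t))"

text \<open>Here \<open>s'\<close> plays the role of $\tilde s$. An element of the space has a well-defined time
  slice at every positive time, so the ambient space of distributions is rendered by the jointly
  measurable functions on \<open>[0,T) \<times> 'a\<close> with measurable slices.\<close>

definition kato_space :: "ereal \<Rightarrow> real \<Rightarrow> real \<Rightarrow> real
    \<Rightarrow> (real \<Rightarrow> 'a::euclidean_space \<Rightarrow> 'k::euclidean_space) set"
  where "kato_space q s s' T =
    {u. (\<lambda>(t, x). u t x) \<in> borel_measurable (lebesgue_on ({0..<T} \<times> UNIV)) \<and>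
        (\<forall>t\<in>{0<..<T}. u t \<in> borel_measurable lebesgue) \<and>
        (\<forall>T'\<in>{0<..<T}. kato_norm q s s' T' u < \<infinity>)}"

text \<open>The space $C([0,T];L^q_s)$. The heat semigroup is not strongly continuous at \<open>t = 0\<close> on
  $L^\infty_s$: if \<open>heat t f\<close> tends to \<open>f\<close> in this space, then \<open>f\<close> has a representative that is
  continuous away from the origin. As usual for \<open>q = \<infinity>\<close>, continuity at \<open>t = 0\<close> (and only there) is
  therefore taken in the weak-* topology of $L^\infty_s = (L^1_{-s})^*$.\<close>

definition wLq_tendsto :: "ereal \<Rightarrow> real \<Rightarrow> (real \<Rightarrow> 'a::euclidean_space \<Rightarrow> 'k::euclidean_space)
    \<Rightarrow> ('a \<Rightarrow> 'k) \<Rightarrow> real filter \<Rightarrow> bool"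
  where "wLq_tendsto q s u f F \<longleftrightarrow> ((\<lambda>t. wnorm q s (\<lambda>x. u t x - f x)) \<longlongrightarrow> 0) F"

definition weak_star_tendsto :: "real \<Rightarrow> (real \<Rightarrow> 'a::euclidean_space \<Rightarrow> 'k::euclidean_space)
    \<Rightarrow> ('a \<Rightarrow> 'k) \<Rightarrow> real filter \<Rightarrow> bool"
  where "weak_star_tendsto s u f F \<longleftrightarrow>
    (\<forall>\<phi> :: 'a \<Rightarrow> real. \<phi> \<in> wLq 1 (- s) \<longrightarrow>
       ((\<lambda>t. LINT x|lebesgue. \<phi> x *\<^sub>R u t x) \<longlongrightarrow> (LINT x|lebesgue. \<phi> x *\<^sub>R f x)) F)"

definition continuous_wLq :: "ereal \<Rightarrow> real \<Rightarrow> real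
    \<Rightarrow> (real \<Rightarrow> 'a::euclidean_space \<Rightarrow> 'k::euclidean_space) set"
  where "continuous_wLq q s T =
    {u. (\<forall>t\<in>{0..T}. u t \<in> wLq q s) \<and>
        (\<forall>t\<in>{0..T}. if q = \<infinity> \<and> t = 0
           then weak_star_tendsto s u (u t) (at t within {0..T})
           else wLq_tendsto q s u (u t) (at t within {0..T}))}"

definition mild_solution :: "real \<Rightarrow> real \<Rightarrow> ereal \<Rightarrow> real \<Rightarrow> real \<Rightarrow> real
    \<Rightarrow> ('a::euclidean_space \<Rightarrow> 'k::euclidean_space) \<Rightarrow> (real \<Rightarrow> 'a \<Rightarrow> 'k) \<Rightarrow> bool"
  where "mild_solution \<gamma> \<alpha> q s s' T u0 u \<longleftrightarrow>
    u \<in> continuous_wLq q s' T \<inter> kato_space q s s' T \<and>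
    (AE x in lebesgue. u 0 x = u0 x) \<and>
    solves_integral_equation \<gamma> \<alpha> T u0 u"

definition max_time :: "real \<Rightarrow> real \<Rightarrow> ereal \<Rightarrow> real \<Rightarrow> real
    \<Rightarrow> ('a::euclidean_space \<Rightarrow> 'k::euclidean_space) \<Rightarrow> ereal"
  where "max_time \<gamma> \<alpha> q s s' u0 =
    Sup {ereal T | T. T > 0 \<and>
      (\<exists>u. mild_solution \<gamma> \<alpha> q s s' T u0 u \<and>
        (\<forall>v. mild_solution \<gamma> \<alpha> q s s' T u0 v \<longrightarrow>
          (\<forall>t\<in>{0..T}. AE x in lebesgue. v t x = u t x)))}"

definition maximal_solution :: "real \<Rightarrow> real \<Rightarrow> ereal \<Rightarrow> real \<Rightarrow> real
    \<Rightarrow> ('a::euclidean_space \<Rightarrow> 'k::euclidean_space) \<Rightarrow> (real \<Rightarrow> 'a \<Rightarrow> 'k) \<Rightarrow> bool"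
  where "maximal_solution \<gamma> \<alpha> q s s' u0 u \<longleftrightarrow>
    (\<forall>T>0. ereal T < max_time \<gamma> \<alpha> q s s' u0 \<longrightarrow> mild_solution \<gamma> \<alpha> q s s' T u0 u)"

definition Linf_wnorm :: "ereal \<Rightarrow> real \<Rightarrow> real
    \<Rightarrow> (real \<Rightarrow> 'a::euclidean_space \<Rightarrow> 'k::euclidean_space) \<Rightarrow> ennreal"
  where "Linf_wnorm q s T w = esssup (lebesgue_on {0<..<T}) (\<lambda>t. wnorm q s (w t))"

end

theory Submission
  imports Defs "HOL-Probability.Distributions" "HOL-Real_Asymp.Real_Asymp"
begin

text \<open>Solutions are fixed points of the map $u \mapsto e^{t\Delta}u_0 + \int_0^t e^{(t-\tau)\Delta} N(u(\tau))\,d\tau$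
  with $N(u) = |x|^\gamma |u|^{\alpha-1}u$. The weight of a Gaussian convolution can be moved from one
  variable to the other at the price of powers of $\sqrt t + |x|$, and the Schur test with power
  weights turns this into the smoothing estimates $L^{q_1}_{s_1} \to L^{q_2}_{s_2}$ of the heat semigroup.
  If $\|u(\tau)\|_{L^q_s} \le M \tau^{-\sigma}$ with $\sigma = (s'-s)/2$, then $N(u(\tau))$ lies in
  $L^{q/\alpha}_{\alpha s-\gamma}$, and the Duhamel term is at most $C M^\alpha t^\delta$ in $L^q_{s'}$ and
  $C M^\alpha t^{\delta-\sigma}$ in $L^q_s$, where $\delta = \frac{\alpha-1}{2}(s_c - s') > 0$. Hence Picard iteration
  converges up to a time of order $\|u_0\|^{-(\alpha-1)/\delta}$. Exponential weights in time make the
  map a contraction on every bounded interval, which gives unconditional uniqueness in the Kato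
  space. Continuity in $L^q_{s'}$ at positive times follows from a Hoelder estimate for the heat
  kernel, at time zero from density of continuous functions or, for $q = \infty$, by duality.
  Finally, restarting at a time $t$ and gluing extends a solution by a time of order
  $\|u(t)\|^{-(\alpha-1)/\delta}$, so this time is at most $T_m - t$ up to a constant; this is the lower bound for the
  blow-up rate.\<close>

section \<open>Bounds for weighted Lebesgue norms\<close>

text \<open>The parameters act through few facts. A smoothing estimate can only lower the weight, so
  s' + \<gamma> \<le> \<alpha> s is what lets the nonlinearity, of weight \<alpha> s - \<gamma>, be
  mapped back both to weight s and to weight s'. The other bounds on s and s' express local
  integrability, of the weights on the target side and of the functions themselves on the source
  side; and s' < s_c is \<delta> > 0. The obstacle that shapes the proof is convergence: no
  convolution and no time integral of a function in the Kato space is known to exist beforehand, and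
  a solution is given only up to null sets at each time. Estimates are therefore proved for
  operators on [0,\<infinity>]-valued functions, where they also yield finiteness almost everywhere
  and hence existence of the Bochner integrals. A given solution is replaced by the right-hand side
  of its equation, formed with a jointly Borel version: this right-hand side depends only on classes
  at almost every time, so it repairs all exceptional null sets at once.\<close>

definition epow :: "ennreal \<Rightarrow> real \<Rightarrow> ennreal"
  where "epow x p = (if x = top then top else ennreal (enn2real x powr p))"

lemma epow_ennreal [simp]: "0 \<le> a \<Longrightarrow> epow (ennreal a) p = ennreal (a powr p)"
  by (simp add: epow_def)

lemma epow_top [simp]: "epow top p = top"
  by (simp add: epow_def)

lemma epow_zero [simp]: "epow 0 p = 0"
  by (simp add: epow_def)

lemma epow_one [simp]: "epow x 1 = x"
  by (cases x) auto

lemma epow_mono: "x \<le> y \<Longrightarrow> 0 \<le> p \<Longrightarrow> epow x p \<le> epow y p"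
  by (cases x; cases y) (auto simp: top_unique intro!: ennreal_leI powr_mono2)

text \<open>Valid for every real p, since \<open>epow\<close> fixes 0 and top whatever the exponent,
  also for p = 0 and p < 0, and 0 * top = 0.\<close>

lemma epow_mult: "epow (x * y) p = epow x p * epow y p"
proof (cases x; cases y)
  fix a b assume "x = ennreal a" "0 \<le> a" "y = ennreal b" "0 \<le> b"
  then show ?thesis by (simp add: powr_mult flip: ennreal_mult)
next
  fix a assume "x = ennreal a" "0 \<le> a" "y = top"
  then show ?thesis by (cases "a = 0") (auto simp: ennreal_mult_top)
next
  fix a assume "y = ennreal a" "0 \<le> a" "x = top"
  then show ?thesis by (cases "a = 0") (auto simp: ennreal_top_mult)
qed auto

lemma epow_epow: "epow (epow x p) r = epow x (p * r)"
  by (cases x) (auto simp: powr_powr)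

lemma epow_add: "epow x (p + r) = epow x p * epow x r"
  by (cases x) (auto simp: powr_add ennreal_mult)

lemma epow_le_iff: "0 < p \<Longrightarrow> epow x p \<le> epow y p \<longleftrightarrow> x \<le> y"
  using epow_mono[of "epow x p" "epow y p" "1 / p"] epow_mono[of x y p]
  by (auto simp: epow_epow)

lemma epow_eq_0_iff [simp]: "epow x p = 0 \<longleftrightarrow> x = 0"
  by (cases x) auto

lemma borel_measurable_epow [measurable]:
  assumes [measurable]: "f \<in> borel_measurable M"
  shows "(\<lambda>x. epow (f x) p) \<in> borel_measurable M"
  unfolding epow_def by measurable

text \<open>Convexity: this is the tangent line inequality for z^p at z = l, solved for x. Being
  affine in \<open>epow x p\<close>, it can be integrated term by term, and l is optimised only
  afterwards.\<close>

lemma le_epow_Young: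
  assumes p: "1 \<le> p" and l: "0 < l"
  shows "x \<le> ennreal (1 / p * l powr (1 - p)) * epow x p + ennreal ((1 - 1 / p) * l)"
proof (cases x)
  case top
  with assms show ?thesis by (simp add: ennreal_mult_top)
next
  case (real a)
  have "a \<le> 1 / p * l powr (1 - p) * a powr p + (1 - 1 / p) * l"
  proof (cases "a = 0")
    case True
    with assms show ?thesis by simp
  next
    case False
    with real have a: "a > 0" by simp
    have "(l powr (1 - p) * a powr p) powr (1 / p) * l powr (1 - 1 / p)
       \<le> 1 / p * (l powr (1 - p) * a powr p) + (1 - 1 / p) * l"
      using p l a by (intro Youngs_inequality_0) (auto simp: field_simps)
    moreover have "(l powr (1 - p) * a powr p) powr (1 / p) * l powr (1 - 1 / p) = a"
    proof -
      have "(l powr (1 - p) * a powr p) powr (1 / p) = l powr ((1 - p) / p) * a"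
        using p l a by (simp add: powr_mult powr_powr)
      moreover have "l powr ((1 - p) / p) * l powr (1 - 1 / p) = 1"
        using p l by (simp flip: powr_add add: field_simps)
      ultimately show ?thesis by (simp add: mult.assoc mult.commute mult.left_commute)
    qed
    ultimately show ?thesis by (simp add: mult.assoc)
  qed
  with p l real show ?thesis
    by (simp flip: ennreal_mult ennreal_plus add: ennreal_leI)
qed

text \<open>Jensen for the measure of density w, of mass at most A, applied to F / w. Young's
  inequality is used with the parameter l * w x, which depends on the point; integration leaves a
  family of bounds in the single parameter l.\<close>

lemma nn_integral_epow_Jensen:
  fixes w :: "'i \<Rightarrow> real"
  assumes [measurable]: "F \<in> borel_measurable M" "w \<in> borel_measurable M"
    and w: "\<And>x. 0 < w x" and p: "1 \<le> p" and A: "0 < A"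
    and wA: "(\<integral>\<^sup>+x. ennreal (w x) \<partial>M) \<le> ennreal A"
  shows "epow (\<integral>\<^sup>+x. F x \<partial>M) p
    \<le> ennreal (A powr (p - 1)) * (\<integral>\<^sup>+x. ennreal (w x powr (1 - p)) * epow (F x) p \<partial>M)"
    (is "_ \<le> _ * ?K")
proof (cases "?K")
  case top
  with A show ?thesis by (simp add: ennreal_mult_top)
next
  case (real k)
  have young: "(\<integral>\<^sup>+x. F x \<partial>M) \<le> ennreal (1 / p * l powr (1 - p) * k + (1 - 1 / p) * l * A)"
    if l: "0 < l" for l
  proof -
    have "F x \<le> ennreal (1 / p * l powr (1 - p)) * (ennreal (w x powr (1 - p)) * epow (F x) p)
        + ennreal ((1 - 1 / p) * l) * ennreal (w x)" for x
    proof -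
      have "F x \<le> ennreal (1 / p * (l * w x) powr (1 - p)) * epow (F x) p
          + ennreal ((1 - 1 / p) * (l * w x))"
        using le_epow_Young[OF p, of "l * w x" "F x"] l w[of x] by simp
      also have "ennreal (1 / p * (l * w x) powr (1 - p))
          = ennreal (1 / p * l powr (1 - p)) * ennreal (w x powr (1 - p))"
        using l w[of x] p by (simp add: powr_mult mult.assoc flip: ennreal_mult)
      also have "ennreal ((1 - 1 / p) * (l * w x)) = ennreal ((1 - 1 / p) * l) * ennreal (w x)"
        using l w[of x] p by (simp add: mult.assoc flip: ennreal_mult)
      finally show ?thesis by (simp add: mult.assoc)
    qed
    then have "(\<integral>\<^sup>+x. F x \<partial>M) \<le> (\<integral>\<^sup>+x. ennreal (1 / p * l powr (1 - p))
          * (ennreal (w x powr (1 - p)) * epow (F x) p)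
        + ennreal ((1 - 1 / p) * l) * ennreal (w x) \<partial>M)"
      by (intro nn_integral_mono)
    also have "\<dots> = ennreal (1 / p * l powr (1 - p)) * ?K
        + ennreal ((1 - 1 / p) * l) * (\<integral>\<^sup>+x. ennreal (w x) \<partial>M)"
      by (subst nn_integral_add) (auto simp: nn_integral_cmult)
    also have "\<dots> \<le> ennreal (1 / p * l powr (1 - p)) * ennreal k + ennreal ((1 - 1 / p) * l) * ennreal A"
      using wA real by (intro add_mono mult_left_mono) auto
    also have "\<dots> = ennreal (1 / p * l powr (1 - p) * k + (1 - 1 / p) * l * A)"
      using l p A real by (simp flip: ennreal_mult ennreal_plus)
    finally show ?thesis .
  qed
  have main: "epow (\<integral>\<^sup>+x. F x \<partial>M) p \<le> ennreal (A powr (p - 1) * k')" if k': "k < k'" for k'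
  proof -
    have k'0: "0 < k'" using k' real by simp
    \<comment> \<open>The minimiser over l of the bound in \<open>young\<close> with k' for k; both
      of its terms become multiples of l * A. Working with k' > k keeps l positive when the integral
      k vanishes.\<close>
    define l where "l = (k' / A) powr (1 / p)"
    have l: "0 < l" using k'0 A by (simp add: l_def)
    have 1: "l powr (1 - p) * k' = l * A"
    proof -
      have "l powr (1 - p) * k' = l * (l powr (- p) * k')"
        using l by (simp add: powr_diff powr_minus field_simps)
      also have "l powr (- p) = A / k'"
        using k'0 A p by (simp add: l_def powr_powr powr_minus)
      finally show ?thesis using k'0 by simp
    qed
    have "(\<integral>\<^sup>+x. F x \<partial>M) \<le> ennreal (1 / p * l powr (1 - p) * k' + (1 - 1 / p) * l * A)"
      using k' p l by (intro order_trans[OF young[OF l]] ennreal_leI add_mono mult_left_mono) auto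
    also have "1 / p * l powr (1 - p) * k' + (1 - 1 / p) * l * A = 1 / p * (l * A) + (1 - 1 / p) * (l * A)"
      by (simp add: mult.assoc 1)
    also have "\<dots> = l * A" by (simp add: algebra_simps)
    finally have "epow (\<integral>\<^sup>+x. F x \<partial>M) p \<le> epow (ennreal (l * A)) p"
      using p by (intro epow_mono) auto
    also have "\<dots> = ennreal ((l * A) powr p)" using l A by simp
    also have "(l * A) powr p = A powr (p - 1) * k'"
      using k'0 A p by (simp add: l_def powr_mult powr_powr powr_diff)
    finally show ?thesis .
  qed
  have "epow (\<integral>\<^sup>+x. F x \<partial>M) p \<le> ennreal (A powr (p - 1) * k)"
  proof (rule ennreal_le_epsilon)
    fix e :: real assume e: "0 < e"
    have "A powr (p - 1) * (k + e / A powr (p - 1)) = A powr (p - 1) * k + e"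
      using A by (simp add: algebra_simps)
    then show "epow (\<integral>\<^sup>+x. F x \<partial>M) p \<le> ennreal (A powr (p - 1) * k) + ennreal e"
      using main[of "k + e / A powr (p - 1)"] e A real by (simp flip: ennreal_plus)
  qed
  with real A show ?thesis by (simp add: ennreal_mult)
qed

text \<open>\<open>bnd (1 / q) s F B\<close> says that the norm of \<open>F\<close> in $L^q_s$ is at most \<open>B\<close>; the value \<open>0\<close> of the first
  argument encodes \<open>q = \<infinity>\<close>. Bounds are used instead of norms so that infinite values need no
  separate treatment.\<close>

definition bnd :: "real \<Rightarrow> real \<Rightarrow> ('a::euclidean_space \<Rightarrow> ennreal) \<Rightarrow> real \<Rightarrow> bool"
  where "bnd r s F B \<longleftrightarrow>
    (if r = 0 then AE x in lborel. ennreal (norm x powr s) * F x \<le> ennreal B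
     else (\<integral>\<^sup>+x. epow (ennreal (norm x powr s) * F x) (1 / r) \<partial>lborel) \<le> ennreal (B powr (1 / r)))"

lemma bnd_mono:
  assumes "bnd r s F B" "AE x in lborel. G x \<le> F x" "0 \<le> B" "B \<le> B'" "0 \<le> r"
  shows "bnd r s G B'"
proof (cases "r = 0")
  case True
  with assms(1) have "AE x in lborel. ennreal (norm x powr s) * F x \<le> ennreal B" by (simp add: bnd_def)
  with assms(2) have "AE x in lborel. ennreal (norm x powr s) * G x \<le> ennreal B'"
  proof eventually_elim
    case (elim x)
    then show ?case
      using assms(4) by (meson ennreal_leI mult_left_mono order_trans zero_le)
  qed
  with True show ?thesis by (simp add: bnd_def)
next
  case False
  have "(\<integral>\<^sup>+x. epow (ennreal (norm x powr s) * G x) (1 / r) \<partial>lborel)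
      \<le> (\<integral>\<^sup>+x. epow (ennreal (norm x powr s) * F x) (1 / r) \<partial>lborel)"
    using assms(2) assms(5)
    by (intro nn_integral_mono_AE) (auto elim!: eventually_mono intro!: epow_mono mult_left_mono)
  also have "\<dots> \<le> ennreal (B powr (1 / r))" using assms(1) False by (simp add: bnd_def)
  also have "\<dots> \<le> ennreal (B' powr (1 / r))" using assms by (intro ennreal_leI powr_mono2) auto
  finally show ?thesis using False by (simp add: bnd_def)
qed

lemma bnd_cong_AE:
  assumes "AE x in lborel. F x = G x"
  shows "bnd r s F B \<longleftrightarrow> bnd r s G B"
proof -
  have "(\<integral>\<^sup>+x. epow (ennreal (norm x powr s) * F x) (1 / r) \<partial>lborel)
      = (\<integral>\<^sup>+x. epow (ennreal (norm x powr s) * G x) (1 / r) \<partial>lborel)"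
    using assms by (intro nn_integral_cong_AE) auto
  moreover have "(AE x in lborel. ennreal (norm x powr s) * F x \<le> ennreal B)
      \<longleftrightarrow> (AE x in lborel. ennreal (norm x powr s) * G x \<le> ennreal B)"
    using assms by (intro iffI) (auto elim: AE_mp)
  ultimately show ?thesis by (simp add: bnd_def)
qed

lemma bnd_zero [simp]: "bnd r s (\<lambda>x. 0) B"
  by (auto simp: bnd_def)

lemma bnd_scale:
  assumes "bnd r s F B" "0 \<le> c" "0 \<le> B" and [measurable]: "F \<in> borel_measurable lborel"
  shows "bnd r s (\<lambda>x. ennreal c * F x) (c * B)"
proof (cases "r = 0")
  case True
  with assms have "AE x in lborel. ennreal (norm x powr s) * F x \<le> ennreal B" by (simp add: bnd_def)
  then have "AE x in lborel. ennreal (norm x powr s) * (ennreal c * F x) \<le> ennreal (c * B)"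
  proof eventually_elim
    case (elim x)
    then have "ennreal c * (ennreal (norm x powr s) * F x) \<le> ennreal c * ennreal B"
      by (intro mult_left_mono) auto
    with assms show ?case by (simp add: ennreal_mult mult_ac)
  qed
  with True show ?thesis by (simp add: bnd_def)
next
  case False
  have "(\<integral>\<^sup>+x. epow (ennreal (norm x powr s) * (ennreal c * F x)) (1 / r) \<partial>lborel)
     = (\<integral>\<^sup>+x. ennreal (c powr (1 / r)) * epow (ennreal (norm x powr s) * F x) (1 / r) \<partial>lborel)"
    using assms by (intro nn_integral_cong) (simp add: epow_mult mult_ac)
  also have "\<dots> = ennreal (c powr (1 / r)) * (\<integral>\<^sup>+x. epow (ennreal (norm x powr s) * F x) (1 / r) \<partial>lborel)"
    by (intro nn_integral_cmult) measurable
  also have "\<dots> \<le> ennreal (c powr (1 / r)) * ennreal (B powr (1 / r))"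
    using assms False by (intro mult_left_mono) (auto simp: bnd_def)
  also have "\<dots> = ennreal ((c * B) powr (1 / r))"
    using assms by (simp add: powr_mult ennreal_mult)
  finally show ?thesis using False by (simp add: bnd_def)
qed

text \<open>Allows a proof to work with bounds strictly above B, hence with positive ones, by which
  one may divide.\<close>

lemma bnd_closed:
  assumes "\<And>B'. B < B' \<Longrightarrow> bnd r s F B'" "0 \<le> B" "0 \<le> r"
  shows "bnd r s F B"
proof (cases "r = 0")
  case True
  have "\<forall>n. AE x in lborel. ennreal (norm x powr s) * F x \<le> ennreal (B + 1 / Suc n)"
    using assms(1) True by (auto simp: bnd_def)
  then have "AE x in lborel. \<forall>n. ennreal (norm x powr s) * F x \<le> ennreal (B + 1 / Suc n)"
    by (simp add: AE_all_countable)
  then have "AE x in lborel. ennreal (norm x powr s) * F x \<le> ennreal B"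
  proof eventually_elim
    case (elim x)
    have "(\<lambda>n. ennreal (B + 1 / Suc n)) \<longlonglongrightarrow> ennreal (B + 0)"
      by (intro tendsto_ennrealI tendsto_add tendsto_const LIMSEQ_Suc[OF lim_1_over_n])
    with elim show ?case
      by (intro LIMSEQ_le_const[where X="\<lambda>n. ennreal (B + 1 / Suc n)"]) auto
  qed
  with True show ?thesis by (simp add: bnd_def)
next
  case False
  with assms have r: "r > 0" by simp
  have "(\<lambda>n. ennreal ((B + 1 / Suc n) powr (1 / r))) \<longlonglongrightarrow> ennreal ((B + 0) powr (1 / r))"
    using r assms(2) by (intro tendsto_ennrealI tendsto_powr' tendsto_add tendsto_const LIMSEQ_Suc[OF lim_1_over_n])
       auto
  moreover have "(\<integral>\<^sup>+x. epow (ennreal (norm x powr s) * F x) (1 / r) \<partial>lborel) \<le> ennreal ((B + 1 / Suc n) powr (1 / r))" for n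
    using assms(1)[of "B + 1 / Suc n"] False by (simp add: bnd_def)
  ultimately have "(\<integral>\<^sup>+x. epow (ennreal (norm x powr s) * F x) (1 / r) \<partial>lborel) \<le> ennreal (B powr (1 / r))"
    by (intro LIMSEQ_le_const[where X="\<lambda>n. ennreal ((B + 1 / Suc n) powr (1 / r))"]) auto
  with False show ?thesis by (simp add: bnd_def)
qed

text \<open>The weight \<open>norm x powr s\<close> is 0 at the origin for every s, negative ones
  included; it can be cancelled only off this null set.\<close>

lemma AE_lborel_nonzero: "AE x in lborel. x \<noteq> (0::'a::euclidean_space)"
  by (intro AE_I[of _ _ "{0}"]) auto

lemma bnd_0_imp_AE_zero:
  assumes "bnd r s F 0" and [measurable]: "F \<in> borel_measurable lborel"
  shows "AE x in lborel. F x = 0"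
proof -
  have "AE x in lborel. ennreal (norm x powr s) * F x = 0"
  proof (cases "r = 0")
    case True
    with assms show ?thesis by (auto simp: bnd_def elim: eventually_mono)
  next
    case False
    with assms have "(\<integral>\<^sup>+x. epow (ennreal (norm x powr s) * F x) (1 / r) \<partial>lborel) = 0"
      by (simp add: bnd_def)
    then have "AE x in lborel. epow (ennreal (norm x powr s) * F x) (1 / r) = 0"
      by (subst (asm) nn_integral_0_iff_AE) measurable
    then show ?thesis by simp
  qed
  with AE_lborel_nonzero show ?thesis by eventually_elim auto
qed

text \<open>Turns each norm estimate for \<open>hop\<close> or \<open>duh\<close> into convergence
  of the corresponding integrals at almost every point.\<close>

lemma bnd_imp_AE_finite:
  assumes "bnd r s F B" and [measurable]: "F \<in> borel_measurable lborel"
  shows "AE x in lborel. F x < top"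
proof -
  have "AE x in lborel. ennreal (norm x powr s) * F x < top"
  proof (cases "r = 0")
    case True
    with assms show ?thesis by (auto simp: bnd_def elim!: eventually_mono intro: le_less_trans)
  next
    case False
    with assms have "(\<integral>\<^sup>+x. epow (ennreal (norm x powr s) * F x) (1 / r) \<partial>lborel) \<le> ennreal (B powr (1 / r))"
      by (simp add: bnd_def)
    then have "AE x in lborel. epow (ennreal (norm x powr s) * F x) (1 / r) \<noteq> top"
      using nn_integral_PInf_AE[of "\<lambda>x. epow (ennreal (norm x powr s) * F x) (1 / r)" lborel]
      by (simp add: less_top le_less_trans[OF _ ennreal_less_top])
    then show ?thesis by eventually_elim (auto simp: epow_def less_top split: if_splits)
  qed
  with AE_lborel_nonzero show ?thesis
    by eventually_elim (auto simp: ennreal_mult_less_top)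
qed

text \<open>Minkowski's integral inequality in majorant form: in the weighted Jensen inequality the
  weight is the majorant of the norms itself, and then Tonelli applies.\<close>

lemma bnd_nn_integral:
  fixes F :: "'i \<Rightarrow> 'a::euclidean_space \<Rightarrow> ennreal" and w :: "'i \<Rightarrow> real"
  assumes "sigma_finite_measure M"
    and [measurable]: "case_prod F \<in> borel_measurable (M \<Otimes>\<^sub>M lborel)" "w \<in> borel_measurable M"
    and w: "\<And>i. 0 < w i"
    and F: "AE i in M. bnd r s (F i) (w i)"
    and W: "(\<integral>\<^sup>+i. ennreal (w i) \<partial>M) \<le> ennreal W" "0 \<le> W"
    and r: "0 \<le> r" "r \<le> 1"
  shows "bnd r s (\<lambda>x. \<integral>\<^sup>+i. F i x \<partial>M) W"
proof -
  interpret M: sigma_finite_measure M by fact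
  interpret P: pair_sigma_finite M "lborel :: 'a measure" ..
  show ?thesis
  proof (cases "r = 0")
    case True
    have "AE i in M. AE x in lborel. ennreal (norm x powr s) * F i x \<le> ennreal (w i)"
      using F True by (simp add: bnd_def)
    then have "AE x in lborel. AE i in M. ennreal (norm x powr s) * F i x \<le> ennreal (w i)"
      by (subst (asm) P.AE_commute) measurable
    then have "AE x in lborel. ennreal (norm x powr s) * (\<integral>\<^sup>+i. F i x \<partial>M) \<le> ennreal W"
    proof eventually_elim
      case (elim x)
      have "ennreal (norm x powr s) * (\<integral>\<^sup>+i. F i x \<partial>M) = (\<integral>\<^sup>+i. ennreal (norm x powr s) * F i x \<partial>M)"
        by (intro nn_integral_cmult[symmetric]) measurable
      also have "\<dots> \<le> (\<integral>\<^sup>+i. ennreal (w i) \<partial>M)" using elim by (intro nn_integral_mono_AE)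
      finally show ?case using W(1) by (rule order_trans)
    qed
    with True show ?thesis by (simp add: bnd_def)
  next
    case False
    with r have r0: "0 < r" by simp
    define p where "p = 1 / r"
    have p: "1 \<le> p" using r r0 by (simp add: p_def)
    show ?thesis
    proof (rule bnd_closed)
      fix A assume "W < A"
      then have A: "0 < A" "(\<integral>\<^sup>+i. ennreal (w i) \<partial>M) \<le> ennreal A"
        using W by (auto intro: order_trans ennreal_leI)
      define E where "E i x = ennreal (norm x powr s) * F i x" for i x
      have [measurable]: "case_prod E \<in> borel_measurable (M \<Otimes>\<^sub>M lborel)"
        unfolding E_def by measurable
      have "(\<integral>\<^sup>+x. epow (ennreal (norm x powr s) * (\<integral>\<^sup>+i. F i x \<partial>M)) p \<partial>lborel)
          = (\<integral>\<^sup>+x. epow (\<integral>\<^sup>+i. E i x \<partial>M) p \<partial>lborel)"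
        unfolding E_def by (intro nn_integral_cong arg_cong2[where f=epow] nn_integral_cmult[symmetric]) auto
      also have "\<dots> \<le> (\<integral>\<^sup>+x. ennreal (A powr (p - 1)) *
          (\<integral>\<^sup>+i. ennreal (w i powr (1 - p)) * epow (E i x) p \<partial>M) \<partial>lborel)"
        using w p A by (intro nn_integral_mono nn_integral_epow_Jensen) auto
      also have "\<dots> = ennreal (A powr (p - 1)) * (\<integral>\<^sup>+x.
          (\<integral>\<^sup>+i. ennreal (w i powr (1 - p)) * epow (E i x) p \<partial>M) \<partial>lborel)"
        by (intro nn_integral_cmult) measurable
      also have "(\<integral>\<^sup>+x. (\<integral>\<^sup>+i. ennreal (w i powr (1 - p)) * epow (E i x) p \<partial>M) \<partial>lborel)
          = (\<integral>\<^sup>+i. (\<integral>\<^sup>+x. ennreal (w i powr (1 - p)) * epow (E i x) p \<partial>lborel) \<partial>M)"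
        by (intro P.Fubini') measurable
      also have "\<dots> \<le> (\<integral>\<^sup>+i. ennreal (w i) \<partial>M)"
      proof (rule nn_integral_mono_AE)
        show "AE i in M. (\<integral>\<^sup>+x. ennreal (w i powr (1 - p)) * epow (E i x) p \<partial>lborel) \<le> ennreal (w i)"
          using F AE_space
        proof eventually_elim
          case (elim i)
          have [measurable]: "E i \<in> borel_measurable lborel" using elim(2) by measurable
          have "(\<integral>\<^sup>+x. ennreal (w i powr (1 - p)) * epow (E i x) p \<partial>lborel)
              = ennreal (w i powr (1 - p)) * (\<integral>\<^sup>+x. epow (E i x) p \<partial>lborel)"
            by (intro nn_integral_cmult) measurable
          also have "\<dots> \<le> ennreal (w i powr (1 - p)) * ennreal (w i powr p)"
            using elim(1) False by (intro mult_left_mono) (auto simp: bnd_def p_def E_def)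
          also have "\<dots> = ennreal (w i)"
            using w[of i] by (simp flip: ennreal_mult powr_add)
          finally show ?case .
        qed
      qed
      also have "ennreal (A powr (p - 1)) * (\<integral>\<^sup>+i. ennreal (w i) \<partial>M) \<le> ennreal (A powr (p - 1)) * ennreal A"
        using A by (intro mult_left_mono) auto
      also have "\<dots> = ennreal (A powr p)"
        using A by (simp add: powr_diff flip: ennreal_mult)
      finally show "bnd r s (\<lambda>x. \<integral>\<^sup>+i. F i x \<partial>M) A"
        using False by (auto simp: bnd_def p_def mult_left_mono)
    qed (use W r in auto)
  qed
qed

text \<open>Minkowski's integral inequality over a two-point counting measure. Adding e to A and B
  makes the majorants positive, as \<open>bnd_nn_integral\<close> requires.\<close>

lemma bnd_add:
  fixes F G :: "'a::euclidean_space \<Rightarrow> ennreal"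
  assumes [measurable]: "F \<in> borel_measurable lborel" "G \<in> borel_measurable lborel"
    and FG: "bnd r s F A" "bnd r s G B" and AB: "0 \<le> A" "0 \<le> B" and r: "0 \<le> r" "r \<le> 1"
  shows "bnd r s (\<lambda>x. F x + G x) (A + B)"
proof (rule bnd_closed)
  fix C assume C: "A + B < C"
  define e where "e = (C - (A + B)) / 2"
  have e: "0 < e" using C by (simp add: e_def)
  define H where "H i = (if i then F else G)" for i :: bool
  define w where "w i = (if i then A + e else B + e)" for i :: bool
  have "bnd r s (\<lambda>x. \<integral>\<^sup>+i. H i x \<partial>count_space UNIV) C"
  proof (rule bnd_nn_integral)
    show "sigma_finite_measure (count_space (UNIV :: bool set))"
      by (intro sigma_finite_measure_count_space_finite) simp
    show "case_prod H \<in> borel_measurable (count_space UNIV \<Otimes>\<^sub>M lborel)"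
      unfolding H_def by (intro measurable_pair_measure_countable1) auto
    show "0 < w i" for i using AB e by (auto simp: w_def)
    show "AE i in count_space UNIV. bnd r s (H i) (w i)"
      using FG AB e r unfolding H_def w_def by (auto simp: AE_count_space intro: bnd_mono)
    have "A + e + (B + e) = C" by (simp add: e_def field_simps)
    then show "(\<integral>\<^sup>+i. ennreal (w i) \<partial>count_space UNIV) \<le> ennreal C"
      using AB e by (simp add: nn_integral_count_space_finite UNIV_bool w_def add.commute flip: ennreal_plus)
  qed (use AB C r in auto)
  then show "bnd r s (\<lambda>x. F x + G x) C"
    by (simp add: nn_integral_count_space_finite UNIV_bool H_def add.commute)
qed (use AB r in auto)

text \<open>Minkowski over the counting measure on the naturals; it sums the increments of the
  Picard iteration.\<close>

lemma bnd_suminf: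
  fixes F :: "nat \<Rightarrow> 'a::euclidean_space \<Rightarrow> ennreal" and w :: "nat \<Rightarrow> real"
  assumes [measurable]: "\<And>n. F n \<in> borel_measurable lborel"
    and F: "\<And>n. bnd r s (F n) (w n)" and w: "\<And>n. 0 < w n" "summable w"
    and r: "0 \<le> r" "r \<le> 1"
  shows "bnd r s (\<lambda>x. \<Sum>n. F n x) (\<Sum>n. w n)"
proof -
  have "bnd r s (\<lambda>x. \<integral>\<^sup>+i. F i x \<partial>count_space UNIV) (\<Sum>n. w n)"
  proof (rule bnd_nn_integral)
    show "sigma_finite_measure (count_space (UNIV :: nat set))"
      by (intro sigma_finite_measure_count_space_countable) simp
    show "case_prod F \<in> borel_measurable (count_space UNIV \<Otimes>\<^sub>M lborel)"
      by (intro measurable_pair_measure_countable1) auto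
    show "(\<integral>\<^sup>+i. ennreal (w i) \<partial>count_space UNIV) \<le> ennreal (\<Sum>n. w n)"
      using w by (simp add: nn_integral_count_space_nat suminf_ennreal2 less_imp_le)
  qed (use F w r in \<open>auto intro: suminf_nonneg less_imp_le\<close>)
  then show ?thesis by (simp add: nn_integral_count_space_nat)
qed

section \<open>Gaussian integrals with power weights\<close>

lemma sets_borel_cball [measurable]: "cball (x::'a::euclidean_space) r \<in> sets borel"
  by simp

lemma heat_kernel_nonneg [simp]: "0 \<le> heat_kernel t x"
  by (simp add: heat_kernel_def)

lemma heat_kernel_pos: "0 < t \<Longrightarrow> 0 < heat_kernel t x"
  by (simp add: heat_kernel_def)

lemma heat_kernel_minus [simp]: "heat_kernel t (- x) = heat_kernel t x"
  by (simp add: heat_kernel_def)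

lemma heat_kernel_minus_commute: "heat_kernel t (x - y) = heat_kernel t (y - x)"
  by (simp add: heat_kernel_def norm_minus_commute)

lemma borel_measurable_heat_kernel [measurable]:
  assumes [measurable]: "f \<in> borel_measurable M" "g \<in> borel_measurable M"
  shows "(\<lambda>x. heat_kernel (f x) (g x)) \<in> borel_measurable M"
  unfolding heat_kernel_def by measurable

text \<open>The coordinates are independent centred normal variables of variance 2t; this reduces
  the total mass of the kernel to one dimension.\<close>

lemma heat_kernel_eq_prod:
  fixes x :: "'a::euclidean_space"
  assumes t: "0 < t"
  shows "heat_kernel t x = (\<Prod>b\<in>Basis. normal_density 0 (sqrt (2 * t)) (x \<bullet> b))"
proof -
  have "(norm x)\<^sup>2 = (\<Sum>b\<in>Basis. (x \<bullet> b)\<^sup>2)"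
    by (subst power2_norm_eq_inner, subst euclidean_inner) (simp add: power2_eq_square)
  then have e: "exp (- ((norm x)\<^sup>2 / (4 * t))) = (\<Prod>b\<in>Basis. exp (- ((x \<bullet> b)\<^sup>2 / (4 * t))))"
    by (simp add: sum_divide_distrib exp_sum flip: sum_negf)
  have "(4 * pi * t) powr (- (real DIM('a) / 2)) = ((4 * pi * t) powr (- (1 / 2))) ^ DIM('a)"
    using t by (simp add: powr_realpow[symmetric] powr_powr)
  also have "(4 * pi * t) powr (- (1 / 2)) = 1 / sqrt (4 * pi * t)"
    using t by (simp add: powr_minus_divide powr_half_sqrt)
  finally have c: "(4 * pi * t) powr (- (real DIM('a) / 2)) = (1 / sqrt (4 * pi * t)) ^ DIM('a)" .
  have "normal_density 0 (sqrt (2 * t)) y = 1 / sqrt (4 * pi * t) * exp (- (y\<^sup>2 / (4 * t)))" for y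
    using t by (simp add: normal_density_def mult_ac)
  then show ?thesis
    unfolding heat_kernel_def e c by (simp only: prod.distrib prod_constant)
qed

lemma nn_integral_heat_kernel:
  assumes t: "0 < t"
  shows "(\<integral>\<^sup>+x. ennreal (heat_kernel t (x::'a::euclidean_space)) \<partial>lborel) = 1"
proof -
  have 1: "(\<integral>\<^sup>+x. ennreal (normal_density 0 (sqrt (2 * t)) x) \<partial>lborel) = 1"
    using t by (subst nn_integral_eq_integral) simp_all
  have "(\<integral>\<^sup>+x. ennreal (heat_kernel t (x::'a)) \<partial>lborel)
      = (\<integral>\<^sup>+x. (\<Prod>b\<in>Basis. ennreal (normal_density 0 (sqrt (2 * t)) ((x::'a) \<bullet> b))) \<partial>lborel)"
    using t by (simp add: heat_kernel_eq_prod prod_ennreal)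
  also have "\<dots> = 1"
    by (subst nn_integral_lborel_prod) (auto simp: 1)
  finally show ?thesis .
qed

lemma nn_integral_lborel_reflect:
  fixes x :: "'a::euclidean_space"
  assumes [measurable]: "f \<in> borel_measurable borel"
  shows "(\<integral>\<^sup>+y. f (x - y) \<partial>lborel) = (\<integral>\<^sup>+y. f y \<partial>lborel)"
proof -
  have "(\<integral>\<^sup>+y. f y \<partial>lborel) = (\<integral>\<^sup>+y. f y \<partial>density (distr lborel borel (\<lambda>y. x + (-1) *\<^sub>R y)) (\<lambda>_. \<bar>-1::real\<bar>^DIM('a)))"
    using lborel_affine[of "-1" x] by simp
  also have "\<dots> = (\<integral>\<^sup>+y. f (x - y) \<partial>lborel)"
    by (subst nn_integral_density) (auto simp: nn_integral_distr)
  finally show ?thesis ..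
qed

lemma nn_integral_lborel_shift:
  fixes x :: "'a::euclidean_space"
  assumes [measurable]: "f \<in> borel_measurable borel"
  shows "(\<integral>\<^sup>+y. f (y - x) \<partial>lborel) = (\<integral>\<^sup>+y. f y \<partial>lborel)"
  using nn_integral_lborel_reflect[of "\<lambda>y. f (- y)" x] nn_integral_lborel_reflect[of f 0]
  by simp

lemma nn_integral_heat_kernel_diff:
  assumes "0 < t"
  shows "(\<integral>\<^sup>+y. ennreal (heat_kernel t (x - y)) \<partial>lborel) = 1"
    "(\<integral>\<^sup>+y. ennreal (heat_kernel t (y - x)) \<partial>lborel) = 1"
  using nn_integral_lborel_reflect[of "\<lambda>y. ennreal (heat_kernel t y)" x]
    nn_integral_lborel_shift[of "\<lambda>y. ennreal (heat_kernel t y)" x] nn_integral_heat_kernel[OF assms]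
  by simp_all

text \<open>Completing the square in w: a Gaussian in a times a normalised Gaussian in w, centred at
  t a / (s + t), with time parameter s t / (s + t). Integration in w then gives the convolution
  semigroup.\<close>

lemma heat_kernel_mult:
  fixes a w :: "'a::euclidean_space"
  assumes s: "0 < s" and t: "0 < t"
  shows "heat_kernel s (a - w) * heat_kernel t w
    = heat_kernel (s + t) a * heat_kernel (s * t / (s + t)) (w - (t / (s + t)) *\<^sub>R a)"
proof -
  have exp: "(norm (a - w))\<^sup>2 / (4 * s) + (norm w)\<^sup>2 / (4 * t)
     = (norm a)\<^sup>2 / (4 * (s + t)) + (norm (w - (t / (s + t)) *\<^sub>R a))\<^sup>2 / (4 * (s * t / (s + t)))"
  proof -
    define A W I where "A = a \<bullet> a" and "W = w \<bullet> w" and "I = a \<bullet> w"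
    have n: "(norm (a - w))\<^sup>2 = A - 2 * I + W" "(norm w)\<^sup>2 = W" "(norm a)\<^sup>2 = A"
      "(norm (w - (t / (s + t)) *\<^sub>R a))\<^sup>2 = W - 2 * (t / (s + t)) * I + (t / (s + t))\<^sup>2 * A"
      unfolding A_def W_def I_def power2_norm_eq_inner
      by (auto simp: inner_diff inner_commute power2_eq_square algebra_simps)
    have "s + t \<noteq> 0" "s \<noteq> 0" "t \<noteq> 0" using s t by auto
    then show ?thesis unfolding n by (simp add: divide_simps) algebra
  qed
  have "s + t > 0" using s t by simp
  then have "(4 * pi * s) powr (- (real DIM('a) / 2)) * (4 * pi * t) powr (- (real DIM('a) / 2))
     = (4 * pi * (s + t)) powr (- (real DIM('a) / 2)) * (4 * pi * (s * t / (s + t))) powr (- (real DIM('a) / 2))"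
  proof -
    have eq: "(4 * pi * s) * (4 * pi * t) = (4 * pi * (s + t)) * (4 * pi * (s * t / (s + t)))"
      using \<open>s + t > 0\<close> by (simp add: field_simps)
    have "(4 * pi * s) powr k * (4 * pi * t) powr k = ((4 * pi * s) * (4 * pi * t)) powr k" for k
      by (rule powr_mult[symmetric])
    also have "((4 * pi * s) * (4 * pi * t)) powr k = (4 * pi * (s + t)) powr k * (4 * pi * (s * t / (s + t))) powr k" for k
      unfolding eq by (rule powr_mult)
    finally show ?thesis .
  qed
  then show ?thesis
    unfolding heat_kernel_def
    using exp by (simp add: mult.assoc mult.left_commute mult_exp_exp) (simp add: mult.assoc[symmetric])
qed

lemma nn_integral_heat_kernel_mult:
  fixes x z :: "'a::euclidean_space"
  assumes s: "0 < s" and t: "0 < t"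
  shows "(\<integral>\<^sup>+y. ennreal (heat_kernel s (x - y)) * ennreal (heat_kernel t (y - z)) \<partial>lborel)
    = ennreal (heat_kernel (s + t) (x - z))"
proof -
  have "(\<integral>\<^sup>+y. ennreal (heat_kernel s (x - y)) * ennreal (heat_kernel t (y - z)) \<partial>lborel)
    = (\<integral>\<^sup>+y. ennreal (heat_kernel (s + t) (x - z)) *
        ennreal (heat_kernel (s * t / (s + t)) (y - (z + (t / (s + t)) *\<^sub>R (x - z)))) \<partial>lborel)"
  proof (intro nn_integral_cong)
    fix y
    show "ennreal (heat_kernel s (x - y)) * ennreal (heat_kernel t (y - z))
      = ennreal (heat_kernel (s + t) (x - z)) *
        ennreal (heat_kernel (s * t / (s + t)) (y - (z + (t / (s + t)) *\<^sub>R (x - z))))"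
      using heat_kernel_mult[OF s t, of "x - z" "y - z"]
      by (simp flip: ennreal_mult add: diff_diff_eq)
  qed
  also have "\<dots> = ennreal (heat_kernel (s + t) (x - z))"
    using s t by (subst nn_integral_cmult) (auto simp: nn_integral_heat_kernel_diff)
  finally show ?thesis .
qed

lemma heat_kernel_le: "0 < t \<Longrightarrow> heat_kernel t (x::'a::euclidean_space) \<le> (4 * pi * t) powr (- (real DIM('a) / 2))"
  by (simp add: heat_kernel_def mult_left_le)

text \<open>With u = |x - y| / sqrt t, each of sqrt t + |x| and sqrt t + |y| is at most 1 + u times
  the other, so the weights differ at most by a factor exp (|\<rho>| u). Half of the Gaussian
  exponent absorbs it; what is left is a kernel at time 2t.\<close>

lemma heat_kernel_weight_exchange:
  "\<exists>C>0. \<forall>t x y. 0 < t \<longrightarrow>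
     (sqrt t + norm x) powr \<rho> * heat_kernel t (x - y)
     \<le> C * (sqrt t + norm (y::'a::euclidean_space)) powr \<rho> * heat_kernel (2 * t) (x - y)"
proof -
  define m where "m = \<bar>\<rho>\<bar>"
  have m: "0 \<le> m" by (simp add: m_def)
  \<comment> \<open>The first factor compares the normalisations at times t and 2t; 2 m^2 is the
    maximum of m u - u^2 / 8 over u.\<close>
  define C where "C = 2 powr (real DIM('a) / 2) * exp (2 * m\<^sup>2)"
  have "(sqrt t + norm x) powr \<rho> * heat_kernel t (x - y)
     \<le> C * (sqrt t + norm y) powr \<rho> * heat_kernel (2 * t) (x - y)" if t: "0 < t" for t and x y :: 'a
  proof -
    define X Y u where "X = sqrt t + norm x" and "Y = sqrt t + norm y" and "u = norm (x - y) / sqrt t"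
    have t': "0 < sqrt t" using t by simp
    have u: "0 \<le> u" "norm (x - y) = sqrt t * u" using t' by (auto simp: u_def)
    have XY: "0 < X" "0 < Y" "sqrt t \<le> X" "sqrt t \<le> Y"
      using t' by (auto simp: X_def Y_def add_pos_nonneg)
    have "X \<le> Y + norm (x - y)" using norm_triangle_sub[of x y] by (simp add: X_def Y_def)
    also have "\<dots> \<le> Y + Y * u" using u XY by (auto intro: mult_right_mono)
    finally have XY1: "X \<le> Y * (1 + u)" by (simp add: algebra_simps)
    have "Y \<le> X + norm (x - y)" using norm_triangle_sub[of y x] by (simp add: X_def Y_def norm_minus_commute)
    also have "\<dots> \<le> X + X * u" using u XY by (auto intro: mult_right_mono)
    finally have YX1: "Y \<le> X * (1 + u)" by (simp add: algebra_simps)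
    have "(1 + u) powr m \<le> exp u powr m"
      using m u exp_ge_add_one_self[of u] by (intro powr_mono2) auto
    then have up: "(1 + u) powr m \<le> exp (m * u)" by (simp add: exp_powr_real mult.commute)
    have "X powr \<rho> \<le> Y powr \<rho> * (1 + u) powr m"
    proof (cases "0 \<le> \<rho>")
      case True
      have "X powr \<rho> \<le> (Y * (1 + u)) powr \<rho>" using True XY1 XY by (intro powr_mono2) auto
      with True show ?thesis using u XY by (simp add: powr_mult m_def)
    next
      case False
      have "Y powr m \<le> (X * (1 + u)) powr m" using m YX1 XY by (intro powr_mono2) auto
      then have "Y powr m \<le> X powr m * (1 + u) powr m" using u XY by (simp add: powr_mult)
      moreover have "X powr \<rho> = 1 / X powr m" "Y powr \<rho> = 1 / Y powr m"
        using False by (auto simp: m_def powr_minus_divide)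
      ultimately show ?thesis using XY unfolding \<open>X powr \<rho> = 1 / X powr m\<close> \<open>Y powr \<rho> = 1 / Y powr m\<close>
        by (simp add: field_simps)
    qed
    also have "\<dots> \<le> Y powr \<rho> * exp (m * u)" using up by (intro mult_left_mono) auto
    finally have 1: "X powr \<rho> \<le> Y powr \<rho> * exp (m * u)" .
    have n2: "(norm (x - y))\<^sup>2 = t * u\<^sup>2" using u t by (simp add: power_mult_distrib)
    have 2: "heat_kernel t (x - y) = 2 powr (real DIM('a) / 2) * exp (- (u\<^sup>2 / 8)) * heat_kernel (2 * t) (x - y)"
    proof -
      have e: "exp (- (u\<^sup>2 / 4)) = exp (- (u\<^sup>2 / 8)) * exp (- (u\<^sup>2 / 8))"
        by (simp flip: exp_add)
      have "(4 * pi * t) powr (- (real DIM('a) / 2)) = 2 powr (real DIM('a) / 2) * (4 * pi * (2 * t)) powr (- (real DIM('a) / 2))"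
      proof -
        have "4 * pi * (2 * t) = 2 * (4 * pi * t)" by simp
        moreover have "(2 * (4 * pi * t)) powr k = 2 powr k * (4 * pi * t) powr k" for k
          by (rule powr_mult)
        moreover have "2 powr k * 2 powr (- k) = (1::real)" for k
          by (simp flip: powr_add)
        ultimately show ?thesis by (simp only: mult.assoc[symmetric])
      qed
      with t show ?thesis unfolding heat_kernel_def n2 by (simp add: e)
    qed
    have "0 \<le> (u - 4 * m)\<^sup>2" by simp
    then have 3: "m * u - u\<^sup>2 / 8 \<le> 2 * m\<^sup>2"
      by (simp add: power2_eq_square field_simps)
    have "X powr \<rho> * heat_kernel t (x - y) \<le> Y powr \<rho> * exp (m * u) * heat_kernel t (x - y)"
      using 1 by (intro mult_right_mono) auto
    also have "\<dots> = 2 powr (real DIM('a) / 2) * exp (m * u - u\<^sup>2 / 8) * Y powr \<rho> * heat_kernel (2 * t) (x - y)"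
    proof -
      have "exp (m * u - u\<^sup>2 / 8) = exp (m * u) * exp (- (u\<^sup>2 / 8))"
        by (simp flip: exp_add)
      then show ?thesis by (simp add: 2)
    qed
    also have "\<dots> \<le> 2 powr (real DIM('a) / 2) * exp (2 * m\<^sup>2) * Y powr \<rho> * heat_kernel (2 * t) (x - y)"
      using 3 by (intro mult_right_mono mult_left_mono) auto
    finally show ?thesis by (simp add: C_def X_def Y_def)
  qed
  moreover have "0 < C" by (simp add: C_def)
  ultimately show ?thesis by blast
qed

text \<open>Dyadic decomposition of the ball into shells r / 2^(n+1) < |y| \<le> r / 2^n. On the
  n-th shell the power is at most \<open>c n\<close>, and its volume is bounded by that of the ball
  of radius \<open>\<rho> n\<close>; the sum is a convergent geometric series because \<kappa> <
  d.\<close>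

lemma nn_integral_norm_powr_cball:
  assumes k: "0 < \<kappa>" "\<kappa> < real DIM('a::euclidean_space)"
  shows "\<exists>C>0. \<forall>r>0. (\<integral>\<^sup>+y. ennreal (norm (y::'a) powr (- \<kappa>)) * indicator (cball 0 r) y \<partial>lborel)
    \<le> ennreal (C * r powr (real DIM('a) - \<kappa>))"
proof -
  define d where "d = real DIM('a)"
  define V where "V = unit_ball_vol d"
  have V: "0 < V" by (simp add: V_def d_def)
  define x where "x = 2 powr (\<kappa> - d)"
  have x: "0 < x" "x < 1" using k by (auto simp: x_def d_def powr_less_one)
  define C where "C = 2 powr \<kappa> * V * (\<Sum>n. x ^ n)"
  have sx: "summable (\<lambda>n. x ^ n)" using x by (intro summable_geometric) auto
  have "0 < (\<Sum>n. x ^ n)" using x sx by (intro suminf_pos) auto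
  then have C: "0 < C" using V by (simp add: C_def)
  have "(\<integral>\<^sup>+y. ennreal (norm (y::'a) powr (- \<kappa>)) * indicator (cball 0 r) y \<partial>lborel)
    \<le> ennreal (C * r powr (d - \<kappa>))" if r: "0 < r" for r
  proof -
    define c where "c n = (2 powr (real n + 1) / r) powr \<kappa>" for n :: nat
    define \<rho> where "\<rho> n = r / 2 powr (real n)" for n :: nat
    have \<rho>: "0 < \<rho> n" for n using r by (simp add: \<rho>_def)
    have "ennreal (norm (y::'a) powr (- \<kappa>)) * indicator (cball 0 r) y
        \<le> (\<Sum>n. ennreal (c n) * indicator (cball 0 (\<rho> n)) y)" for y
    proof (cases "y = 0 \<or> norm y > r")
      case True
      then show ?thesis by auto
    next
      case False
      then have y: "0 < norm y" "norm y \<le> r" by auto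
      define u where "u = r / norm y"
      have u: "1 \<le> u" using y by (simp add: u_def)
      then have l0: "0 \<le> log 2 u" by simp
      \<comment> \<open>The index of the dyadic shell that contains y.\<close>
      define n where "n = nat \<lfloor>log 2 u\<rfloor>"
      have n: "real n \<le> log 2 u" "log 2 u < real n + 1" using l0 by (auto simp: n_def)
      have "2 powr (real n) \<le> u" "u \<le> 2 powr (real n + 1)"
        using n u by (auto simp: powr_le_iff log_le_iff[symmetric])
      then have "norm y \<le> \<rho> n" and un: "u \<le> 2 powr (real n + 1)"
        using y by (auto simp: u_def \<rho>_def field_simps)
      have "norm y powr (- \<kappa>) = (u / r) powr \<kappa>"
        using y r by (simp add: u_def powr_minus_divide powr_divide)
      also have "\<dots> \<le> c n" unfolding c_def using un r u k by (intro powr_mono2 divide_right_mono) auto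
      finally have "ennreal (norm (y::'a) powr (- \<kappa>)) * indicator (cball 0 r) y
        \<le> ennreal (c n) * indicator (cball 0 (\<rho> n)) y"
        using \<open>norm y \<le> \<rho> n\<close> by (auto simp: indicator_def intro: ennreal_leI)
      also have "\<dots> \<le> (\<Sum>n. ennreal (c n) * indicator (cball 0 (\<rho> n)) y)"
        using sum_le_suminf[of "\<lambda>n. ennreal (c n) * indicator (cball 0 (\<rho> n)) y" "{n}"]
        by (simp del: sum_mult_indicator)
      finally show ?thesis .
    qed
    then have "(\<integral>\<^sup>+y. ennreal (norm (y::'a) powr (- \<kappa>)) * indicator (cball 0 r) y \<partial>lborel)
      \<le> (\<integral>\<^sup>+y. (\<Sum>n. ennreal (c n) * indicator (cball 0 (\<rho> n)) (y::'a)) \<partial>lborel)"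
      by (intro nn_integral_mono)
    also have "\<dots> = (\<Sum>n. \<integral>\<^sup>+y. ennreal (c n) * indicator (cball 0 (\<rho> n)) (y::'a) \<partial>lborel)"
      by (intro nn_integral_suminf) measurable
    also have "\<dots> = (\<Sum>n. ennreal (2 powr \<kappa> * V * r powr (d - \<kappa>) * x ^ n))"
    proof (intro suminf_cong)
      fix n
      have "(\<integral>\<^sup>+y. ennreal (c n) * indicator (cball 0 (\<rho> n)) (y::'a) \<partial>lborel)
          = ennreal (c n) * emeasure lborel (cball (0::'a) (\<rho> n))"
        by (intro nn_integral_cmult_indicator) simp
      also have "emeasure lborel (cball (0::'a) (\<rho> n)) = ennreal (V * \<rho> n powr d)"
        using \<rho>[of n] by (simp add: emeasure_cball V_def d_def powr_realpow)
      also have "ennreal (c n) * ennreal (V * \<rho> n powr d) = ennreal (c n * (V * \<rho> n powr d))"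
        using V by (intro ennreal_mult[symmetric]) (auto simp: c_def)
      also have "c n * (V * \<rho> n powr d) = 2 powr \<kappa> * V * r powr (d - \<kappa>) * x ^ n"
      proof -
        have "c n = 2 powr \<kappa> * (2 powr \<kappa>) ^ n * r powr (- \<kappa>)"
        proof -
          have "(2 powr (real n + 1)) powr \<kappa> = 2 powr (\<kappa> + \<kappa> * real n)"
            by (simp only: powr_powr) (simp add: algebra_simps)
          also have "\<dots> = 2 powr \<kappa> * (2 powr \<kappa>) ^ n"
            by (simp add: powr_add powr_powr flip: powr_realpow)
          finally show ?thesis
            using r by (simp only: c_def powr_divide) (simp add: powr_minus field_simps)
        qed
        moreover have "\<rho> n powr d = r powr d * (2 powr (- d)) ^ n"
        proof -
          have "(2 powr real n) powr d = (2 powr d) ^ n"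
            by (simp add: powr_powr mult.commute flip: powr_realpow)
          then show ?thesis
            by (simp add: \<rho>_def powr_divide powr_minus_divide power_one_over)
        qed
        moreover have "x ^ n = (2 powr \<kappa>) ^ n * (2 powr (- d)) ^ n"
          by (simp add: x_def powr_diff powr_minus field_simps flip: power_mult_distrib)
        moreover have "r powr (d - \<kappa>) = r powr d * r powr (- \<kappa>)"
          by (simp flip: powr_add)
        ultimately show ?thesis by simp
      qed
      finally show "(\<integral>\<^sup>+y. ennreal (c n) * indicator (cball 0 (\<rho> n)) (y::'a) \<partial>lborel)
          = ennreal (2 powr \<kappa> * V * r powr (d - \<kappa>) * x ^ n)" .
    qed
    also have "\<dots> = ennreal (\<Sum>n. 2 powr \<kappa> * V * r powr (d - \<kappa>) * x ^ n)"
      using sx V x by (intro suminf_ennreal2) (auto intro!: summable_mult)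
    also have "(\<Sum>n. 2 powr \<kappa> * V * r powr (d - \<kappa>) * x ^ n) = C * r powr (d - \<kappa>)"
      using sx by (subst suminf_mult) (auto simp: C_def)
    finally show ?thesis .
  qed
  with C show ?thesis unfolding d_def by blast
qed

text \<open>Moving (sqrt t + |x|)^\<kappa> through the kernel leaves the ratio ((sqrt t + |y|) /
  |y|)^\<kappa>. It is at most 2^|\<kappa>| unless \<kappa> > 0 and |y| \<le> sqrt t. There the
  kernel is replaced by its maximum, of order t^(-d/2), and the integral of |y|^(-\<kappa>) over the
  ball of radius sqrt t makes all powers of t cancel.\<close>

lemma nn_integral_heat_kernel_norm_powr:
  assumes k: "\<kappa> < real DIM('a::euclidean_space)"
  shows "\<exists>C>0. \<forall>t x. 0 < t \<longrightarrow>
    (\<integral>\<^sup>+y. ennreal (heat_kernel t (x - y) * norm y powr (- \<kappa>)) \<partial>lborel)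
    \<le> ennreal (C * (sqrt t + norm (x::'a)) powr (- \<kappa>))"
proof -
  define d where "d = real DIM('a)"
  obtain C1 where C1: "0 < C1" "\<And>t x y::'a. 0 < t \<Longrightarrow> (sqrt t + norm x) powr \<kappa> * heat_kernel t (x - y)
     \<le> C1 * (sqrt t + norm y) powr \<kappa> * heat_kernel (2 * t) (x - y)"
    using heat_kernel_weight_exchange[of \<kappa>] by blast
  obtain C2 where C2: "0 < C2" "\<And>r. 0 < \<kappa> \<Longrightarrow> 0 < r \<Longrightarrow>
      (\<integral>\<^sup>+y. ennreal (norm (y::'a) powr (- \<kappa>)) * indicator (cball 0 r) y \<partial>lborel)
    \<le> ennreal (C2 * r powr (d - \<kappa>))"
  proof (cases "0 < \<kappa>")
    case True
    then show ?thesis using that nn_integral_norm_powr_cball[OF True k] unfolding d_def by metis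
  qed (use that[of 1] in auto)
  define K where "K = C1 * 2 powr \<bar>\<kappa>\<bar>"
  define L where "L = K * (1 + (8 * pi) powr (- (d / 2)) * C2)"
  have K: "0 < K" using C1 by (simp add: K_def)
  have "1 + (8 * pi) powr (- (d / 2)) * C2 > 0" using C2(1) by (intro add_pos_pos) auto
  then have L: "0 < L" using K by (simp add: L_def)
  have "(\<integral>\<^sup>+y. ennreal (heat_kernel t (x - y) * norm y powr (- \<kappa>)) \<partial>lborel)
    \<le> ennreal (L * (sqrt t + norm (x::'a)) powr (- \<kappa>))" if t: "0 < t" for t x
  proof -
    define X where "X = sqrt t + norm x"
    have X: "0 < X" using t by (simp add: X_def add_pos_nonneg)
    \<comment> \<open>The singular part near the origin, which arises only for \<kappa> > 0.\<close>
    define I where "I y = (if 0 < \<kappa> then ennreal (norm (y::'a) powr (- \<kappa>)) * indicator (cball 0 (sqrt t)) y else 0)" for y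
    have [measurable]: "I \<in> borel_measurable lborel"
      by (cases "0 < \<kappa>") (simp_all add: I_def[abs_def])
    have pt: "ennreal (heat_kernel t (x - y) * norm y powr (- \<kappa>))
      \<le> ennreal (K * X powr (- \<kappa>)) * (ennreal (heat_kernel (2 * t) (x - y))
         + ennreal ((8 * pi * t) powr (- (d / 2)) * t powr (\<kappa> / 2)) * I y)" if y: "y \<noteq> 0" for y
    proof -
      define Y where "Y = sqrt t + norm y"
      have Y: "0 < Y" "0 < norm y" using t y by (auto simp: Y_def add_pos_nonneg)
      have "X powr \<kappa> * heat_kernel t (x - y) \<le> C1 * Y powr \<kappa> * heat_kernel (2 * t) (x - y)"
        using C1(2)[OF t] by (simp add: X_def Y_def)
      then have "heat_kernel t (x - y) * norm y powr (- \<kappa>)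
          \<le> C1 * X powr (- \<kappa>) * (Y / norm y) powr \<kappa> * heat_kernel (2 * t) (x - y)"
        using X Y by (simp add: powr_minus powr_divide field_simps)
      then have 1: "ennreal (heat_kernel t (x - y) * norm y powr (- \<kappa>))
         \<le> ennreal (C1 * X powr (- \<kappa>)) * ennreal ((Y / norm y) powr \<kappa> * heat_kernel (2 * t) (x - y))"
        using C1(1) by (simp flip: ennreal_mult add: ennreal_leI mult.assoc)
      have 2: "ennreal ((Y / norm y) powr \<kappa> * heat_kernel (2 * t) (x - y))
        \<le> ennreal (2 powr \<bar>\<kappa>\<bar>) * (ennreal (heat_kernel (2 * t) (x - y))
         + ennreal ((8 * pi * t) powr (- (d / 2)) * t powr (\<kappa> / 2)) * I y)"
      proof (cases "0 < \<kappa> \<and> norm y \<le> sqrt t")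
        case True
        then have "Y / norm y \<le> 2 * (sqrt t / norm y)" using Y by (simp add: Y_def field_simps)
        then have "(Y / norm y) powr \<kappa> \<le> (2 * (sqrt t / norm y)) powr \<kappa>"
          using True Y by (intro powr_mono2) auto
        also have "\<dots> = 2 powr \<kappa> * (t powr (\<kappa> / 2) * norm y powr (- \<kappa>))"
          using Y t by (simp only: powr_mult powr_divide) (simp add: powr_minus field_simps powr_half_sqrt[symmetric] powr_powr)
        finally have "(Y / norm y) powr \<kappa> * heat_kernel (2 * t) (x - y)
           \<le> (2 powr \<kappa> * (t powr (\<kappa> / 2) * norm y powr (- \<kappa>))) * (4 * pi * (2 * t)) powr (- (d / 2))"
          using heat_kernel_le[of "2 * t" "x - y"] t unfolding d_def by (intro mult_mono) auto
        also have "\<dots> = 2 powr \<bar>\<kappa>\<bar> * ((8 * pi * t) powr (- (d / 2)) * t powr (\<kappa> / 2) * norm y powr (- \<kappa>))"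
          using True by (simp add: mult_ac)
        finally have "ennreal ((Y / norm y) powr \<kappa> * heat_kernel (2 * t) (x - y))
          \<le> ennreal (2 powr \<bar>\<kappa>\<bar>) * (ennreal ((8 * pi * t) powr (- (d / 2)) * t powr (\<kappa> / 2)) * I y)"
          using True by (simp add: I_def ennreal_leI flip: ennreal_mult)
        also have "\<dots> \<le> ennreal (2 powr \<bar>\<kappa>\<bar>) * (ennreal (heat_kernel (2 * t) (x - y))
         + ennreal ((8 * pi * t) powr (- (d / 2)) * t powr (\<kappa> / 2)) * I y)"
          by (intro mult_left_mono) auto
        finally show ?thesis .
      next
        case False
        have "(Y / norm y) powr \<kappa> \<le> 2 powr \<bar>\<kappa>\<bar>"
        proof (cases "0 < \<kappa>")
          case True
          with False have "Y / norm y \<le> 2" using Y by (simp add: Y_def field_simps)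
          with True Y show ?thesis by (auto intro!: powr_mono2)
        next
          case k: False
          have "Y / norm y \<ge> 1" using Y t by (simp add: Y_def)
          then have "(Y / norm y) powr \<kappa> \<le> (Y / norm y) powr 0" using k by (intro powr_mono) auto
          also have "\<dots> \<le> 2 powr \<bar>\<kappa>\<bar>" using Y by (simp add: ge_one_powr_ge_zero)
          finally show ?thesis .
        qed
        then have "ennreal ((Y / norm y) powr \<kappa> * heat_kernel (2 * t) (x - y))
          \<le> ennreal (2 powr \<bar>\<kappa>\<bar>) * ennreal (heat_kernel (2 * t) (x - y))"
          by (simp flip: ennreal_mult add: ennreal_leI mult_right_mono)
        also have "\<dots> \<le> ennreal (2 powr \<bar>\<kappa>\<bar>) * (ennreal (heat_kernel (2 * t) (x - y))
         + ennreal ((8 * pi * t) powr (- (d / 2)) * t powr (\<kappa> / 2)) * I y)"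
          by (intro mult_left_mono) auto
        finally show ?thesis .
      qed
      have "ennreal (C1 * X powr (- \<kappa>)) * ennreal (2 powr \<bar>\<kappa>\<bar>) = ennreal (K * X powr (- \<kappa>))"
        using C1 by (simp add: K_def mult_ac flip: ennreal_mult)
      with order_trans[OF 1 mult_left_mono[OF 2]] show ?thesis by (simp add: mult.assoc[symmetric])
    qed
    have IC: "(\<integral>\<^sup>+y. I y \<partial>lborel) \<le> ennreal (C2 * sqrt t powr (d - \<kappa>))"
      using C2 t by (cases "0 < \<kappa>") (auto simp: I_def)
    have "(\<integral>\<^sup>+y. ennreal (heat_kernel t (x - y) * norm y powr (- \<kappa>)) \<partial>lborel)
      \<le> (\<integral>\<^sup>+y. ennreal (K * X powr (- \<kappa>)) * (ennreal (heat_kernel (2 * t) (x - y))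
         + ennreal ((8 * pi * t) powr (- (d / 2)) * t powr (\<kappa> / 2)) * I y) \<partial>lborel)"
      by (intro nn_integral_mono_AE eventually_mono[OF AE_lborel_nonzero]) (rule pt)
    also have "\<dots> = ennreal (K * X powr (- \<kappa>)) * (1
         + ennreal ((8 * pi * t) powr (- (d / 2)) * t powr (\<kappa> / 2)) * (\<integral>\<^sup>+y. I y \<partial>lborel))"
      using t by (simp add: nn_integral_cmult nn_integral_add nn_integral_heat_kernel_diff)
    also have "\<dots> \<le> ennreal (K * X powr (- \<kappa>)) * (ennreal 1
         + ennreal ((8 * pi * t) powr (- (d / 2)) * t powr (\<kappa> / 2)) * ennreal (C2 * sqrt t powr (d - \<kappa>)))"
      using IC by (intro mult_left_mono add_mono) auto
    also have "\<dots> = ennreal (K * X powr (- \<kappa>) * (1 +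
          (8 * pi * t) powr (- (d / 2)) * t powr (\<kappa> / 2) * (C2 * sqrt t powr (d - \<kappa>))))"
      using K C2 by (simp flip: ennreal_mult ennreal_plus del: ennreal_1)
    also have "(8 * pi * t) powr (- (d / 2)) * t powr (\<kappa> / 2) * (C2 * sqrt t powr (d - \<kappa>)) = (8 * pi) powr (- (d / 2)) * C2"
    proof -
      have "sqrt t powr (d - \<kappa>) = t powr (d / 2) * t powr (- (\<kappa> / 2))"
        using t by (simp add: powr_half_sqrt[symmetric] powr_powr diff_divide_distrib flip: powr_add)
      moreover have "(8 * pi * t) powr (- (d / 2)) = (8 * pi) powr (- (d / 2)) * t powr (- (d / 2))"
        using t by (simp add: powr_mult)
      moreover have "t powr (- (d / 2)) * t powr (d / 2) = 1" "t powr (\<kappa> / 2) * t powr (- (\<kappa> / 2)) = 1"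
        using t by (auto simp flip: powr_add)
      moreover have "(p * a) * b * (C2 * (c * e)) = p * C2 * ((a * c) * (b * e))" for p a b c e :: real
        by simp
      ultimately show ?thesis by (simp only: mult_1_right)
    qed
    also have "K * X powr (- \<kappa>) * (1 + (8 * pi) powr (- (d / 2)) * C2) = L * X powr (- \<kappa>)"
      by (simp add: L_def mult_ac)
    finally show ?thesis by (simp add: X_def)
  qed
  with L show ?thesis by blast
qed

section \<open>Weighted smoothing estimates for the heat semigroup\<close>

text \<open>The heat semigroup and, later, the Duhamel operator \<open>duh\<close> act on \<open>[0,\<infinity>]\<close>-valued functions, where
  Tonelli's theorem applies without any integrability assumption.\<close>

definition hop :: "real \<Rightarrow> ('a::euclidean_space \<Rightarrow> ennreal) \<Rightarrow> 'a \<Rightarrow> ennreal"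
  where "hop t F x = (\<integral>\<^sup>+y. ennreal (heat_kernel t (x - y)) * F y \<partial>lborel)"

lemma borel_measurable_hop [measurable]:
  assumes [measurable]: "F \<in> borel_measurable lborel"
  shows "hop t F \<in> borel_measurable lborel"
  unfolding hop_def[abs_def] by measurable

lemma ennreal_mult_left_assoc: "0 \<le> a \<Longrightarrow> 0 \<le> b \<Longrightarrow> ennreal a * (ennreal b * c) = ennreal (a * b) * c"
  by (simp add: ennreal_mult mult.assoc)

lemma sqrt_double_powr_le:
  assumes "0 < t" "0 \<le> n"
  shows "(sqrt (2 * t) + n) powr a \<le> 2 powr \<bar>a\<bar> * (sqrt t + n) powr a"
proof (cases "0 \<le> a")
  case True
  have "sqrt 2 \<le> 2" by (intro real_le_lsqrt) auto
  then have "sqrt 2 * sqrt t \<le> 2 * sqrt t" using assms by (intro mult_right_mono) auto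
  then have "sqrt (2 * t) + n \<le> 2 * (sqrt t + n)" using assms by (simp only: real_sqrt_mult distrib_left)
  then have "(sqrt (2 * t) + n) powr a \<le> (2 * (sqrt t + n)) powr a"
    using assms True by (intro powr_mono2) auto
  also have "\<dots> = 2 powr a * (sqrt t + n) powr a" by (rule powr_mult)
  finally show ?thesis using True by simp
next
  case False
  have "(sqrt (2 * t) + n) powr a \<le> 1 * (sqrt t + n) powr a"
    using assms False by (simp add: powr_mono2' add_pos_nonneg)
  also have "\<dots> \<le> 2 powr \<bar>a\<bar> * (sqrt t + n) powr a"
    by (intro mult_right_mono) (auto simp: ge_one_powr_ge_zero)
  finally show ?thesis .
qed

text \<open>The companion estimate in which the output variable is integrated, as the Schur test
  needs. The regular weight is moved to y first; the singular weight |x|^a is then handled by the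
  symmetry of the kernel.\<close>

lemma nn_integral_heat_kernel_weights:
  assumes a: "- real DIM('a::euclidean_space) < a"
  shows "\<exists>C>0. \<forall>t y. 0 < t \<longrightarrow>
    (\<integral>\<^sup>+x. ennreal (heat_kernel t (x - y) * norm x powr a * (sqrt t + norm x) powr b) \<partial>lborel)
    \<le> ennreal (C * (sqrt t + norm (y::'a)) powr (a + b))"
proof -
  obtain C1 where C1: "0 < C1" "\<And>t x y::'a. 0 < t \<Longrightarrow> (sqrt t + norm x) powr b * heat_kernel t (x - y)
     \<le> C1 * (sqrt t + norm y) powr b * heat_kernel (2 * t) (x - y)"
    using heat_kernel_weight_exchange[of b] by blast
  obtain C2 where C2: "0 < C2" "\<And>t y. 0 < t \<Longrightarrow>
    (\<integral>\<^sup>+x. ennreal (heat_kernel t (y - x) * norm x powr a) \<partial>lborel) \<le> ennreal (C2 * (sqrt t + norm (y::'a)) powr a)"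
    using nn_integral_heat_kernel_norm_powr[of "- a", where ?'a='a] a by auto
  have "(\<integral>\<^sup>+x. ennreal (heat_kernel t (x - y) * norm x powr a * (sqrt t + norm x) powr b) \<partial>lborel)
    \<le> ennreal (C1 * (C2 * 2 powr \<bar>a\<bar>) * (sqrt t + norm y) powr (a + b))" if t: "0 < t" for t and y :: 'a
  proof -
    have "(\<integral>\<^sup>+x. ennreal (heat_kernel t (x - y) * norm x powr a * (sqrt t + norm x) powr b) \<partial>lborel)
      \<le> (\<integral>\<^sup>+x. ennreal (C1 * (sqrt t + norm y) powr b) * ennreal (heat_kernel (2 * t) (y - x) * norm x powr a) \<partial>lborel)"
    proof (intro nn_integral_mono)
      fix x
      have "heat_kernel t (x - y) * norm x powr a * (sqrt t + norm x) powr b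
        = (sqrt t + norm x) powr b * heat_kernel t (x - y) * norm x powr a" by simp
      also have "\<dots> \<le> C1 * (sqrt t + norm y) powr b * heat_kernel (2 * t) (x - y) * norm x powr a"
        using C1(2)[OF t] by (intro mult_right_mono) auto
      also have "\<dots> = C1 * (sqrt t + norm y) powr b * (heat_kernel (2 * t) (y - x) * norm x powr a)"
        by (simp add: heat_kernel_minus_commute)
      finally show "ennreal (heat_kernel t (x - y) * norm x powr a * (sqrt t + norm x) powr b)
        \<le> ennreal (C1 * (sqrt t + norm y) powr b) * ennreal (heat_kernel (2 * t) (y - x) * norm x powr a)"
        using C1(1) by (simp flip: ennreal_mult add: ennreal_leI)
    qed
    also have "\<dots> = ennreal (C1 * (sqrt t + norm y) powr b) * (\<integral>\<^sup>+x. ennreal (heat_kernel (2 * t) (y - x) * norm x powr a) \<partial>lborel)"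
      by (intro nn_integral_cmult) measurable
    also have "\<dots> \<le> ennreal (C1 * (sqrt t + norm y) powr b) * ennreal (C2 * (2 powr \<bar>a\<bar> * (sqrt t + norm y) powr a))"
      using t C2(1) sqrt_double_powr_le[OF t, of "norm y" a]
      by (intro mult_left_mono order_trans[OF C2(2)] ennreal_leI mult_left_mono) auto
    also have "\<dots> = ennreal (C1 * (C2 * 2 powr \<bar>a\<bar>) * (sqrt t + norm y) powr (a + b))"
      using C1(1) C2(1) by (simp add: powr_add mult_ac flip: ennreal_mult)
    finally show ?thesis .
  qed
  moreover have "0 < C1 * (C2 * 2 powr \<bar>a\<bar>)" using C1(1) C2(1) by simp
  ultimately show ?thesis by blast
qed

text \<open>Jensen with the density kernel times |y|^(-\<kappa>), whose mass is bounded by a power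
  of sqrt t + |x|. The kernel survives in the result with exponent one, so that the bound can still
  be integrated in x.\<close>

lemma hop_epow_le:
  fixes s :: real
  assumes p: "1 \<le> p" and s: "s < real DIM('a::euclidean_space) * (1 - 1 / p)"
  shows "\<exists>C>0. \<forall>t F x. 0 < t \<longrightarrow> F \<in> borel_measurable lborel \<longrightarrow>
    epow (hop t F (x::'a)) p \<le> ennreal (C * (sqrt t + norm x) powr (- (s * p + max 0 (- s)))) *
      (\<integral>\<^sup>+y. ennreal (heat_kernel t (x - y) * norm y powr (max 0 (- s))) *
        epow (ennreal (norm y powr s) * F y) p \<partial>lborel)"
proof -
  define d where "d = real DIM('a)"
  have d: "0 < d" by (simp add: d_def)
  define \<eta> where "\<eta> = max 0 (- s)"
  \<comment> \<open>For s > 0 this is s times the dual exponent of p, and \<kappa> < d says exactly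
    s < d (1 - 1/p). For s \<le> 0 the choice \<kappa> = s avoids the division by p - 1, which may
    be 0, at the price of the factor |y|^\<eta>.\<close>
  define \<kappa> where "\<kappa> = (if s \<le> 0 then s else s * p / (p - 1))"
  have p1: "p \<noteq> 1" if "0 < s" using that s by auto
  have \<kappa>p: "\<kappa> * (p - 1) = s * p + \<eta>"
  proof (cases "s \<le> 0")
    case True
    then show ?thesis by (simp add: \<kappa>_def \<eta>_def algebra_simps)
  qed (use p1 in \<open>auto simp: \<kappa>_def \<eta>_def\<close>)
  have "\<kappa> < d"
  proof (cases "s \<le> 0")
    case False
    then have "s * p < d * (p - 1)" using s p by (simp add: d_def field_simps)
    then show ?thesis using False p1 p by (simp add: \<kappa>_def field_simps)
  qed (use d in \<open>simp add: \<kappa>_def\<close>)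
  then obtain C where C: "0 < C" "\<And>t x. 0 < t \<Longrightarrow>
    (\<integral>\<^sup>+y. ennreal (heat_kernel t (x - y) * norm y powr (- \<kappa>)) \<partial>lborel)
    \<le> ennreal (C * (sqrt t + norm (x::'a)) powr (- \<kappa>))"
    using nn_integral_heat_kernel_norm_powr[of \<kappa>, where ?'a='a] unfolding d_def by blast
  have "epow (hop t F x) p \<le> ennreal (C powr (p - 1) * (sqrt t + norm x) powr (- (s * p + \<eta>))) *
      (\<integral>\<^sup>+y. ennreal (heat_kernel t (x - y) * norm y powr \<eta>) *
        epow (ennreal (norm y powr s) * F y) p \<partial>lborel)"
    if t: "0 < t" and F[measurable]: "F \<in> borel_measurable lborel" for t F and x :: 'a
  proof -
    define X where "X = sqrt t + norm x"
    have X: "0 < X" using t by (simp add: X_def add_pos_nonneg)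
    \<comment> \<open>Jensen needs a density that is positive everywhere, while
      \<open>norm 0 powr (- \<kappa>)\<close> is 0; hence the separate value at the origin.\<close>
    define w where "w y = heat_kernel t (x - y) * (if y = 0 then 1 else norm y powr (- \<kappa>))" for y
    have w: "0 < w y" for y using heat_kernel_pos[OF t, of "x - y"] by (simp add: w_def)
    have [measurable]: "w \<in> borel_measurable lborel" unfolding w_def by measurable
    have "(\<integral>\<^sup>+y. ennreal (w y) \<partial>lborel) = (\<integral>\<^sup>+y. ennreal (heat_kernel t (x - y) * norm y powr (- \<kappa>)) \<partial>lborel)"
      by (intro nn_integral_cong_AE eventually_mono[OF AE_lborel_nonzero]) (simp add: w_def)
    also have "\<dots> \<le> ennreal (C * X powr (- \<kappa>))" using C(2)[OF t] by (simp add: X_def)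
    finally have "epow (\<integral>\<^sup>+y. ennreal (heat_kernel t (x - y)) * F y \<partial>lborel) p
      \<le> ennreal ((C * X powr (- \<kappa>)) powr (p - 1)) * (\<integral>\<^sup>+y. ennreal (w y powr (1 - p)) *
          epow (ennreal (heat_kernel t (x - y)) * F y) p \<partial>lborel)"
      using w p C(1) X by (intro nn_integral_epow_Jensen) auto
    also have "(C * X powr (- \<kappa>)) powr (p - 1) = C powr (p - 1) * X powr (- (s * p + \<eta>))"
      using C(1) X by (simp add: powr_mult powr_powr flip: \<kappa>p)
    also have "(\<integral>\<^sup>+y. ennreal (w y powr (1 - p)) * epow (ennreal (heat_kernel t (x - y)) * F y) p \<partial>lborel)
       = (\<integral>\<^sup>+y. ennreal (heat_kernel t (x - y) * norm y powr \<eta>) *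
        epow (ennreal (norm y powr s) * F y) p \<partial>lborel)"
    proof (intro nn_integral_cong_AE eventually_mono[OF AE_lborel_nonzero])
      fix y :: 'a assume y: "y \<noteq> 0"
      define g where "g = heat_kernel t (x - y)"
      have g: "0 < g" using heat_kernel_pos[OF t] by (simp add: g_def)
      have "w y powr (1 - p) * g powr p = g * norm y powr (\<kappa> * (p - 1))"
      proof -
        have "w y powr (1 - p) = g powr (1 - p) * norm y powr (\<kappa> * (p - 1))"
          using y by (simp add: w_def g_def powr_mult powr_powr algebra_simps)
        moreover have "g powr (1 - p) * g powr p = g" using g by (simp flip: powr_add)
        ultimately show ?thesis by (simp add: mult_ac)
      qed
      also have "\<dots> = g * norm y powr \<eta> * (norm y powr s) powr p"
        unfolding \<kappa>p by (simp add: powr_add powr_powr)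
      finally have "ennreal (w y powr (1 - p)) * ennreal (g powr p)
         = ennreal (g * norm y powr \<eta>) * ennreal ((norm y powr s) powr p)"
        using g by (simp flip: ennreal_mult)
      then show "ennreal (w y powr (1 - p)) * epow (ennreal (heat_kernel t (x - y)) * F y) p
        = ennreal (heat_kernel t (x - y) * norm y powr \<eta>) * epow (ennreal (norm y powr s) * F y) p"
        using g unfolding g_def by (simp add: epow_mult mult.assoc[symmetric])
    qed
    finally show ?thesis by (simp add: hop_def X_def)
  qed
  moreover have "0 < C powr (p - 1)" using C(1) by simp
  ultimately show ?thesis unfolding \<eta>_def by blast
qed

text \<open>The kernel left over in \<open>hop_epow_le\<close> is bounded by its maximum, after
  |y|^\<eta> has been exchanged for (sqrt t + |x|)^\<eta>, which cancels the \<eta> in the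
  prefactor.\<close>

lemma hop_epow_pointwise:
  fixes s :: real
  assumes p: "1 \<le> p" and s: "s < real DIM('a::euclidean_space) * (1 - 1 / p)"
  shows "\<exists>C>0. \<forall>t F x. 0 < t \<longrightarrow> F \<in> borel_measurable lborel \<longrightarrow>
    epow (hop t F (x::'a)) p \<le> ennreal (C * t powr (- (real DIM('a) / 2)) * (sqrt t + norm x) powr (- (s * p))) *
      (\<integral>\<^sup>+y. epow (ennreal (norm y powr s) * F y) p \<partial>lborel)"
proof -
  define d where "d = real DIM('a)"
  define \<eta> where "\<eta> = max 0 (- s)"
  obtain C1 where C1: "0 < C1" "\<And>t F x. 0 < t \<Longrightarrow> F \<in> borel_measurable lborel \<Longrightarrow>
    epow (hop t F (x::'a)) p \<le> ennreal (C1 * (sqrt t + norm x) powr (- (s * p + \<eta>))) *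
      (\<integral>\<^sup>+y. ennreal (heat_kernel t (x - y) * norm y powr \<eta>) *
        epow (ennreal (norm y powr s) * F y) p \<partial>lborel)"
    using hop_epow_le[OF p s] unfolding \<eta>_def by blast
  obtain C2 where C2: "0 < C2" "\<And>t x y::'a. 0 < t \<Longrightarrow> (sqrt t + norm x) powr \<eta> * heat_kernel t (x - y)
     \<le> C2 * (sqrt t + norm y) powr \<eta> * heat_kernel (2 * t) (x - y)"
    using heat_kernel_weight_exchange[of \<eta>] by blast
  define C where "C = C1 * (C2 * (8 * pi) powr (- (d / 2)))"
  have "epow (hop t F (x::'a)) p \<le> ennreal (C * t powr (- (d / 2)) * (sqrt t + norm x) powr (- (s * p))) *
      (\<integral>\<^sup>+y. epow (ennreal (norm y powr s) * F y) p \<partial>lborel)" (is "_ \<le> _ * ?I")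
    if t: "0 < t" and F[measurable]: "F \<in> borel_measurable lborel" for t F and x :: 'a
  proof -
    define X where "X = sqrt t + norm x"
    have X: "0 < X" using t by (simp add: X_def add_pos_nonneg)
    have pt: "heat_kernel t (x - y) * norm y powr \<eta> \<le> C2 * (8 * pi) powr (- (d / 2)) * t powr (- (d / 2)) * X powr \<eta>" for y
    proof -
      have "heat_kernel t (x - y) * norm y powr \<eta> \<le> (sqrt t + norm y) powr \<eta> * heat_kernel t (y - x)"
        using t by (subst heat_kernel_minus_commute, subst mult.commute)
          (intro mult_right_mono powr_mono2, auto simp: \<eta>_def)
      also have "\<dots> \<le> C2 * X powr \<eta> * heat_kernel (2 * t) (y - x)"
        using C2(2)[OF t] by (simp add: X_def)
      also have "\<dots> \<le> C2 * X powr \<eta> * (4 * pi * (2 * t)) powr (- (d / 2))"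
        using C2(1) t heat_kernel_le[of "2 * t" "y - x"] by (intro mult_left_mono) (auto simp: d_def)
      also have "(4 * pi * (2 * t)) powr (- (d / 2)) = (8 * pi) powr (- (d / 2)) * t powr (- (d / 2))"
      proof -
        have "4 * pi * (2 * t) = 8 * pi * t" by simp
        then show ?thesis by (simp only: powr_mult[of "8 * pi" t])
      qed
      finally show ?thesis by (simp add: mult_ac)
    qed
    have "(\<integral>\<^sup>+y. ennreal (heat_kernel t (x - y) * norm y powr \<eta>) * epow (ennreal (norm y powr s) * F y) p \<partial>lborel)
      \<le> (\<integral>\<^sup>+y. ennreal (C2 * (8 * pi) powr (- (d / 2)) * t powr (- (d / 2)) * X powr \<eta>) *
          epow (ennreal (norm y powr s) * F y) p \<partial>lborel)"
      using pt by (intro nn_integral_mono mult_right_mono ennreal_leI) auto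
    also have "\<dots> = ennreal (C2 * (8 * pi) powr (- (d / 2)) * t powr (- (d / 2)) * X powr \<eta>) * ?I"
      by (intro nn_integral_cmult) measurable
    finally have "epow (hop t F x) p \<le> ennreal (C1 * X powr (- (s * p + \<eta>))) *
       (ennreal (C2 * (8 * pi) powr (- (d / 2)) * t powr (- (d / 2)) * X powr \<eta>) * ?I)"
      by (intro order_trans[OF C1(2)[OF t F]]) (auto simp: X_def intro: mult_left_mono)
    also have "\<dots> = ennreal (C * t powr (- (d / 2)) * X powr (- (s * p))) * ?I"
    proof -
      have "X powr (- (s * p + \<eta>)) * X powr \<eta> = X powr (- (s * p))" by (simp flip: powr_add)
      then have "C1 * X powr (- (s * p + \<eta>)) * (C2 * (8 * pi) powr (- (d / 2)) * t powr (- (d / 2)) * X powr \<eta>)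
        = C * t powr (- (d / 2)) * X powr (- (s * p))" by (simp add: C_def) 
      moreover have "0 \<le> C1 * X powr (- (s * p + \<eta>))"
          "0 \<le> C2 * (8 * pi) powr (- (d / 2)) * t powr (- (d / 2)) * X powr \<eta>"
        using C1(1) C2(1) by auto
      ultimately show ?thesis by (simp only: ennreal_mult_left_assoc)
    qed
    finally show ?thesis by (simp add: X_def)
  qed
  moreover have "0 < C" using C1(1) C2(1) by (simp add: C_def)
  ultimately show ?thesis unfolding d_def by blast
qed

text \<open>A bound at every x, with the exact weight (sqrt t + |x|)^(-s). It is the L^\<infinity>
  end point of the interpolation in \<open>hop_bnd\<close>, and it also shows that the convolution
  is finite everywhere.\<close>

lemma hop_pointwise_bnd:
  fixes s :: real
  assumes r: "0 \<le> r" "r \<le> 1" and s: "s < real DIM('a::euclidean_space) * (1 - r)"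
  shows "\<exists>C>0. \<forall>t F x B. 0 < t \<longrightarrow> F \<in> borel_measurable lborel \<longrightarrow> 0 \<le> B \<longrightarrow> bnd r s F B \<longrightarrow>
    hop t F (x::'a) \<le> ennreal (C * t powr (- (real DIM('a) * r / 2)) * (sqrt t + norm x) powr (- s) * B)"
proof (cases "r = 0")
  case True
  then have "s < real DIM('a)" using s by simp
  then obtain C where C: "0 < C" "\<And>t x. 0 < t \<Longrightarrow>
    (\<integral>\<^sup>+y. ennreal (heat_kernel t (x - y) * norm y powr (- s)) \<partial>lborel)
    \<le> ennreal (C * (sqrt t + norm (x::'a)) powr (- s))"
    using nn_integral_heat_kernel_norm_powr[of s, where ?'a='a] by blast
  have "hop t F x \<le> ennreal (C * (sqrt t + norm x) powr (- s) * B)"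
    if t: "0 < t" and [measurable]: "F \<in> borel_measurable lborel" and B: "0 \<le> B" "bnd r s F B" for t F B and x :: 'a
  proof -
    have "AE y in lborel. ennreal (norm y powr s) * F y \<le> ennreal B"
      using B True by (simp add: bnd_def)
    then have "AE y in lborel. ennreal (heat_kernel t (x - y)) * F y
      \<le> ennreal B * ennreal (heat_kernel t (x - y) * norm y powr (- s))"
      using AE_lborel_nonzero
    proof eventually_elim
      case (elim y)
      have "F y = ennreal (norm y powr (- s)) * (ennreal (norm y powr s) * F y)"
        using elim(2) by (simp add: mult.assoc[symmetric] powr_minus flip: ennreal_mult)
      also have "\<dots> \<le> ennreal (norm y powr (- s)) * ennreal B"
        using elim(1) by (intro mult_left_mono) auto
      finally have "ennreal (heat_kernel t (x - y)) * F y
        \<le> ennreal (heat_kernel t (x - y)) * (ennreal (norm y powr (- s)) * ennreal B)"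
        by (intro mult_left_mono) auto
      then show ?case using B by (simp add: ennreal_mult mult_ac)
    qed
    then have "hop t F x \<le> (\<integral>\<^sup>+y. ennreal B * ennreal (heat_kernel t (x - y) * norm y powr (- s)) \<partial>lborel)"
      unfolding hop_def by (intro nn_integral_mono_AE)
    also have "\<dots> = ennreal B * (\<integral>\<^sup>+y. ennreal (heat_kernel t (x - y) * norm y powr (- s)) \<partial>lborel)"
      by (intro nn_integral_cmult) measurable
    also have "\<dots> \<le> ennreal B * ennreal (C * (sqrt t + norm x) powr (- s))"
      using C(2)[OF t] by (intro mult_left_mono) auto
    also have "\<dots> = ennreal (C * (sqrt t + norm x) powr (- s) * B)"
      using C(1) B by (simp add: mult_ac flip: ennreal_mult)
    finally show ?thesis .
  qed
  with C(1) True show ?thesis by (intro exI[of _ C]) simp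
next
  case False
  with r have r0: "0 < r" by simp
  define p where "p = 1 / r"
  have p: "1 \<le> p" "0 < p" and rp: "r = 1 / p" using r r0 by (auto simp: p_def)
  obtain C where C: "0 < C" "\<And>t F x. 0 < t \<Longrightarrow> F \<in> borel_measurable lborel \<Longrightarrow>
    epow (hop t F (x::'a)) p \<le> ennreal (C * t powr (- (real DIM('a) / 2)) * (sqrt t + norm x) powr (- (s * p))) *
      (\<integral>\<^sup>+y. epow (ennreal (norm y powr s) * F y) p \<partial>lborel)"
    using hop_epow_pointwise[OF p(1), of s, where ?'a='a] s unfolding rp by blast
  have "hop t F x \<le> ennreal (C powr r * t powr (- (real DIM('a) * r / 2)) * (sqrt t + norm x) powr (- s) * B)"
    if t: "0 < t" and [measurable]: "F \<in> borel_measurable lborel" and B: "0 \<le> B" "bnd r s F B" for t F B and x :: 'a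
  proof -
    define X where "X = sqrt t + norm x"
    have X: "0 < X" using t by (simp add: X_def add_pos_nonneg)
    have "epow (hop t F x) p \<le> ennreal (C * t powr (- (real DIM('a) / 2)) * X powr (- (s * p))) *
      (\<integral>\<^sup>+y. epow (ennreal (norm y powr s) * F y) p \<partial>lborel)"
      unfolding X_def by (intro C(2)) fact+
    also have "\<dots> \<le> ennreal (C * t powr (- (real DIM('a) / 2)) * X powr (- (s * p))) * ennreal (B powr p)"
      using B False by (intro mult_left_mono) (auto simp: bnd_def p_def)
    also have "\<dots> = ennreal ((C powr r * t powr (- (real DIM('a) * r / 2)) * X powr (- s) * B) powr p)"
      using C(1) p B(1) by (simp add: powr_mult powr_powr rp flip: ennreal_mult)
    also have "\<dots> = epow (ennreal (C powr r * t powr (- (real DIM('a) * r / 2)) * X powr (- s) * B)) p"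
      using C(1) B(1) by simp
    finally show ?thesis using p by (simp add: epow_le_iff X_def)
  qed
  moreover have "0 < C powr r" using C(1) by simp
  ultimately show ?thesis by blast
qed

text \<open>For finite exponents \<open>1 \<le> p \<le> q\<close> write
  \<open>(hop t F)\<^sup>q = (hop t F)\<^sup>p (hop t F)\<^sup>q\<^sup>-\<^sup>p\<close>, estimate the second factor pointwise and the first by
  the Schur test with a power weight.\<close>

lemma hop_bnd:
  fixes s1 s2 r1 r2 :: real
  assumes r: "0 \<le> r2" "r2 \<le> r1" "r1 \<le> 1" "r1 = 0 \<longleftrightarrow> r2 = 0"
    and s: "- real DIM('a::euclidean_space) * r2 < s2" "s2 \<le> s1" "s1 < real DIM('a) * (1 - r1)"
  shows "\<exists>C>0. \<forall>t F B. 0 < t \<longrightarrow> F \<in> borel_measurable lborel \<longrightarrow> 0 \<le> B \<longrightarrow> bnd r1 s1 F B \<longrightarrow>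
    bnd r2 s2 (hop t F :: 'a \<Rightarrow> ennreal)
      (C * t powr (- (real DIM('a) / 2 * (r1 - r2) + (s1 - s2) / 2)) * B)"
proof -
  define d where "d = real DIM('a)"
  have r1: "0 \<le> r1" using r by simp
  obtain C1 where C1: "0 < C1" "\<And>t F x B. 0 < t \<Longrightarrow> F \<in> borel_measurable lborel \<Longrightarrow> 0 \<le> B \<Longrightarrow> bnd r1 s1 F B \<Longrightarrow>
    hop t F (x::'a) \<le> ennreal (C1 * t powr (- (d * r1 / 2)) * (sqrt t + norm x) powr (- s1) * B)"
    using hop_pointwise_bnd[OF r1 r(3) s(3)] unfolding d_def by blast
  show ?thesis
  \<comment> \<open>From L^\<infinity> to L^\<infinity> the pointwise bound suffices: 0 < s2 \<le>
    s1 gives |x|^s2 (sqrt t + |x|)^(-s1) \<le> t^(-(s1 - s2)/2).\<close>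
  proof (cases "r2 = 0")
    case True
    then have r10: "r1 = 0" using r by simp
    have s2: "0 < s2" using s True by simp
    have "bnd r2 s2 (hop t (F :: 'a \<Rightarrow> ennreal)) (C1 * t powr (- ((s1 - s2) / 2)) * B)"
      if t: "0 < t" and F: "F \<in> borel_measurable lborel" "0 \<le> B" "bnd r1 s1 F B" for t F B
    proof -
      have "ennreal (norm x powr s2) * hop t F x \<le> ennreal (C1 * t powr (- ((s1 - s2) / 2)) * B)" for x :: 'a
      proof -
        define X where "X = sqrt t + norm x"
        have X: "0 < X" "sqrt t \<le> X" "norm x \<le> X" using t by (auto simp: X_def add_pos_nonneg)
        have "ennreal (norm x powr s2) * hop t F x \<le> ennreal (norm x powr s2) * ennreal (C1 * X powr (- s1) * B)"
          using C1(2)[OF t F, of x] r10 t by (intro mult_left_mono) (auto simp: X_def)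
        also have "\<dots> = ennreal (C1 * (norm x powr s2 * X powr (- s1)) * B)"
          using C1(1) F by (simp add: mult_ac flip: ennreal_mult)
        also have "\<dots> \<le> ennreal (C1 * t powr (- ((s1 - s2) / 2)) * B)"
        proof -
          have "norm x powr s2 * X powr (- s1) \<le> X powr s2 * X powr (- s1)"
            using s2 X by (intro mult_right_mono powr_mono2) auto
          also have "\<dots> = X powr (- (s1 - s2))" by (simp flip: powr_add)
          also have "\<dots> \<le> sqrt t powr (- (s1 - s2))" using s X t by (intro powr_mono2') auto
          also have "\<dots> = t powr (- ((s1 - s2) / 2))"
            using t by (simp add: powr_half_sqrt[symmetric] powr_powr minus_divide_left)
          finally show ?thesis using C1(1) F by (intro ennreal_leI mult_right_mono mult_left_mono) auto
        qed
        finally show ?thesis .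
      qed
      then show ?thesis using True by (simp add: bnd_def)
    qed
    with C1(1) True r10 show ?thesis by (intro exI[of _ C1]) simp
  next
    case False
    then have r20: "0 < r2" "0 < r1" using r by auto
    define p q where "p = 1 / r1" and "q = 1 / r2"
    have rp: "r1 = 1 / p" and rq: "r2 = 1 / q" by (auto simp: p_def q_def)
    have p: "1 \<le> p" "p \<le> q" "0 < p" "0 < q" using r r20 by (auto simp: p_def q_def frac_le)
    define \<eta> where "\<eta> = max 0 (- s1)"
    obtain C2 where C2: "0 < C2" "\<And>t F x. 0 < t \<Longrightarrow> F \<in> borel_measurable lborel \<Longrightarrow>
      epow (hop t F (x::'a)) p \<le> ennreal (C2 * (sqrt t + norm x) powr (- (s1 * p + \<eta>))) *
      (\<integral>\<^sup>+y. ennreal (heat_kernel t (x - y) * norm y powr \<eta>) *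
        epow (ennreal (norm y powr s1) * F y) p \<partial>lborel)"
      using hop_epow_le[OF p(1), of s1, where ?'a='a] s(3) unfolding \<eta>_def rp by blast
    \<comment> \<open>The lower bound on s2 is exactly the local integrability of |x|^(s2
      q).\<close>
    have "- d < s2 * q" using s(1) p by (simp add: rq d_def field_simps)
    then obtain C3 where C3: "0 < C3" "\<And>t y. 0 < t \<Longrightarrow>
      (\<integral>\<^sup>+x. ennreal (heat_kernel t (x - y) * norm x powr (s2 * q) * (sqrt t + norm x) powr (- (s1 * q + \<eta>))) \<partial>lborel)
      \<le> ennreal (C3 * (sqrt t + norm (y::'a)) powr (s2 * q + - (s1 * q + \<eta>)))"
      using nn_integral_heat_kernel_weights[of "s2 * q" "- (s1 * q + \<eta>)", where ?'a='a] unfolding d_def by blast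
    define K where "K = C1 powr (q - p) * C2 * C3"
    have K: "0 < K" using C1(1) C2(1) C3(1) by (simp add: K_def)
    have "bnd r2 s2 (hop t (F :: 'a \<Rightarrow> ennreal)) (K powr r2 * t powr (- (d / 2 * (r1 - r2) + (s1 - s2) / 2)) * B)"
      if t: "0 < t" and F[measurable]: "F \<in> borel_measurable lborel" and B: "0 \<le> B" "bnd r1 s1 F B" for t F B
    proof -
      define h where "h y = epow (ennreal (norm y powr s1) * F y) p" for y :: 'a
      have [measurable]: "h \<in> borel_measurable lborel" unfolding h_def by measurable
      have hB: "(\<integral>\<^sup>+y. h y \<partial>lborel) \<le> ennreal (B powr p)"
        using B r20 by (simp add: bnd_def h_def p_def)
      \<comment> \<open>The part independent of x in the bound for the factor of power q - p; the
        remaining power of sqrt t + |x| joins the kernel in the Schur test.\<close>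
      define A where "A = (C1 * t powr (- (d * r1 / 2)) * B) powr (q - p)"
      have A: "0 \<le> A" by (simp add: A_def)
      have pt: "epow (ennreal (norm x powr s2) * hop t F x) q
        \<le> ennreal (A * C2) * (\<integral>\<^sup>+y. ennreal (heat_kernel t (x - y) * norm x powr (s2 * q)
           * (sqrt t + norm x) powr (- (s1 * q + \<eta>)) * norm y powr \<eta>) * h y \<partial>lborel)" for x :: 'a
      proof -
        define X where "X = sqrt t + norm x"
        have X: "0 < X" using t by (simp add: X_def add_pos_nonneg)
        have "epow (hop t F x) (q - p) \<le> epow (ennreal (C1 * t powr (- (d * r1 / 2)) * X powr (- s1) * B)) (q - p)"
          using C1(2)[OF t F B, of x] p by (intro epow_mono) (auto simp: X_def)
        also have "\<dots> = ennreal (A * X powr (- (s1 * (q - p))))"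
          using C1(1) B(1) by (simp add: A_def powr_mult powr_powr mult_ac)
        finally have 1: "epow (hop t F x) (q - p) \<le> ennreal (A * X powr (- (s1 * (q - p))))" .
        have "epow (hop t F x) q = epow (hop t F x) (q - p) * epow (hop t F x) p"
          by (simp flip: epow_add)
        also have "\<dots> \<le> ennreal (A * X powr (- (s1 * (q - p)))) * (ennreal (C2 * X powr (- (s1 * p + \<eta>))) *
            (\<integral>\<^sup>+y. ennreal (heat_kernel t (x - y) * norm y powr \<eta>) * h y \<partial>lborel))"
          using 1 C2(2)[OF t F, of x] by (intro mult_mono) (auto simp: X_def h_def)
        also have "\<dots> = ennreal (A * C2 * X powr (- (s1 * q + \<eta>))) *
            (\<integral>\<^sup>+y. ennreal (heat_kernel t (x - y) * norm y powr \<eta>) * h y \<partial>lborel)"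
        proof -
          have "X powr (- (s1 * (q - p))) * X powr (- (s1 * p + \<eta>)) = X powr (- (s1 * q + \<eta>))"
            by (simp flip: powr_add add: algebra_simps)
          then have "A * X powr (- (s1 * (q - p))) * (C2 * X powr (- (s1 * p + \<eta>))) = A * C2 * X powr (- (s1 * q + \<eta>))"
            by simp
          moreover have "0 \<le> A * X powr (- (s1 * (q - p)))" "0 \<le> C2 * X powr (- (s1 * p + \<eta>))"
            using A C2(1) by auto
          ultimately show ?thesis by (simp only: ennreal_mult_left_assoc)
        qed
        finally have "epow (ennreal (norm x powr s2) * hop t F x) q \<le> ennreal (norm x powr (s2 * q)) *
           (ennreal (A * C2 * X powr (- (s1 * q + \<eta>))) *
            (\<integral>\<^sup>+y. ennreal (heat_kernel t (x - y) * norm y powr \<eta>) * h y \<partial>lborel))"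
          by (auto simp: epow_mult powr_powr intro: mult_left_mono)
        also have "\<dots> = ennreal (A * C2) * (ennreal (norm x powr (s2 * q) * X powr (- (s1 * q + \<eta>))) *
            (\<integral>\<^sup>+y. ennreal (heat_kernel t (x - y) * norm y powr \<eta>) * h y \<partial>lborel))"
          using A C2(1) by (simp add: mult_ac ennreal_mult)
        also have "ennreal (norm x powr (s2 * q) * X powr (- (s1 * q + \<eta>))) *
            (\<integral>\<^sup>+y. ennreal (heat_kernel t (x - y) * norm y powr \<eta>) * h y \<partial>lborel)
          = (\<integral>\<^sup>+y. ennreal (norm x powr (s2 * q) * X powr (- (s1 * q + \<eta>))) *
            (ennreal (heat_kernel t (x - y) * norm y powr \<eta>) * h y) \<partial>lborel)"
          by (intro nn_integral_cmult[symmetric]) measurable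
        also have "\<dots> = (\<integral>\<^sup>+y. ennreal (heat_kernel t (x - y) * norm x powr (s2 * q)
           * X powr (- (s1 * q + \<eta>)) * norm y powr \<eta>) * h y \<partial>lborel)"
          by (intro nn_integral_cong) (simp add: mult_ac ennreal_mult)
        finally show ?thesis by (simp add: X_def)
      qed
      have "(\<integral>\<^sup>+x. epow (ennreal (norm x powr s2) * hop t F x) q \<partial>lborel)
        \<le> (\<integral>\<^sup>+x. ennreal (A * C2) * (\<integral>\<^sup>+y. ennreal (heat_kernel t (x - y) * norm x powr (s2 * q)
           * (sqrt t + norm x) powr (- (s1 * q + \<eta>)) * norm y powr \<eta>) * h y \<partial>lborel) \<partial>lborel)"
        by (intro nn_integral_mono pt)
      also have "\<dots> = ennreal (A * C2) * (\<integral>\<^sup>+x. (\<integral>\<^sup>+y. ennreal (heat_kernel t (x - y) * norm x powr (s2 * q)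
           * (sqrt t + norm x) powr (- (s1 * q + \<eta>)) * norm y powr \<eta>) * h y \<partial>lborel) \<partial>lborel)"
        by (intro nn_integral_cmult) measurable
      also have "(\<integral>\<^sup>+x. (\<integral>\<^sup>+y. ennreal (heat_kernel t (x - y) * norm x powr (s2 * q)
           * (sqrt t + norm x) powr (- (s1 * q + \<eta>)) * norm y powr \<eta>) * h y \<partial>lborel) \<partial>lborel)
         = (\<integral>\<^sup>+y. (\<integral>\<^sup>+x. ennreal (heat_kernel t (x - y) * norm x powr (s2 * q)
           * (sqrt t + norm x) powr (- (s1 * q + \<eta>)) * norm y powr \<eta>) * h y \<partial>lborel) \<partial>lborel)"
        by (intro lborel_pair.Fubini') measurable
      also have "\<dots> \<le> (\<integral>\<^sup>+y. ennreal (C3 * t powr (- ((s1 - s2) * q / 2))) * h y \<partial>lborel)"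
      proof (intro nn_integral_mono)
        fix y :: 'a
        define Y where "Y = sqrt t + norm y"
        have Y: "0 < Y" "sqrt t \<le> Y" "norm y \<le> Y" using t by (auto simp: Y_def add_pos_nonneg)
        have "(\<integral>\<^sup>+x. ennreal (heat_kernel t (x - y) * norm x powr (s2 * q)
           * (sqrt t + norm x) powr (- (s1 * q + \<eta>)) * norm y powr \<eta>) * h y \<partial>lborel)
          = (\<integral>\<^sup>+x. ennreal (norm y powr \<eta>) * h y * ennreal (heat_kernel t (x - y) * norm x powr (s2 * q)
           * (sqrt t + norm x) powr (- (s1 * q + \<eta>))) \<partial>lborel)"
          by (intro nn_integral_cong) (simp add: ennreal_mult mult_ac)
        also have "\<dots> = ennreal (norm y powr \<eta>) * h y * (\<integral>\<^sup>+x. ennreal (heat_kernel t (x - y) * norm x powr (s2 * q)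
           * (sqrt t + norm x) powr (- (s1 * q + \<eta>))) \<partial>lborel)"
          by (intro nn_integral_cmult) measurable
        also have "\<dots> \<le> ennreal (norm y powr \<eta>) * h y * ennreal (C3 * Y powr (s2 * q + - (s1 * q + \<eta>)))"
          using C3(2)[OF t] by (intro mult_left_mono) (auto simp: Y_def)
        also have "\<dots> = ennreal (C3 * (norm y powr \<eta> * Y powr (s2 * q + - (s1 * q + \<eta>)))) * h y"
          using C3(1) by (simp add: ennreal_mult mult_ac)
        also have "\<dots> \<le> ennreal (C3 * t powr (- ((s1 - s2) * q / 2))) * h y"
        proof -
          \<comment> \<open>Here \<eta> drops out, and since s2 \<le> s1 the remaining power of Y is
            largest at Y = sqrt t. This is the origin of the factor t^(-(s1 - s2)/2) and the reason
            for the restriction s2 \<le> s1.\<close>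
          have "norm y powr \<eta> * Y powr (s2 * q + - (s1 * q + \<eta>)) \<le> Y powr \<eta> * Y powr (s2 * q + - (s1 * q + \<eta>))"
            using Y by (intro mult_right_mono powr_mono2) (auto simp: \<eta>_def)
          also have "\<dots> = Y powr (- ((s1 - s2) * q))" by (simp flip: powr_add add: algebra_simps)
          also have "\<dots> \<le> sqrt t powr (- ((s1 - s2) * q))"
            using s p Y t by (intro powr_mono2') auto
          also have "\<dots> = t powr (- ((s1 - s2) * q / 2))" using t by (simp add: powr_half_sqrt[symmetric] powr_powr)
          finally show ?thesis using C3(1) by (intro mult_right_mono ennreal_leI mult_left_mono) auto
        qed
        finally show "(\<integral>\<^sup>+x. ennreal (heat_kernel t (x - y) * norm x powr (s2 * q)
           * (sqrt t + norm x) powr (- (s1 * q + \<eta>)) * norm y powr \<eta>) * h y \<partial>lborel)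
           \<le> ennreal (C3 * t powr (- ((s1 - s2) * q / 2))) * h y" .
      qed
      also have "\<dots> = ennreal (C3 * t powr (- ((s1 - s2) * q / 2))) * (\<integral>\<^sup>+y. h y \<partial>lborel)"
        by (intro nn_integral_cmult) measurable
      also have "ennreal (A * C2) * (ennreal (C3 * t powr (- ((s1 - s2) * q / 2))) * (\<integral>\<^sup>+y. h y \<partial>lborel))
        \<le> ennreal (A * C2) * (ennreal (C3 * t powr (- ((s1 - s2) * q / 2))) * ennreal (B powr p))"
        using hB by (intro mult_left_mono) auto
      also have "\<dots> = ennreal (A * C2 * (C3 * t powr (- ((s1 - s2) * q / 2)) * B powr p))"
        using A C2(1) C3(1) by (simp flip: ennreal_mult)
      also have "A * C2 * (C3 * t powr (- ((s1 - s2) * q / 2)) * B powr p)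
        = (K powr r2 * t powr (- (d / 2 * (r1 - r2) + (s1 - s2) / 2)) * B) powr q"
      proof -
        have "B powr (q - p) * B powr p = B powr q" by (simp flip: powr_add)
        moreover have "(t powr (- (d * r1 / 2))) powr (q - p) * t powr (- ((s1 - s2) * q / 2))
          = (t powr (- (d / 2 * (r1 - r2) + (s1 - s2) / 2))) powr q"
        proof -
          have "- (d * r1 / 2) * (q - p) + - ((s1 - s2) * q / 2) = - (d / 2 * (r1 - r2) + (s1 - s2) / 2) * q"
            using p by (simp add: rp rq field_simps)
          then show ?thesis by (simp only: powr_powr powr_add[symmetric])
        qed
        moreover have "(K powr r2) powr q = K" using K p by (simp add: powr_powr rq)
        ultimately have "(K powr r2 * t powr (- (d / 2 * (r1 - r2) + (s1 - s2) / 2)) * B) powr q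
          = (C1 powr (q - p) * C2 * C3) * ((t powr (- (d * r1 / 2))) powr (q - p) * t powr (- ((s1 - s2) * q / 2)))
             * (B powr (q - p) * B powr p)"
          by (simp only: powr_mult) (simp only: K_def)
        then show ?thesis by (simp only: A_def powr_mult mult_ac)
      qed
      finally show ?thesis using False by (auto simp: bnd_def q_def mult_left_mono)
    qed
    moreover have "0 < K powr r2" using K by simp
    ultimately show ?thesis unfolding d_def by blast
  qed
qed

lemma hop_mono: "(\<And>y. F y \<le> G y) \<Longrightarrow> hop t F x \<le> hop t G x"
  unfolding hop_def by (intro nn_integral_mono mult_left_mono) auto

lemma hop_hop:
  fixes x :: "'a::euclidean_space"
  assumes s: "0 < s" and t: "0 < t" and [measurable]: "F \<in> borel_measurable lborel"
  shows "hop s (hop t F) x = hop (s + t) F x"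
proof -
  have "hop s (hop t F) x = (\<integral>\<^sup>+y. (\<integral>\<^sup>+z. ennreal (heat_kernel s (x - y)) * (ennreal (heat_kernel t (y - z)) * F z) \<partial>lborel) \<partial>lborel)"
    unfolding hop_def by (intro nn_integral_cong nn_integral_cmult[symmetric]) measurable
  also have "\<dots> = (\<integral>\<^sup>+z. (\<integral>\<^sup>+y. ennreal (heat_kernel s (x - y)) * (ennreal (heat_kernel t (y - z)) * F z) \<partial>lborel) \<partial>lborel)"
    by (intro lborel_pair.Fubini') measurable
  also have "\<dots> = (\<integral>\<^sup>+z. ennreal (heat_kernel (s + t) (x - z)) * F z \<partial>lborel)"
  proof (intro nn_integral_cong)
    fix z
    have "(\<integral>\<^sup>+y. ennreal (heat_kernel s (x - y)) * (ennreal (heat_kernel t (y - z)) * F z) \<partial>lborel)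
      = (\<integral>\<^sup>+y. F z * (ennreal (heat_kernel s (x - y)) * ennreal (heat_kernel t (y - z))) \<partial>lborel)"
      by (intro nn_integral_cong) (simp add: mult_ac)
    also have "\<dots> = F z * (\<integral>\<^sup>+y. ennreal (heat_kernel s (x - y)) * ennreal (heat_kernel t (y - z)) \<partial>lborel)"
      by (intro nn_integral_cmult) measurable
    finally show "(\<integral>\<^sup>+y. ennreal (heat_kernel s (x - y)) * (ennreal (heat_kernel t (y - z)) * F z) \<partial>lborel)
      = ennreal (heat_kernel (s + t) (x - z)) * F z"
      using nn_integral_heat_kernel_mult[OF s t, of x z] by (simp add: mult.commute)
  qed
  finally show ?thesis by (simp add: hop_def)
qed

section \<open>The Duhamel integral\<close>

lemma heat_kernel_le_double:
  assumes t: "0 < t"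
  shows "heat_kernel t (x::'a::euclidean_space) \<le> 2 powr (real DIM('a) / 2) * heat_kernel (2 * t) x"
proof -
  have "4 * pi * (2 * t) = 2 * (4 * pi * t)" by simp
  moreover have "(2 * (4 * pi * t)) powr k = 2 powr k * (4 * pi * t) powr k" for k
    by (rule powr_mult)
  moreover have "2 powr k * 2 powr (- k) = (1::real)" for k
    by (simp flip: powr_add)
  ultimately have c: "(4 * pi * t) powr (- (real DIM('a) / 2))
      = 2 powr (real DIM('a) / 2) * (4 * pi * (2 * t)) powr (- (real DIM('a) / 2))"
    by (simp only: mult.assoc[symmetric])
  have "exp (- ((norm x)\<^sup>2 / (4 * t))) \<le> exp (- ((norm x)\<^sup>2 / (4 * (2 * t))))"
    using t by (simp add: divide_left_mono)
  then show ?thesis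
    unfolding heat_kernel_def c by (simp add: mult_left_mono mult.assoc)
qed

lemma DERIV_heat_kernel:
  assumes t: "0 < t"
  shows "((\<lambda>t. heat_kernel t (x::'a::euclidean_space)) has_real_derivative
    heat_kernel t x / t * ((norm x)\<^sup>2 / (4 * t) - real DIM('a) / 2)) (at t)"
proof -
  define k where "k = real DIM('a) / 2"
  have 1: "(4 * pi * t) powr (- k - 1) = (4 * pi * t) powr (- k) / (4 * pi * t)"
    using t by (simp add: powr_diff)
  have "((\<lambda>t. (4 * pi * t) powr (- k) * exp (- ((norm x)\<^sup>2 / (4 * t)))) has_real_derivative
     (- k * (4 * pi * t) powr (- k - 1) * (4 * pi)) * exp (- ((norm x)\<^sup>2 / (4 * t)))
     + (4 * pi * t) powr (- k) * (exp (- ((norm x)\<^sup>2 / (4 * t))) * ((norm x)\<^sup>2 / (4 * t\<^sup>2)))) (at t)"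
    using t by (auto intro!: derivative_eq_intros simp: power2_eq_square field_simps)
  moreover have "(- k * (4 * pi * t) powr (- k - 1) * (4 * pi)) * exp (- ((norm x)\<^sup>2 / (4 * t)))
     + (4 * pi * t) powr (- k) * (exp (- ((norm x)\<^sup>2 / (4 * t))) * ((norm x)\<^sup>2 / (4 * t\<^sup>2)))
     = (4 * pi * t) powr (- k) * exp (- ((norm x)\<^sup>2 / (4 * t))) / t * ((norm x)\<^sup>2 / (4 * t) - k)"
    unfolding 1 using t by (simp add: field_simps power2_eq_square)
  ultimately show ?thesis unfolding heat_kernel_def k_def by simp
qed

text \<open>For h < r the mean value theorem gives h / \<rho> times the kernel at an intermediate
  time \<rho> times a factor of order 1 + |x|^2 / \<rho>, which half of the Gaussian absorbs. For h
  \<ge> r the triangle inequality is enough. The form with a minimum permits interpolation later on: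
  min 1 z \<le> z^e for 0 < e \<le> 1.\<close>

lemma heat_kernel_time_diff:
  "\<exists>C>0. \<forall>r h x. 0 < r \<longrightarrow> 0 \<le> h \<longrightarrow>
    \<bar>heat_kernel (r + h) (x::'a::euclidean_space) - heat_kernel r x\<bar>
    \<le> C * min 1 (h / r) * (heat_kernel (2 * (r + h)) x + heat_kernel (2 * r) x)"
proof -
  define k where "k = real DIM('a) / 2"
  have k: "0 < k" by (simp add: k_def)
  define C where "C = 4 powr k * (2 * (1 + k))"
  have p2: "1 \<le> 2 powr k" using k by (simp add: ge_one_powr_ge_zero)
  have "2 powr k \<le> 4 powr k" using k by (intro powr_mono2) auto
  then have "2 powr k * 1 \<le> 4 powr k * (2 * (1 + k))" using k by (intro mult_mono) auto
  then have C1: "2 powr k \<le> C" by (simp add: C_def)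
  then have C: "0 < C" using p2 by simp
  have "\<bar>heat_kernel (r + h) x - heat_kernel r x\<bar>
    \<le> C * min 1 (h / r) * (heat_kernel (2 * (r + h)) x + heat_kernel (2 * r) x)" if r: "0 < r" and h: "0 \<le> h" for r h and x :: 'a
  proof (cases "r \<le> h")
    case True
    have "\<bar>heat_kernel (r + h) x - heat_kernel r x\<bar> \<le> heat_kernel (r + h) x + heat_kernel r x"
      using heat_kernel_nonneg[of "r + h" x] heat_kernel_nonneg[of r x] by linarith
    also have "\<dots> \<le> 2 powr k * heat_kernel (2 * (r + h)) x + 2 powr k * heat_kernel (2 * r) x"
      using r h unfolding k_def by (intro add_mono heat_kernel_le_double) auto
    also have "\<dots> = 2 powr k * (heat_kernel (2 * (r + h)) x + heat_kernel (2 * r) x)"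
      by (simp add: distrib_left)
    also have "\<dots> \<le> C * (heat_kernel (2 * (r + h)) x + heat_kernel (2 * r) x)"
      using C1 by (intro mult_right_mono add_nonneg_nonneg) auto
    finally show ?thesis using True r by simp
  next
    case hr: False
    have main: "\<bar>heat_kernel (r + h) x - heat_kernel r x\<bar> \<le> C * (h / r) * heat_kernel (2 * (r + h)) x"
    proof (cases "h = 0")
      case False
      with h have h: "0 < h" by simp
      obtain \<rho> where \<rho>: "r < \<rho>" "\<rho> < r + h" "heat_kernel (r + h) x - heat_kernel r x
          = (r + h - r) * (heat_kernel \<rho> x / \<rho> * ((norm x)\<^sup>2 / (4 * \<rho>) - k))"
        using MVT2[of r "r + h" "\<lambda>t. heat_kernel t x" "\<lambda>t. heat_kernel t x / t * ((norm x)\<^sup>2 / (4 * t) - k)"]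
          r h DERIV_heat_kernel[of _ x] unfolding k_def by auto
      define u where "u = (norm x)\<^sup>2 / (4 * \<rho>)"
      have \<rho>0: "0 < \<rho>" using r \<rho> by simp
      then have u: "0 \<le> u" by (simp add: u_def)
      have gr: "heat_kernel \<rho> x = (4 * pi * \<rho>) powr (- k) * exp (- (u / 2)) * exp (- (u / 2))"
        unfolding heat_kernel_def u_def k_def by (simp flip: exp_add add: mult.assoc)
      have "u / 2 * exp (- (u / 2)) \<le> 1"
        using exp_ge_add_one_self[of "u / 2"] u by (simp add: exp_minus field_simps)
      then have "u * exp (- (u / 2)) \<le> 2" by simp
      moreover have "k * exp (- (u / 2)) \<le> k * 1" using k u by (intro mult_left_mono) auto
      ultimately have "u * exp (- (u / 2)) + k * exp (- (u / 2)) \<le> 2 + k * 1" by (rule add_mono)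
      also have "\<dots> \<le> 2 * (1 + k)" using k by simp
      finally have ue: "(u + k) * exp (- (u / 2)) \<le> 2 * (1 + k)" by (simp only: distrib_right)
      have "(4 * pi * \<rho>) powr (- k) \<le> (4 * pi * r) powr (- k)"
        using \<rho> r k by (intro powr_mono2') auto
      \<comment> \<open>In this branch h < r, hence (r + h) / 2 < r.\<close>
      also have "\<dots> \<le> (1 / 4 * (4 * pi * (2 * (r + h)))) powr (- k)"
        using hr r h k by (intro powr_mono2') auto
      also have "\<dots> = (1 / 4) powr (- k) * (4 * pi * (2 * (r + h))) powr (- k)" by (rule powr_mult)
      also have "(1 / 4) powr (- k) = 4 powr k" by (simp add: powr_minus powr_divide)
      finally have pk: "(4 * pi * \<rho>) powr (- k) \<le> 4 powr k * (4 * pi * (2 * (r + h))) powr (- k)" .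
      have ex: "exp (- (u / 2)) \<le> exp (- ((norm x)\<^sup>2 / (4 * (2 * (r + h)))))"
        using \<rho> \<rho>0 by (simp add: u_def divide_left_mono)
      have "heat_kernel \<rho> x * (u + k) = (4 * pi * \<rho>) powr (- k) * exp (- (u / 2)) * ((u + k) * exp (- (u / 2)))"
        by (simp add: gr)
      also have "\<dots> \<le> 4 powr k * (4 * pi * (2 * (r + h))) powr (- k) * exp (- ((norm x)\<^sup>2 / (4 * (2 * (r + h)))))
          * (2 * (1 + k))"
        by (rule mult_mono[OF mult_mono[OF pk ex] ue]) (use u k in auto)
      also have "\<dots> = C * heat_kernel (2 * (r + h)) x"
        by (simp add: C_def heat_kernel_def k_def)
      finally have Gu: "heat_kernel \<rho> x * (u + k) \<le> C * heat_kernel (2 * (r + h)) x" .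
      have "\<bar>heat_kernel (r + h) x - heat_kernel r x\<bar> = h / \<rho> * (heat_kernel \<rho> x * \<bar>u - k\<bar>)"
        unfolding \<rho>(3) using h \<rho>0 by (simp add: abs_mult u_def)
      also have "\<dots> \<le> h / r * (C * heat_kernel (2 * (r + h)) x)"
      proof (rule mult_mono)
        have "heat_kernel \<rho> x * \<bar>u - k\<bar> \<le> heat_kernel \<rho> x * (u + k)"
          using u k by (intro mult_left_mono) auto
        with Gu show "heat_kernel \<rho> x * \<bar>u - k\<bar> \<le> C * heat_kernel (2 * (r + h)) x" by simp
      qed (use h r \<rho> in \<open>auto intro: divide_left_mono\<close>)
      finally show ?thesis by (simp add: mult_ac)
    qed (use C in auto)
    also have "C * (h / r) * heat_kernel (2 * (r + h)) x \<le> C * (h / r) * (heat_kernel (2 * (r + h)) x + heat_kernel (2 * r) x)"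
      using C h r by (intro mult_left_mono) auto
    finally show ?thesis using hr r by (simp add: min_def)
  qed
  with C show ?thesis by blast
qed

section \<open>Heat semigroup and Duhamel term of vector-valued functions\<close>

abbreviation nrm :: "('a \<Rightarrow> 'k::real_normed_vector) \<Rightarrow> 'a \<Rightarrow> ennreal"
  where "nrm f \<equiv> \<lambda>x. ennreal (norm (f x))"

text \<open>\<open>heat\<close> integrates over Lebesgue measure. For Borel functions it may be
  computed over \<open>lborel\<close>, where product measurability and Fubini's theorem are at
  hand.\<close>

lemma heat_eq_lborel:
  fixes f :: "'a::euclidean_space \<Rightarrow> 'k::euclidean_space"
  assumes [measurable]: "f \<in> borel_measurable lborel" and "t \<noteq> 0"
  shows "heat t f x = (LINT y|lborel. heat_kernel t (x - y) *\<^sub>R f y)"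
  unfolding heat_def using assms(2) by (simp add: integral_completion)

text \<open>Time, function and point may all depend on the parameter; this one form gives
  measurability of slices, joint measurability of the linear evolution, and measurability of the
  Duhamel integrand in \<tau>.\<close>

lemma borel_measurable_heat:
  fixes F :: "'i \<Rightarrow> 'a::euclidean_space \<Rightarrow> 'k::euclidean_space"
  assumes F: "case_prod F \<in> borel_measurable (M \<Otimes>\<^sub>M lborel)"
    and [measurable]: "g \<in> borel_measurable M" "h \<in> measurable M borel"
  shows "(\<lambda>i. heat (g i) (F i) (h i)) \<in> borel_measurable M"
proof -
  note F[measurable]
  have [measurable]: "(\<lambda>i. F i (h i)) \<in> borel_measurable M"
    using measurable_compose[of "\<lambda>i. (i, h i)" M "M \<Otimes>\<^sub>M lborel", OF _ F] by simp
  have "(\<lambda>i. if g i = 0 then F i (h i) else (LINT y|lborel. heat_kernel (g i) (h i - y) *\<^sub>R F i y)) \<in> borel_measurable M"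
    by measurable
  moreover have "heat (g i) (F i) (h i) = (if g i = 0 then F i (h i)
      else (LINT y|lborel. heat_kernel (g i) (h i - y) *\<^sub>R F i y))" if "i \<in> space M" for i
  proof -
    have "F i \<in> borel_measurable lborel" using F that by measurable
    then show ?thesis by (auto simp: heat_eq_lborel) (simp add: heat_def)
  qed
  ultimately show ?thesis by (simp cong: measurable_cong)
qed

lemma integrable_heat:
  fixes f :: "'a::euclidean_space \<Rightarrow> 'k::euclidean_space"
  assumes [measurable]: "f \<in> borel_measurable lborel" and "hop t (nrm f) x < top"
  shows "integrable lborel (\<lambda>y. heat_kernel t (x - y) *\<^sub>R f y)"
  using assms(2) by (intro integrableI_bounded) (auto simp: hop_def ennreal_mult)

text \<open>No integrability is assumed: a divergent Bochner integral has the value 0, and then the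
  inequality is trivial.\<close>

lemma norm_heat_le:
  fixes f :: "'a::euclidean_space \<Rightarrow> 'k::euclidean_space"
  assumes [measurable]: "f \<in> borel_measurable lborel" and "0 < t"
  shows "nrm (heat t f) x \<le> hop t (nrm f) x"
proof (cases "integrable lborel (\<lambda>y. heat_kernel t (x - y) *\<^sub>R f y)")
  case True
  from integral_norm_bound_ennreal[OF this] show ?thesis
    using assms(2) by (simp add: heat_eq_lborel hop_def ennreal_mult)
next
  case False
  then show ?thesis using assms(2) by (simp add: heat_eq_lborel not_integrable_integral_eq)
qed

lemma heat_diff:
  fixes f g :: "'a::euclidean_space \<Rightarrow> 'k::euclidean_space"
  assumes [measurable]: "f \<in> borel_measurable lborel" "g \<in> borel_measurable lborel" and t: "0 < t"
    and "hop t (nrm f) x < top" "hop t (nrm g) x < top"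
  shows "heat t (\<lambda>y. f y - g y) x = heat t f x - heat t g x"
  using t integrable_heat[OF assms(1,4)] integrable_heat[OF assms(2,5)]
  by (simp add: heat_eq_lborel scaleR_diff_right)

text \<open>f itself may fail to be Borel. The time 0 is excluded because \<open>heat 0\<close> is
  the identity on functions and so sees null sets.\<close>

lemma heat_cong_AE:
  fixes f g :: "'a::euclidean_space \<Rightarrow> 'k::euclidean_space"
  assumes "AE y in lborel. f y = g y" "t \<noteq> 0" and [measurable]: "g \<in> borel_measurable lborel"
  shows "heat t f x = heat t g x"
proof -
  have ae: "AE y in lebesgue. f y = g y" using assms(1) by (simp add: AE_completion_iff)
  have g: "(\<lambda>y. heat_kernel t (x - y) *\<^sub>R g y) \<in> borel_measurable lebesgue"
    by (intro measurable_completion) measurable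
  have "(\<lambda>y. heat_kernel t (x - y) *\<^sub>R f y) \<in> borel_measurable lebesgue"
    using ae by (intro borel_measurable_AE[OF g]) (auto elim!: eventually_mono)
  with g have "(LINT y|lebesgue. heat_kernel t (x - y) *\<^sub>R f y) = (LINT y|lebesgue. heat_kernel t (x - y) *\<^sub>R g y)"
    using ae by (intro integral_cong_AE) (auto elim!: eventually_mono)
  with assms(2) show ?thesis by (simp add: heat_def)
qed

text \<open>The open interval leaves out \<tau> = t, where \<open>hop 0\<close> is 0 while
  \<open>heat 0\<close> is the identity, and \<tau> = 0, where a Kato bound says nothing.\<close>

definition duh :: "(real \<Rightarrow> 'a::euclidean_space \<Rightarrow> ennreal) \<Rightarrow> real \<Rightarrow> 'a \<Rightarrow> ennreal"
  where "duh F t x = (\<integral>\<^sup>+\<tau>. indicator {0<..<t} \<tau> * hop (t - \<tau>) (F \<tau>) x \<partial>lborel)"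

definition duhamel :: "(real \<Rightarrow> 'a::euclidean_space \<Rightarrow> 'k::euclidean_space) \<Rightarrow> real \<Rightarrow> 'a \<Rightarrow> 'k"
  where "duhamel N t x = (LINT \<tau>:{0..t}|lebesgue. heat (t - \<tau>) (N \<tau>) x)"

lemma borel_measurable_hop_param [measurable (raw)]:
  assumes [measurable]: "case_prod F \<in> borel_measurable (M \<Otimes>\<^sub>M lborel)"
    "g \<in> borel_measurable M" "h \<in> measurable M borel"
  shows "(\<lambda>i. hop (g i) (F i) (h i)) \<in> borel_measurable M"
  unfolding hop_def by measurable

lemma duh_mono:
  assumes "\<And>\<tau> x. 0 < \<tau> \<Longrightarrow> \<tau> < t \<Longrightarrow> F \<tau> x \<le> G \<tau> x"
  shows "duh F t x \<le> duh G t x"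
  unfolding duh_def using assms
  by (intro nn_integral_mono) (auto intro!: hop_mono simp: indicator_def)

lemma borel_measurable_slice:
  assumes "case_prod F \<in> borel_measurable (lborel \<Otimes>\<^sub>M lborel)"
  shows "F (\<tau>::real) \<in> borel_measurable (lborel :: 'a::euclidean_space measure)"
  using measurable_compose_Pair1[of \<tau> lborel "case_prod F" lborel borel] assms by simp

lemma set_integrable_lebesgue_iff:
  fixes f :: "real \<Rightarrow> 'k::euclidean_space"
  assumes [measurable]: "f \<in> borel_measurable lborel"
  shows "set_integrable lebesgue {a..b} f \<longleftrightarrow> integrable lborel (\<lambda>\<tau>. indicator {a..b} \<tau> *\<^sub>R f \<tau>)"
    "(LINT \<tau>:{a..b}|lebesgue. f \<tau>) = (LINT \<tau>|lborel. indicator {a..b} \<tau> *\<^sub>R f \<tau>)"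
  unfolding set_integrable_def set_lebesgue_integral_def
  by (simp_all add: integrable_completion integral_completion)

text \<open>Finiteness of the majorant \<open>duh\<close> at one point gives every convergence that
  the nonlinear term of the equation demands there: of the convolutions at almost all times, and of
  the time integral. The two end points, where majorant and integrand are unrelated, form a null
  set.\<close>

lemma duhamel_converges:
  fixes N :: "real \<Rightarrow> 'a::euclidean_space \<Rightarrow> 'k::euclidean_space"
  assumes N[measurable]: "case_prod N \<in> borel_measurable (lborel \<Otimes>\<^sub>M lborel)"
    and fin: "duh (\<lambda>\<tau>. nrm (N \<tau>)) t x < top"
  shows "AE \<tau> in lborel. \<tau> \<in> {0<..<t} \<longrightarrow> hop (t - \<tau>) (nrm (N \<tau>)) x < top"
    "AE \<tau> in lborel. \<tau> \<in> {0<..<t} \<longrightarrow> integrable lborel (\<lambda>y. heat_kernel (t - \<tau>) (x - y) *\<^sub>R N \<tau> y)"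
    "integrable lborel (\<lambda>\<tau>. indicator {0..t} \<tau> *\<^sub>R heat (t - \<tau>) (N \<tau>) x)"
    "nrm (duhamel N t) x \<le> duh (\<lambda>\<tau>. nrm (N \<tau>)) t x"
proof -
  have Ns[measurable]: "N \<tau> \<in> borel_measurable lborel" for \<tau>
    using N by (rule borel_measurable_slice)
  have [measurable]: "(\<lambda>\<tau>. heat (t - \<tau>) (N \<tau>) x) \<in> borel_measurable lborel"
    by (intro borel_measurable_heat) measurable
  have "AE \<tau> in lborel. indicator {0<..<t} \<tau> * hop (t - \<tau>) (nrm (N \<tau>)) x \<noteq> \<infinity>"
    using fin unfolding duh_def by (intro nn_integral_PInf_AE) auto
  then show 1: "AE \<tau> in lborel. \<tau> \<in> {0<..<t} \<longrightarrow> hop (t - \<tau>) (nrm (N \<tau>)) x < top"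
    by eventually_elim (auto simp: less_top)
  then show "AE \<tau> in lborel. \<tau> \<in> {0<..<t} \<longrightarrow> integrable lborel (\<lambda>y. heat_kernel (t - \<tau>) (x - y) *\<^sub>R N \<tau> y)"
    by eventually_elim (auto intro: integrable_heat)
  have "AE \<tau> in lborel. \<tau> \<noteq> 0 \<and> \<tau> \<noteq> t"
    by (intro AE_conjI AE_I[of _ _ "{0}"] AE_I[of _ _ "{t}"]) auto
  then have "(\<integral>\<^sup>+\<tau>. nrm (\<lambda>\<tau>. indicator {0..t} \<tau> *\<^sub>R heat (t - \<tau>) (N \<tau>) x) \<tau> \<partial>lborel) \<le> duh (\<lambda>\<tau>. nrm (N \<tau>)) t x"
    unfolding duh_def
  proof (intro nn_integral_mono_AE, eventually_elim)
    case (elim \<tau>)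
    then show ?case
      using norm_heat_le[OF Ns, of "t - \<tau>" \<tau> x] by (auto simp: indicator_def)
  qed
  note le = this
  then show i: "integrable lborel (\<lambda>\<tau>. indicator {0..t} \<tau> *\<^sub>R heat (t - \<tau>) (N \<tau>) x)"
    using fin by (intro integrableI_bounded) (auto intro: le_less_trans)
  have "nrm (duhamel N t) x \<le> (\<integral>\<^sup>+\<tau>. nrm (\<lambda>\<tau>. indicator {0..t} \<tau> *\<^sub>R heat (t - \<tau>) (N \<tau>) x) \<tau> \<partial>lborel)"
    using integral_norm_bound_ennreal[OF i] by (simp add: duhamel_def set_integrable_lebesgue_iff(2))
  with le show "nrm (duhamel N t) x \<le> duh (\<lambda>\<tau>. nrm (N \<tau>)) t x" by (rule order_trans[rotated])
qed

lemma duhamel_diff: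
  fixes N1 N2 :: "real \<Rightarrow> 'a::euclidean_space \<Rightarrow> 'k::euclidean_space"
  assumes N[measurable]: "case_prod N1 \<in> borel_measurable (lborel \<Otimes>\<^sub>M lborel)"
      "case_prod N2 \<in> borel_measurable (lborel \<Otimes>\<^sub>M lborel)"
    and fin: "duh (\<lambda>\<tau>. nrm (N1 \<tau>)) t x < top" "duh (\<lambda>\<tau>. nrm (N2 \<tau>)) t x < top"
  shows "duhamel N1 t x - duhamel N2 t x = duhamel (\<lambda>\<tau> y. N1 \<tau> y - N2 \<tau> y) t x"
proof -
  have Ns[measurable]: "N1 \<tau> \<in> borel_measurable lborel" "N2 \<tau> \<in> borel_measurable lborel" for \<tau>
    using N by (auto intro: borel_measurable_slice)
  have m[measurable]: "(\<lambda>\<tau>. heat (t - \<tau>) (N1 \<tau>) x) \<in> borel_measurable lborel"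
    "(\<lambda>\<tau>. heat (t - \<tau>) (N2 \<tau>) x) \<in> borel_measurable lborel"
    "(\<lambda>\<tau>. heat (t - \<tau>) (\<lambda>y. N1 \<tau> y - N2 \<tau> y) x) \<in> borel_measurable lborel"
    by (intro borel_measurable_heat; measurable)+
  note c1 = duhamel_converges[OF N(1) fin(1)] and c2 = duhamel_converges[OF N(2) fin(2)]
  have "AE \<tau> in lborel. \<tau> \<noteq> 0 \<and> \<tau> \<noteq> t"
    by (intro AE_conjI AE_I[of _ _ "{0}"] AE_I[of _ _ "{t}"]) auto
  then have "AE \<tau> in lborel. indicator {0..t} \<tau> *\<^sub>R heat (t - \<tau>) (N1 \<tau>) x - indicator {0..t} \<tau> *\<^sub>R heat (t - \<tau>) (N2 \<tau>) x
    = indicator {0..t} \<tau> *\<^sub>R heat (t - \<tau>) (\<lambda>y. N1 \<tau> y - N2 \<tau> y) x"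
    using c1(1) c2(1)
    by eventually_elim (auto simp: indicator_def heat_diff)
  then have "(LINT \<tau>|lborel. indicator {0..t} \<tau> *\<^sub>R heat (t - \<tau>) (N1 \<tau>) x - indicator {0..t} \<tau> *\<^sub>R heat (t - \<tau>) (N2 \<tau>) x)
    = (LINT \<tau>|lborel. indicator {0..t} \<tau> *\<^sub>R heat (t - \<tau>) (\<lambda>y. N1 \<tau> y - N2 \<tau> y) x)"
    by (intro integral_cong_AE) measurable
  then show ?thesis
    unfolding duhamel_def set_integrable_lebesgue_iff(2)[OF m(1)] set_integrable_lebesgue_iff(2)[OF m(2)]
      set_integrable_lebesgue_iff(2)[OF m(3)]
    using c1(3) c2(3) by (simp add: Bochner_Integration.integral_diff)
qed

section \<open>Time integrals with power singularities and the bounds they give for the Duhamel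
  operator\<close>

lemma nn_integral_time_powr:
  assumes b: "b < 1" and t: "0 \<le> t"
  shows "(\<integral>\<^sup>+\<tau>. indicator {0<..<t} \<tau> * ennreal (\<tau> powr (- b)) \<partial>lborel) \<le> ennreal (t powr (1 - b) / (1 - b))"
    "(\<integral>\<^sup>+\<tau>. indicator {0<..<t} \<tau> * ennreal ((t - \<tau>) powr (- b)) \<partial>lborel) \<le> ennreal (t powr (1 - b) / (1 - b))"
proof -
  have "((\<lambda>x. x powr (- b)) has_integral (t powr (1 - b) / (1 - b))) {0..t}"
    using has_integral_powr_from_0[of "- b" t] b t by (simp add: add.commute)
  then have "(\<integral>\<^sup>+\<tau>. ennreal (\<tau> powr (- b)) * indicator {0..t} \<tau> \<partial>lborel) = ennreal (t powr (1 - b) / (1 - b))"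
    by (intro nn_integral_has_integral_lebesgue') auto
  moreover have "(\<integral>\<^sup>+\<tau>. indicator {0<..<t} \<tau> * ennreal (\<tau> powr (- b)) \<partial>lborel)
      \<le> (\<integral>\<^sup>+\<tau>. ennreal (\<tau> powr (- b)) * indicator {0..t} \<tau> \<partial>lborel)"
    by (intro nn_integral_mono) (auto simp: indicator_def)
  ultimately show 1: "(\<integral>\<^sup>+\<tau>. indicator {0<..<t} \<tau> * ennreal (\<tau> powr (- b)) \<partial>lborel) \<le> ennreal (t powr (1 - b) / (1 - b))"
    by simp
  have "(\<integral>\<^sup>+\<tau>. indicator {0<..<t} \<tau> * ennreal ((t - \<tau>) powr (- b)) \<partial>lborel)
    = (\<integral>\<^sup>+\<tau>. indicator {0<..<t} (t - \<tau>) * ennreal ((t - \<tau>) powr (- b)) \<partial>lborel)"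
    by (intro nn_integral_cong) (auto simp: indicator_def)
  also have "\<dots> = (\<integral>\<^sup>+\<tau>. indicator {0<..<t} \<tau> * ennreal (\<tau> powr (- b)) \<partial>lborel)"
    by (rule nn_integral_lborel_reflect[of "\<lambda>\<tau>. indicator {0<..<t} \<tau> * ennreal (\<tau> powr (- b))" t]) measurable
  finally show "(\<integral>\<^sup>+\<tau>. indicator {0<..<t} \<tau> * ennreal ((t - \<tau>) powr (- b)) \<partial>lborel) \<le> ennreal (t powr (1 - b) / (1 - b))"
    using 1 by simp
qed

text \<open>A Beta integral. On each half of (0, t) one of the two factors is at most a constant
  times a power of t, and the other one is integrated.\<close>

lemma nn_integral_time_convolution:
  assumes a: "0 \<le> a" "a < 1" and b: "0 \<le> b" "b < 1"
  shows "\<exists>C>0. \<forall>t>0. (\<integral>\<^sup>+\<tau>. indicator {0<..<t} \<tau> * ennreal ((t - \<tau>) powr (- a) * \<tau> powr (- b)) \<partial>lborel)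
    \<le> ennreal (C * t powr (1 - a - b))"
proof -
  define C where "C = 2 powr a / (1 - b) + 2 powr b / (1 - a)"
  have C: "0 < C" unfolding C_def using a b by (intro add_pos_pos divide_pos_pos) auto
  have "(\<integral>\<^sup>+\<tau>. indicator {0<..<t} \<tau> * ennreal ((t - \<tau>) powr (- a) * \<tau> powr (- b)) \<partial>lborel)
    \<le> ennreal (C * t powr (1 - a - b))" if t: "0 < t" for t :: real
  proof -
    have "(\<integral>\<^sup>+\<tau>. indicator {0<..<t} \<tau> * ennreal ((t - \<tau>) powr (- a) * \<tau> powr (- b)) \<partial>lborel)
      \<le> (\<integral>\<^sup>+\<tau>. ennreal ((t / 2) powr (- a)) * (indicator {0<..<t} \<tau> * ennreal (\<tau> powr (- b)))
         + ennreal ((t / 2) powr (- b)) * (indicator {0<..<t} \<tau> * ennreal ((t - \<tau>) powr (- a))) \<partial>lborel)"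
    proof (intro nn_integral_mono)
      fix \<tau> :: real
      have "(t - \<tau>) powr (- a) * \<tau> powr (- b)
        \<le> (t / 2) powr (- a) * \<tau> powr (- b) + (t / 2) powr (- b) * (t - \<tau>) powr (- a)" if "0 < \<tau>" "\<tau> < t"
      proof (cases "\<tau> \<le> t / 2")
        case True
        have "(t - \<tau>) powr (- a) * \<tau> powr (- b) \<le> (t / 2) powr (- a) * \<tau> powr (- b)"
          using True t a by (intro mult_right_mono powr_mono2') auto
        then show ?thesis by (simp add: add_increasing2)
      next
        case False
        have "\<tau> powr (- b) * (t - \<tau>) powr (- a) \<le> (t / 2) powr (- b) * (t - \<tau>) powr (- a)"
          using False t b by (intro mult_right_mono powr_mono2') auto
        moreover have "0 \<le> (t / 2) powr (- a) * \<tau> powr (- b)" by simp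
        ultimately show ?thesis by (simp only: mult.commute[of "\<tau> powr (- b)"])
      qed
      then show "indicator {0<..<t} \<tau> * ennreal ((t - \<tau>) powr (- a) * \<tau> powr (- b))
        \<le> ennreal ((t / 2) powr (- a)) * (indicator {0<..<t} \<tau> * ennreal (\<tau> powr (- b)))
         + ennreal ((t / 2) powr (- b)) * (indicator {0<..<t} \<tau> * ennreal ((t - \<tau>) powr (- a)))"
        by (auto simp: indicator_def ennreal_leI simp flip: ennreal_mult ennreal_plus)
    qed
    also have "\<dots> = ennreal ((t / 2) powr (- a)) * (\<integral>\<^sup>+\<tau>. indicator {0<..<t} \<tau> * ennreal (\<tau> powr (- b)) \<partial>lborel)
         + ennreal ((t / 2) powr (- b)) * (\<integral>\<^sup>+\<tau>. indicator {0<..<t} \<tau> * ennreal ((t - \<tau>) powr (- a)) \<partial>lborel)"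
      by (subst nn_integral_add) (auto simp: nn_integral_cmult)
    also have "\<dots> \<le> ennreal ((t / 2) powr (- a)) * ennreal (t powr (1 - b) / (1 - b))
         + ennreal ((t / 2) powr (- b)) * ennreal (t powr (1 - a) / (1 - a))"
      using t a b by (intro add_mono mult_left_mono nn_integral_time_powr) auto
    also have "\<dots> = ennreal ((t / 2) powr (- a) * (t powr (1 - b) / (1 - b)) + (t / 2) powr (- b) * (t powr (1 - a) / (1 - a)))"
      using a b by (simp flip: ennreal_mult ennreal_plus)
    also have "(t / 2) powr (- a) * (t powr (1 - b) / (1 - b)) + (t / 2) powr (- b) * (t powr (1 - a) / (1 - a))
       = C * t powr (1 - a - b)"
    proof -
      have 1: "(t / 2) powr (- c) = 2 powr c * t powr (- c)" for c
        using t by (simp add: powr_divide powr_minus field_simps)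
      have "t powr (- a) * t powr (1 - b) = t powr (1 - a - b)" "t powr (- b) * t powr (1 - a) = t powr (1 - a - b)"
        by (simp_all flip: powr_add add: algebra_simps)
      then have "2 powr a * t powr (- a) * (t powr (1 - b) / (1 - b)) + 2 powr b * t powr (- b) * (t powr (1 - a) / (1 - a))
        = 2 powr a * t powr (1 - a - b) / (1 - b) + 2 powr b * t powr (1 - a - b) / (1 - a)"
        by (simp add: mult.assoc times_divide_eq_right)
      then show ?thesis unfolding 1 by (simp add: C_def distrib_right)
    qed
    finally show ?thesis .
  qed
  with C show ?thesis by blast
qed

lemma bnd_time_integral:
  fixes P :: "real \<Rightarrow> 'a::euclidean_space \<Rightarrow> ennreal"
  assumes [measurable]: "case_prod P \<in> borel_measurable (lborel \<Otimes>\<^sub>M lborel)" "w \<in> borel_measurable lborel"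
    and w0: "\<And>\<tau>. 0 < \<tau> \<Longrightarrow> \<tau> < t \<Longrightarrow> 0 < w \<tau>"
    and P: "\<And>\<tau>. 0 < \<tau> \<Longrightarrow> \<tau> < t \<Longrightarrow> bnd r s (P \<tau>) (w \<tau>)"
    and W: "(\<integral>\<^sup>+\<tau>. indicator {0<..<t} \<tau> * ennreal (w \<tau>) \<partial>lborel) \<le> ennreal W" "0 \<le> W"
    and r: "0 \<le> r" "r \<le> 1"
  shows "bnd r s (\<lambda>x. \<integral>\<^sup>+\<tau>. indicator {0<..<t} \<tau> * P \<tau> x \<partial>lborel) W"
proof -
  define M where "M = density lborel (indicator {0<..<t} :: real \<Rightarrow> ennreal)"
  have [measurable_cong]: "sets M = sets lborel" by (simp add: M_def)
  \<comment> \<open>The majorant in Minkowski's inequality must be positive everywhere; outside (0,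
    t), where M has no mass, any positive value will do.\<close>
  define w' where "w' \<tau> = (if 0 < \<tau> \<and> \<tau> < t then w \<tau> else 1)" for \<tau>
  have [measurable]: "w' \<in> borel_measurable lborel" unfolding w'_def by measurable
  have "bnd r s (\<lambda>x. \<integral>\<^sup>+\<tau>. P \<tau> x \<partial>M) W"
  proof (rule bnd_nn_integral)
    show "sigma_finite_measure M"
      unfolding M_def by (subst sigma_finite_measure.sigma_finite_iff_density_finite[OF sigma_finite_lborel])
        (auto simp: indicator_def)
    show "case_prod P \<in> borel_measurable (M \<Otimes>\<^sub>M lborel)" "w' \<in> borel_measurable M" by measurable
    show "AE \<tau> in M. bnd r s (P \<tau>) (w' \<tau>)"
      unfolding M_def using P by (subst AE_density) (auto simp: indicator_def w'_def)
    have "(\<integral>\<^sup>+\<tau>. ennreal (w' \<tau>) \<partial>M) = (\<integral>\<^sup>+\<tau>. indicator {0<..<t} \<tau> * ennreal (w \<tau>) \<partial>lborel)"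
      unfolding M_def by (subst nn_integral_density) (auto intro!: nn_integral_cong simp: w'_def indicator_def)
    with W show "(\<integral>\<^sup>+\<tau>. ennreal (w' \<tau>) \<partial>M) \<le> ennreal W" by simp
    show "0 < w' \<tau>" for \<tau> using w0 by (simp add: w'_def)
  qed (use W r in auto)
  moreover have "(\<integral>\<^sup>+\<tau>. P \<tau> x \<partial>M) = (\<integral>\<^sup>+\<tau>. indicator {0<..<t} \<tau> * P \<tau> x \<partial>lborel)" for x
    unfolding M_def by (intro nn_integral_density) measurable
  ultimately show ?thesis by simp
qed

lemma nn_integral_time_cmult_le:
  fixes f :: "real \<Rightarrow> real"
  assumes [measurable]: "f \<in> borel_measurable lborel" and c: "0 \<le> c"
    and W: "(\<integral>\<^sup>+\<tau>. indicator {0<..<t} \<tau> * ennreal (f \<tau>) \<partial>lborel) \<le> ennreal W"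
  shows "(\<integral>\<^sup>+\<tau>. indicator {0<..<t} \<tau> * ennreal (c * f \<tau>) \<partial>lborel) \<le> ennreal (c * W)"
proof -
  have "(\<integral>\<^sup>+\<tau>. indicator {0<..<t} \<tau> * ennreal (c * f \<tau>) \<partial>lborel)
    = (\<integral>\<^sup>+\<tau>. ennreal c * (indicator {0<..<t} \<tau> * ennreal (f \<tau>)) \<partial>lborel)"
    using c by (intro nn_integral_cong) (simp add: ennreal_mult' mult_ac)
  also have "\<dots> = ennreal c * (\<integral>\<^sup>+\<tau>. indicator {0<..<t} \<tau> * ennreal (f \<tau>) \<partial>lborel)"
    by (intro nn_integral_cmult) measurable
  also have "\<dots> \<le> ennreal c * ennreal W" using W by (rule mult_left_mono) simp
  finally show ?thesis using c by (simp add: ennreal_mult')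
qed

text \<open>The smoothing estimate enters as the hypothesis \<open>hop\<close>, so that one
  statement serves both target spaces, and m is an arbitrary time majorant, with or without an
  exponential factor.\<close>

lemma bnd_duh:
  fixes F :: "real \<Rightarrow> 'a::euclidean_space \<Rightarrow> ennreal"
  assumes hop: "\<And>t F B. 0 < t \<Longrightarrow> F \<in> borel_measurable lborel \<Longrightarrow> 0 \<le> B \<Longrightarrow> bnd r1 s1 F B \<Longrightarrow>
      bnd r2 s2 (hop t F :: 'a \<Rightarrow> ennreal) (K * t powr (- a) * B)" and K: "0 < K"
    and F[measurable]: "case_prod F \<in> borel_measurable (lborel \<Otimes>\<^sub>M lborel)"
    and m[measurable]: "m \<in> borel_measurable lborel" and m0: "\<And>\<tau>. 0 < \<tau> \<Longrightarrow> \<tau> < t \<Longrightarrow> 0 < m \<tau>"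
    and Fm: "\<And>\<tau>. 0 < \<tau> \<Longrightarrow> \<tau> < t \<Longrightarrow> bnd r1 s1 (F \<tau>) (m \<tau>)"
    and W: "(\<integral>\<^sup>+\<tau>. indicator {0<..<t} \<tau> * ennreal ((t - \<tau>) powr (- a) * m \<tau>) \<partial>lborel) \<le> ennreal W" "0 \<le> W"
    and r: "0 \<le> r2" "r2 \<le> 1"
  shows "bnd r2 s2 (duh F t) (K * W)"
proof -
  have Fs: "F \<tau> \<in> borel_measurable lborel" for \<tau> using F by (rule borel_measurable_slice)
  show ?thesis
    unfolding duh_def
  proof (rule bnd_time_integral[where w = "\<lambda>\<tau>. K * ((t - \<tau>) powr (- a) * m \<tau>)"])
    show "bnd r2 s2 (hop (t - \<tau>) (F \<tau>)) (K * ((t - \<tau>) powr (- a) * m \<tau>))" if "0 < \<tau>" "\<tau> < t" for \<tau>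
      using hop[OF _ Fs _ Fm[OF that], of "t - \<tau>"] m0[OF that] that by (simp add: mult.assoc)
    show "(\<integral>\<^sup>+\<tau>. indicator {0<..<t} \<tau> * ennreal (K * ((t - \<tau>) powr (- a) * m \<tau>)) \<partial>lborel) \<le> ennreal (K * W)"
      using K W by (intro nn_integral_time_cmult_le) auto
  qed (use K W m0 r in auto)
qed

lemma bnd_duh_powr:
  assumes hop: "\<And>t F B. 0 < t \<Longrightarrow> F \<in> borel_measurable lborel \<Longrightarrow> 0 \<le> B \<Longrightarrow> bnd r1 s1 F B \<Longrightarrow>
      bnd r2 s2 (hop t F :: 'a::euclidean_space \<Rightarrow> ennreal) (K * t powr (- a) * B)" and K: "0 < K"
    and a: "0 \<le> a" "a < 1" and b: "0 \<le> b" "b < 1" and r: "0 \<le> r1" "0 \<le> r2" "r2 \<le> 1"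
  shows "\<exists>C>0. \<forall>t (F :: real \<Rightarrow> 'a \<Rightarrow> ennreal) M. 0 < t \<longrightarrow> 0 \<le> M \<longrightarrow> case_prod F \<in> borel_measurable (lborel \<Otimes>\<^sub>M lborel) \<longrightarrow>
    (\<forall>\<tau>. 0 < \<tau> \<longrightarrow> \<tau> < t \<longrightarrow> bnd r1 s1 (F \<tau>) (M * \<tau> powr (- b))) \<longrightarrow>
    bnd r2 s2 (duh F t) (C * M * t powr (1 - a - b))"
proof -
  obtain C where C: "0 < C" "\<And>t. 0 < t \<Longrightarrow>
    (\<integral>\<^sup>+\<tau>. indicator {0<..<t} \<tau> * ennreal ((t - \<tau>) powr (- a) * \<tau> powr (- b)) \<partial>lborel) \<le> ennreal (C * t powr (1 - a - b))"
    using nn_integral_time_convolution[OF a b] by blast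
  have "bnd r2 s2 (duh F t) (K * C * M * t powr (1 - a - b))"
    if t: "0 < t" and M: "0 \<le> M" and F: "case_prod F \<in> borel_measurable (lborel \<Otimes>\<^sub>M lborel)"
     and FM: "\<forall>\<tau>. 0 < \<tau> \<longrightarrow> \<tau> < t \<longrightarrow> bnd r1 s1 (F \<tau>) (M * \<tau> powr (- b))"
    for t M and F :: "real \<Rightarrow> 'a \<Rightarrow> ennreal"
  proof (rule bnd_closed)
    fix B assume B: "K * C * M * t powr (1 - a - b) < B"
    \<comment> \<open>M may be 0, but the time majorant has to be positive. M' > M is the value for
      which the resulting bound is exactly B.\<close>
    define M' where "M' = B / (K * C * t powr (1 - a - b))"
    have "M < M'" using B K C(1) t by (simp add: M'_def field_simps)
    then have M': "0 < M'" "M \<le> M'" using M by auto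
    have "bnd r2 s2 (duh F t) (K * (M' * (C * t powr (1 - a - b))))"
    proof (rule bnd_duh[OF hop K F, where m = "\<lambda>\<tau>. M' * \<tau> powr (- b)"])
      show "bnd r1 s1 (F \<tau>) (M' * \<tau> powr (- b))" if "0 < \<tau>" "\<tau> < t" for \<tau>
        using FM that M M' r by (auto intro: bnd_mono mult_right_mono)
      show "(\<integral>\<^sup>+\<tau>. indicator {0<..<t} \<tau> * ennreal ((t - \<tau>) powr (- a) * (M' * \<tau> powr (- b))) \<partial>lborel)
        \<le> ennreal (M' * (C * t powr (1 - a - b)))"
        unfolding mult.left_commute[of _ M'] using M' C(2)[OF t] by (intro nn_integral_time_cmult_le) auto
    qed (use M' C(1) r in auto)
    moreover have "K * (M' * (C * t powr (1 - a - b))) = B"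
      using K C(1) t by (simp add: M'_def)
    ultimately show "bnd r2 s2 (duh F t) B" by simp
  qed (use K C(1) M r in auto)
  moreover have "0 < K * C" using K C(1) by simp
  ultimately show ?thesis by blast
qed

text \<open>Time weights \<open>exp (l * \<tau>)\<close> turn the Duhamel operator into a contraction for large \<open>l\<close>,
  since \<open>exp (- z) \<le> z powr (- e)\<close> converts part of the integrability reserve into decay in \<open>l\<close>.\<close>

lemma bnd_duh_exp:
  assumes hop: "\<And>t F B. 0 < t \<Longrightarrow> F \<in> borel_measurable lborel \<Longrightarrow> 0 \<le> B \<Longrightarrow> bnd r1 s1 F B \<Longrightarrow>
      bnd r2 s2 (hop t F :: 'a::euclidean_space \<Rightarrow> ennreal) (K * t powr (- a) * B)" and K: "0 < K"
    and a: "0 \<le> a" "a + e < 1" and e: "0 < e" "e \<le> 1" and b: "0 \<le> b" "b < 1" and r: "0 \<le> r1" "0 \<le> r2" "r2 \<le> 1"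
  shows "\<exists>C>0. \<forall>l t (F :: real \<Rightarrow> 'a \<Rightarrow> ennreal) M. 0 < l \<longrightarrow> 0 < t \<longrightarrow> 0 < M \<longrightarrow> case_prod F \<in> borel_measurable (lborel \<Otimes>\<^sub>M lborel) \<longrightarrow>
    (\<forall>\<tau>. 0 < \<tau> \<longrightarrow> \<tau> < t \<longrightarrow> bnd r1 s1 (F \<tau>) (M * exp (l * \<tau>) * \<tau> powr (- b))) \<longrightarrow>
    bnd r2 s2 (duh F t) (C * M * l powr (- e) * exp (l * t) * t powr (1 - a - e - b))"
proof -
  have "0 \<le> a + e" using a e by simp
  from nn_integral_time_convolution[OF this a(2) b]
  obtain C where C: "0 < C" "\<And>t. 0 < t \<Longrightarrow>
    (\<integral>\<^sup>+\<tau>. indicator {0<..<t} \<tau> * ennreal ((t - \<tau>) powr (- (a + e)) * \<tau> powr (- b)) \<partial>lborel) \<le> ennreal (C * t powr (1 - (a + e) - b))"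
    by blast
  have "bnd r2 s2 (duh F t) (K * C * M * l powr (- e) * exp (l * t) * t powr (1 - a - e - b))"
    if l: "0 < l" and t: "0 < t" and M: "0 < M" and F: "case_prod F \<in> borel_measurable (lborel \<Otimes>\<^sub>M lborel)"
     and FM: "\<forall>\<tau>. 0 < \<tau> \<longrightarrow> \<tau> < t \<longrightarrow> bnd r1 s1 (F \<tau>) (M * exp (l * \<tau>) * \<tau> powr (- b))"
    for l t M and F :: "real \<Rightarrow> 'a \<Rightarrow> ennreal"
  proof -
    define A where "A = M * l powr (- e) * exp (l * t)"
    have A: "0 < A" using M l by (simp add: A_def)
    have "bnd r2 s2 (duh F t) (K * (A * (C * t powr (1 - (a + e) - b))))"
    proof (rule bnd_duh[OF hop K F, where m = "\<lambda>\<tau>. M * exp (l * \<tau>) * \<tau> powr (- b)"])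
      have "(\<integral>\<^sup>+\<tau>. indicator {0<..<t} \<tau> * ennreal ((t - \<tau>) powr (- a) * (M * exp (l * \<tau>) * \<tau> powr (- b))) \<partial>lborel)
         \<le> (\<integral>\<^sup>+\<tau>. indicator {0<..<t} \<tau> * ennreal (A * ((t - \<tau>) powr (- (a + e)) * \<tau> powr (- b))) \<partial>lborel)"
      proof (intro nn_integral_mono)
        fix \<tau> :: real
        have "(t - \<tau>) powr (- a) * (M * exp (l * \<tau>) * \<tau> powr (- b)) \<le> A * ((t - \<tau>) powr (- (a + e)) * \<tau> powr (- b))"
          if \<tau>: "0 < \<tau>" "\<tau> < t"
        proof -
          define z where "z = l * (t - \<tau>)"
          have z: "0 < z" using l \<tau> by (simp add: z_def)
          have "z powr e \<le> exp z"
          proof (cases "z \<le> 1")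
            case True
            then have "z powr e \<le> 1 powr e" using z e by (intro powr_mono2) auto
            also have "\<dots> \<le> exp z" using z by simp
            finally show ?thesis .
          next
            case False
            then have "z powr e \<le> z powr 1" using e by (intro powr_mono) auto
            also have "\<dots> \<le> exp z" using z exp_ge_add_one_self[of z] by (simp only: powr_one)
            finally show ?thesis .
          qed
          then have "exp (- z) \<le> z powr (- e)" using z by (simp add: exp_minus powr_minus le_imp_inverse_le)
          also have "\<dots> = l powr (- e) * (t - \<tau>) powr (- e)" by (simp add: z_def powr_mult)
          finally have ez: "exp (- z) \<le> l powr (- e) * (t - \<tau>) powr (- e)" .
          have "exp (l * \<tau>) = exp (l * t) * exp (- z)" by (simp add: z_def algebra_simps flip: exp_add)
          also have "\<dots> \<le> exp (l * t) * (l powr (- e) * (t - \<tau>) powr (- e))" using ez by (intro mult_left_mono) auto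
          finally have "(t - \<tau>) powr (- a) * (M * exp (l * \<tau>) * \<tau> powr (- b))
            \<le> (t - \<tau>) powr (- a) * (M * (exp (l * t) * (l powr (- e) * (t - \<tau>) powr (- e))) * \<tau> powr (- b))"
            using M by (intro mult_left_mono mult_right_mono) auto
          also have "\<dots> = A * ((t - \<tau>) powr (- a) * (t - \<tau>) powr (- e) * \<tau> powr (- b))"
            by (simp add: A_def mult_ac)
          also have "(t - \<tau>) powr (- a) * (t - \<tau>) powr (- e) = (t - \<tau>) powr (- (a + e))"
            by (simp flip: powr_add)
          finally show ?thesis .
        qed
        then show "indicator {0<..<t} \<tau> * ennreal ((t - \<tau>) powr (- a) * (M * exp (l * \<tau>) * \<tau> powr (- b)))
          \<le> indicator {0<..<t} \<tau> * ennreal (A * ((t - \<tau>) powr (- (a + e)) * \<tau> powr (- b)))"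
          by (auto simp: indicator_def ennreal_leI)
      qed
      also have "\<dots> \<le> ennreal (A * (C * t powr (1 - (a + e) - b)))"
        using A C(2)[OF t] by (intro nn_integral_time_cmult_le) auto
      finally show "(\<integral>\<^sup>+\<tau>. indicator {0<..<t} \<tau> * ennreal ((t - \<tau>) powr (- a) * (M * exp (l * \<tau>) * \<tau> powr (- b))) \<partial>lborel)
        \<le> ennreal (A * (C * t powr (1 - (a + e) - b)))" .
    qed (use A C(1) M r FM in auto)
    moreover have "K * (A * (C * t powr (1 - (a + e) - b))) = K * C * M * l powr (- e) * exp (l * t) * t powr (1 - a - e - b)"
      by (simp add: A_def mult_ac diff_diff_eq)
    ultimately show ?thesis by simp
  qed
  moreover have "0 < K * C" using K C(1) by simp
  ultimately show ?thesis by blast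
qed

section \<open>The linear estimates behind the fixed point argument\<close>

text \<open>By symmetry |v| \<le> |u|. The difference is |u|^\<beta> (u - v) plus (|u|^\<beta> -
  |v|^\<beta>) v, and the second term is estimated by the mean value theorem.\<close>

lemma norm_power_scale_diff_le:
  fixes u v :: "'k::real_normed_vector"
  assumes \<beta>: "0 < \<beta>"
  shows "norm (norm u powr \<beta> *\<^sub>R u - norm v powr \<beta> *\<^sub>R v)
    \<le> (\<beta> + 1) * (norm u powr \<beta> + norm v powr \<beta>) * norm (u - v)"
proof -
  have *: "norm (norm u powr \<beta> *\<^sub>R u - norm v powr \<beta> *\<^sub>R v) \<le> (\<beta> + 1) * norm u powr \<beta> * norm (u - v)"
    if uv: "norm v \<le> norm u" for u v :: 'k
  proof -
    define A B where "A = norm u" and "B = norm v"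
    have AB: "0 \<le> B" "B \<le> A" "A - B \<le> norm (u - v)" using uv norm_triangle_ineq2[of u v] by (auto simp: A_def B_def)
    have "(A powr \<beta> - B powr \<beta>) * B \<le> \<beta> * A powr \<beta> * (A - B)"
    proof (cases "B = 0 \<or> A = B")
      case True
      with AB \<beta> show ?thesis by auto
    next
      case False
      with AB have B: "0 < B" "B < A" by auto
      have "((\<lambda>z. z powr \<beta>) has_real_derivative \<beta> * x powr (\<beta> - 1)) (at x)" if "B \<le> x" for x
        using B that by (intro has_real_derivative_powr) auto
      then obtain z where z: "B < z" "z < A" "A powr \<beta> - B powr \<beta> = (A - B) * (\<beta> * z powr (\<beta> - 1))"
        using MVT2[of B A "\<lambda>z. z powr \<beta>" "\<lambda>z. \<beta> * z powr (\<beta> - 1)"] B by blast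
      \<comment> \<open>The factor B \<le> z turns z^(\<beta> - 1) into z^\<beta>, which is
        increasing also when \<beta> < 1.\<close>
      have "(A powr \<beta> - B powr \<beta>) * B \<le> (A - B) * (\<beta> * z powr (\<beta> - 1)) * z"
        unfolding z(3) using z B \<beta> by (intro mult_left_mono) auto
      also have "\<dots> = \<beta> * z powr \<beta> * (A - B)" using z B by (simp add: powr_diff)
      also have "\<dots> \<le> \<beta> * A powr \<beta> * (A - B)"
        using z B \<beta> by (intro mult_right_mono mult_left_mono powr_mono2) auto
      finally show ?thesis .
    qed
    also have "\<dots> \<le> \<beta> * A powr \<beta> * norm (u - v)" using AB \<beta> by (intro mult_left_mono) auto
    finally have 1: "(A powr \<beta> - B powr \<beta>) * B \<le> \<beta> * A powr \<beta> * norm (u - v)" .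
    have "A powr \<beta> *\<^sub>R u - B powr \<beta> *\<^sub>R v = A powr \<beta> *\<^sub>R (u - v) + (A powr \<beta> - B powr \<beta>) *\<^sub>R v"
      by (simp add: algebra_simps)
    then have "norm (A powr \<beta> *\<^sub>R u - B powr \<beta> *\<^sub>R v) \<le> norm (A powr \<beta> *\<^sub>R (u - v)) + norm ((A powr \<beta> - B powr \<beta>) *\<^sub>R v)"
      by (metis norm_triangle_ineq)
    also have "norm ((A powr \<beta> - B powr \<beta>) *\<^sub>R v) = (A powr \<beta> - B powr \<beta>) * B"
      using AB \<beta> by (simp add: B_def[symmetric] powr_mono2)
    also have "norm (A powr \<beta> *\<^sub>R (u - v)) = A powr \<beta> * norm (u - v)" by simp
    finally show ?thesis using 1 by (simp add: A_def B_def algebra_simps)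
  qed
  have mono: "(\<beta> + 1) * x * norm (u - v) \<le> (\<beta> + 1) * (norm u powr \<beta> + norm v powr \<beta>) * norm (u - v)"
    if "x = norm u powr \<beta> \<or> x = norm v powr \<beta>" for x
    using that \<beta> by (intro mult_right_mono mult_left_mono) auto
  show ?thesis
  proof (cases "norm v \<le> norm u")
    case True
    from order_trans[OF *[OF this] mono[of "norm u powr \<beta>"]] show ?thesis by simp
  next
    case False
    then have "norm u \<le> norm v" by simp
    from *[OF this] mono[of "norm v powr \<beta>"] show ?thesis by (simp add: norm_minus_commute)
  qed
qed

lemma nonlinearity_diff_le:
  assumes \<alpha>: "1 < \<alpha>"
  shows "norm (nonlinearity \<gamma> \<alpha> f x - nonlinearity \<gamma> \<alpha> g x)
    \<le> \<alpha> * (norm x powr \<gamma> * norm (f x) powr (\<alpha> - 1) * norm (f x - g x)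
       + norm x powr \<gamma> * norm (g x) powr (\<alpha> - 1) * norm (f x - g x))"
proof -
  have "norm (nonlinearity \<gamma> \<alpha> f x - nonlinearity \<gamma> \<alpha> g x)
     = norm x powr \<gamma> * norm (norm (f x) powr (\<alpha> - 1) *\<^sub>R f x - norm (g x) powr (\<alpha> - 1) *\<^sub>R g x)"
    by (simp add: nonlinearity_def scaleR_diff_right[symmetric] flip: scaleR_scaleR)
  also have "\<dots> \<le> norm x powr \<gamma> * (\<alpha> * (norm (f x) powr (\<alpha> - 1) + norm (g x) powr (\<alpha> - 1)) * norm (f x - g x))"
    using norm_power_scale_diff_le[of "\<alpha> - 1" "f x" "g x"] \<alpha> by (intro mult_left_mono) auto
  finally show ?thesis by (simp add: algebra_simps)
qed

text \<open>Hoelder's inequality with exponents \<alpha> / (\<alpha> - 1) and \<alpha> for the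
  weighted functions |x|^s U and |x|^s W, proved by Young's inequality after normalisation by A and
  B. The weights balance because |x|^(\<alpha> s - \<gamma>) |x|^\<gamma> is the \<alpha>-th power
  of |x|^s.\<close>

lemma bnd_power_mult:
  fixes U W :: "'a::euclidean_space \<Rightarrow> real"
  assumes \<alpha>: "1 < \<alpha>" and r: "0 \<le> r"
    and [measurable]: "U \<in> borel_measurable lborel" "W \<in> borel_measurable lborel"
    and UW0: "\<And>x. 0 \<le> U x" "\<And>x. 0 \<le> W x"
    and AB0: "0 \<le> A" "0 \<le> B"
    and U: "bnd r s (\<lambda>x. ennreal (U x)) A" and W: "bnd r s (\<lambda>x. ennreal (W x)) B"
  shows "bnd (\<alpha> * r) (\<alpha> * s - \<gamma>) (\<lambda>x. ennreal (norm x powr \<gamma> * U x powr (\<alpha> - 1) * W x)) (A powr (\<alpha> - 1) * B)"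
proof (cases "A = 0 \<or> B = 0")
  case True
  then have "AE x in lborel. ennreal (U x) = 0 \<or> ennreal (W x) = 0"
  proof
    assume "A = 0"
    with bnd_0_imp_AE_zero[of r s "\<lambda>x. ennreal (U x)"] U show ?thesis by (auto elim: eventually_mono)
  next
    assume "B = 0"
    with bnd_0_imp_AE_zero[of r s "\<lambda>x. ennreal (W x)"] W show ?thesis by (auto elim: eventually_mono)
  qed
  then have "AE x in lborel. ennreal (norm x powr \<gamma> * U x powr (\<alpha> - 1) * W x) = 0"
  proof eventually_elim
    case (elim x)
    with UW0[of x] have "U x = 0 \<or> W x = 0" by (auto simp: ennreal_eq_0_iff)
    then show ?case by auto
  qed
  from bnd_cong_AE[OF this] show ?thesis by simp
next
  case False
  with AB0 have AB: "0 < A" "0 < B" by auto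
  define X Y where "X x = norm x powr s * U x" and "Y x = norm x powr s * W x" for x
  have XY: "0 \<le> X x" "0 \<le> Y x" for x using UW0 by (auto simp: X_def Y_def)
  have XYw: "ennreal (norm x powr (\<alpha> * s - \<gamma>)) * ennreal (norm x powr \<gamma> * U x powr (\<alpha> - 1) * W x)
    = ennreal (X x powr (\<alpha> - 1) * Y x)" if x: "x \<noteq> 0" for x
  proof -
    have "norm x powr (\<alpha> * s - \<gamma>) * norm x powr \<gamma> = norm x powr (s * (\<alpha> - 1)) * norm x powr s"
      by (simp add: algebra_simps flip: powr_add)
    then have "norm x powr (\<alpha> * s - \<gamma>) * (norm x powr \<gamma> * U x powr (\<alpha> - 1) * W x) = X x powr (\<alpha> - 1) * Y x"
      unfolding X_def Y_def powr_mult powr_powr by (simp add: mult_ac)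
    then show ?thesis using UW0 by (simp flip: ennreal_mult)
  qed
  show ?thesis
  proof (cases "r = 0")
    case True
    from U W True have "AE x in lborel. ennreal (X x) \<le> ennreal A" "AE x in lborel. ennreal (Y x) \<le> ennreal B"
      using UW0 by (auto simp: bnd_def X_def Y_def ennreal_mult)
    then have "AE x in lborel. ennreal (norm x powr (\<alpha> * s - \<gamma>)) * ennreal (norm x powr \<gamma> * U x powr (\<alpha> - 1) * W x)
        \<le> ennreal (A powr (\<alpha> - 1) * B)"
      using AE_lborel_nonzero
    proof eventually_elim
      case (elim x)
      then have "X x \<le> A" "Y x \<le> B" using AB XY[of x] by (auto simp: ennreal_le_iff)
      then have "X x powr (\<alpha> - 1) * Y x \<le> A powr (\<alpha> - 1) * B"
        using \<alpha> XY[of x] by (intro mult_mono powr_mono2) auto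
      with XYw[OF elim(3)] show ?case by (simp add: ennreal_leI)
    qed
    with True show ?thesis by (simp add: bnd_def)
  next
    case rn: False
    with r have r0: "0 < r" by simp
    define q p where "q = 1 / r" and "p = 1 / (\<alpha> * r)"
    have qp: "0 < q" "0 < p" "q = \<alpha> * p" using r0 \<alpha> by (auto simp: q_def p_def)
    have IX: "(\<integral>\<^sup>+x. ennreal (X x powr q) \<partial>lborel) \<le> ennreal (A powr q)"
      and IY: "(\<integral>\<^sup>+x. ennreal (Y x powr q) \<partial>lborel) \<le> ennreal (B powr q)"
      using U W rn UW0 by (auto simp: bnd_def q_def X_def Y_def simp flip: ennreal_mult)
    define c where "c = 1 / \<alpha>"
    have c: "0 < c" "c < 1" using \<alpha> by (auto simp: c_def)
    define Z where "Z = (A powr (\<alpha> - 1) * B) powr p"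
    have Z: "0 < Z" using AB by (simp add: Z_def)
    have pt: "(X x powr (\<alpha> - 1) * Y x) powr p
      \<le> Z * (1 - c) / A powr q * X x powr q + Z * c / B powr q * Y x powr q" for x
    proof (cases "X x = 0 \<or> Y x = 0")
      case True
      then have "(X x powr (\<alpha> - 1) * Y x) powr p = 0" by auto
      then show ?thesis using Z c by (auto intro!: add_nonneg_nonneg)
    next
      case False
      then have pos: "0 < X x" "0 < Y x" using XY[of x] by auto
      have "((X x / A) powr q) powr (1 - c) * ((Y x / B) powr q) powr c
        \<le> (1 - c) * (X x / A) powr q + c * (Y x / B) powr q"
        using c pos AB by (intro Youngs_inequality_0) auto
      moreover have "((X x / A) powr q) powr (1 - c) * ((Y x / B) powr q) powr c = (X x powr (\<alpha> - 1) * Y x) powr p / Z"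
      proof -
        have "q * (1 - c) = (\<alpha> - 1) * p" "q * c = p" using \<alpha> by (auto simp: qp c_def field_simps)
        then show ?thesis unfolding Z_def using pos AB by (simp add: powr_powr powr_divide powr_mult)
      qed
      ultimately have "(X x powr (\<alpha> - 1) * Y x) powr p \<le> Z * ((1 - c) * (X x / A) powr q + c * (Y x / B) powr q)"
        using Z by (simp only: pos_divide_le_eq mult.commute[of Z])
      also have "\<dots> = Z * (1 - c) / A powr q * X x powr q + Z * c / B powr q * Y x powr q"
        by (simp add: powr_divide distrib_left)
      finally show ?thesis .
    qed
    have [measurable]: "X \<in> borel_measurable lborel" "Y \<in> borel_measurable lborel"
      unfolding X_def Y_def by measurable
    have "(\<integral>\<^sup>+x. epow (ennreal (norm x powr (\<alpha> * s - \<gamma>)) * ennreal (norm x powr \<gamma> * U x powr (\<alpha> - 1) * W x)) p \<partial>lborel)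
      = (\<integral>\<^sup>+x. ennreal ((X x powr (\<alpha> - 1) * Y x) powr p) \<partial>lborel)"
      using XY by (intro nn_integral_cong_AE eventually_mono[OF AE_lborel_nonzero]) (simp add: XYw)
    also have "\<dots> \<le> (\<integral>\<^sup>+x. ennreal (Z * (1 - c) / A powr q) * ennreal (X x powr q) + ennreal (Z * c / B powr q) * ennreal (Y x powr q) \<partial>lborel)"
      using Z c pt by (intro nn_integral_mono) (simp flip: ennreal_mult ennreal_plus add: ennreal_leI)
    also have "\<dots> = ennreal (Z * (1 - c) / A powr q) * (\<integral>\<^sup>+x. ennreal (X x powr q) \<partial>lborel)
        + ennreal (Z * c / B powr q) * (\<integral>\<^sup>+x. ennreal (Y x powr q) \<partial>lborel)"
      by (subst nn_integral_add) (auto simp: nn_integral_cmult)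
    also have "\<dots> \<le> ennreal (Z * (1 - c) / A powr q) * ennreal (A powr q) + ennreal (Z * c / B powr q) * ennreal (B powr q)"
      using IX IY by (intro add_mono mult_left_mono) auto
    also have "\<dots> = ennreal Z"
    proof -
      have "Z * (1 - c) / A powr q * A powr q + Z * c / B powr q * B powr q = Z"
        using AB by simp (simp add: algebra_simps)
      then show ?thesis using Z c by (simp flip: ennreal_mult ennreal_plus del: times_divide_eq_left)
    qed
    finally show ?thesis using rn \<alpha> by (simp add: bnd_def Z_def p_def)
  qed
qed

text \<open>The constants \<open>a\<close> and \<open>a'\<close> are the time singularities of the heat semigroup from the space
  $L^{q/\alpha}_{\alpha s-\gamma}$ of the nonlinearity to $L^q_s$ and $L^q_{s'}$. The slack \<open>e\<close> is spent on
  exponential time weights (uniqueness) and on Hoelder continuity in time. The parameter \<open>E\<close> only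
  carries the type of the space.\<close>

locale kato_setting =
  fixes \<gamma> \<alpha> r s s' a a' C0 e :: real and E :: "'a::euclidean_space itself"
  assumes space: "E = TYPE('a)" and \<alpha>: "1 < \<alpha>" and r: "0 \<le> r" "\<alpha> * r \<le> 1"
    and ss': "s < s'" and a: "0 \<le> a" "a + e < 1" and a': "0 \<le> a'" "a' < 1"
    and aa': "a = a' + (s' - s) / 2"
    and e: "0 < e" "e \<le> 1" "e \<le> 1 - a' - \<alpha> * ((s' - s) / 2)"
    and C0: "0 < C0"
    and hop_data: "\<And>t F B. 0 < t \<Longrightarrow> F \<in> borel_measurable lborel \<Longrightarrow> 0 \<le> B \<Longrightarrow> bnd r s' F B \<Longrightarrow>
        bnd r s (hop t F :: 'a \<Rightarrow> ennreal) (C0 * t powr (- ((s' - s) / 2)) * B)"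
    and hop_data': "\<And>t F B. 0 < t \<Longrightarrow> F \<in> borel_measurable lborel \<Longrightarrow> 0 \<le> B \<Longrightarrow> bnd r s' F B \<Longrightarrow>
        bnd r s' (hop t F :: 'a \<Rightarrow> ennreal) (C0 * B)"
    and hop_source: "\<And>t F B. 0 < t \<Longrightarrow> F \<in> borel_measurable lborel \<Longrightarrow> 0 \<le> B \<Longrightarrow> bnd (\<alpha> * r) (\<alpha> * s - \<gamma>) F B \<Longrightarrow>
        bnd r s (hop t F :: 'a \<Rightarrow> ennreal) (C0 * t powr (- a) * B)"
    and hop_source': "\<And>t F B. 0 < t \<Longrightarrow> F \<in> borel_measurable lborel \<Longrightarrow> 0 \<le> B \<Longrightarrow> bnd (\<alpha> * r) (\<alpha> * s - \<gamma>) F B \<Longrightarrow>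
        bnd r s' (hop t F :: 'a \<Rightarrow> ennreal) (C0 * t powr (- a') * B)"
    and duh_source: "\<And>t (F :: real \<Rightarrow> 'a \<Rightarrow> ennreal) M. 0 < t \<Longrightarrow> 0 \<le> M \<Longrightarrow>
        case_prod F \<in> borel_measurable (lborel \<Otimes>\<^sub>M lborel) \<Longrightarrow>
        (\<And>\<tau>. 0 < \<tau> \<Longrightarrow> \<tau> < t \<Longrightarrow> bnd (\<alpha> * r) (\<alpha> * s - \<gamma>) (F \<tau>) (M * \<tau> powr (- (\<alpha> * ((s' - s) / 2))))) \<Longrightarrow>
        bnd r s (duh F t) (C0 * M * t powr (1 - a - \<alpha> * ((s' - s) / 2)))"
    and duh_source': "\<And>t (F :: real \<Rightarrow> 'a \<Rightarrow> ennreal) M. 0 < t \<Longrightarrow> 0 \<le> M \<Longrightarrow>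
        case_prod F \<in> borel_measurable (lborel \<Otimes>\<^sub>M lborel) \<Longrightarrow>
        (\<And>\<tau>. 0 < \<tau> \<Longrightarrow> \<tau> < t \<Longrightarrow> bnd (\<alpha> * r) (\<alpha> * s - \<gamma>) (F \<tau>) (M * \<tau> powr (- (\<alpha> * ((s' - s) / 2))))) \<Longrightarrow>
        bnd r s' (duh F t) (C0 * M * t powr (1 - a' - \<alpha> * ((s' - s) / 2)))"
    and duh_source_exp: "\<And>l t (F :: real \<Rightarrow> 'a \<Rightarrow> ennreal) M. 0 < l \<Longrightarrow> 0 < t \<Longrightarrow> 0 < M \<Longrightarrow>
        case_prod F \<in> borel_measurable (lborel \<Otimes>\<^sub>M lborel) \<Longrightarrow>
        (\<And>\<tau>. 0 < \<tau> \<Longrightarrow> \<tau> < t \<Longrightarrow> bnd (\<alpha> * r) (\<alpha> * s - \<gamma>) (F \<tau>) (M * exp (l * \<tau>) * \<tau> powr (- (\<alpha> * ((s' - s) / 2))))) \<Longrightarrow>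
        bnd r s (duh F t) (C0 * M * l powr (- e) * exp (l * t) * t powr (1 - a - e - \<alpha> * ((s' - s) / 2)))"

text \<open>Collects the linear theory. The singularities a and a' are the exponents of
  \<open>hop_bnd\<close> for the passage from reciprocal \<alpha> r and weight \<alpha> s - \<gamma>
  to reciprocal r and weight s or s'. The last equation identifies \<delta> with (\<alpha> - 1) / 2
  times the gap between s' and the critical weight; the blow-up exponent is read off from
  it.\<close>

lemma kato_setting_exists:
  fixes d \<gamma> \<alpha> s' s r :: real
  assumes d: "d = real DIM('a::euclidean_space)" and \<alpha>: "1 < \<alpha>" and r: "0 \<le> r" "\<alpha> * r \<le> 1"
    and s: "- d * r < s" "s < s'" "s' + \<gamma> \<le> \<alpha> * s" "\<alpha> * s - \<gamma> < d * (1 - \<alpha> * r)"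
    and s': "s' < d * (1 - r)" "(\<alpha> - 1) * s' + d * (\<alpha> - 1) * r < 2 + \<gamma>"
  shows "\<exists>a a' C0 e. kato_setting \<gamma> \<alpha> r s s' a a' C0 e TYPE('a)
    \<and> 1 - a' - \<alpha> * ((s' - s) / 2) = (\<alpha> - 1) / 2 * ((2 + \<gamma>) / (\<alpha> - 1) - d * r - s')"
proof -
  define a where "a = d / 2 * (\<alpha> * r - r) + (\<alpha> * s - \<gamma> - s) / 2"
  define a' where "a' = d / 2 * (\<alpha> * r - r) + (\<alpha> * s - \<gamma> - s') / 2"
  define \<sigma> where "\<sigma> = (s' - s) / 2"
  define \<delta> where "\<delta> = 1 - a' - \<alpha> * \<sigma>"
  have d0: "0 < d" by (simp add: d)
  have r1: "r \<le> \<alpha> * r" using \<alpha> r by (simp add: mult_le_cancel_right1)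
  then have r1': "r \<le> 1" using r by simp
  have \<sigma>0: "0 < \<sigma>" using s by (simp add: \<sigma>_def)
  have dr: "0 \<le> d / 2 * (\<alpha> * r - r)" using d0 r1 by simp
  have aa': "a = a' + \<sigma>" by (simp add: a_def a'_def \<sigma>_def field_simps)
  have a'0: "0 \<le> a'" using dr s by (simp add: a'_def)
  have a0: "0 \<le> a" using aa' a'0 \<sigma>0 by simp
  \<comment> \<open>Subcriticality of s' passes to the smaller weight s, where it says a <
    1.\<close>
  have "(\<alpha> - 1) * s < (\<alpha> - 1) * s'" using \<alpha> s by (intro mult_strict_left_mono) auto
  then have a1: "a < 1" using s' by (simp add: a_def field_simps)
  have a'1: "a' < 1" using aa' a1 \<sigma>0 by simp
  have \<delta>0: "0 < \<delta>" using s'(2) by (simp add: \<delta>_def a'_def \<sigma>_def field_simps)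
  have b: "0 \<le> \<alpha> * \<sigma>" "\<alpha> * \<sigma> < 1" using \<alpha> \<sigma>0 \<delta>0 a'0 by (auto simp: \<delta>_def)
  have \<delta>c: "1 - a' - \<alpha> * \<sigma> = (\<alpha> - 1) / 2 * ((2 + \<gamma>) / (\<alpha> - 1) - d * r - s')"
    using \<alpha> by (simp add: a'_def \<sigma>_def field_simps)
  \<comment> \<open>Three demands on the slack: e \<le> 1 for z^e \<le> exp z, e \<le> \<delta> so
    that t^(\<delta> - e) stays bounded for t \<le> T, and a + e < 1 for integrability in
    time.\<close>
  define e where "e = min (min 1 \<delta>) ((1 - a) / 2)"
  have e: "0 < e" "e \<le> 1" "e \<le> \<delta>" "a + e < 1"
    using \<delta>0 a1 unfolding e_def by (auto simp: min_def field_simps)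
  have rr: "\<alpha> * r = 0 \<longleftrightarrow> r = 0" using \<alpha> by auto
  have sr': "- d * r < s'" using s by simp
  have ss: "s \<le> \<alpha> * s - \<gamma>" "s' \<le> \<alpha> * s - \<gamma>" using s by auto
  obtain C1 where C1: "0 < C1" "\<And>t F B. 0 < t \<Longrightarrow> F \<in> borel_measurable lborel \<Longrightarrow> 0 \<le> B \<Longrightarrow> bnd r s' F B \<Longrightarrow>
        bnd r s (hop t F :: 'a \<Rightarrow> ennreal) (C1 * t powr (- \<sigma>) * B)"
    using hop_bnd[of r r s s', where ?'a='a] r r1' s s' unfolding d \<sigma>_def by auto
  obtain C2 where C2: "0 < C2" "\<And>t F B. 0 < t \<Longrightarrow> F \<in> borel_measurable lborel \<Longrightarrow> 0 \<le> B \<Longrightarrow> bnd r s' F B \<Longrightarrow>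
        bnd r s' (hop t F :: 'a \<Rightarrow> ennreal) (C2 * B)"
    using hop_bnd[of r r s' s', where ?'a='a] r r1' s s' sr' unfolding d by auto
  obtain C3 where C3: "0 < C3" "\<And>t F B. 0 < t \<Longrightarrow> F \<in> borel_measurable lborel \<Longrightarrow> 0 \<le> B \<Longrightarrow> bnd (\<alpha> * r) (\<alpha> * s - \<gamma>) F B \<Longrightarrow>
        bnd r s (hop t F :: 'a \<Rightarrow> ennreal) (C3 * t powr (- a) * B)"
    using hop_bnd[OF r(1) r1 r(2) rr, of s "\<alpha> * s - \<gamma>", where ?'a='a] s ss unfolding d a_def by blast
  obtain C4 where C4: "0 < C4" "\<And>t F B. 0 < t \<Longrightarrow> F \<in> borel_measurable lborel \<Longrightarrow> 0 \<le> B \<Longrightarrow> bnd (\<alpha> * r) (\<alpha> * s - \<gamma>) F B \<Longrightarrow>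
        bnd r s' (hop t F :: 'a \<Rightarrow> ennreal) (C4 * t powr (- a') * B)"
    using hop_bnd[OF r(1) r1 r(2) rr, of s' "\<alpha> * s - \<gamma>", where ?'a='a] s ss sr' unfolding d a'_def by blast
  have ar: "0 \<le> \<alpha> * r" using \<alpha> r by simp
  obtain C5 where "0 < C5" and C5': "\<forall>t (F :: real \<Rightarrow> 'a \<Rightarrow> ennreal) M. 0 < t \<longrightarrow> 0 \<le> M \<longrightarrow>
        case_prod F \<in> borel_measurable (lborel \<Otimes>\<^sub>M lborel) \<longrightarrow>
        (\<forall>\<tau>. 0 < \<tau> \<longrightarrow> \<tau> < t \<longrightarrow> bnd (\<alpha> * r) (\<alpha> * s - \<gamma>) (F \<tau>) (M * \<tau> powr (- (\<alpha> * \<sigma>)))) \<longrightarrow>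
        bnd r s (duh F t) (C5 * M * t powr (1 - a - \<alpha> * \<sigma>))"
    by (rule exE[OF bnd_duh_powr[OF C3(2) C3(1) a0 a1 b ar r(1) r1']])
      (assumption | (erule conjE, rule that, assumption, assumption))+
  note C5 = \<open>0 < C5\<close> C5'[rule_format]
  obtain C6 where "0 < C6" and C6': "\<forall>t (F :: real \<Rightarrow> 'a \<Rightarrow> ennreal) M. 0 < t \<longrightarrow> 0 \<le> M \<longrightarrow>
        case_prod F \<in> borel_measurable (lborel \<Otimes>\<^sub>M lborel) \<longrightarrow>
        (\<forall>\<tau>. 0 < \<tau> \<longrightarrow> \<tau> < t \<longrightarrow> bnd (\<alpha> * r) (\<alpha> * s - \<gamma>) (F \<tau>) (M * \<tau> powr (- (\<alpha> * \<sigma>)))) \<longrightarrow>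
        bnd r s' (duh F t) (C6 * M * t powr (1 - a' - \<alpha> * \<sigma>))"
    by (rule exE[OF bnd_duh_powr[OF C4(2) C4(1) a'0 a'1 b ar r(1) r1']])
      (assumption | (erule conjE, rule that, assumption, assumption))+
  note C6 = \<open>0 < C6\<close> C6'[rule_format]
  obtain C7 where "0 < C7" and C7': "\<forall>l t (F :: real \<Rightarrow> 'a \<Rightarrow> ennreal) M. 0 < l \<longrightarrow> 0 < t \<longrightarrow> 0 < M \<longrightarrow>
        case_prod F \<in> borel_measurable (lborel \<Otimes>\<^sub>M lborel) \<longrightarrow>
        (\<forall>\<tau>. 0 < \<tau> \<longrightarrow> \<tau> < t \<longrightarrow> bnd (\<alpha> * r) (\<alpha> * s - \<gamma>) (F \<tau>) (M * exp (l * \<tau>) * \<tau> powr (- (\<alpha> * \<sigma>)))) \<longrightarrow>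
        bnd r s (duh F t) (C7 * M * l powr (- e) * exp (l * t) * t powr (1 - a - e - \<alpha> * \<sigma>))"
    by (rule exE[OF bnd_duh_exp[OF C3(2) C3(1) a0 e(4) e(1,2) b ar r(1) r1']])
      (assumption | (erule conjE, rule that, assumption, assumption))+
  note C7 = \<open>0 < C7\<close> C7'[rule_format]
  \<comment> \<open>One constant that dominates all seven linear estimates, so that later thresholds
    depend on a single number.\<close>
  define C0 where "C0 = C1 + C2 + C3 + C4 + C5 + C6 + C7"
  have C0: "0 < C0" "C1 \<le> C0" "C2 \<le> C0" "C3 \<le> C0" "C4 \<le> C0" "C5 \<le> C0" "C6 \<le> C0" "C7 \<le> C0"
    using C1(1) C2(1) C3(1) C4(1) C5(1) C6(1) C7(1) by (auto simp: C0_def)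
  have mono: "bnd r z F (C0 * B)" if "bnd r z F (C * B)" "C \<le> C0" "0 < C" "0 \<le> B" for z C B and F :: "'a \<Rightarrow> ennreal"
    using that r by (intro bnd_mono[OF that(1)]) (auto intro: mult_right_mono)
  have "kato_setting \<gamma> \<alpha> r s s' a a' C0 e TYPE('a)"
    unfolding kato_setting_def \<sigma>_def[symmetric] mult.assoc
  proof (intro conjI allI impI)
    show "e \<le> 1 - a' - \<alpha> * \<sigma>" using e by (simp add: \<delta>_def)
    fix t B :: real and F :: "'a \<Rightarrow> ennreal" assume F: "0 < t" "F \<in> borel_measurable lborel" "0 \<le> B"
    show "bnd r s (hop t F) (C0 * (t powr (- \<sigma>) * B))" if "bnd r s' F B"
      using C1(2)[OF F that] C1(1) C0 F by (intro mono[of _ _ C1]) (auto simp: mult.assoc)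
    show "bnd r s' (hop t F) (C0 * B)" if "bnd r s' F B"
      using C2(2)[OF F that] C2(1) C0 F by (intro mono[of _ _ C2]) auto
    show "bnd r s (hop t F) (C0 * (t powr (- a) * B))" if "bnd (\<alpha> * r) (\<alpha> * s - \<gamma>) F B"
      using C3(2)[OF F that] C3(1) C0 F by (intro mono[of _ _ C3]) (auto simp: mult.assoc)
    show "bnd r s' (hop t F) (C0 * (t powr (- a') * B))" if "bnd (\<alpha> * r) (\<alpha> * s - \<gamma>) F B"
      using C4(2)[OF F that] C4(1) C0 F by (intro mono[of _ _ C4]) (auto simp: mult.assoc)
  next
    fix t M :: real and F :: "real \<Rightarrow> 'a \<Rightarrow> ennreal"
    assume F: "0 < t" "0 \<le> M" "case_prod F \<in> borel_measurable (lborel \<Otimes>\<^sub>M lborel)"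
      and "\<forall>\<tau>. 0 < \<tau> \<longrightarrow> \<tau> < t \<longrightarrow> bnd (\<alpha> * r) (\<alpha> * s - \<gamma>) (F \<tau>) (M * \<tau> powr (- (\<alpha> * \<sigma>)))"
    then have FM: "\<And>\<tau>. 0 < \<tau> \<Longrightarrow> \<tau> < t \<Longrightarrow> bnd (\<alpha> * r) (\<alpha> * s - \<gamma>) (F \<tau>) (M * \<tau> powr (- (\<alpha> * \<sigma>)))"
      by blast
    show "bnd r s (duh F t) (C0 * (M * t powr (1 - a - \<alpha> * \<sigma>)))"
      using C5(2)[OF F FM] C5(1) C0 F by (intro mono[of _ _ C5]) (auto simp: mult.assoc)
    show "bnd r s' (duh F t) (C0 * (M * t powr (1 - a' - \<alpha> * \<sigma>)))"
      using C6(2)[OF F FM] C6(1) C0 F by (intro mono[of _ _ C6]) (auto simp: mult.assoc)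
  next
    fix l t M :: real and F :: "real \<Rightarrow> 'a \<Rightarrow> ennreal"
    assume F: "0 < l" "0 < t" "0 < M" "case_prod F \<in> borel_measurable (lborel \<Otimes>\<^sub>M lborel)"
      and FM: "\<forall>\<tau>. 0 < \<tau> \<longrightarrow> \<tau> < t \<longrightarrow> bnd (\<alpha> * r) (\<alpha> * s - \<gamma>) (F \<tau>) (M * (exp (l * \<tau>) * \<tau> powr (- (\<alpha> * \<sigma>))))"
    have "bnd r s (duh F t) (C7 * M * l powr (- e) * exp (l * t) * t powr (1 - a - e - \<alpha> * \<sigma>))"
      using FM by (intro C7(2)[OF F]) (simp add: mult.assoc)
    then show "bnd r s (duh F t) (C0 * (M * (l powr (- e) * (exp (l * t) * t powr (1 - a - e - \<alpha> * \<sigma>)))))"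
      using C7(1) C0 F by (intro mono[of _ _ C7]) (auto simp: mult.assoc)
  qed (use \<alpha> r s a0 e a'0 a'1 aa' C0 in \<open>auto\<close>)
  with \<delta>c show ?thesis unfolding \<sigma>_def by blast
qed

section \<open>Fixed points of the integral equation\<close>

text \<open>Borel rather than Lebesgue measurability in space-time: all slices are then measurable,
  and Tonelli's theorem applies to the product measure.\<close>

abbreviation jmeas :: "(real \<Rightarrow> 'a::euclidean_space \<Rightarrow> 'b::topological_space) \<Rightarrow> bool"
  where "jmeas u \<equiv> case_prod u \<in> borel_measurable (lborel \<Otimes>\<^sub>M lborel)"

definition Phi :: "real \<Rightarrow> real \<Rightarrow> ('a::euclidean_space \<Rightarrow> 'k::euclidean_space) \<Rightarrow> (real \<Rightarrow> 'a \<Rightarrow> 'k) \<Rightarrow> real \<Rightarrow> 'a \<Rightarrow> 'k"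
  where "Phi \<gamma> \<alpha> u0 u t x = heat t u0 x + duhamel (\<lambda>\<tau>. nonlinearity \<gamma> \<alpha> (u \<tau>)) t x"

lemma jmeas_nonlinearity:
  assumes [measurable]: "jmeas u"
  shows "jmeas (\<lambda>\<tau>. nonlinearity \<gamma> \<alpha> (u \<tau>))"
  unfolding nonlinearity_def by measurable

lemma borel_measurable_nonlinearity [measurable]:
  assumes [measurable]: "f \<in> borel_measurable lborel"
  shows "nonlinearity \<gamma> \<alpha> f \<in> borel_measurable lborel"
  unfolding nonlinearity_def[abs_def] by measurable

lemma jmeas_duhamel:
  fixes N :: "real \<Rightarrow> 'a::euclidean_space \<Rightarrow> 'k::euclidean_space"
  assumes N[measurable]: "jmeas N"
  shows "jmeas (duhamel N)"
proof -
  have [measurable]: "(\<lambda>(p, \<tau>). heat (fst p - \<tau>) (N \<tau>) (snd p)) \<in> borel_measurable ((lborel \<Otimes>\<^sub>M lborel) \<Otimes>\<^sub>M lborel)"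
    unfolding split_beta' by (intro borel_measurable_heat) measurable
  have "duhamel N t x = (LINT \<tau>|lborel. (if 0 \<le> \<tau> \<and> \<tau> \<le> t then heat (t - \<tau>) (N \<tau>) x else 0))" for t x
  proof -
    have Ns: "N \<tau> \<in> borel_measurable lborel" for \<tau> using N by (rule borel_measurable_slice)
    have "(\<lambda>\<tau>. heat (t - \<tau>) (N \<tau>) x) \<in> borel_measurable lborel"
      by (intro borel_measurable_heat) measurable
    then show ?thesis
      unfolding duhamel_def by (subst set_integrable_lebesgue_iff) (auto intro!: Bochner_Integration.integral_cong)
  qed
  then show ?thesis by (simp only: split_beta') measurable
qed

lemma jmeas_Phi:
  fixes u :: "real \<Rightarrow> 'a::euclidean_space \<Rightarrow> 'k::euclidean_space"
  assumes [measurable]: "u0 \<in> borel_measurable lborel" and u: "jmeas u"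
  shows "jmeas (Phi \<gamma> \<alpha> u0 u)"
proof -
  note jmeas_duhamel[OF jmeas_nonlinearity[OF u], measurable]
  have [measurable]: "(\<lambda>(t, x). heat t u0 x) \<in> borel_measurable (lborel \<Otimes>\<^sub>M lborel)"
    unfolding split_beta' by (intro borel_measurable_heat) measurable
  show ?thesis unfolding Phi_def by measurable
qed

text \<open>Nothing is assumed about joint measurability of M. This carries the equation from a
  given solution over to a Borel version that agrees with it only at almost every time.\<close>

lemma duhamel_cong:
  fixes N :: "real \<Rightarrow> 'a::euclidean_space \<Rightarrow> 'k::euclidean_space"
  assumes N: "jmeas N" and MN: "AE \<tau> in lborel. 0 < \<tau> \<longrightarrow> \<tau> < t \<longrightarrow> (AE y in lborel. M \<tau> y = N \<tau> y)"
  shows "set_integrable lebesgue {0..t} (\<lambda>\<tau>. heat (t - \<tau>) (M \<tau>) x) \<longleftrightarrow> set_integrable lebesgue {0..t} (\<lambda>\<tau>. heat (t - \<tau>) (N \<tau>) x)"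
    "duhamel M t x = duhamel N t x"
proof -
  have Ns: "N \<tau> \<in> borel_measurable lborel" for \<tau> using N by (rule borel_measurable_slice)
  have "AE \<tau> in lborel. \<tau> \<noteq> 0 \<and> \<tau> \<noteq> t"
    by (intro AE_conjI AE_I[of _ _ "{0}"] AE_I[of _ _ "{t}"]) auto
  with MN have "AE \<tau> in lborel. indicat_real {0..t} \<tau> *\<^sub>R heat (t - \<tau>) (M \<tau>) x = indicat_real {0..t} \<tau> *\<^sub>R heat (t - \<tau>) (N \<tau>) x"
  proof eventually_elim
    case (elim \<tau>)
    then show ?case
      using heat_cong_AE[OF _ _ Ns, of "M \<tau>" \<tau> "t - \<tau>" x] by (auto simp: indicator_def)
  qed
  then have ae: "AE \<tau> in lebesgue. indicat_real {0..t} \<tau> *\<^sub>R heat (t - \<tau>) (M \<tau>) x = indicat_real {0..t} \<tau> *\<^sub>R heat (t - \<tau>) (N \<tau>) x"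
    by (simp add: AE_completion_iff)
  note N[measurable]
  have [measurable]: "(\<lambda>\<tau>. heat (t - \<tau>) (N \<tau>) x) \<in> borel_measurable borel"
    using borel_measurable_heat[of N lborel "\<lambda>\<tau>. t - \<tau>" "\<lambda>_. x"] by simp
  have m: "(\<lambda>\<tau>. indicat_real {0..t} \<tau> *\<^sub>R heat (t - \<tau>) (N \<tau>) x) \<in> borel_measurable lebesgue"
    by (intro measurable_completion) measurable
  have m': "(\<lambda>\<tau>. indicat_real {0..t} \<tau> *\<^sub>R heat (t - \<tau>) (M \<tau>) x) \<in> borel_measurable lebesgue"
    using ae by (intro borel_measurable_AE[OF m]) (auto elim!: eventually_mono)
  show "set_integrable lebesgue {0..t} (\<lambda>\<tau>. heat (t - \<tau>) (M \<tau>) x) \<longleftrightarrow> set_integrable lebesgue {0..t} (\<lambda>\<tau>. heat (t - \<tau>) (N \<tau>) x)"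
    unfolding set_integrable_def by (intro integrable_cong_AE m m' ae)
  show "duhamel M t x = duhamel N t x"
    unfolding duhamel_def set_lebesgue_integral_def by (intro integral_cong_AE m m' ae)
qed

text \<open>Equality at every x although u and v agree only almost everywhere: the convolutions see
  only classes. Hence Phi of a solution is a representative determined by the class of the
  solution.\<close>

lemma Phi_cong:
  fixes u v :: "real \<Rightarrow> 'a::euclidean_space \<Rightarrow> 'k::euclidean_space"
  assumes v: "jmeas v" and uv: "AE \<tau> in lborel. 0 < \<tau> \<longrightarrow> \<tau> < t \<longrightarrow> (AE y in lborel. u \<tau> y = v \<tau> y)"
  shows "Phi \<gamma> \<alpha> u0 u t x = Phi \<gamma> \<alpha> u0 v t x"
proof -
  have "AE \<tau> in lborel. 0 < \<tau> \<longrightarrow> \<tau> < t \<longrightarrow> (AE y in lborel. nonlinearity \<gamma> \<alpha> (u \<tau>) y = nonlinearity \<gamma> \<alpha> (v \<tau>) y)"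
    using uv by (auto simp: nonlinearity_def elim!: eventually_mono)
  from duhamel_cong(2)[OF jmeas_nonlinearity[OF v] this] show ?thesis by (simp add: Phi_def)
qed

lemma duhamel_zero_time [simp]: "duhamel N 0 x = 0"
proof -
  have "AE \<tau> in lebesgue. indicat_real {0..0} \<tau> *\<^sub>R heat (0 - \<tau>) (N \<tau>) x = 0"
    unfolding AE_completion_iff by (intro AE_I[of _ _ "{0}"]) (auto split: split_indicator_asm)
  then show ?thesis unfolding duhamel_def set_lebesgue_integral_def by (rule integral_eq_zero_AE)
qed

lemma Phi_zero_time [simp]: "Phi \<gamma> \<alpha> u0 u 0 x = u0 x"
  by (simp add: Phi_def heat_def)

lemma bnd_tendsto:
  assumes "\<And>n. bnd r s F (B + c n)" "c \<longlonglongrightarrow> 0" "0 \<le> B" "\<And>n. 0 \<le> c n" "0 \<le> r"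
  shows "bnd r s F B"
proof (rule bnd_closed)
  fix B' assume "B < B'"
  then have "eventually (\<lambda>n. c n < B' - B) sequentially"
    using assms(2) by (intro order_tendstoD(2)) auto
  then obtain n where "c n < B' - B" by (auto simp: eventually_sequentially)
  then show "bnd r s F B'" using assms by (intro bnd_mono[OF assms(1)[of n]]) auto
qed (use assms in auto)

lemma bnd_tendsto_0:
  assumes "\<And>n. bnd r s F (c n)" "c \<longlonglongrightarrow> 0" "\<And>n. 0 \<le> c n" "0 \<le> r" "F \<in> borel_measurable lborel"
  shows "AE x in lborel. F x = 0"
  using bnd_tendsto[of r s F 0 c] assms by (intro bnd_0_imp_AE_zero[of r s]) auto

text \<open>Telescoping. The summability hypothesis ensures that \<open>lim f\<close> is a genuine
  limit.\<close>

lemma lim_if_suminf_finite: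
  fixes f :: "nat \<Rightarrow> 'k::banach"
  assumes "(\<Sum>k. ennreal (norm (f (Suc k) - f k))) < top"
  shows "ennreal (norm (lim f - f n)) \<le> (\<Sum>k. ennreal (norm (f (Suc (n + k)) - f (n + k))))"
proof -
  have s: "summable (\<lambda>k. norm (f (Suc k) - f k))"
    using assms by (intro summable_suminf_not_top) auto
  then have "summable (\<lambda>k. f (Suc k) - f k)" by (rule summable_norm_cancel)
  then have "convergent (\<lambda>n. \<Sum>k<n. f (Suc k) - f k)" by (simp add: summable_iff_convergent)
  then have "convergent (\<lambda>n. f n - f 0)" by (simp add: sum_lessThan_telescope)
  then have "convergent f" by (simp add: convergent_diff_const_right_iff)
  then have l: "f \<longlonglongrightarrow> lim f" by (simp add: convergent_LIMSEQ_iff)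
  have l1: "(\<lambda>m. ennreal (norm (f (m + n) - f n))) \<longlonglongrightarrow> ennreal (norm (lim f - f n))"
    by (intro tendsto_ennrealI tendsto_norm tendsto_diff tendsto_const LIMSEQ_ignore_initial_segment l)
  have l2: "ennreal (norm (f (m + n) - f n)) \<le> (\<Sum>k. ennreal (norm (f (Suc (n + k)) - f (n + k))))" for m
  proof -
    have "f (m + n) - f n = (\<Sum>k<m. f (Suc (n + k)) - f (n + k))"
      using sum_lessThan_telescope[of "\<lambda>k. f (n + k)" m] by (simp add: add.commute)
    then have "ennreal (norm (f (m + n) - f n)) \<le> ennreal (\<Sum>k<m. norm (f (Suc (n + k)) - f (n + k)))"
      by (simp add: norm_sum ennreal_leI)
    also have "\<dots> = (\<Sum>k<m. ennreal (norm (f (Suc (n + k)) - f (n + k))))" by (simp add: sum_ennreal)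
    also have "\<dots> \<le> (\<Sum>k. ennreal (norm (f (Suc (n + k)) - f (n + k))))" by (intro sum_le_suminf) auto
    finally show ?thesis .
  qed
  show ?thesis using l2 by (intro LIMSEQ_le_const2[OF l1]) blast
qed

context kato_setting
begin

abbreviation \<sigma> :: real where "\<sigma> \<equiv> (s' - s) / 2"
abbreviation \<delta> :: real where "\<delta> \<equiv> 1 - a' - \<alpha> * \<sigma>"
abbreviation N :: "('a \<Rightarrow> 'k::euclidean_space) \<Rightarrow> 'a \<Rightarrow> 'k" where "N \<equiv> nonlinearity \<gamma> \<alpha>"

lemma r_le_1: "r \<le> 1"
proof -
  have "1 * r \<le> \<alpha> * r" using \<alpha> r(1) by (intro mult_right_mono) auto
  with r(2) show ?thesis by simp
qed

lemma \<delta>_pos: "0 < \<delta>" and \<delta>_ge: "e \<le> \<delta>" using e by auto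

text \<open>Relative to the weight t^(-\<sigma>) of the Kato norm the Duhamel term gains the same
  factor t^\<delta> as in the norm with weight s'. The form as a sum suits
  \<open>powr_add\<close>.\<close>

lemma exponent_eq: "1 - a - \<alpha> * \<sigma> = \<delta> + - \<sigma>" using aa' by simp

lemma ar0: "0 \<le> \<alpha> * r" using \<alpha> r by simp

lemma bnd_nonlinearity_diff:
  fixes f g :: "'a \<Rightarrow> 'k::euclidean_space"
  assumes [measurable]: "f \<in> borel_measurable lborel" "g \<in> borel_measurable lborel"
    and "bnd r s (nrm f) A" "bnd r s (nrm g) B" "bnd r s (nrm (\<lambda>x. f x - g x)) W" "0 \<le> A" "0 \<le> B" "0 \<le> W"
  shows "bnd (\<alpha> * r) (\<alpha> * s - \<gamma>) (nrm (\<lambda>x. N f x - N g x)) (\<alpha> * (A powr (\<alpha> - 1) + B powr (\<alpha> - 1)) * W)"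
proof -
  have "bnd (\<alpha> * r) (\<alpha> * s - \<gamma>) (\<lambda>x. ennreal \<alpha> * (ennreal (norm x powr \<gamma> * norm (f x) powr (\<alpha> - 1) * norm (f x - g x))
      + ennreal (norm x powr \<gamma> * norm (g x) powr (\<alpha> - 1) * norm (f x - g x)))) (\<alpha> * (A powr (\<alpha> - 1) * W + B powr (\<alpha> - 1) * W))"
    using assms \<alpha> r ar0 by (intro bnd_scale bnd_add bnd_power_mult) auto
  then have "bnd (\<alpha> * r) (\<alpha> * s - \<gamma>) (nrm (\<lambda>x. N f x - N g x)) (\<alpha> * (A powr (\<alpha> - 1) * W + B powr (\<alpha> - 1) * W))"
  proof (rule bnd_mono)
    show "AE x in lborel. nrm (\<lambda>x. N f x - N g x) x \<le> ennreal \<alpha> * (ennreal (norm x powr \<gamma> * norm (f x) powr (\<alpha> - 1) * norm (f x - g x))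
      + ennreal (norm x powr \<gamma> * norm (g x) powr (\<alpha> - 1) * norm (f x - g x)))"
      using nonlinearity_diff_le[OF \<alpha>, of \<gamma> f _ g] \<alpha>
      by (intro AE_I2) (simp flip: ennreal_mult ennreal_plus add: ennreal_leI)
  qed (use assms \<alpha> ar0 in auto)
  then show ?thesis by (simp add: algebra_simps)
qed

lemma bnd_nonlinearity:
  fixes f :: "'a \<Rightarrow> 'k::euclidean_space"
  assumes [measurable]: "f \<in> borel_measurable lborel" and "bnd r s (nrm f) A" "0 \<le> A"
  shows "bnd (\<alpha> * r) (\<alpha> * s - \<gamma>) (nrm (N f)) (A powr \<alpha>)"
proof -
  have "bnd (\<alpha> * r) (\<alpha> * s - \<gamma>) (\<lambda>x. ennreal (norm x powr \<gamma> * norm (f x) powr (\<alpha> - 1) * norm (f x))) (A powr (\<alpha> - 1) * A)"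
    using assms \<alpha> r by (intro bnd_power_mult) auto
  moreover have "A powr (\<alpha> - 1) * A = A powr \<alpha>" using assms \<alpha> by (cases "A = 0") (auto simp: powr_diff)
  ultimately show ?thesis by (simp add: nonlinearity_def)
qed

text \<open>Only times \<tau> < t occur, because the Duhamel term at time t depends on earlier times
  alone; a bound on (0, t) thus yields one at t.\<close>

definition kato_on :: "(real \<Rightarrow> 'a \<Rightarrow> 'k::euclidean_space) \<Rightarrow> real \<Rightarrow> real \<Rightarrow> bool"
  where "kato_on u t M \<longleftrightarrow> (\<forall>\<tau>. 0 < \<tau> \<longrightarrow> \<tau> < t \<longrightarrow> bnd r s (nrm (u \<tau>)) (M * \<tau> powr (- \<sigma>)))"

lemma kato_onD: "kato_on u t M \<Longrightarrow> 0 < \<tau> \<Longrightarrow> \<tau> < t \<Longrightarrow> bnd r s (nrm (u \<tau>)) (M * \<tau> powr (- \<sigma>))"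
  by (simp add: kato_on_def)

lemma kato_on_mono: "kato_on u t M \<Longrightarrow> t' \<le> t \<Longrightarrow> 0 \<le> M \<Longrightarrow> M \<le> M' \<Longrightarrow> kato_on u t' M'"
  unfolding kato_on_def
proof (intro allI impI)
  fix \<tau> assume *: "\<forall>\<tau>. 0 < \<tau> \<longrightarrow> \<tau> < t \<longrightarrow> bnd r s (nrm (u \<tau>)) (M * \<tau> powr (- \<sigma>))"
    "t' \<le> t" "0 \<le> M" "M \<le> M'" "0 < \<tau>" "\<tau> < t'"
  then have "bnd r s (nrm (u \<tau>)) (M * \<tau> powr (- \<sigma>))" by simp
  then show "bnd r s (nrm (u \<tau>)) (M' * \<tau> powr (- \<sigma>))"
    by (rule bnd_mono) (use * r(1) in \<open>simp_all add: mult_right_mono\<close>)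
qed

lemma bnd_duh_nonlinearity:
  fixes u :: "real \<Rightarrow> 'a \<Rightarrow> 'k::euclidean_space"
  assumes u: "jmeas u" "kato_on u t M" and t: "0 < t" and M: "0 \<le> M"
  shows "bnd r s (duh (\<lambda>\<tau>. nrm (N (u \<tau>))) t) (C0 * M powr \<alpha> * t powr (\<delta> + - \<sigma>))"
    "bnd r s' (duh (\<lambda>\<tau>. nrm (N (u \<tau>))) t) (C0 * M powr \<alpha> * t powr \<delta>)"
    "AE x in lborel. duh (\<lambda>\<tau>. nrm (N (u \<tau>))) t x < top"
proof -
  have [measurable]: "jmeas (\<lambda>\<tau>. N (u \<tau>))" using u(1) by (rule jmeas_nonlinearity)
  have us: "u \<tau> \<in> borel_measurable lborel" for \<tau> using u(1) by (rule borel_measurable_slice)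
  have b: "bnd (\<alpha> * r) (\<alpha> * s - \<gamma>) (nrm (N (u \<tau>))) (M powr \<alpha> * \<tau> powr (- (\<alpha> * \<sigma>)))" if "0 < \<tau>" "\<tau> < t" for \<tau>
  proof -
    have "bnd (\<alpha> * r) (\<alpha> * s - \<gamma>) (nrm (N (u \<tau>))) ((M * \<tau> powr (- \<sigma>)) powr \<alpha>)"
      using us kato_onD[OF u(2) that] M by (intro bnd_nonlinearity) auto
    moreover have "(M * \<tau> powr (- \<sigma>)) powr \<alpha> = M powr \<alpha> * \<tau> powr (- (\<alpha> * \<sigma>))"
      unfolding powr_mult powr_powr by (simp add: mult.commute)
    ultimately show ?thesis by simp
  qed
  show "bnd r s (duh (\<lambda>\<tau>. nrm (N (u \<tau>))) t) (C0 * M powr \<alpha> * t powr (\<delta> + - \<sigma>))"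
    unfolding exponent_eq[symmetric] using b t by (intro duh_source) auto
  show *: "bnd r s' (duh (\<lambda>\<tau>. nrm (N (u \<tau>))) t) (C0 * M powr \<alpha> * t powr \<delta>)"
    using b t by (intro duh_source') auto
  show "AE x in lborel. duh (\<lambda>\<tau>. nrm (N (u \<tau>))) t x < top"
    by (rule bnd_imp_AE_finite[OF *]) (unfold duh_def, measurable)
qed

text \<open>For u0 = v0 the linear part vanishes, which gives the contraction; for v = 0 and v0 = 0
  it bounds a single Phi. Both majorants must be finite before the Duhamel integrals can be
  subtracted, and this is known only almost everywhere.\<close>

lemma Phi_diff_AE:
  fixes u v :: "real \<Rightarrow> 'a \<Rightarrow> 'k::euclidean_space"
  assumes u: "jmeas u" "kato_on u t M" and v: "jmeas v" "kato_on v t M'" and t: "0 < t" and M: "0 \<le> M" "0 \<le> M'"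
  shows "AE x in lborel. nrm (\<lambda>x. Phi \<gamma> \<alpha> u0 u t x - Phi \<gamma> \<alpha> v0 v t x) x
    \<le> nrm (\<lambda>x. heat t u0 x - heat t v0 x) x + duh (\<lambda>\<tau>. nrm (\<lambda>y. N (u \<tau>) y - N (v \<tau>) y)) t x"
  using bnd_duh_nonlinearity(3)[OF u t M(1)] bnd_duh_nonlinearity(3)[OF v t M(2)]
proof eventually_elim
  case (elim x)
  note [measurable] = jmeas_nonlinearity[OF u(1), of \<gamma> \<alpha>] jmeas_nonlinearity[OF v(1), of \<gamma> \<alpha>]
  have "duhamel (\<lambda>\<tau>. N (u \<tau>)) t x - duhamel (\<lambda>\<tau>. N (v \<tau>)) t x = duhamel (\<lambda>\<tau> y. N (u \<tau>) y - N (v \<tau>) y) t x"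
    using elim by (intro duhamel_diff) auto
  then have eq: "Phi \<gamma> \<alpha> u0 u t x - Phi \<gamma> \<alpha> v0 v t x = (heat t u0 x - heat t v0 x) + duhamel (\<lambda>\<tau> y. N (u \<tau>) y - N (v \<tau>) y) t x"
    by (simp add: Phi_def algebra_simps)
  have "nrm (duhamel (\<lambda>\<tau> y. N (u \<tau>) y - N (v \<tau>) y) t) x \<le> duh (\<lambda>\<tau>. nrm (\<lambda>y. N (u \<tau>) y - N (v \<tau>) y)) t x"
  proof (rule duhamel_converges(4))
    show "jmeas (\<lambda>\<tau> y. N (u \<tau>) y - N (v \<tau>) y)" by measurable
    have Nus: "N (u \<tau>) \<in> borel_measurable lborel" "N (v \<tau>) \<in> borel_measurable lborel" for \<tau>
      using u v by (auto intro!: borel_measurable_nonlinearity borel_measurable_slice)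
    have "duh (\<lambda>\<tau>. nrm (\<lambda>y. N (u \<tau>) y - N (v \<tau>) y)) t x
      \<le> duh (\<lambda>\<tau> y. nrm (N (u \<tau>)) y + nrm (N (v \<tau>)) y) t x"
      by (intro duh_mono) (simp flip: ennreal_plus add: ennreal_leI norm_triangle_ineq4)
    also have "\<dots> = duh (\<lambda>\<tau>. nrm (N (u \<tau>))) t x + duh (\<lambda>\<tau>. nrm (N (v \<tau>))) t x"
    proof -
      have "hop (t - \<tau>) (\<lambda>y. nrm (N (u \<tau>)) y + nrm (N (v \<tau>)) y) x = hop (t - \<tau>) (nrm (N (u \<tau>))) x + hop (t - \<tau>) (nrm (N (v \<tau>))) x" for \<tau>
        using Nus[of \<tau>] unfolding hop_def distrib_left by (intro nn_integral_add) auto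
      then show ?thesis unfolding duh_def distrib_left by (simp add: distrib_left) (intro nn_integral_add, measurable)
    qed
    also have "\<dots> < top" using elim by simp
    finally show "duh (\<lambda>\<tau>. nrm (\<lambda>y. N (u \<tau>) y - N (v \<tau>) y)) t x < top" .
  qed
  then show ?case unfolding eq
    by (intro order_trans[OF ennreal_leI[OF norm_triangle_ineq]]) (simp add: add_left_mono)
qed

lemma borel_measurable_duh [measurable]:
  assumes [measurable]: "jmeas F"
  shows "duh F t \<in> borel_measurable lborel"
  unfolding duh_def[abs_def] by measurable

lemma bnd_duh_nonlinearity_diff:
  fixes u v :: "real \<Rightarrow> 'a \<Rightarrow> 'k::euclidean_space"
  assumes u: "jmeas u" "kato_on u t M" and v: "jmeas v" "kato_on v t M'" and w: "kato_on (\<lambda>\<tau> x. u \<tau> x - v \<tau> x) t W"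
    and t: "0 < t" and M: "0 \<le> M" "0 \<le> M'" "0 \<le> W"
  shows "bnd r s (duh (\<lambda>\<tau>. nrm (\<lambda>y. N (u \<tau>) y - N (v \<tau>) y)) t) (C0 * (\<alpha> * (M powr (\<alpha> - 1) + M' powr (\<alpha> - 1)) * W) * t powr (\<delta> + - \<sigma>))"
    "bnd r s' (duh (\<lambda>\<tau>. nrm (\<lambda>y. N (u \<tau>) y - N (v \<tau>) y)) t) (C0 * (\<alpha> * (M powr (\<alpha> - 1) + M' powr (\<alpha> - 1)) * W) * t powr \<delta>)"
proof -
  note [measurable] = jmeas_nonlinearity[OF u(1), of \<gamma> \<alpha>] jmeas_nonlinearity[OF v(1), of \<gamma> \<alpha>]
  have us: "u \<tau> \<in> borel_measurable lborel" "v \<tau> \<in> borel_measurable lborel" for \<tau>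
    using u(1) v(1) by (auto intro: borel_measurable_slice)
  have b: "bnd (\<alpha> * r) (\<alpha> * s - \<gamma>) (nrm (\<lambda>y. N (u \<tau>) y - N (v \<tau>) y))
      (\<alpha> * (M powr (\<alpha> - 1) + M' powr (\<alpha> - 1)) * W * \<tau> powr (- (\<alpha> * \<sigma>)))" if \<tau>: "0 < \<tau>" "\<tau> < t" for \<tau>
  proof -
    have "bnd (\<alpha> * r) (\<alpha> * s - \<gamma>) (nrm (\<lambda>y. N (u \<tau>) y - N (v \<tau>) y))
      (\<alpha> * ((M * \<tau> powr (- \<sigma>)) powr (\<alpha> - 1) + (M' * \<tau> powr (- \<sigma>)) powr (\<alpha> - 1)) * (W * \<tau> powr (- \<sigma>)))"
      using us kato_onD[OF u(2) \<tau>] kato_onD[OF v(2) \<tau>] kato_onD[OF w \<tau>] M by (intro bnd_nonlinearity_diff) auto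
    moreover have "\<alpha> * ((M * \<tau> powr (- \<sigma>)) powr (\<alpha> - 1) + (M' * \<tau> powr (- \<sigma>)) powr (\<alpha> - 1)) * (W * \<tau> powr (- \<sigma>))
      = \<alpha> * (M powr (\<alpha> - 1) + M' powr (\<alpha> - 1)) * W * \<tau> powr (- (\<alpha> * \<sigma>))"
    proof -
      have "- \<sigma> * (\<alpha> - 1) + - \<sigma> = - (\<alpha> * \<sigma>)" by (simp add: field_simps)
      then have "\<tau> powr (- (\<alpha> * \<sigma>)) = (\<tau> powr (- \<sigma>)) powr (\<alpha> - 1) * \<tau> powr (- \<sigma>)"
        by (simp only: powr_powr powr_add[symmetric])
      then show ?thesis by (simp only: powr_mult) (simp add: algebra_simps)
    qed
    ultimately show ?thesis by simp
  qed
  show "bnd r s (duh (\<lambda>\<tau>. nrm (\<lambda>y. N (u \<tau>) y - N (v \<tau>) y)) t) (C0 * (\<alpha> * (M powr (\<alpha> - 1) + M' powr (\<alpha> - 1)) * W) * t powr (\<delta> + - \<sigma>))"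
    unfolding exponent_eq[symmetric] using b t M \<alpha> by (intro duh_source) auto
  show "bnd r s' (duh (\<lambda>\<tau>. nrm (\<lambda>y. N (u \<tau>) y - N (v \<tau>) y)) t) (C0 * (\<alpha> * (M powr (\<alpha> - 1) + M' powr (\<alpha> - 1)) * W) * t powr \<delta>)"
    using b t M \<alpha> by (intro duh_source') auto
qed

lemma borel_measurable_Phi:
  fixes u :: "real \<Rightarrow> 'a \<Rightarrow> 'k::euclidean_space"
  assumes "u0 \<in> borel_measurable lborel" "jmeas u"
  shows "Phi \<gamma> \<alpha> u0 u t \<in> borel_measurable lborel"
  using jmeas_Phi[OF assms] by (rule borel_measurable_slice)

text \<open>L measures the linear evolution and not the data, so that the solution is bounded by
  twice the Kato norm of that evolution. The smallness condition keeps the ball of radius 2 L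
  invariant and halves distances in it: each of the two functions compared contributes \<alpha> C0
  (2 L)^(\<alpha> - 1) T^\<delta> \<le> 1/4.\<close>

lemma picard:
  fixes u0 :: "'a \<Rightarrow> 'k::euclidean_space"
  assumes u0[measurable]: "u0 \<in> borel_measurable lborel" and L: "0 \<le> L" and T: "0 < T"
    and lin: "\<And>t. 0 < t \<Longrightarrow> t \<le> T \<Longrightarrow> bnd r s (nrm (heat t u0)) (L * t powr (- \<sigma>))"
    and small: "4 * \<alpha> * C0 * (2 * L) powr (\<alpha> - 1) * T powr \<delta> \<le> 1"
  shows "\<exists>u. jmeas u \<and> (\<forall>t. 0 < t \<longrightarrow> t \<le> T \<longrightarrow> bnd r s (nrm (u t)) (2 * L * t powr (- \<sigma>)))
    \<and> (\<forall>t x. t \<le> T \<longrightarrow> u t x = Phi \<gamma> \<alpha> u0 u t x)"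
proof -
  define U where "U n = (Phi \<gamma> \<alpha> u0 ^^ n) (\<lambda>_ _. 0)" for n
  have U0: "U 0 = (\<lambda>_ _. 0)" and US: "U (Suc n) = Phi \<gamma> \<alpha> u0 (U n)" for n by (auto simp: U_def)
  have Um: "jmeas (U n)" for n
    by (induction n) (auto simp: U0 US intro!: jmeas_Phi u0)
  note [measurable] = Um
  have Uts[measurable]: "U n t \<in> borel_measurable lborel" for n t using Um by (rule borel_measurable_slice)
  have [measurable]: "heat t u0 \<in> borel_measurable lborel" for t
    by (intro borel_measurable_heat) measurable
  have tT: "t powr (\<delta> + - \<sigma>) \<le> T powr \<delta> * t powr (- \<sigma>)" if "0 < t" "t \<le> T" for t
    unfolding powr_add using that \<delta>_pos by (intro mult_right_mono powr_mono2) auto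
  have N0: "N (\<lambda>_::'a. 0 :: 'k) = (\<lambda>_. 0)" by (auto simp: nonlinearity_def)
  have h0: "heat t (\<lambda>_::'a. 0 :: 'k) = (\<lambda>_. 0)" for t by (auto simp: heat_def)
  have Phi0: "Phi \<gamma> \<alpha> (\<lambda>_. 0 :: 'k) (\<lambda>_ _. 0) t x = 0" for t and x :: 'a
    by (simp add: Phi_def N0 h0 duhamel_def set_lebesgue_integral_def)
  have kato0: "kato_on (\<lambda>_ _. 0 :: 'k) t 0" for t by (simp add: kato_on_def)
  have j0: "jmeas (\<lambda>_ _. 0 :: 'k)" by simp
  have self: "bnd r s (nrm (Phi \<gamma> \<alpha> u0 u t)) (2 * L * t powr (- \<sigma>))"
    if u: "jmeas u" "kato_on u t (2 * L)" and t: "0 < t" "t \<le> T" for u t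
  proof -
    have [measurable]: "jmeas (\<lambda>\<tau>. N (u \<tau>))" using u(1) by (rule jmeas_nonlinearity)
    have "bnd r s (\<lambda>x. nrm (heat t u0) x + duh (\<lambda>\<tau>. nrm (N (u \<tau>))) t x) (L * t powr (- \<sigma>) + C0 * (2 * L) powr \<alpha> * t powr (\<delta> + - \<sigma>))"
      using lin[OF t] bnd_duh_nonlinearity(1)[OF u t(1)] L C0 r r_le_1 by (intro bnd_add) auto
    then show ?thesis
    proof (rule bnd_mono)
      show "AE x in lborel. nrm (Phi \<gamma> \<alpha> u0 u t) x \<le> nrm (heat t u0) x + duh (\<lambda>\<tau>. nrm (N (u \<tau>))) t x"
        using Phi_diff_AE[OF u j0 kato0 t(1), of u0 "\<lambda>_. 0"] L by (simp add: Phi0 N0 h0)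
      have "(2 * L) powr \<alpha> = (2 * L) powr (\<alpha> - 1) * (2 * L)" using L \<alpha> by (cases "L = 0") (auto simp: powr_diff)
      then have "C0 * (2 * L) powr \<alpha> * t powr (\<delta> + - \<sigma>) = C0 * ((2 * L) powr (\<alpha> - 1) * (2 * L)) * t powr (\<delta> + - \<sigma>)"
        by simp
      also have "\<dots> \<le> C0 * ((2 * L) powr (\<alpha> - 1) * (2 * L)) * (T powr \<delta> * t powr (- \<sigma>))"
        by (rule mult_left_mono[OF tT[OF t]]) (use C0 L in auto)
      also have "\<dots> = (C0 * (2 * L) powr (\<alpha> - 1) * T powr \<delta>) * (2 * L * t powr (- \<sigma>))" by (simp add: mult_ac)
      also have "\<dots> \<le> 1 / 2 * (2 * L * t powr (- \<sigma>))"
      proof (rule mult_right_mono)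
        \<comment> \<open>The factor 4 \<alpha> in the smallness condition is tuned to the
          contraction below; for the invariance of the ball it leaves room.\<close>
        have "1 * (C0 * (2 * L) powr (\<alpha> - 1) * T powr \<delta>) \<le> \<alpha> * (C0 * (2 * L) powr (\<alpha> - 1) * T powr \<delta>)"
          using \<alpha> C0 by (intro mult_right_mono) auto
        with small show "C0 * (2 * L) powr (\<alpha> - 1) * T powr \<delta> \<le> 1 / 2" by (simp add: mult_ac)
      qed (use L in auto)
      finally show "L * t powr (- \<sigma>) + C0 * (2 * L) powr \<alpha> * t powr (\<delta> + - \<sigma>) \<le> 2 * L * t powr (- \<sigma>)" by simp
    qed (use L C0 r in auto)
  qed
  have contr: "bnd r s (nrm (\<lambda>x. Phi \<gamma> \<alpha> u0 u t x - Phi \<gamma> \<alpha> u0 v t x)) (W / 2 * t powr (- \<sigma>))"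
    if u: "jmeas u" "kato_on u t (2 * L)" and v: "jmeas v" "kato_on v t (2 * L)"
      and w: "kato_on (\<lambda>\<tau> x. u \<tau> x - v \<tau> x) t W" "0 \<le> W" and t: "0 < t" "t \<le> T" for u v t W
  proof -
    have L2: "0 \<le> 2 * L" using L by simp
    have "bnd r s (duh (\<lambda>\<tau>. nrm (\<lambda>y. N (u \<tau>) y - N (v \<tau>) y)) t) (C0 * (\<alpha> * ((2 * L) powr (\<alpha> - 1) + (2 * L) powr (\<alpha> - 1)) * W) * t powr (\<delta> + - \<sigma>))"
      using w L2 by (intro bnd_duh_nonlinearity_diff[OF u v]) (use t in auto)
    then show ?thesis
    proof (rule bnd_mono)
      show "AE x in lborel. nrm (\<lambda>x. Phi \<gamma> \<alpha> u0 u t x - Phi \<gamma> \<alpha> u0 v t x) x \<le> duh (\<lambda>\<tau>. nrm (\<lambda>y. N (u \<tau>) y - N (v \<tau>) y)) t x"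
        using Phi_diff_AE[OF u v t(1) L2 L2, of u0 u0] by simp
      have "C0 * (\<alpha> * ((2 * L) powr (\<alpha> - 1) + (2 * L) powr (\<alpha> - 1)) * W) * t powr (\<delta> + - \<sigma>)
        \<le> C0 * (\<alpha> * ((2 * L) powr (\<alpha> - 1) + (2 * L) powr (\<alpha> - 1)) * W) * (T powr \<delta> * t powr (- \<sigma>))"
        using tT[OF t] C0 \<alpha> w by (intro mult_left_mono) auto
      also have "\<dots> = (4 * \<alpha> * C0 * (2 * L) powr (\<alpha> - 1) * T powr \<delta>) * (W / 2 * t powr (- \<sigma>))" by (simp add: mult_ac)
      also have "\<dots> \<le> 1 * (W / 2 * t powr (- \<sigma>))" using small w by (intro mult_right_mono) auto
      finally show "C0 * (\<alpha> * ((2 * L) powr (\<alpha> - 1) + (2 * L) powr (\<alpha> - 1)) * W) * t powr (\<delta> + - \<sigma>) \<le> W / 2 * t powr (- \<sigma>)" by simp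
    qed (use \<alpha> C0 r w in auto)
  qed
  have Ub: "bnd r s (nrm (U n t)) (2 * L * t powr (- \<sigma>))" if "0 < t" "t \<le> T" for n t
    using that
  proof (induction n arbitrary: t)
    case (Suc n)
    then show ?case unfolding US by (intro self Um) (auto simp: kato_on_def)
  qed (simp add: U0)
  have Uk: "kato_on (U n) t (2 * L)" if "t \<le> T" for n t
    using Ub that by (auto simp: kato_on_def)
  \<comment> \<open>L + 1 in place of L keeps the bounds positive when L = 0, as
    \<open>bnd_suminf\<close> requires.\<close>
  define w where "w n = (L + 1) * (1 / 2) ^ n" for n
  have w0: "0 < w n" for n using L by (simp add: w_def)
  have wlim: "w \<longlonglongrightarrow> 0"
    unfolding w_def by (intro tendsto_mult_right_zero LIMSEQ_realpow_zero) auto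
  have Ud: "bnd r s (nrm (\<lambda>x. U (Suc n) t x - U n t x)) (w n * t powr (- \<sigma>))" if "0 < t" "t \<le> T" for n t
    using that
  proof (induction n arbitrary: t)
    case 0
    have "bnd r s (nrm (heat t u0)) (w 0 * t powr (- \<sigma>))"
      using L r by (intro bnd_mono[OF lin[OF 0]]) (auto simp: w_def intro: mult_right_mono)
    moreover have "Phi \<gamma> \<alpha> u0 (\<lambda>_ _. 0) t x = heat t u0 x" for x
      using Phi0[of t x] by (simp add: Phi_def h0)
    ultimately show ?case by (simp add: US U0)
  next
    case (Suc n)
    have "bnd r s (nrm (\<lambda>x. Phi \<gamma> \<alpha> u0 (U (Suc n)) t x - Phi \<gamma> \<alpha> u0 (U n) t x)) (w n / 2 * t powr (- \<sigma>))"
      using Suc w0[of n] by (intro contr Um Uk) (auto simp: kato_on_def)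
    then show ?case by (simp add: US w_def)
  qed
  \<comment> \<open>A pointwise limit, so that joint measurability is preserved; at each time in (0,
    T] the sequence converges off a null set.\<close>
  define u where "u t x = lim (\<lambda>n. U n t x)" for t x
  have um[measurable]: "jmeas u"
  proof -
    have "(\<lambda>p. lim (\<lambda>n. case_prod (U n) p)) \<in> borel_measurable (lborel \<Otimes>\<^sub>M lborel)"
      by (intro borel_measurable_lim_metric Um)
    then show ?thesis by (simp add: u_def split_beta')
  qed
  have uts[measurable]: "u t \<in> borel_measurable lborel" for t using um by (rule borel_measurable_slice)
  have ud: "bnd r s (nrm (\<lambda>x. u t x - U n t x)) (2 * w n * t powr (- \<sigma>))" if t: "0 < t" "t \<le> T" for n t
  proof -
    have sum: "bnd r s (\<lambda>x. \<Sum>k. nrm (\<lambda>x. U (Suc (n + k)) t x - U (n + k) t x) x) (\<Sum>k. w (n + k) * t powr (- \<sigma>))" 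
      and sw: "(\<Sum>k. w (n + k) * t powr (- \<sigma>)) = 2 * w n * t powr (- \<sigma>)" for n
    proof -
      have eq: "w (n + k) * t powr (- \<sigma>) = (w n * t powr (- \<sigma>)) * (1 / 2) ^ k" for k
        by (simp add: w_def power_add)
      have "(\<lambda>k. (w n * t powr (- \<sigma>)) * (1 / 2) ^ k) sums ((w n * t powr (- \<sigma>)) * (1 / (1 - 1 / 2)))"
        by (intro sums_mult geometric_sums) auto
      then have sums: "(\<lambda>k. w (n + k) * t powr (- \<sigma>)) sums (2 * w n * t powr (- \<sigma>))"
        unfolding eq by (simp add: mult_ac)
      then show "(\<Sum>k. w (n + k) * t powr (- \<sigma>)) = 2 * w n * t powr (- \<sigma>)" by (rule sums_unique[symmetric])
      show "bnd r s (\<lambda>x. \<Sum>k. nrm (\<lambda>x. U (Suc (n + k)) t x - U (n + k) t x) x) (\<Sum>k. w (n + k) * t powr (- \<sigma>))"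
        using sums w0 t r r_le_1 by (intro bnd_suminf Ud) (auto simp: sums_iff)
    qed
    have "AE x in lborel. (\<Sum>k. nrm (\<lambda>x. U (Suc (0 + k)) t x - U (0 + k) t x) x) < top"
      by (rule bnd_imp_AE_finite[OF sum[of 0]]) measurable
    then have "AE x in lborel. nrm (\<lambda>x. u t x - U n t x) x \<le> (\<Sum>k. nrm (\<lambda>x. U (Suc (n + k)) t x - U (n + k) t x) x)"
      unfolding u_def by eventually_elim (rule lim_if_suminf_finite, simp)
    then show ?thesis
      by (rule bnd_mono[OF sum[of n, unfolded sw]]) (use w0[of n] r in auto)
  qed
  have wt: "(\<lambda>n. c * w n * t powr (- \<sigma>)) \<longlonglongrightarrow> 0" for c t
    using tendsto_mult[OF tendsto_mult[OF tendsto_const[of c] wlim] tendsto_const[of "t powr (- \<sigma>)"]] by simp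
  have ub: "bnd r s (nrm (u t)) (2 * L * t powr (- \<sigma>))" if t: "0 < t" "t \<le> T" for t
  proof (rule bnd_tendsto[OF _ wt])
    fix n
    have "bnd r s (\<lambda>x. nrm (U n t) x + nrm (\<lambda>x. u t x - U n t x) x) (2 * L * t powr (- \<sigma>) + 2 * w n * t powr (- \<sigma>))"
      using Ub[OF t] ud[OF t] L w0[of n] r r_le_1 by (intro bnd_add) auto
    then show "bnd r s (nrm (u t)) (2 * L * t powr (- \<sigma>) + 2 * w n * t powr (- \<sigma>))"
    proof (rule bnd_mono)
      have "norm (u t x) \<le> norm (U n t x) + norm (u t x - U n t x)" for x by (rule norm_triangle_sub)
      then show "AE x in lborel. nrm (u t) x \<le> nrm (U n t) x + nrm (\<lambda>x. u t x - U n t x) x"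
        by (intro AE_I2) (simp flip: ennreal_plus add: ennreal_leI)
    qed (use L w0[of n] r in auto)
  qed (use L w0 r in \<open>auto simp: less_imp_le\<close>)
  have uk: "kato_on u t (2 * L)" if "t \<le> T" for t using ub that by (auto simp: kato_on_def)
  have fix_AE: "AE x in lborel. u t x = Phi \<gamma> \<alpha> u0 u t x" if t: "0 < t" "t \<le> T" for t
  proof -
    note [measurable] = borel_measurable_Phi[OF u0 um, of t] borel_measurable_Phi[OF u0 Um, of _ t]
    have "AE x in lborel. nrm (\<lambda>x. u t x - Phi \<gamma> \<alpha> u0 u t x) x = 0"
    proof (rule bnd_tendsto_0[OF _ wt])
      fix n
      have "bnd r s (nrm (\<lambda>x. Phi \<gamma> \<alpha> u0 u t x - Phi \<gamma> \<alpha> u0 (U n) t x)) ((2 * w n) / 2 * t powr (- \<sigma>))"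
        using t w0[of n] ud by (intro contr um Um uk Uk) (auto simp: kato_on_def)
      then have "bnd r s (\<lambda>x. nrm (\<lambda>x. u t x - U (Suc n) t x) x + nrm (\<lambda>x. Phi \<gamma> \<alpha> u0 u t x - Phi \<gamma> \<alpha> u0 (U n) t x) x)
          (2 * w (Suc n) * t powr (- \<sigma>) + (2 * w n) / 2 * t powr (- \<sigma>))"
        using ud[OF t, of "Suc n"] w0[of n] w0[of "Suc n"] r r_le_1 by (intro bnd_add) auto
      then show "bnd r s (nrm (\<lambda>x. u t x - Phi \<gamma> \<alpha> u0 u t x)) (2 * w n * t powr (- \<sigma>))"
      proof (rule bnd_mono)
        have "norm (u t x - Phi \<gamma> \<alpha> u0 u t x) \<le> norm (u t x - U (Suc n) t x) + norm (Phi \<gamma> \<alpha> u0 u t x - Phi \<gamma> \<alpha> u0 (U n) t x)" for x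
          unfolding US using norm_triangle_ineq4[of "u t x - Phi \<gamma> \<alpha> u0 (U n) t x" "Phi \<gamma> \<alpha> u0 u t x - Phi \<gamma> \<alpha> u0 (U n) t x"] by simp
        then show "AE x in lborel. nrm (\<lambda>x. u t x - Phi \<gamma> \<alpha> u0 u t x) x
            \<le> nrm (\<lambda>x. u t x - U (Suc n) t x) x + nrm (\<lambda>x. Phi \<gamma> \<alpha> u0 u t x - Phi \<gamma> \<alpha> u0 (U n) t x) x"
          by (intro AE_I2) (simp flip: ennreal_plus add: ennreal_leI)
        have w: "w (Suc n) = w n / 2" by (simp add: w_def)
        show "2 * w (Suc n) * t powr (- \<sigma>) + (2 * w n) / 2 * t powr (- \<sigma>) \<le> 2 * w n * t powr (- \<sigma>)"
          unfolding w by simp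
      qed (use w0[of n] w0[of "Suc n"] r in auto)
    qed (use w0 r in \<open>auto simp: less_imp_le\<close>)
    then show ?thesis by (auto simp: ennreal_eq_0_iff elim!: eventually_mono)
  qed
  \<comment> \<open>u solves the equation only almost everywhere at each time. Phi of u has the same
    slices up to null sets, and since Phi does not see null sets in its argument, it satisfies the
    equation at every point.\<close>
  define v where "v = Phi \<gamma> \<alpha> u0 u"
  have vu: "AE x in lborel. v t x = u t x" if "0 < t" "t \<le> T" for t
    using fix_AE[OF that] by (auto simp: v_def)
  have "v t x = Phi \<gamma> \<alpha> u0 v t x" if "t \<le> T" for t x
    unfolding v_def[THEN fun_cong, THEN fun_cong, of t x]
    by (rule Phi_cong[symmetric, OF um]) (use vu that in \<open>auto intro!: AE_I2\<close>)
  moreover have "jmeas v" unfolding v_def by (intro jmeas_Phi u0 um)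
  moreover have "bnd r s (nrm (v t)) (2 * L * t powr (- \<sigma>))" if "0 < t" "t \<le> T" for t
  proof -
    have "AE x in lborel. nrm (v t) x = nrm (u t) x" using vu[OF that] by eventually_elim simp
    from bnd_cong_AE[OF this] ub[OF that] show ?thesis by simp
  qed
  ultimately show ?thesis by blast
qed

text \<open>No smallness of T: measured against exp (l t) t^(-\<sigma>), the difference has a bound
  W that each application of the equation halves, starting from the trivial value 2 M.\<close>

lemma uniqueness:
  fixes u v :: "real \<Rightarrow> 'a \<Rightarrow> 'k::euclidean_space"
  assumes u: "jmeas u" "kato_on u T M" and v: "jmeas v" "kato_on v T M"
    and eq: "\<And>t. 0 < t \<Longrightarrow> t < T \<Longrightarrow> AE x in lborel. u t x = Phi \<gamma> \<alpha> u0 u t x"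
      "\<And>t. 0 < t \<Longrightarrow> t < T \<Longrightarrow> AE x in lborel. v t x = Phi \<gamma> \<alpha> u0 v t x"
    and M: "0 < M" and t: "0 < t" "t < T"
  shows "AE x in lborel. u t x = v t x"
proof -
  note [measurable] = u(1) v(1) jmeas_nonlinearity[OF u(1), of \<gamma> \<alpha>] jmeas_nonlinearity[OF v(1), of \<gamma> \<alpha>]
  have us[measurable]: "u \<tau> \<in> borel_measurable lborel" "v \<tau> \<in> borel_measurable lborel" for \<tau>
    using u(1) v(1) by (auto intro: borel_measurable_slice)
  define K where "K = C0 * (2 * \<alpha> * M powr (\<alpha> - 1)) * T powr (\<delta> - e)"
  have K: "0 < K" using C0 \<alpha> M t by (simp add: K_def)
  \<comment> \<open>Chosen so that K l^(-e) = 1/2, where K collects all factors of one application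
    of the equation up to time T.\<close>
  define l where "l = (2 * K) powr (1 / e)"
  have l: "0 < l" using K by (simp add: l_def)
  have lK: "K * l powr (- e) = 1 / 2"
    using K e(1) by (simp add: l_def powr_powr powr_minus)
  have step: "bnd r s (nrm (\<lambda>x. u t x - v t x)) (W / 2 * exp (l * t) * t powr (- \<sigma>))"
    if W: "0 < W" and w: "\<And>t. 0 < t \<Longrightarrow> t < T \<Longrightarrow> bnd r s (nrm (\<lambda>x. u t x - v t x)) (W * exp (l * t) * t powr (- \<sigma>))"
      and t: "0 < t" "t < T" for W t
  proof -
    define A where "A = 2 * \<alpha> * M powr (\<alpha> - 1) * W"
    have A: "0 < A" using W \<alpha> M by (simp add: A_def)
    have "bnd (\<alpha> * r) (\<alpha> * s - \<gamma>) (nrm (\<lambda>y. N (u \<tau>) y - N (v \<tau>) y)) (A * exp (l * \<tau>) * \<tau> powr (- (\<alpha> * \<sigma>)))"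
      if \<tau>: "0 < \<tau>" "\<tau> < t" for \<tau>
    proof -
      have \<tau>T: "\<tau> < T" using \<tau> t by simp
      have "bnd (\<alpha> * r) (\<alpha> * s - \<gamma>) (nrm (\<lambda>y. N (u \<tau>) y - N (v \<tau>) y))
        (\<alpha> * ((M * \<tau> powr (- \<sigma>)) powr (\<alpha> - 1) + (M * \<tau> powr (- \<sigma>)) powr (\<alpha> - 1)) * (W * exp (l * \<tau>) * \<tau> powr (- \<sigma>)))"
        using us kato_onD[OF u(2) \<tau>(1) \<tau>T] kato_onD[OF v(2) \<tau>(1) \<tau>T] w[OF \<tau>(1) \<tau>T] M W by (intro bnd_nonlinearity_diff) auto
      moreover have "\<alpha> * ((M * \<tau> powr (- \<sigma>)) powr (\<alpha> - 1) + (M * \<tau> powr (- \<sigma>)) powr (\<alpha> - 1)) * (W * exp (l * \<tau>) * \<tau> powr (- \<sigma>))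
         = A * exp (l * \<tau>) * \<tau> powr (- (\<alpha> * \<sigma>))"
      proof -
        have "- \<sigma> * (\<alpha> - 1) + - \<sigma> = - (\<alpha> * \<sigma>)" by (simp add: field_simps)
        then have "\<tau> powr (- (\<alpha> * \<sigma>)) = (\<tau> powr (- \<sigma>)) powr (\<alpha> - 1) * \<tau> powr (- \<sigma>)"
          by (simp only: powr_powr powr_add[symmetric])
        then show ?thesis by (simp only: powr_mult A_def) (simp add: algebra_simps)
      qed
      ultimately show ?thesis by (simp only:)
    qed
    then have "bnd r s (duh (\<lambda>\<tau>. nrm (\<lambda>y. N (u \<tau>) y - N (v \<tau>) y)) t) (C0 * A * l powr (- e) * exp (l * t) * t powr (1 - a - e - \<alpha> * \<sigma>))"
      using l t A by (intro duh_source_exp) auto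
    then show ?thesis
    proof (rule bnd_mono)
      have "AE x in lborel. nrm (\<lambda>x. Phi \<gamma> \<alpha> u0 u t x - Phi \<gamma> \<alpha> u0 v t x) x \<le> duh (\<lambda>\<tau>. nrm (\<lambda>y. N (u \<tau>) y - N (v \<tau>) y)) t x"
        using Phi_diff_AE[OF u(1) kato_on_mono[OF u(2)] v(1) kato_on_mono[OF v(2)] t(1), of M M u0 u0] M t by simp
      with eq(1)[OF t] eq(2)[OF t] show "AE x in lborel. nrm (\<lambda>x. u t x - v t x) x \<le> duh (\<lambda>\<tau>. nrm (\<lambda>y. N (u \<tau>) y - N (v \<tau>) y)) t x"
        by eventually_elim simp
      have ex: "1 - a - e - \<alpha> * \<sigma> = (\<delta> - e) + - \<sigma>" using aa' by simp
      have "t powr (1 - a - e - \<alpha> * \<sigma>) \<le> T powr (\<delta> - e) * t powr (- \<sigma>)"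
        unfolding ex powr_add using t \<delta>_ge by (intro mult_right_mono powr_mono2) auto
      then have "C0 * A * l powr (- e) * exp (l * t) * t powr (1 - a - e - \<alpha> * \<sigma>)
        \<le> C0 * A * l powr (- e) * exp (l * t) * (T powr (\<delta> - e) * t powr (- \<sigma>))"
        using C0 A by (intro mult_left_mono) auto
      also have "\<dots> = (K * l powr (- e)) * (W * exp (l * t) * t powr (- \<sigma>))" by (simp add: A_def K_def mult_ac)
      also have "\<dots> = W / 2 * exp (l * t) * t powr (- \<sigma>)" by (simp add: lK)
      finally show "C0 * A * l powr (- e) * exp (l * t) * t powr (1 - a - e - \<alpha> * \<sigma>) \<le> W / 2 * exp (l * t) * t powr (- \<sigma>)" .
    qed (use C0 A r in auto)
  qed
  define w where "w n = 2 * M * (1 / 2) ^ n" for n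
  have iter: "bnd r s (nrm (\<lambda>x. u t x - v t x)) (w n * exp (l * t) * t powr (- \<sigma>))" if "0 < t" "t < T" for n t
    using that
  proof (induction n arbitrary: t)
    case 0
    have "bnd r s (\<lambda>x. nrm (u t) x + nrm (v t) x) (M * t powr (- \<sigma>) + M * t powr (- \<sigma>))"
      using kato_onD[OF u(2) 0] kato_onD[OF v(2) 0] M r r_le_1 by (intro bnd_add) auto
    then show ?case
    proof (rule bnd_mono)
      show "AE x in lborel. nrm (\<lambda>x. u t x - v t x) x \<le> nrm (u t) x + nrm (v t) x"
        by (intro AE_I2) (simp flip: ennreal_plus add: ennreal_leI norm_triangle_ineq4)
      have "2 * M * 1 * t powr (- \<sigma>) \<le> 2 * M * exp (l * t) * t powr (- \<sigma>)"
        using M l 0 by (intro mult_right_mono mult_left_mono) auto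
      then show "M * t powr (- \<sigma>) + M * t powr (- \<sigma>) \<le> w 0 * exp (l * t) * t powr (- \<sigma>)" by (simp add: w_def)
    qed (use M r in auto)
  next
    case (Suc n)
    have "bnd r s (nrm (\<lambda>x. u t x - v t x)) (w n / 2 * exp (l * t) * t powr (- \<sigma>))"
      using Suc M by (intro step) (auto simp: w_def)
    then show ?case by (simp add: w_def)
  qed
  have "(\<lambda>n. 2 * M * (1 / 2) ^ n * exp (l * t) * t powr (- \<sigma>)) \<longlonglongrightarrow> 2 * M * 0 * exp (l * t) * t powr (- \<sigma>)"
    by (intro tendsto_mult tendsto_const LIMSEQ_realpow_zero) auto
  then have "(\<lambda>n. w n * exp (l * t) * t powr (- \<sigma>)) \<longlonglongrightarrow> 0" by (simp add: w_def)
  from bnd_tendsto_0[OF iter[OF t] this] have "AE x in lborel. nrm (\<lambda>x. u t x - v t x) x = 0"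
    using M r by (simp add: w_def)
  then show ?thesis by (auto simp: ennreal_eq_0_iff elim!: eventually_mono)
qed

end

section \<open>Time translation and regularity in time\<close>

lemma jmeas_nrm:
  fixes N :: "real \<Rightarrow> 'a::euclidean_space \<Rightarrow> 'k::real_normed_vector"
  assumes [measurable]: "jmeas N"
  shows "jmeas (\<lambda>\<tau>. nrm (N \<tau>))"
  by measurable

lemma integrable_heat_heat:
  fixes f :: "'a::euclidean_space \<Rightarrow> 'k::euclidean_space"
  assumes [measurable]: "f \<in> borel_measurable lborel" and t: "0 < t1" "0 < t2" and fin: "hop (t1 + t2) (nrm f) x < top"
  shows "hop t1 (nrm (heat t2 f)) x < top"
proof -
  have "hop t1 (nrm (heat t2 f)) x \<le> hop t1 (hop t2 (nrm f)) x"
    using t by (intro hop_mono norm_heat_le) auto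
  also have "\<dots> = hop (t1 + t2) (nrm f) x" using t by (intro hop_hop) auto
  finally show ?thesis using fin by simp
qed

text \<open>Finiteness of \<open>hop\<close> at time t1 + t2 in the point x is exactly the
  integrability that Fubini needs; the integral over the middle variable is then the convolution of
  two kernels.\<close>

lemma heat_heat:
  fixes f :: "'a::euclidean_space \<Rightarrow> 'k::euclidean_space"
  assumes f[measurable]: "f \<in> borel_measurable lborel" and t: "0 < t1" "0 < t2" and fin: "hop (t1 + t2) (nrm f) x < top"
  shows "heat t1 (heat t2 f) x = heat (t1 + t2) f x"
proof -
  have [measurable]: "heat t2 f \<in> borel_measurable lborel" by (intro borel_measurable_heat) measurable
  have "heat t1 (heat t2 f) x = (LINT y|lborel. heat_kernel t1 (x - y) *\<^sub>R (LINT z|lborel. heat_kernel t2 (y - z) *\<^sub>R f z))"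
    using t by (simp add: heat_eq_lborel)
  also have "\<dots> = (LINT y|lborel. (LINT z|lborel. heat_kernel t1 (x - y) *\<^sub>R heat_kernel t2 (y - z) *\<^sub>R f z))"
    by (intro Bochner_Integration.integral_cong refl integral_scaleR_right[symmetric])
  also have "\<dots> = (LINT z|lborel. (LINT y|lborel. heat_kernel t1 (x - y) *\<^sub>R heat_kernel t2 (y - z) *\<^sub>R f z))"
  proof (rule lborel_pair.Fubini_integral[symmetric])
    have "(\<integral>\<^sup>+p. ennreal (norm (case p of (y, z) \<Rightarrow> heat_kernel t1 (x - y) *\<^sub>R heat_kernel t2 (y - z) *\<^sub>R f z)) \<partial>(lborel \<Otimes>\<^sub>M lborel))
      = (\<integral>\<^sup>+y. (\<integral>\<^sup>+z. ennreal (heat_kernel t1 (x - y)) * (ennreal (heat_kernel t2 (y - z)) * nrm f z) \<partial>lborel) \<partial>lborel)"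
      by (subst lborel.nn_integral_fst[symmetric]) (auto simp: ennreal_mult mult.assoc)
    also have "\<dots> = hop t1 (hop t2 (nrm f)) x"
      unfolding hop_def by (intro nn_integral_cong nn_integral_cmult) measurable
    also have "\<dots> = hop (t1 + t2) (nrm f) x" using t by (intro hop_hop) auto
    finally show "integrable (lborel \<Otimes>\<^sub>M lborel) (\<lambda>(y, z). heat_kernel t1 (x - y) *\<^sub>R heat_kernel t2 (y - z) *\<^sub>R f z)"
      using fin by (intro integrableI_bounded) auto
  qed
  also have "\<dots> = (LINT z|lborel. heat_kernel (t1 + t2) (x - z) *\<^sub>R f z)"
  proof (intro Bochner_Integration.integral_cong refl)
    fix z
    have i: "(\<integral>\<^sup>+y. ennreal (heat_kernel t1 (x - y) * heat_kernel t2 (y - z)) \<partial>lborel) = ennreal (heat_kernel (t1 + t2) (x - z))"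
      using nn_integral_heat_kernel_mult[OF t, of x z] by (simp add: ennreal_mult)
    have "has_bochner_integral lborel (\<lambda>y. heat_kernel t1 (x - y) * heat_kernel t2 (y - z)) (heat_kernel (t1 + t2) (x - z))"
      using i by (intro has_bochner_integral_nn_integral) auto
    then have "has_bochner_integral lborel (\<lambda>y. (heat_kernel t1 (x - y) * heat_kernel t2 (y - z)) *\<^sub>R f z) (heat_kernel (t1 + t2) (x - z) *\<^sub>R f z)"
      by (intro has_bochner_integral_scaleR_left) auto
    then show "(LINT y|lborel. heat_kernel t1 (x - y) *\<^sub>R heat_kernel t2 (y - z) *\<^sub>R f z) = heat_kernel (t1 + t2) (x - z) *\<^sub>R f z"
      by (simp add: has_bochner_integral_integral_eq)
  qed
  also have "\<dots> = heat (t1 + t2) f x" using t by (simp add: heat_eq_lborel)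
  finally show ?thesis .
qed

lemma heat_add:
  fixes f g :: "'a::euclidean_space \<Rightarrow> 'k::euclidean_space"
  assumes [measurable]: "f \<in> borel_measurable lborel" "g \<in> borel_measurable lborel" and t: "0 < t"
    and "hop t (nrm f) x < top" "hop t (nrm g) x < top"
  shows "heat t (\<lambda>y. f y + g y) x = heat t f x + heat t g x"
  using t integrable_heat[OF assms(1,4)] integrable_heat[OF assms(2,5)]
  by (simp add: heat_eq_lborel scaleR_add_right)

text \<open>\<open>heat_kernel_time_diff\<close> integrated against |f|; finiteness at x at both
  times is what allows the two convolutions to be subtracted.\<close>

lemma heat_time_diff_le:
  "\<exists>C>0. \<forall>t h (f :: 'a::euclidean_space \<Rightarrow> 'k::euclidean_space) x. 0 < t \<longrightarrow> 0 \<le> h \<longrightarrow> f \<in> borel_measurable lborel \<longrightarrow>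
      hop (t + h) (nrm f) x < top \<longrightarrow> hop t (nrm f) x < top \<longrightarrow>
      nrm (\<lambda>x. heat (t + h) f x - heat t f x) x
        \<le> ennreal (C * min 1 (h / t)) * (hop (2 * (t + h)) (nrm f) x + hop (2 * t) (nrm f) x)"
proof -
  obtain C where C: "0 < C" "\<And>r h x. 0 < r \<Longrightarrow> 0 \<le> h \<Longrightarrow> \<bar>heat_kernel (r + h) (x::'a) - heat_kernel r x\<bar>
    \<le> C * min 1 (h / r) * (heat_kernel (2 * (r + h)) x + heat_kernel (2 * r) x)"
    using heat_kernel_time_diff[where ?'a='a] by blast
  have "nrm (\<lambda>x. heat (t + h) f x - heat t f x) x
        \<le> ennreal (C * min 1 (h / t)) * (hop (2 * (t + h)) (nrm f) x + hop (2 * t) (nrm f) x)"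
    if t: "0 < t" "0 \<le> h" and f[measurable]: "f \<in> borel_measurable lborel" and fin: "hop (t + h) (nrm f) x < top" "hop t (nrm f) x < top"
    for t h x and f :: "'a \<Rightarrow> 'k"
  proof -
    define c where "c = C * min 1 (h / t)"
    have c: "0 \<le> c" using C(1) t by (simp add: c_def)
    note i = integrable_heat[OF f fin(1)] integrable_heat[OF f fin(2)]
    have "heat (t + h) f x - heat t f x = (LINT y|lborel. heat_kernel (t + h) (x - y) *\<^sub>R f y - heat_kernel t (x - y) *\<^sub>R f y)"
      using t i by (simp add: heat_eq_lborel)
    then have "nrm (\<lambda>x. heat (t + h) f x - heat t f x) x
      \<le> (\<integral>\<^sup>+y. ennreal (norm (heat_kernel (t + h) (x - y) *\<^sub>R f y - heat_kernel t (x - y) *\<^sub>R f y)) \<partial>lborel)"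
      using i by (simp only:) (intro integral_norm_bound_ennreal Bochner_Integration.integrable_diff)
    also have "\<dots> \<le> (\<integral>\<^sup>+y. ennreal c * (ennreal (heat_kernel (2 * (t + h)) (x - y)) * nrm f y + ennreal (heat_kernel (2 * t) (x - y)) * nrm f y) \<partial>lborel)"
    proof (intro nn_integral_mono)
      fix y
      have "norm (heat_kernel (t + h) (x - y) *\<^sub>R f y - heat_kernel t (x - y) *\<^sub>R f y) = \<bar>heat_kernel (t + h) (x - y) - heat_kernel t (x - y)\<bar> * norm (f y)"
        by (simp flip: scaleR_diff_left)
      also have "\<dots> \<le> c * (heat_kernel (2 * (t + h)) (x - y) + heat_kernel (2 * t) (x - y)) * norm (f y)"
        unfolding c_def using C(2)[OF t] by (intro mult_right_mono) auto
      also have "\<dots> = c * (heat_kernel (2 * (t + h)) (x - y) * norm (f y) + heat_kernel (2 * t) (x - y) * norm (f y))"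
        by (simp add: algebra_simps)
      finally show "ennreal (norm (heat_kernel (t + h) (x - y) *\<^sub>R f y - heat_kernel t (x - y) *\<^sub>R f y))
        \<le> ennreal c * (ennreal (heat_kernel (2 * (t + h)) (x - y)) * nrm f y + ennreal (heat_kernel (2 * t) (x - y)) * nrm f y)"
        using c by (simp flip: ennreal_mult ennreal_plus add: ennreal_leI)
    qed
    also have "\<dots> = ennreal c * (hop (2 * (t + h)) (nrm f) x + hop (2 * t) (nrm f) x)"
      unfolding hop_def by (simp add: nn_integral_cmult nn_integral_add)
    finally show ?thesis by (simp add: c_def)
  qed
  with C(1) show ?thesis by blast
qed

lemma duhamel_eq_lborel:
  fixes N :: "real \<Rightarrow> 'a::euclidean_space \<Rightarrow> 'k::euclidean_space"
  assumes N[measurable]: "jmeas N"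
  shows "duhamel N t x = (LINT \<tau>|lborel. indicator {0..t} \<tau> *\<^sub>R heat (t - \<tau>) (N \<tau>) x)"
proof -
  have "(\<lambda>\<tau>. heat (t - \<tau>) (N \<tau>) x) \<in> borel_measurable lborel"
    by (intro borel_measurable_heat) measurable
  then show ?thesis by (simp add: duhamel_def set_integrable_lebesgue_iff(2))
qed

lemma AE_ne: "AE \<tau> in lborel. \<tau> \<noteq> (c::real)"
  by (intro AE_I[of _ _ "{c}"]) auto

lemma hop_duh:
  fixes N :: "real \<Rightarrow> 'a::euclidean_space \<Rightarrow> ennreal"
  assumes N[measurable]: "jmeas N" and t: "0 < t" "0 < t0"
  shows "hop t (duh N t0) x = (\<integral>\<^sup>+\<tau>. indicator {0<..<t0} \<tau> * hop (t + (t0 - \<tau>)) (N \<tau>) x \<partial>lborel)"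
proof -
  have Ns: "N \<tau> \<in> borel_measurable lborel" for \<tau> using N by (rule borel_measurable_slice)
  have "hop t (duh N t0) x = (\<integral>\<^sup>+y. (\<integral>\<^sup>+\<tau>. ennreal (heat_kernel t (x - y)) * (indicator {0<..<t0} \<tau> * hop (t0 - \<tau>) (N \<tau>) y) \<partial>lborel) \<partial>lborel)"
    unfolding hop_def[of t] duh_def by (intro nn_integral_cong nn_integral_cmult[symmetric]) measurable
  also have "\<dots> = (\<integral>\<^sup>+\<tau>. (\<integral>\<^sup>+y. ennreal (heat_kernel t (x - y)) * (indicator {0<..<t0} \<tau> * hop (t0 - \<tau>) (N \<tau>) y) \<partial>lborel) \<partial>lborel)"
    by (intro lborel_pair.Fubini') measurable
  also have "\<dots> = (\<integral>\<^sup>+\<tau>. indicator {0<..<t0} \<tau> * hop (t + (t0 - \<tau>)) (N \<tau>) x \<partial>lborel)"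
  proof (intro nn_integral_cong)
    fix \<tau>
    note [measurable] = Ns[of \<tau>]
    have "(\<integral>\<^sup>+y. ennreal (heat_kernel t (x - y)) * (indicator {0<..<t0} \<tau> * hop (t0 - \<tau>) (N \<tau>) y) \<partial>lborel)
      = indicator {0<..<t0} \<tau> * hop t (hop (t0 - \<tau>) (N \<tau>)) x"
      unfolding hop_def[of t] by (subst nn_integral_cmult[symmetric]) (auto simp: mult_ac)
    also have "\<dots> = indicator {0<..<t0} \<tau> * hop (t + (t0 - \<tau>)) (N \<tau>) x"
      using t Ns by (cases "\<tau> \<in> {0<..<t0}") (auto simp: hop_hop)
    finally show "(\<integral>\<^sup>+y. ennreal (heat_kernel t (x - y)) * (indicator {0<..<t0} \<tau> * hop (t0 - \<tau>) (N \<tau>) y) \<partial>lborel)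
      = indicator {0<..<t0} \<tau> * hop (t + (t0 - \<tau>)) (N \<tau>) x" .
  qed
  finally show ?thesis .
qed

text \<open>The semigroup passes under the time integral by Fubini in the variables \<tau> and y.
  The hypothesis bounds the double integral of the norms and also makes the semigroup law available
  at almost every \<tau>.\<close>

lemma heat_duhamel:
  fixes N :: "real \<Rightarrow> 'a::euclidean_space \<Rightarrow> 'k::euclidean_space"
  assumes N[measurable]: "jmeas N" and t: "0 < t" "0 < t0" and fin: "hop t (duh (\<lambda>\<tau>. nrm (N \<tau>)) t0) x < top"
  shows "heat t (duhamel N t0) x = (LINT \<tau>|lborel. indicator {0..t0} \<tau> *\<^sub>R heat (t + (t0 - \<tau>)) (N \<tau>) x)"
proof -
  have Ns[measurable]: "N \<tau> \<in> borel_measurable lborel" for \<tau> using N by (rule borel_measurable_slice)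
  have [measurable]: "duhamel N t0 \<in> borel_measurable lborel"
    using jmeas_duhamel[OF N] by (rule borel_measurable_slice)
  have hs[measurable]: "(\<lambda>(\<tau>, y). heat (t0 - \<tau>) (N \<tau>) y) \<in> borel_measurable (lborel \<Otimes>\<^sub>M lborel)"
    unfolding split_beta' by (intro borel_measurable_heat) measurable
  have hm[measurable]: "(\<lambda>\<tau>. heat (t + (t0 - \<tau>)) (N \<tau>) x) \<in> borel_measurable lborel"
    by (intro borel_measurable_heat) measurable
  define I where "I \<tau> = indicat_real {0..t0} \<tau>" for \<tau>
  have [measurable]: "I \<in> borel_measurable borel" unfolding I_def by measurable
  have "heat t (duhamel N t0) x = (LINT y|lborel. heat_kernel t (x - y) *\<^sub>R (LINT \<tau>|lborel. I \<tau> *\<^sub>R heat (t0 - \<tau>) (N \<tau>) y))"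
    using t by (simp add: heat_eq_lborel duhamel_eq_lborel I_def)
  also have "\<dots> = (LINT y|lborel. (LINT \<tau>|lborel. heat_kernel t (x - y) *\<^sub>R I \<tau> *\<^sub>R heat (t0 - \<tau>) (N \<tau>) y))"
    by (intro Bochner_Integration.integral_cong refl integral_scaleR_right[symmetric])
  also have "\<dots> = (LINT \<tau>|lborel. (LINT y|lborel. heat_kernel t (x - y) *\<^sub>R I \<tau> *\<^sub>R heat (t0 - \<tau>) (N \<tau>) y))"
  proof (rule lborel_pair.Fubini_integral)
    have "(\<integral>\<^sup>+p. ennreal (norm (case p of (\<tau>, y) \<Rightarrow> heat_kernel t (x - y) *\<^sub>R I \<tau> *\<^sub>R heat (t0 - \<tau>) (N \<tau>) y)) \<partial>(lborel \<Otimes>\<^sub>M lborel))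
      = (\<integral>\<^sup>+\<tau>. (\<integral>\<^sup>+y. ennreal (heat_kernel t (x - y)) * (indicator {0..t0} \<tau> * nrm (heat (t0 - \<tau>) (N \<tau>)) y) \<partial>lborel) \<partial>lborel)"
      by (subst lborel.nn_integral_fst[symmetric])
        (auto simp: ennreal_mult mult.assoc I_def indicator_def intro!: nn_integral_cong)
    also have "\<dots> \<le> (\<integral>\<^sup>+\<tau>. (\<integral>\<^sup>+y. ennreal (heat_kernel t (x - y)) * (indicator {0<..<t0} \<tau> * hop (t0 - \<tau>) (nrm (N \<tau>)) y) \<partial>lborel) \<partial>lborel)"
      using AE_ne[of 0] AE_ne[of t0]
      by (intro nn_integral_mono_AE, eventually_elim)
        (auto intro!: nn_integral_mono mult_left_mono simp: indicator_def norm_heat_le)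
    also have "\<dots> = (\<integral>\<^sup>+y. (\<integral>\<^sup>+\<tau>. ennreal (heat_kernel t (x - y)) * (indicator {0<..<t0} \<tau> * hop (t0 - \<tau>) (nrm (N \<tau>)) y) \<partial>lborel) \<partial>lborel)"
      by (intro lborel_pair.Fubini') measurable
    also have "\<dots> = hop t (duh (\<lambda>\<tau>. nrm (N \<tau>)) t0) x"
      unfolding hop_def[of t] duh_def by (intro nn_integral_cong nn_integral_cmult) measurable
    finally show "integrable (lborel \<Otimes>\<^sub>M lborel) (\<lambda>(\<tau>, y). heat_kernel t (x - y) *\<^sub>R I \<tau> *\<^sub>R heat (t0 - \<tau>) (N \<tau>) y)"
      using fin by (intro integrableI_bounded) (auto intro: le_less_trans)
  qed
  also have "\<dots> = (LINT \<tau>|lborel. I \<tau> *\<^sub>R heat (t + (t0 - \<tau>)) (N \<tau>) x)"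
  proof (rule integral_cong_AE)
    have "AE \<tau> in lborel. indicator {0<..<t0} \<tau> * hop (t + (t0 - \<tau>)) (nrm (N \<tau>)) x \<noteq> \<infinity>"
      using fin t unfolding hop_duh[OF jmeas_nrm[OF N] t]
      by (intro nn_integral_PInf_AE) auto
    then show "AE \<tau> in lborel. (LINT y|lborel. heat_kernel t (x - y) *\<^sub>R I \<tau> *\<^sub>R heat (t0 - \<tau>) (N \<tau>) y) = I \<tau> *\<^sub>R heat (t + (t0 - \<tau>)) (N \<tau>) x"
      using AE_ne[of 0] AE_ne[of t0]
    proof eventually_elim
      case (elim \<tau>)
      have [measurable]: "heat (t0 - \<tau>) (N \<tau>) \<in> borel_measurable lborel" by (intro borel_measurable_heat) measurable
      show ?case
      proof (cases "\<tau> \<in> {0<..<t0}")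
        case True
        with elim have "hop (t + (t0 - \<tau>)) (nrm (N \<tau>)) x < top" by (simp add: less_top)
        from heat_heat[OF Ns t(1) _ this] True t show ?thesis by (simp add: I_def heat_eq_lborel)
      qed (use elim in \<open>auto simp: I_def indicator_def\<close>)
    qed
  qed measurable
  finally show ?thesis by (simp add: I_def)
qed

text \<open>The time integral is cut at t0. The semigroup law turns the earlier part into the
  evolution of the Duhamel term at t0, and translation turns the later part into a Duhamel term with
  shifted source.\<close>

lemma duhamel_split:
  fixes N :: "real \<Rightarrow> 'a::euclidean_space \<Rightarrow> 'k::euclidean_space"
  assumes N[measurable]: "jmeas N" and t: "0 < t" "0 < t0" and fin: "duh (\<lambda>\<tau>. nrm (N \<tau>)) (t0 + t) x < top"
  shows "duhamel N (t0 + t) x = heat t (duhamel N t0) x + duhamel (\<lambda>\<tau>. N (t0 + \<tau>)) t x"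
    "hop t (duh (\<lambda>\<tau>. nrm (N \<tau>)) t0) x < top"
proof -
  have [measurable]: "jmeas (\<lambda>\<tau>. N (t0 + \<tau>))" by measurable
  have [measurable]: "(\<lambda>\<tau>. heat (t + (t0 - \<tau>)) (N \<tau>) x) \<in> borel_measurable lborel" "(\<lambda>\<tau>. heat (t - \<tau>) (N (t0 + \<tau>)) x) \<in> borel_measurable lborel"
    by (intro borel_measurable_heat; measurable)+
  have "hop t (duh (\<lambda>\<tau>. nrm (N \<tau>)) t0) x \<le> duh (\<lambda>\<tau>. nrm (N \<tau>)) (t0 + t) x"
    unfolding hop_duh[OF jmeas_nrm[OF N] t] duh_def[of _ "t0 + t"] using t
    by (intro nn_integral_mono) (auto simp: indicator_def add_diff_eq add.commute)
  with fin show f: "hop t (duh (\<lambda>\<tau>. nrm (N \<tau>)) t0) x < top" by (rule le_less_trans[rotated])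
  note c = duhamel_converges(3)[OF N fin]
  define f where "f \<tau> = indicator {0..t0 + t} \<tau> *\<^sub>R heat (t0 + t - \<tau>) (N \<tau>) x" for \<tau>
  have f: "integrable lborel f" unfolding f_def by (rule c)
  have f1: "integrable lborel (\<lambda>\<tau>. indicat_real {..t0} \<tau> *\<^sub>R f \<tau>)" and f2: "integrable lborel (\<lambda>\<tau>. indicat_real {t0<..} \<tau> *\<^sub>R f \<tau>)"
    using f by (auto intro!: integrable_mult_indicator)
  have "duhamel N (t0 + t) x = (LINT \<tau>|lborel. f \<tau>)" by (simp add: duhamel_eq_lborel f_def)
  also have "\<dots> = (LINT \<tau>|lborel. indicat_real {..t0} \<tau> *\<^sub>R f \<tau> + indicat_real {t0<..} \<tau> *\<^sub>R f \<tau>)"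
    by (intro Bochner_Integration.integral_cong) (auto simp: indicator_def)
  also have "\<dots> = (LINT \<tau>|lborel. indicat_real {..t0} \<tau> *\<^sub>R f \<tau>) + (LINT \<tau>|lborel. indicat_real {t0<..} \<tau> *\<^sub>R f \<tau>)"
    using f1 f2 by (rule Bochner_Integration.integral_add)
  also have "(LINT \<tau>|lborel. indicat_real {..t0} \<tau> *\<^sub>R f \<tau>) = heat t (duhamel N t0) x"
    unfolding heat_duhamel[OF N t \<open>hop t (duh (\<lambda>\<tau>. nrm (N \<tau>)) t0) x < top\<close>] using t
    by (intro Bochner_Integration.integral_cong) (auto simp: indicator_def f_def algebra_simps)
  also have "(LINT \<tau>|lborel. indicat_real {t0<..} \<tau> *\<^sub>R f \<tau>) = (LINT \<tau>|lborel. indicat_real {t0<..} (t0 + \<tau>) *\<^sub>R f (t0 + \<tau>))"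
    using lborel_integral_real_affine[of 1 "\<lambda>\<tau>. indicat_real {t0<..} \<tau> *\<^sub>R f \<tau>" t0] by simp
  also have "\<dots> = duhamel (\<lambda>\<tau>. N (t0 + \<tau>)) t x"
    unfolding duhamel_eq_lborel[OF \<open>jmeas (\<lambda>\<tau>. N (t0 + \<tau>))\<close>]
  proof (rule integral_cong_AE)
    show "AE \<tau> in lborel. indicat_real {t0<..} (t0 + \<tau>) *\<^sub>R f (t0 + \<tau>) = indicat_real {0..t} \<tau> *\<^sub>R heat (t - \<tau>) (N (t0 + \<tau>)) x"
      using AE_ne[of 0] by eventually_elim (use t in \<open>auto simp: indicator_def f_def\<close>)
    have [measurable]: "f \<in> borel_measurable lborel" using f by auto
    show "(\<lambda>\<tau>. indicat_real {t0<..} (t0 + \<tau>) *\<^sub>R f (t0 + \<tau>)) \<in> borel_measurable lborel" by measurable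
  qed measurable
  finally show "duhamel N (t0 + t) x = heat t (duhamel N t0) x + duhamel (\<lambda>\<tau>. N (t0 + \<tau>)) t x" .
qed

context kato_setting
begin

text \<open>Holds for any jointly measurable u with a Kato bound, solution or not, so it serves both
  for restarting a solution and for verifying the equation after gluing.\<close>

lemma Phi_shift:
  fixes u :: "real \<Rightarrow> 'a \<Rightarrow> 'k::euclidean_space"
  assumes u0[measurable]: "u0 \<in> borel_measurable lborel" and B: "bnd r s' (nrm u0) B" "0 \<le> B"
    and u: "jmeas u" "kato_on u (t0 + t) M" "0 \<le> M" and t: "0 < t" "0 < t0"
  shows "AE x in lborel. Phi \<gamma> \<alpha> u0 u (t0 + t) x = Phi \<gamma> \<alpha> (Phi \<gamma> \<alpha> u0 u t0) (\<lambda>\<tau>. u (t0 + \<tau>)) t x"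
proof -
  have N[measurable]: "jmeas (\<lambda>\<tau>. N (u \<tau>))" using u(1) by (rule jmeas_nonlinearity)
  have [measurable]: "duhamel (\<lambda>\<tau>. N (u \<tau>)) t0 \<in> borel_measurable lborel"
    using jmeas_duhamel[OF N] by (rule borel_measurable_slice)
  have [measurable]: "heat t0 u0 \<in> borel_measurable lborel" by (intro borel_measurable_heat) measurable
  have t0t: "0 < t0 + t" using t by simp
  have fin0: "AE x in lborel. hop (t + t0) (nrm u0) x < top"
    using t B by (intro bnd_imp_AE_finite[OF hop_data'[OF _ _ _ B(1)]]) auto
  have k0: "kato_on u t0 M" using u t by (intro kato_on_mono[OF u(2)]) auto
  have fin1: "AE x in lborel. duh (\<lambda>\<tau>. nrm (N (u \<tau>))) (t0 + t) x < top"
    by (rule bnd_duh_nonlinearity(3)[OF u(1,2) t0t u(3)])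
  have le: "AE x in lborel. nrm (duhamel (\<lambda>\<tau>. N (u \<tau>)) t0) x \<le> duh (\<lambda>\<tau>. nrm (N (u \<tau>))) t0 x"
    using bnd_duh_nonlinearity(3)[OF u(1) k0 t(2) u(3)] by eventually_elim (rule duhamel_converges(4)[OF N])
  show ?thesis using fin0 fin1
  proof eventually_elim
    case (elim x)
    have h1: "hop t (nrm (heat t0 u0)) x < top" using elim t by (intro integrable_heat_heat) auto
    have "hop t (nrm (duhamel (\<lambda>\<tau>. N (u \<tau>)) t0)) x \<le> hop t (duh (\<lambda>\<tau>. nrm (N (u \<tau>))) t0) x"
      unfolding hop_def using le by (intro nn_integral_mono_AE) (auto elim!: eventually_mono intro: mult_left_mono)
    with duhamel_split(2)[OF N t elim(2)] have h2: "hop t (nrm (duhamel (\<lambda>\<tau>. N (u \<tau>)) t0)) x < top" by simp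
    have "heat t (Phi \<gamma> \<alpha> u0 u t0) x = heat t (heat t0 u0) x + heat t (duhamel (\<lambda>\<tau>. N (u \<tau>)) t0) x"
      unfolding Phi_def[abs_def] using t h1 h2 by (intro heat_add) auto
    also have "heat t (heat t0 u0) x = heat (t0 + t) u0 x"
      using heat_heat[OF u0 t elim(1)] by (simp add: add.commute)
    finally show ?case
      unfolding Phi_def[of \<gamma> \<alpha> u0 u "t0 + t"] Phi_def[of \<gamma> \<alpha> "Phi \<gamma> \<alpha> u0 u t0"]
      using duhamel_split(1)[OF N t elim(2)] by simp
  qed
qed

text \<open>Three contributions: the linear evolution, the new part of the time integral over (t, t
  + h), and the change of the semigroup on (0, t). The last one carries the factor min 1 (h / (t -
  \<tau>)), of which only the power e is kept.\<close>

lemma Phi_time_diff: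
  "\<exists>C>0. \<forall>(u0 :: 'a \<Rightarrow> 'k::euclidean_space) B u M t h. u0 \<in> borel_measurable lborel \<longrightarrow> bnd r s' (nrm u0) B \<longrightarrow> 0 \<le> B \<longrightarrow>
    jmeas u \<longrightarrow> kato_on u (t + h) M \<longrightarrow> 0 < M \<longrightarrow> 0 < t \<longrightarrow> 0 < h \<longrightarrow>
    bnd r s' (nrm (\<lambda>x. Phi \<gamma> \<alpha> u0 u (t + h) x - Phi \<gamma> \<alpha> u0 u t x))
      (C * (B * (h / t) + M powr \<alpha> * t powr (- (\<alpha> * \<sigma>)) * h powr (1 - a') + M powr \<alpha> * h powr e * t powr (\<delta> - e)))"
proof -
  obtain C1 where C1: "0 < C1" "\<And>t h (f :: 'a \<Rightarrow> 'k) x. 0 < t \<Longrightarrow> 0 \<le> h \<Longrightarrow> f \<in> borel_measurable lborel \<Longrightarrow>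
      hop (t + h) (nrm f) x < top \<Longrightarrow> hop t (nrm f) x < top \<Longrightarrow>
      nrm (\<lambda>x. heat (t + h) f x - heat t f x) x
        \<le> ennreal (C1 * min 1 (h / t)) * (hop (2 * (t + h)) (nrm f) x + hop (2 * t) (nrm f) x)"
    using heat_time_diff_le[where ?'a='a and ?'k='k] by blast
  have "0 < \<sigma>" using ss' by simp
  then have a'e: "0 \<le> a' + e" "a' + e < 1" using a(2) a'(1) e(1) aa' by linarith+
  have as: "0 \<le> \<alpha> * \<sigma>" "\<alpha> * \<sigma> < 1" using \<alpha> ss' \<delta>_pos a' by auto
  obtain C2 where C2: "0 < C2" "\<And>t. 0 < t \<Longrightarrow>
    (\<integral>\<^sup>+\<tau>. indicator {0<..<t} \<tau> * ennreal ((t - \<tau>) powr (- (a' + e)) * \<tau> powr (- (\<alpha> * \<sigma>))) \<partial>lborel)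
      \<le> ennreal (C2 * t powr (1 - (a' + e) - \<alpha> * \<sigma>))"
    using nn_integral_time_convolution[OF a'e as] by blast
  \<comment> \<open>The constants of the three contributions, in the order linear part, new
    interval, change of the semigroup.\<close>
  define D where "D = 2 * C1 * C0 + C0 / (1 - a') + 2 * C1 * C0 * C2"
  have D: "2 * C1 * C0 \<le> D" "C0 / (1 - a') \<le> D" "2 * C1 * C0 * C2 \<le> D" "0 < D"
    using C1(1) C2(1) C0 a' by (auto simp: D_def intro!: add_pos_pos add_nonneg_nonneg)
  have "bnd r s' (nrm (\<lambda>x. Phi \<gamma> \<alpha> u0 u (t + h) x - Phi \<gamma> \<alpha> u0 u t x))
      (D * (B * (h / t) + M powr \<alpha> * t powr (- (\<alpha> * \<sigma>)) * h powr (1 - a') + M powr \<alpha> * h powr e * t powr (\<delta> - e)))"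
    if u0[measurable]: "u0 \<in> borel_measurable lborel" and B: "bnd r s' (nrm u0) B" "0 \<le> B"
      and u: "jmeas u" "kato_on u (t + h) M" and M: "0 < M" and t: "0 < t" "0 < h"
    for u0 :: "'a \<Rightarrow> 'k" and B u M t h
  proof -
    have N[measurable]: "jmeas (\<lambda>\<tau>. N (u \<tau>))" using u(1) by (rule jmeas_nonlinearity)
    have Nh[measurable]: "jmeas (\<lambda>\<tau>. N (u (t + \<tau>)))" by measurable
    have us: "u \<tau> \<in> borel_measurable lborel" for \<tau> using u(1) by (rule borel_measurable_slice)
    have Ns[measurable]: "N (u \<tau>) \<in> borel_measurable lborel" for \<tau> using us by measurable
    have th: "0 < t + h" using t by simp
    have k: "kato_on u t M" using M t by (intro kato_on_mono[OF u(2)]) auto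
    have bN: "bnd (\<alpha> * r) (\<alpha> * s - \<gamma>) (nrm (N (u \<tau>))) (M powr \<alpha> * \<tau> powr (- (\<alpha> * \<sigma>)))" if "0 < \<tau>" "\<tau> < t + h" for \<tau>
    proof -
      have "bnd (\<alpha> * r) (\<alpha> * s - \<gamma>) (nrm (N (u \<tau>))) ((M * \<tau> powr (- \<sigma>)) powr \<alpha>)"
        using us kato_onD[OF u(2) that] M by (intro bnd_nonlinearity) auto
      moreover have "(M * \<tau> powr (- \<sigma>)) powr \<alpha> = M powr \<alpha> * \<tau> powr (- (\<alpha> * \<sigma>))"
        unfolding powr_mult powr_powr by (simp add: mult.commute)
      ultimately show ?thesis by simp
    qed
    define F1 where "F1 x = ennreal (C1 * (h / t)) * (hop (2 * (t + h)) (nrm u0) x + hop (2 * t) (nrm u0) x)" for x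
    define F2 where "F2 = duh (\<lambda>\<tau>. nrm (N (u (t + \<tau>)))) h"
    define P where "P \<tau> x = ennreal (C1 * min 1 (h / (t - \<tau>))) *
        (hop (2 * (t - \<tau> + h)) (nrm (N (u \<tau>))) x + hop (2 * (t - \<tau>)) (nrm (N (u \<tau>))) x)" for \<tau> x
    define F3 where "F3 x = (\<integral>\<^sup>+\<tau>. indicator {0<..<t} \<tau> * P \<tau> x \<partial>lborel)" for x
    have P[measurable]: "jmeas P" unfolding P_def by measurable
    have Fm[measurable]: "F1 \<in> borel_measurable lborel" "F2 \<in> borel_measurable lborel" "F3 \<in> borel_measurable lborel"
      unfolding F1_def F2_def F3_def by measurable
    have b1: "bnd r s' F1 (C1 * (h / t) * (C0 * B + C0 * B))"
      unfolding F1_def using C1(1) C0 B t r r_le_1 by (intro bnd_scale bnd_add hop_data') auto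
    have b2: "bnd r s' F2 (C0 * (M powr \<alpha> * t powr (- (\<alpha> * \<sigma>)) * (h powr (1 - a') / (1 - a'))))"
      unfolding F2_def
    proof (rule bnd_duh[OF hop_source' C0, where m="\<lambda>_. M powr \<alpha> * t powr (- (\<alpha> * \<sigma>))"])
      fix \<tau> assume \<tau>: "0 < \<tau>" "\<tau> < h"
      \<comment> \<open>On the new interval the source is bounded uniformly; only the singularity of
        the semigroup remains to be integrated.\<close>
      have "(t + \<tau>) powr (- (\<alpha> * \<sigma>)) \<le> t powr (- (\<alpha> * \<sigma>))" using as \<tau> t by (intro powr_mono2') auto
      then show "bnd (\<alpha> * r) (\<alpha> * s - \<gamma>) (nrm (N (u (t + \<tau>)))) (M powr \<alpha> * t powr (- (\<alpha> * \<sigma>)))"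
        using \<tau> t ar0 by (intro bnd_mono[OF bN[of "t + \<tau>"]]) (auto intro: mult_left_mono)
    next
      show "(\<integral>\<^sup>+\<tau>. indicator {0<..<h} \<tau> * ennreal ((h - \<tau>) powr (- a') * (M powr \<alpha> * t powr (- (\<alpha> * \<sigma>)))) \<partial>lborel)
        \<le> ennreal (M powr \<alpha> * t powr (- (\<alpha> * \<sigma>)) * (h powr (1 - a') / (1 - a')))"
        unfolding mult.commute[of "_ powr (- a')"] using a' t
        by (intro nn_integral_time_cmult_le nn_integral_time_powr) auto
    qed (use M t a' r r_le_1 in auto)
    define K where "K = 2 * C1 * C0 * M powr \<alpha> * h powr e"
    have K: "0 < K" using C1(1) C0 M t by (simp add: K_def)
    have b3: "bnd r s' F3 (K * (C2 * t powr (1 - (a' + e) - \<alpha> * \<sigma>)))"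
      unfolding F3_def
    proof (rule bnd_time_integral[OF P, where w="\<lambda>\<tau>. K * ((t - \<tau>) powr (- (a' + e)) * \<tau> powr (- (\<alpha> * \<sigma>)))"])
      fix \<tau> assume \<tau>: "0 < \<tau>" "\<tau> < t"
      define A where "A = C0 * (t - \<tau>) powr (- a') * (M powr \<alpha> * \<tau> powr (- (\<alpha> * \<sigma>)))"
      have A: "0 \<le> A" using C0 by (simp add: A_def)
      have hb: "bnd r s' (hop q (nrm (N (u \<tau>)))) A" if q: "t - \<tau> \<le> q" for q
      proof (rule bnd_mono)
        show "bnd r s' (hop q (nrm (N (u \<tau>)))) (C0 * q powr (- a') * (M powr \<alpha> * \<tau> powr (- (\<alpha> * \<sigma>))))"
          using \<tau> t q by (intro hop_source' bN) auto
        have "q powr (- a') \<le> (t - \<tau>) powr (- a')" using q \<tau> a' by (intro powr_mono2') auto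
        then show "C0 * q powr (- a') * (M powr \<alpha> * \<tau> powr (- (\<alpha> * \<sigma>))) \<le> A"
          unfolding A_def using C0 by (intro mult_right_mono mult_left_mono) auto
      qed (use C0 r in auto)
      \<comment> \<open>This gains h^e and raises the singularity to a' + e, which is still below
        1.\<close>
      have mn: "min 1 (h / (t - \<tau>)) \<le> (h / (t - \<tau>)) powr e"
      proof (cases "h / (t - \<tau>) \<le> 1")
        case True
        have "(h / (t - \<tau>)) powr 1 \<le> (h / (t - \<tau>)) powr e"
          using True \<tau> t e by (intro powr_mono') auto
        with True \<tau> t show ?thesis by simp
      next
        case False
        then have "1 \<le> (h / (t - \<tau>)) powr e" using e by (intro ge_one_powr_ge_zero) auto
        then show ?thesis by simp
      qed
      have "bnd r s' (P \<tau>) (C1 * min 1 (h / (t - \<tau>)) * (A + A))"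
        unfolding P_def[abs_def] using C1(1) A t \<tau> r r_le_1 by (intro bnd_scale bnd_add hb) auto
      then show "bnd r s' (P \<tau>) (K * ((t - \<tau>) powr (- (a' + e)) * \<tau> powr (- (\<alpha> * \<sigma>))))"
      proof (rule bnd_mono)
        have "C1 * min 1 (h / (t - \<tau>)) * (A + A) \<le> C1 * ((h / (t - \<tau>)) powr e) * (A + A)"
          using mn C1(1) A by (intro mult_right_mono mult_left_mono) auto
        also have "(h / (t - \<tau>)) powr e = h powr e * (t - \<tau>) powr (- e)"
          using \<tau> t by (simp add: powr_divide powr_minus_divide)
        also have "C1 * (h powr e * (t - \<tau>) powr (- e)) * (A + A) = K * ((t - \<tau>) powr (- a') * (t - \<tau>) powr (- e) * \<tau> powr (- (\<alpha> * \<sigma>)))"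
          by (simp add: A_def K_def)
        also have "(t - \<tau>) powr (- a') * (t - \<tau>) powr (- e) = (t - \<tau>) powr (- (a' + e))" by (simp flip: powr_add)
        finally show "C1 * min 1 (h / (t - \<tau>)) * (A + A) \<le> K * ((t - \<tau>) powr (- (a' + e)) * \<tau> powr (- (\<alpha> * \<sigma>)))" .
      qed (use C1(1) A \<tau> t r in auto)
    next
      show "(\<integral>\<^sup>+\<tau>. indicator {0<..<t} \<tau> * ennreal (K * ((t - \<tau>) powr (- (a' + e)) * \<tau> powr (- (\<alpha> * \<sigma>)))) \<partial>lborel)
        \<le> ennreal (K * (C2 * t powr (1 - (a' + e) - \<alpha> * \<sigma>)))"
        using K C2(2)[OF t(1)] by (intro nn_integral_time_cmult_le) auto
    qed (use K C2(1) r r_le_1 in auto)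
    have bsum: "bnd r s' (\<lambda>x. F1 x + (F3 x + F2 x)) (C1 * (h / t) * (C0 * B + C0 * B) +
       (K * (C2 * t powr (1 - (a' + e) - \<alpha> * \<sigma>)) + C0 * (M powr \<alpha> * t powr (- (\<alpha> * \<sigma>)) * (h powr (1 - a') / (1 - a')))))"
      using C1(1) C2(1) C0 K t B a' r r_le_1 by (intro bnd_add b1 b2 b3 Fm borel_measurable_add add_nonneg_nonneg) auto
    have fin: "AE x in lborel. hop (t + h) (nrm u0) x < top" "AE x in lborel. hop t (nrm u0) x < top"
      using t B by (auto intro!: bnd_imp_AE_finite[OF hop_data'[OF _ _ _ B(1)]])
    have finF2: "AE x in lborel. F2 x < top" by (rule bnd_imp_AE_finite[OF b2]) measurable
    show ?thesis
    proof (rule bnd_mono[OF bsum])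
      show "AE x in lborel. nrm (\<lambda>x. Phi \<gamma> \<alpha> u0 u (t + h) x - Phi \<gamma> \<alpha> u0 u t x) x \<le> F1 x + (F3 x + F2 x)"
        using fin finF2 bnd_duh_nonlinearity(3)[OF u(1) u(2) th less_imp_le[OF M]] bnd_duh_nonlinearity(3)[OF u(1) k t(1) less_imp_le[OF M]]
      proof eventually_elim
        case (elim x)
        have "nrm (\<lambda>x. heat (t + h) u0 x - heat t u0 x) x \<le> ennreal (C1 * min 1 (h / t)) * (hop (2 * (t + h)) (nrm u0) x + hop (2 * t) (nrm u0) x)"
          using elim t by (intro C1(2)) auto
        also have "\<dots> \<le> F1 x"
          unfolding F1_def using C1(1) t by (intro mult_right_mono ennreal_leI mult_left_mono) auto
        finally have 1: "nrm (\<lambda>x. heat (t + h) u0 x - heat t u0 x) x \<le> F1 x" .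
        have 2: "nrm (duhamel (\<lambda>\<tau>. N (u (t + \<tau>))) h) x \<le> F2 x"
          using elim(3) unfolding F2_def by (rule duhamel_converges(4)[OF Nh])
        note sp = duhamel_split[OF N t(2,1) elim(4)]
        note c1 = duhamel_converges[OF N elim(4)] and c2 = duhamel_converges[OF N elim(5)]
        define f1 where "f1 \<tau> = indicat_real {0..t} \<tau> *\<^sub>R heat (h + (t - \<tau>)) (N (u \<tau>)) x" for \<tau>
        define f2 where "f2 \<tau> = indicat_real {0..t} \<tau> *\<^sub>R heat (t - \<tau>) (N (u \<tau>)) x" for \<tau>
        have f1: "integrable lborel f1"
        proof -
          have "integrable lborel (\<lambda>\<tau>. indicat_real {..t} \<tau> *\<^sub>R (indicat_real {0..t + h} \<tau> *\<^sub>R heat (t + h - \<tau>) (N (u \<tau>)) x))"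
            by (rule integrable_mult_indicator[OF _ c1(3)]) simp
          moreover have "indicat_real {..t} \<tau> *\<^sub>R (indicat_real {0..t + h} \<tau> *\<^sub>R heat (t + h - \<tau>) (N (u \<tau>)) x) = f1 \<tau>" for \<tau>
            using t by (auto simp: f1_def indicator_def algebra_simps)
          ultimately show ?thesis by (simp only:)
        qed
        have f2: "integrable lborel f2" unfolding f2_def by (rule c2(3))
        have eq: "heat h (duhamel (\<lambda>\<tau>. N (u \<tau>)) t) x - duhamel (\<lambda>\<tau>. N (u \<tau>)) t x = (LINT \<tau>|lborel. f1 \<tau> - f2 \<tau>)"
          unfolding heat_duhamel[OF N t(2,1) sp(2)] duhamel_eq_lborel[OF N, of t x] f1_def[symmetric] f2_def[symmetric]
          using f1 f2 by (rule Bochner_Integration.integral_diff[symmetric])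
        have "nrm (\<lambda>x. heat h (duhamel (\<lambda>\<tau>. N (u \<tau>)) t) x - duhamel (\<lambda>\<tau>. N (u \<tau>)) t x) x \<le> (\<integral>\<^sup>+\<tau>. ennreal (norm (f1 \<tau> - f2 \<tau>)) \<partial>lborel)"
          unfolding eq using f1 f2 by (intro integral_norm_bound_ennreal Bochner_Integration.integrable_diff)
        also have "\<dots> \<le> F3 x"
          unfolding F3_def
        proof (rule nn_integral_mono_AE)
          show "AE \<tau> in lborel. ennreal (norm (f1 \<tau> - f2 \<tau>)) \<le> indicator {0<..<t} \<tau> * P \<tau> x"
            using c1(1) c2(1) AE_ne[of 0] AE_ne[of t]
          proof eventually_elim
            case (elim \<tau>)
            show ?case
            proof (cases "0 < \<tau> \<and> \<tau> < t")
              case True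
              have "nrm (\<lambda>x. heat (t - \<tau> + h) (N (u \<tau>)) x - heat (t - \<tau>) (N (u \<tau>)) x) x \<le> P \<tau> x"
                unfolding P_def using True elim t by (intro C1(2)) (auto simp: algebra_simps)
              with True show ?thesis by (simp add: f1_def f2_def add.commute)
            qed (use elim in \<open>auto simp: f1_def f2_def indicator_def\<close>)
          qed
        qed
        finally have 3: "nrm (\<lambda>x. heat h (duhamel (\<lambda>\<tau>. N (u \<tau>)) t) x - duhamel (\<lambda>\<tau>. N (u \<tau>)) t x) x \<le> F3 x" .
        have "Phi \<gamma> \<alpha> u0 u (t + h) x - Phi \<gamma> \<alpha> u0 u t x = (heat (t + h) u0 x - heat t u0 x)
          + ((heat h (duhamel (\<lambda>\<tau>. N (u \<tau>)) t) x - duhamel (\<lambda>\<tau>. N (u \<tau>)) t x) + duhamel (\<lambda>\<tau>. N (u (t + \<tau>))) h x)"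
          using sp(1) by (simp add: Phi_def)
        then have "nrm (\<lambda>x. Phi \<gamma> \<alpha> u0 u (t + h) x - Phi \<gamma> \<alpha> u0 u t x) x \<le> ennreal (norm (heat (t + h) u0 x - heat t u0 x)
          + (norm (heat h (duhamel (\<lambda>\<tau>. N (u \<tau>)) t) x - duhamel (\<lambda>\<tau>. N (u \<tau>)) t x) + norm (duhamel (\<lambda>\<tau>. N (u (t + \<tau>))) h x)))"
          by (simp only:) (intro ennreal_leI order_trans[OF norm_triangle_ineq] add_left_mono norm_triangle_ineq)
        also have "\<dots> \<le> F1 x + (F3 x + F2 x)"
          using 1 2 3 by (simp add: ennreal_plus add_mono)
        finally show ?case .
      qed
      define Z where "Z = M powr \<alpha> * t powr (- (\<alpha> * \<sigma>)) * h powr (1 - a')"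
      define Y where "Y = M powr \<alpha> * h powr e * t powr (\<delta> - e)"
      have ZY: "0 \<le> Z" "0 \<le> Y" "0 \<le> B * (h / t)" using B t by (auto simp: Z_def Y_def)
      have ex: "1 - (a' + e) - \<alpha> * \<sigma> = \<delta> - e" by simp
      have "C1 * (h / t) * (C0 * B + C0 * B) = 2 * C1 * C0 * (B * (h / t))" by simp
      moreover have "K * (C2 * t powr (1 - (a' + e) - \<alpha> * \<sigma>)) = 2 * C1 * C0 * C2 * Y"
        unfolding ex by (simp add: K_def Y_def)
      moreover have "C0 * (M powr \<alpha> * t powr (- (\<alpha> * \<sigma>)) * (h powr (1 - a') / (1 - a'))) = C0 / (1 - a') * Z"
        by (simp add: Z_def)
      moreover have "2 * C1 * C0 * (B * (h / t)) \<le> D * (B * (h / t))" "2 * C1 * C0 * C2 * Y \<le> D * Y" "C0 / (1 - a') * Z \<le> D * Z"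
        using D ZY by (blast intro: mult_right_mono)+
      moreover have "D * (B * (h / t) + Z + Y) = D * (B * (h / t)) + D * Z + D * Y" by (simp only: distrib_left)
      ultimately show "C1 * (h / t) * (C0 * B + C0 * B) +
       (K * (C2 * t powr (1 - (a' + e) - \<alpha> * \<sigma>)) + C0 * (M powr \<alpha> * t powr (- (\<alpha> * \<sigma>)) * (h powr (1 - a') / (1 - a'))))
        \<le> D * (B * (h / t) + M powr \<alpha> * t powr (- (\<alpha> * \<sigma>)) * h powr (1 - a') + M powr \<alpha> * h powr e * t powr (\<delta> - e))"
        unfolding Z_def[symmetric] Y_def[symmetric] by linarith
    qed (use C1(1) C2(1) C0 K t B a' r in \<open>auto intro!: add_nonneg_nonneg\<close>)
  qed
  with D(4) show ?thesis by blast
qed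

end

section \<open>Continuity of the heat semigroup at time zero\<close>

lemma ennreal_norm_triangle: "ennreal (norm (a - c)) \<le> ennreal (norm (a - b)) + ennreal (norm (b - c))"
  using norm_triangle_ineq[of "a - b" "b - c"] by (simp flip: ennreal_plus add: ennreal_leI)

lemma ennreal_norm_le_add: "ennreal (norm b) \<le> ennreal (norm a) + ennreal (norm (a - b))"
  using norm_triangle_sub[of b a] by (simp flip: ennreal_plus add: ennreal_leI norm_minus_commute)

text \<open>The duality behind the weak-* case: the opposite weights cancel off the origin.\<close>

lemma bnd_pairing:
  assumes F: "bnd 1 (- s) F P" "0 \<le> P" and G: "bnd 0 s G B" "0 \<le> B" and [measurable]: "F \<in> borel_measurable lborel"
  shows "(\<integral>\<^sup>+x. F x * G x \<partial>lborel) \<le> ennreal (P * B)"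
proof -
  have "AE x in lborel. ennreal (norm x powr s) * G x \<le> ennreal B" using G by (simp add: bnd_def)
  then have "AE x in lborel. F x * G x \<le> ennreal B * (ennreal (norm x powr (- s)) * F x)"
    using AE_lborel_nonzero
  proof eventually_elim
    case (elim x)
    have "F x * G x = (ennreal (norm x powr (- s)) * F x) * (ennreal (norm x powr s) * G x)"
    proof -
      have "ennreal (norm x powr (- s)) * ennreal (norm x powr s) = 1"
        using elim(2) by (simp flip: ennreal_mult powr_add)
      then show ?thesis by (metis (no_types, lifting) mult.assoc mult.commute mult.right_neutral)
    qed
    also have "\<dots> \<le> (ennreal (norm x powr (- s)) * F x) * ennreal B" using elim(1) by (intro mult_left_mono) auto
    finally show ?case by (simp add: mult.commute)
  qed
  then have "(\<integral>\<^sup>+x. F x * G x \<partial>lborel) \<le> (\<integral>\<^sup>+x. ennreal B * (ennreal (norm x powr (- s)) * F x) \<partial>lborel)"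
    by (intro nn_integral_mono_AE)
  also have "\<dots> = ennreal B * (\<integral>\<^sup>+x. ennreal (norm x powr (- s)) * F x \<partial>lborel)"
    by (intro nn_integral_cmult) measurable
  also have "\<dots> \<le> ennreal B * ennreal P"
    using F by (intro mult_left_mono) (auto simp: bnd_def)
  finally show ?thesis using assms by (simp add: mult.commute ennreal_mult)
qed

text \<open>Stated for finite exponents, r > 0, where dominated convergence applies to the p-th
  powers. For q = \<infinity> the continuity at time zero goes through duality instead.\<close>

lemma bnd_dominated_convergence:
  fixes f :: "nat \<Rightarrow> 'a::euclidean_space \<Rightarrow> 'k::euclidean_space"
  assumes r: "0 < r" and [measurable]: "\<And>n. f n \<in> borel_measurable lborel" "D \<in> borel_measurable lborel"
    and D: "bnd r s D B" and le: "\<And>n. AE x in lborel. nrm (f n) x \<le> D x"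
    and lim: "AE x in lborel. (\<lambda>n. f n x) \<longlonglongrightarrow> 0" and e: "0 < e"
  shows "\<exists>n0. \<forall>n\<ge>n0. bnd r s (nrm (f n)) e"
proof -
  define p where "p = 1 / r"
  have p: "0 < p" using r by (simp add: p_def)
  have "(\<lambda>n. \<integral>\<^sup>+x. epow (ennreal (norm x powr s) * nrm (f n) x) p \<partial>lborel) \<longlonglongrightarrow> (\<integral>\<^sup>+(x::'a). 0 \<partial>lborel)"
  proof (rule nn_integral_dominated_convergence[where w="\<lambda>x. epow (ennreal (norm x powr s) * D x) p"])
    show "AE x in lborel. epow (ennreal (norm x powr s) * nrm (f n) x) p \<le> epow (ennreal (norm x powr s) * D x) p" for n
      using le[of n] by eventually_elim (use p in \<open>auto intro!: epow_mono mult_left_mono\<close>)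
    show "(\<integral>\<^sup>+x. epow (ennreal (norm x powr s) * D x) p \<partial>lborel) < \<infinity>"
      using D r by (auto simp: bnd_def p_def intro: le_less_trans)
    show "AE x in lborel. (\<lambda>n. epow (ennreal (norm x powr s) * nrm (f n) x) p) \<longlonglongrightarrow> 0"
      using lim
    proof eventually_elim
      case (elim x)
      have "(\<lambda>n. ennreal ((norm x powr s * norm (f n x)) powr p)) \<longlonglongrightarrow> ennreal ((norm x powr s * 0) powr p)"
        using p by (intro tendsto_ennrealI tendsto_powr' tendsto_mult tendsto_const tendsto_norm_zero elim) auto
      then show ?case using p by (simp flip: ennreal_mult)
    qed
  qed measurable
  then have "eventually (\<lambda>n. (\<integral>\<^sup>+x. epow (ennreal (norm x powr s) * nrm (f n) x) p \<partial>lborel) < ennreal (e powr p)) sequentially"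
    using e by (intro order_tendstoD) auto
  then show ?thesis
    using r unfolding eventually_sequentially by (auto simp: bnd_def p_def intro: less_imp_le)
qed

text \<open>For n > 0 the radial projection onto the closed ball of radius n, which is
  continuous.\<close>

definition clamp_norm :: "real \<Rightarrow> 'k::real_normed_vector \<Rightarrow> 'k"
  where "clamp_norm n y = (n / max n (norm y)) *\<^sub>R y"

text \<open>Vanishes near the origin as well as far out, so that the weight |x|^s is bounded on the
  support for either sign of s.\<close>

definition annulus_cutoff :: "real \<Rightarrow> 'a::real_normed_vector \<Rightarrow> real"
  where "annulus_cutoff n x = max 0 (min 1 (n * norm x - 1)) * max 0 (min 1 (n - norm x))"

lemma norm_clamp_norm_le: "0 < n \<Longrightarrow> norm (clamp_norm n y) \<le> n"
  by (cases "norm y \<le> n") (auto simp: clamp_norm_def max_def field_simps)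

lemma clamp_norm_eq: "0 < n \<Longrightarrow> norm y \<le> n \<Longrightarrow> clamp_norm n y = y"
  by (simp add: clamp_norm_def max_def)

lemma continuous_clamp_norm: "0 < n \<Longrightarrow> continuous_on UNIV (clamp_norm n)"
  unfolding clamp_norm_def by (intro continuous_intros) (auto simp: max_def)

lemma continuous_annulus_cutoff: "continuous_on UNIV (annulus_cutoff n)"
  unfolding annulus_cutoff_def by (intro continuous_intros)

lemma annulus_cutoff_range: "0 \<le> annulus_cutoff n x" "annulus_cutoff n x \<le> 1"
  by (auto simp: annulus_cutoff_def intro!: mult_le_one)

lemma norm_cutoff_clamp_le: "0 < m \<Longrightarrow> norm (annulus_cutoff m x *\<^sub>R clamp_norm m y) \<le> m"
  using mult_mono[of "annulus_cutoff m x" 1 "norm (clamp_norm m y)" m] annulus_cutoff_range[of m x]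
    norm_clamp_norm_le[of m y]
  by simp

lemma annulus_cutoff_support: "0 < n \<Longrightarrow> annulus_cutoff n x \<noteq> 0 \<Longrightarrow> 1 / n \<le> norm x \<and> norm x \<le> n"
  by (auto simp: annulus_cutoff_def max_def min_def field_simps split: if_splits)

lemma annulus_cutoff_eq_1: "1 \<le> n * norm x - 1 \<Longrightarrow> norm x + 1 \<le> n \<Longrightarrow> annulus_cutoff n x = 1"
  by (simp add: annulus_cutoff_def)

lemma bnd_indicator_annulus:
  assumes r: "0 < r" and n: "0 < n" and c: "0 \<le> c"
  shows "\<exists>B\<ge>0. bnd r s (\<lambda>x::'a::euclidean_space. ennreal c * indicator {x. 1 / n \<le> norm x \<and> norm x \<le> n} x) B"
proof -
  define S where "S = {x::'a. 1 / n \<le> norm x \<and> norm x \<le> n}"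
  have [measurable]: "S \<in> sets borel" unfolding S_def by measurable
  define m where "m = max (n powr s) ((1 / n) powr s)"
  have m: "norm x powr s \<le> m" if "x \<in> S" for x
  proof (cases "0 \<le> s")
    case True
    then have "norm x powr s \<le> n powr s" using that n by (intro powr_mono2) (auto simp: S_def)
    then show ?thesis by (simp add: m_def)
  next
    case False
    then have "norm x powr s \<le> (1 / n) powr s" using that n by (intro powr_mono2') (auto simp: S_def)
    then show ?thesis by (simp add: m_def)
  qed
  have "S \<subseteq> cball 0 n" by (auto simp: S_def)
  then have fin: "emeasure lborel S < top"
    using emeasure_mono[of S "cball 0 n" lborel] emeasure_lborel_cball_finite[of "0::'a" n] by (auto intro: le_less_trans)
  have "(\<integral>\<^sup>+x. epow (ennreal (norm x powr s) * (ennreal c * indicator S x)) (1 / r) \<partial>lborel)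
    \<le> (\<integral>\<^sup>+x. ennreal ((m * c) powr (1 / r)) * indicator S (x::'a) \<partial>lborel)"
  proof (intro nn_integral_mono)
    fix x :: 'a
    show "epow (ennreal (norm x powr s) * (ennreal c * indicator S x)) (1 / r) \<le> ennreal ((m * c) powr (1 / r)) * indicator S x"
    proof (cases "x \<in> S")
      case True
      then show ?thesis
        using m[OF True] c r by (simp flip: ennreal_mult) (intro ennreal_leI powr_mono2 mult_right_mono; simp)
    qed simp
  qed
  also have "\<dots> = ennreal ((m * c) powr (1 / r)) * emeasure lborel S" by (intro nn_integral_cmult_indicator) simp
  also have "\<dots> < top" using fin by (simp add: ennreal_mult_less_top)
  finally obtain K where K: "0 \<le> K" "(\<integral>\<^sup>+x. epow (ennreal (norm x powr s) * (ennreal c * indicator S x)) (1 / r) \<partial>lborel) = ennreal K"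
    by (cases "(\<integral>\<^sup>+x. epow (ennreal (norm x powr s) * (ennreal c * indicator S x)) (1 / r) \<partial>lborel)") auto
  then have "bnd r s (\<lambda>x. ennreal c * indicator S x) (K powr r)"
    using r by (simp add: bnd_def powr_powr)
  then show ?thesis unfolding S_def by (intro exI[of _ "K powr r"]) auto
qed

text \<open>Two dominated limits. f is truncated in value and to an annulus, with majorant |f|. Then
  f is replaced by continuous functions that converge to it almost everywhere and pass through the
  same truncation, with a multiple of an indicator as majorant. One number n bounds both the values
  and the support.\<close>

lemma continuous_dense:
  fixes f :: "'a::euclidean_space \<Rightarrow> 'k::euclidean_space"
  assumes r: "0 < r" "r \<le> 1" and f[measurable]: "f \<in> borel_measurable lborel" and B: "bnd r s (nrm f) B" and e: "0 < e"
  shows "\<exists>g n. 0 < n \<and> continuous_on UNIV g \<and> (\<forall>x. norm (g x) \<le> n) \<and> (\<forall>x. g x \<noteq> 0 \<longrightarrow> norm x \<le> n) \<and> bnd r s (nrm (\<lambda>x. f x - g x)) e"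
proof -
  define F where "F n x = annulus_cutoff (Suc n) x *\<^sub>R clamp_norm (Suc n) (f x)" for n :: nat and x
  have cl[measurable]: "clamp_norm (real (Suc n)) \<in> borel_measurable borel" "annulus_cutoff (real (Suc n)) \<in> borel_measurable borel" for n
    by (auto intro!: borel_measurable_continuous_onI continuous_clamp_norm continuous_annulus_cutoff)
  have Fm[measurable]: "F n \<in> borel_measurable lborel" for n unfolding F_def by measurable
  have "\<exists>n0. \<forall>n\<ge>n0. bnd r s (nrm (\<lambda>x. f x - F n x)) (e / 2)"
  proof (rule bnd_dominated_convergence[OF r(1) _ _ B])
    show "AE x in lborel. nrm (\<lambda>x. f x - F n x) x \<le> nrm f x" for n
    proof (intro AE_I2 ennreal_leI)
      fix x
      \<comment> \<open>The truncation is f times a scalar in [0, 1], so the error never exceeds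
        |f|.\<close>
      define q where "q = real (Suc n) / max (real (Suc n)) (norm (f x))"
      define c where "c = annulus_cutoff (real (Suc n)) x * q"
      have "0 < max (real (Suc n)) (norm (f x))" by (simp add: max.strict_coboundedI1)
      then have "0 \<le> q" "q \<le> 1" by (auto simp: q_def divide_le_eq)
      then have c: "0 \<le> c" "c \<le> 1" unfolding c_def using annulus_cutoff_range[of "real (Suc n)" x]
        by (blast intro: mult_le_one mult_nonneg_nonneg)+
      have "F n x = c *\<^sub>R f x" by (simp only: F_def c_def q_def clamp_norm_def scaleR_scaleR)
      then have "f x - F n x = (1 - c) *\<^sub>R f x" by (simp add: scaleR_diff_left)
      then have "norm (f x - F n x) = (1 - c) * norm (f x)" using c by simp
      also have "\<dots> \<le> 1 * norm (f x)" using c by (intro mult_right_mono) auto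
      finally show "norm (f x - F n x) \<le> norm (f x)" by simp
    qed
    show "AE x in lborel. (\<lambda>n. f x - F n x) \<longlonglongrightarrow> 0"
      using AE_lborel_nonzero
    proof eventually_elim
      case (elim x)
      obtain k :: nat where k: "norm (f x) + norm x + 1 + 2 / norm x \<le> real k" using real_arch_simple by blast
      have "f x - F n x = 0" if "k \<le> n" for n
      proof -
        have "0 \<le> 2 / norm x" by simp
        with k that have n: "norm (f x) \<le> real (Suc n)" "norm x + 1 \<le> real (Suc n)" "2 / norm x \<le> real (Suc n)"
          using norm_ge_zero[of x] norm_ge_zero[of "f x"] by (smt (verit) of_nat_Suc of_nat_mono)+
        from n(3) elim have "2 \<le> real (Suc n) * norm x" by (simp add: field_simps)
        with n have "annulus_cutoff (real (Suc n)) x = 1" by (intro annulus_cutoff_eq_1) auto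
        with n show ?thesis by (simp add: F_def clamp_norm_eq)
      qed
      then show ?case by (intro tendsto_eventually) (auto simp: eventually_sequentially)
    qed
  qed (use e in auto)
  then obtain n where n: "bnd r s (nrm (\<lambda>x. f x - F n x)) (e / 2)" by blast
  define m where "m = real (Suc n)"
  have m: "0 < m" by (simp add: m_def)
  \<comment> \<open>Lebesgue measurable functions are limits of continuous ones off a negligible
    set.\<close>
  have "f \<in> borel_measurable (lebesgue_on UNIV)" using measurable_completion[OF f] by (simp add: lebesgue_on_UNIV_eq)
  then have "f measurable_on UNIV" by (intro lebesgue_measurable_imp_measurable_on) auto
  then obtain Z g where Z: "negligible Z" and g: "\<And>k. continuous_on UNIV (g k)" and gf: "\<And>x. x \<notin> Z \<Longrightarrow> (\<lambda>k. g k x) \<longlonglongrightarrow> f x"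
    unfolding measurable_on_def by auto
  define h where "h k x = annulus_cutoff m x *\<^sub>R clamp_norm m (g k x)" for k x
  have hc: "continuous_on UNIV (h k)" for k
    unfolding h_def using g continuous_clamp_norm[OF m] continuous_annulus_cutoff
    by (intro continuous_on_scaleR continuous_on_compose2[OF continuous_clamp_norm[OF m]]) auto
  have hm[measurable]: "h k \<in> borel_measurable lborel" for k
    using borel_measurable_continuous_onI[OF hc] by simp
  have hn: "norm (h k x) \<le> m" for k x
    unfolding h_def by (rule norm_cutoff_clamp_le[OF m])
  obtain B' where B': "0 \<le> B'" "bnd r s (\<lambda>x::'a. ennreal (2 * m) * indicator {x. 1 / m \<le> norm x \<and> norm x \<le> m} x) B'"
    using bnd_indicator_annulus[OF r(1) m, of "2 * m" s, where ?'a='a] m by auto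
  have "\<exists>k0. \<forall>k\<ge>k0. bnd r s (nrm (\<lambda>x. F n x - h k x)) (e / 2)"
  proof (rule bnd_dominated_convergence[OF r(1) _ _ B'(2)])
    show "AE x in lborel. nrm (\<lambda>x. F n x - h k x) x \<le> ennreal (2 * m) * indicator {x. 1 / m \<le> norm x \<and> norm x \<le> m} x" for k
    proof (intro AE_I2)
      fix x
      show "nrm (\<lambda>x. F n x - h k x) x \<le> ennreal (2 * m) * indicator {x. 1 / m \<le> norm x \<and> norm x \<le> m} x"
      proof (cases "annulus_cutoff m x = 0")
        case False
        have "norm (F n x) \<le> m"
          unfolding F_def m_def[symmetric] by (rule norm_cutoff_clamp_le[OF m])
        then have "norm (F n x - h k x) \<le> 2 * m" using hn[of k x] norm_triangle_ineq4[of "F n x" "h k x"] by simp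
        then show ?thesis using annulus_cutoff_support[OF m False] by (simp add: ennreal_leI)
      qed (simp add: F_def h_def m_def[symmetric] del: of_nat_Suc)
    qed
    have ae: "AE x in lborel. x \<notin> Z"
      using Z AE_not_in[of Z lebesgue] by (simp add: negligible_iff_null_sets AE_completion_iff)
    show "AE x in lborel. (\<lambda>k. F n x - h k x) \<longlonglongrightarrow> 0"
      using ae
    proof eventually_elim
      case (elim x)
      have "(\<lambda>k. clamp_norm m (g k x)) \<longlonglongrightarrow> clamp_norm m (f x)"
        by (rule continuous_on_tendsto_compose[OF continuous_clamp_norm[OF m] gf[OF elim]]) auto
      then have "(\<lambda>k. F n x - h k x) \<longlonglongrightarrow> F n x - annulus_cutoff m x *\<^sub>R clamp_norm m (f x)"
        unfolding h_def by (intro tendsto_intros)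
      then show ?case by (simp add: F_def m_def)
    qed
  qed (use e in auto)
  then obtain k where k: "bnd r s (nrm (\<lambda>x. F n x - h k x)) (e / 2)" by blast
  have "bnd r s (\<lambda>x. nrm (\<lambda>x. f x - F n x) x + nrm (\<lambda>x. F n x - h k x) x) (e / 2 + e / 2)"
    using n k e r by (intro bnd_add) auto
  then have "bnd r s (nrm (\<lambda>x. f x - h k x)) e"
  proof (rule bnd_mono)
    show "AE x in lborel. nrm (\<lambda>x. f x - h k x) x \<le> nrm (\<lambda>x. f x - F n x) x + nrm (\<lambda>x. F n x - h k x) x"
      by (intro AE_I2 ennreal_norm_triangle)
  qed (use e r in auto)
  moreover have "norm x \<le> m" if "h k x \<noteq> 0" for x
    using annulus_cutoff_support[OF m, of x] that by (auto simp: h_def)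
  ultimately show ?thesis using m hc hn by blast
qed

text \<open>Near x the continuity of g is used. At distance at least d, half of the Gaussian
  exponent gives the factor exp (- d^2 / (8 t)), and the other half is a kernel at time 2t, of mass
  one.\<close>

lemma heat_tendsto_pointwise:
  fixes g :: "'a::euclidean_space \<Rightarrow> 'k::euclidean_space"
  assumes g: "continuous_on UNIV g" and m: "\<And>x. norm (g x) \<le> m"
  shows "((\<lambda>t. heat t g x) \<longlongrightarrow> g x) (at_right 0)"
proof (rule tendstoI)
  fix e :: real assume e: "0 < e"
  have [measurable]: "g \<in> borel_measurable borel" using g by (rule borel_measurable_continuous_onI)
  have m0: "0 \<le> m" using m[of x] norm_ge_zero[of "g x"] by linarith
  obtain d where d: "0 < d" "\<And>y. dist y x < d \<Longrightarrow> dist (g y) (g x) < e / 2"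
    using g e unfolding continuous_on_iff by (metis UNIV_I half_gt_zero)
  \<comment> \<open>D is the dimension, d the radius supplied by the continuity of g.\<close>
  define D where "D = real DIM('a)"
  have "((\<lambda>t. 2 * m * (2 powr (D / 2) * exp (- (d\<^sup>2 / (8 * t))))) \<longlongrightarrow> 0) (at_right 0)"
  proof (intro tendsto_mult_right_zero)
    show "((\<lambda>t. exp (- (d\<^sup>2 / (8 * t)))) \<longlongrightarrow> 0) (at_right 0)"
    proof (rule tendsto_sandwich[of "\<lambda>_. 0" _ _ "\<lambda>t. 8 * t / d\<^sup>2"])
      show "eventually (\<lambda>t. exp (- (d\<^sup>2 / (8 * t))) \<le> 8 * t / d\<^sup>2) (at_right 0)"
        using eventually_at_right_less[of "0::real"]
      proof eventually_elim
        case (elim t)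
        have z: "0 < d\<^sup>2 / (8 * t)" using elim d by simp
        have "d\<^sup>2 / (8 * t) \<le> exp (d\<^sup>2 / (8 * t))"
          using exp_ge_add_one_self[of "d\<^sup>2 / (8 * t)"] by linarith
        then have "inverse (exp (d\<^sup>2 / (8 * t))) \<le> inverse (d\<^sup>2 / (8 * t))"
          using z by (rule le_imp_inverse_le)
        then show ?case by (simp add: exp_minus)
      qed
      have "((\<lambda>t. 8 * t / d\<^sup>2) \<longlongrightarrow> 8 * 0 / d\<^sup>2) (at_right 0)" using d by (intro tendsto_intros) auto
      then show "((\<lambda>t. 8 * t / d\<^sup>2) \<longlongrightarrow> 0) (at_right 0)" by simp
    qed auto
  qed
  then have "eventually (\<lambda>t. 2 * m * (2 powr (D / 2) * exp (- (d\<^sup>2 / (8 * t)))) < e / 2) (at_right 0)"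
    using e by (intro order_tendstoD) auto
  moreover have "eventually (\<lambda>t::real. 0 < t) (at_right 0)" by (simp add: eventually_at_right_less)
  ultimately show "eventually (\<lambda>t. dist (heat t g x) (g x) < e) (at_right 0)"
  proof eventually_elim
    case (elim t)
    note t = elim(2)
    have G: "integrable lborel (\<lambda>y. heat_kernel t (x - y))" "(LINT y|lborel. heat_kernel t (x - y)) = 1"
      using nn_integral_heat_kernel_diff(1)[OF t, of x]
      by (auto intro!: integrableI_nonneg simp: integral_eq_nn_integral)
    have bd: "integrable lborel (\<lambda>y. heat_kernel t (x - y) *\<^sub>R g y)"
      by (rule Bochner_Integration.integrable_bound[OF integrable_mult_left[OF G(1), of m]]) (use m m0 in \<open>auto intro!: AE_I2 mult_left_mono\<close>)
    have "heat t g x - g x = (LINT y|lborel. heat_kernel t (x - y) *\<^sub>R g y) - (LINT y|lborel. heat_kernel t (x - y) *\<^sub>R g x)"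
      using t G by (simp add: heat_eq_lborel)
    also have "\<dots> = (LINT y|lborel. heat_kernel t (x - y) *\<^sub>R g y - heat_kernel t (x - y) *\<^sub>R g x)"
      using bd G(1) by (intro Bochner_Integration.integral_diff[symmetric]) auto
    finally have "ennreal (norm (heat t g x - g x)) \<le> (\<integral>\<^sup>+y. ennreal (norm (heat_kernel t (x - y) *\<^sub>R g y - heat_kernel t (x - y) *\<^sub>R g x)) \<partial>lborel)"
      using bd G(1) by (simp only:) (intro integral_norm_bound_ennreal Bochner_Integration.integrable_diff, auto)
    also have "\<dots> \<le> (\<integral>\<^sup>+y. ennreal (e / 2) * ennreal (heat_kernel t (x - y))
         + ennreal (2 * m * (2 powr (D / 2) * exp (- (d\<^sup>2 / (8 * t))))) * ennreal (heat_kernel (2 * t) (x - y)) \<partial>lborel)"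
    proof (intro nn_integral_mono)
      fix y
      have "norm (heat_kernel t (x - y) *\<^sub>R g y - heat_kernel t (x - y) *\<^sub>R g x) = heat_kernel t (x - y) * norm (g y - g x)"
        by (simp flip: scaleR_diff_right)
      also have "\<dots> \<le> e / 2 * heat_kernel t (x - y) + 2 * m * (2 powr (D / 2) * exp (- (d\<^sup>2 / (8 * t)))) * heat_kernel (2 * t) (x - y)"
      proof (cases "dist y x < d")
        case True
        then have "heat_kernel t (x - y) * norm (g y - g x) \<le> heat_kernel t (x - y) * (e / 2)"
          using d(2)[OF True] by (intro mult_left_mono) (auto simp: dist_norm)
        also have "\<dots> = e / 2 * heat_kernel t (x - y)" by simp
        finally show ?thesis using m0 by (simp add: add_increasing2)
      next
        case False
        have "d\<^sup>2 \<le> (norm (x - y))\<^sup>2" using False d(1) by (intro power_mono) (auto simp: dist_norm norm_minus_commute)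
        then have ex: "exp (- ((norm (x - y))\<^sup>2 / (8 * t))) \<le> exp (- (d\<^sup>2 / (8 * t)))" using t by (simp add: divide_right_mono)
        have "4 * pi * (2 * t) = 2 * (4 * pi * t)" by simp
        then have c: "(4 * pi * t) powr (- (D / 2)) = 2 powr (D / 2) * (4 * pi * (2 * t)) powr (- (D / 2))"
          by (simp only: powr_mult[of 2]) (simp add: powr_minus)
        have e2: "exp (- ((norm (x - y))\<^sup>2 / (4 * t))) = exp (- ((norm (x - y))\<^sup>2 / (8 * t))) * exp (- ((norm (x - y))\<^sup>2 / (4 * (2 * t))))"
          by (simp flip: exp_add)
        have "heat_kernel t (x - y) = 2 powr (D / 2) * exp (- ((norm (x - y))\<^sup>2 / (8 * t))) * heat_kernel (2 * t) (x - y)"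
          unfolding heat_kernel_def D_def[symmetric] c e2 by simp
        also have "\<dots> \<le> 2 powr (D / 2) * exp (- (d\<^sup>2 / (8 * t))) * heat_kernel (2 * t) (x - y)"
          using ex by (intro mult_right_mono mult_left_mono) auto
        finally have h: "heat_kernel t (x - y) \<le> 2 powr (D / 2) * exp (- (d\<^sup>2 / (8 * t))) * heat_kernel (2 * t) (x - y)" .
        have "norm (g y - g x) \<le> 2 * m" using m[of x] m[of y] norm_triangle_ineq4[of "g y" "g x"] by linarith
        with h have "heat_kernel t (x - y) * norm (g y - g x) \<le> (2 powr (D / 2) * exp (- (d\<^sup>2 / (8 * t))) * heat_kernel (2 * t) (x - y)) * (2 * m)"
          by (intro mult_mono) auto
        also have "\<dots> = 2 * m * (2 powr (D / 2) * exp (- (d\<^sup>2 / (8 * t)))) * heat_kernel (2 * t) (x - y)" by simp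
        finally show ?thesis using e by (simp add: add_increasing)
      qed
      finally show "ennreal (norm (heat_kernel t (x - y) *\<^sub>R g y - heat_kernel t (x - y) *\<^sub>R g x))
        \<le> ennreal (e / 2) * ennreal (heat_kernel t (x - y))
         + ennreal (2 * m * (2 powr (D / 2) * exp (- (d\<^sup>2 / (8 * t))))) * ennreal (heat_kernel (2 * t) (x - y))"
        using e m0 by (simp flip: ennreal_mult ennreal_plus add: ennreal_leI)
    qed
    also have "\<dots> = ennreal (e / 2) + ennreal (2 * m * (2 powr (D / 2) * exp (- (d\<^sup>2 / (8 * t)))))"
      using t by (simp add: nn_integral_add nn_integral_cmult nn_integral_heat_kernel_diff)
    also have "\<dots> < ennreal e"
      using elim(1) e m0 by (simp flip: ennreal_plus add: ennreal_less_iff)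
    finally show ?case using e by (simp add: dist_norm ennreal_less_iff)
  qed
qed

text \<open>The constant 5 is 4 (t + 1/4) at t = 1: the Gaussian exp (- |x|^2), evolved up to time
  1, stays below this function.\<close>

lemma bnd_gaussian:
  assumes r: "0 < r" and s: "- real DIM('a::euclidean_space) * r < s"
  shows "\<exists>B\<ge>0. bnd r s (\<lambda>x::'a. ennreal (exp (- ((norm x)\<^sup>2 / 5)))) B"
proof -
  define p where "p = 1 / r"
  have p: "0 < p" using r by (simp add: p_def)
  have "- (s * p) < real DIM('a)" using s r by (simp add: p_def field_simps)
  then obtain C where C: "0 < C" "\<And>t x. 0 < t \<Longrightarrow> (\<integral>\<^sup>+y. ennreal (heat_kernel t (x - y) * norm y powr (s * p)) \<partial>lborel)
      \<le> ennreal (C * (sqrt t + norm (x::'a)) powr (s * p))"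
    using nn_integral_heat_kernel_norm_powr[of "- (s * p)", where ?'a='a] by auto
  \<comment> \<open>At this time the p-th power of the Gaussian is a multiple of the heat
    kernel.\<close>
  define t where "t = 5 / (4 * p)"
  have t: "0 < t" using p by (simp add: t_def)
  define K where "K = (4 * pi * t) powr (real DIM('a) / 2)"
  have K: "0 < K" using t by (simp add: K_def)
  have pt: "epow (ennreal (norm x powr s) * ennreal (exp (- ((norm x)\<^sup>2 / 5)))) p
      = ennreal K * ennreal (heat_kernel t (0 - x) * norm x powr (s * p))" for x :: 'a
  proof -
    have "4 * t = 5 / p" using p by (simp add: t_def)
    then have "(norm x)\<^sup>2 / (4 * t) = (norm x)\<^sup>2 / 5 * p" by simp
    then have "exp (- ((norm x)\<^sup>2 / 5)) powr p = exp (- ((norm x)\<^sup>2 / (4 * t)))"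
      by (simp add: exp_powr_real)
    also have "\<dots> = K * heat_kernel t (0 - x)"
      using t by (simp add: heat_kernel_def K_def powr_minus)
    finally have "(norm x powr s * exp (- ((norm x)\<^sup>2 / 5))) powr p = K * (heat_kernel t (0 - x) * norm x powr (s * p))"
      by (simp add: powr_mult powr_powr)
    then show ?thesis using K by (simp flip: ennreal_mult)
  qed
  have "(\<integral>\<^sup>+x. epow (ennreal (norm x powr s) * ennreal (exp (- ((norm (x::'a))\<^sup>2 / 5)))) p \<partial>lborel)
    = ennreal K * (\<integral>\<^sup>+x. ennreal (heat_kernel t (0 - x) * norm (x::'a) powr (s * p)) \<partial>lborel)"
    unfolding pt by (intro nn_integral_cmult) measurable
  also have "\<dots> \<le> ennreal K * ennreal (C * (sqrt t + norm (0::'a)) powr (s * p))"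
    by (rule mult_left_mono[OF C(2)[OF t, of 0]]) simp
  also have "\<dots> = ennreal (K * (C * sqrt t powr (s * p)))" using K C(1) by (simp add: ennreal_mult)
  finally have "bnd r s (\<lambda>x::'a. ennreal (exp (- ((norm x)\<^sup>2 / 5)))) ((K * (C * sqrt t powr (s * p))) powr r)"
    using r K C(1) by (simp add: bnd_def powr_powr p_def)
  then show ?thesis by (intro exI[of _ "(K * (C * sqrt t powr (s * p))) powr r"]) simp
qed

text \<open>A bounded g of bounded support lies below a multiple of a Gaussian, and so does its
  evolution for times up to 1; this provides the majorant for dominated convergence. As that theorem
  concerns sequences, the claim is negated and a bad sequence of times extracted.\<close>

lemma heat_strong_continuity_dense:
  fixes g :: "'a::euclidean_space \<Rightarrow> 'k::euclidean_space"
  assumes r: "0 < r" "r \<le> 1" and s: "- real DIM('a) * r < s"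
    and g: "continuous_on UNIV g" and m: "\<And>x. norm (g x) \<le> m" and supp: "\<And>x. g x \<noteq> 0 \<Longrightarrow> norm x \<le> m"
    and e: "0 < e"
  shows "eventually (\<lambda>t. bnd r s (nrm (\<lambda>x. heat t g x - g x)) e) (at_right 0)"
proof (rule ccontr)
  assume "\<not> ?thesis"
  then have "\<exists>t>0. t < b \<and> \<not> bnd r s (nrm (\<lambda>x. heat t g x - g x)) e" if "0 < b" for b
    using that by (auto simp: eventually_at_right_field)
  then have "\<exists>t>0. t < 1 / Suc n \<and> \<not> bnd r s (nrm (\<lambda>x. heat t g x - g x)) e" for n by simp
  then obtain t where t: "\<And>n. 0 < t n" "\<And>n::nat. t n < 1 / Suc n" "\<And>n. \<not> bnd r s (nrm (\<lambda>x. heat (t n) g x - g x)) e"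
    by metis
  have gm[measurable]: "g \<in> borel_measurable lborel" using borel_measurable_continuous_onI[OF g] by simp
  have hm[measurable]: "heat (t n) g \<in> borel_measurable lborel" for n by (intro borel_measurable_heat) measurable
  have m0: "0 \<le> m" using m[of 0] norm_ge_zero[of "g 0"] by linarith
  have t1: "t n \<le> 1" for n
  proof -
    have "1 / real (Suc n) \<le> 1" by simp
    with t(2)[of n] show ?thesis by linarith
  qed
  define D where "D = real DIM('a)"
  \<comment> \<open>On the support |x| \<le> m, hence exp (m^2 - |x|^2) \<ge> 1.\<close>
  define A where "A = m * exp (m\<^sup>2)"
  have A: "0 \<le> A" using m0 by (simp add: A_def)
  have gA: "norm (g x) \<le> A * exp (- (norm x)\<^sup>2)" for x
  proof (cases "g x = 0")
    case False
    have "(norm x)\<^sup>2 \<le> m\<^sup>2" using supp[OF False] by (intro power_mono) auto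
    then have "1 \<le> exp (m\<^sup>2) * exp (- (norm x)\<^sup>2)" by (simp flip: exp_add)
    then have "m * 1 \<le> m * (exp (m\<^sup>2) * exp (- (norm x)\<^sup>2))" using m0 by (rule mult_left_mono)
    with m[of x] show ?thesis by (simp add: A_def mult.assoc)
  qed (use A in simp)
  have e5: "exp (- (norm x)\<^sup>2) \<le> exp (- ((norm x)\<^sup>2 / 5))" for x :: 'a by simp
  \<comment> \<open>Identified with a heat kernel, the Gaussian majorant evolves explicitly by the
    convolution law.\<close>
  have g4: "exp (- (norm x)\<^sup>2) = pi powr (D / 2) * heat_kernel (1 / 4) (x :: 'a)" for x
    by (simp add: heat_kernel_def D_def powr_minus)
  have hA: "nrm (heat (t n) g) x \<le> ennreal (A * exp (- ((norm x)\<^sup>2 / 5)))" for n x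
  proof -
    have "nrm (heat (t n) g) x \<le> hop (t n) (nrm g) x" using t by (intro norm_heat_le) auto
    also have "\<dots> \<le> (\<integral>\<^sup>+y. ennreal (A * pi powr (D / 2)) * (ennreal (heat_kernel (t n) (x - y)) * ennreal (heat_kernel (1 / 4) (y - 0))) \<partial>lborel)"
      unfolding hop_def
    proof (intro nn_integral_mono)
      fix y
      have "nrm g y \<le> ennreal (A * pi powr (D / 2)) * ennreal (heat_kernel (1 / 4) y)"
        using gA[of y] A by (simp add: g4 mult.assoc ennreal_leI flip: ennreal_mult)
      then have "ennreal (heat_kernel (t n) (x - y)) * nrm g y \<le> ennreal (heat_kernel (t n) (x - y)) * (ennreal (A * pi powr (D / 2)) * ennreal (heat_kernel (1 / 4) y))"
        by (intro mult_left_mono) auto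
      then show "ennreal (heat_kernel (t n) (x - y)) * nrm g y
         \<le> ennreal (A * pi powr (D / 2)) * (ennreal (heat_kernel (t n) (x - y)) * ennreal (heat_kernel (1 / 4) (y - 0)))"
        by (simp add: mult_ac)
    qed
    also have "\<dots> = ennreal (A * pi powr (D / 2)) * ennreal (heat_kernel (t n + 1 / 4) (x - 0))"
      using nn_integral_heat_kernel_mult[OF t(1)[of n], of "1 / 4" x 0] by (simp add: nn_integral_cmult)
    also have "\<dots> = ennreal (A * pi powr (D / 2) * heat_kernel (t n + 1 / 4) x)" using A by (simp flip: ennreal_mult)
    also have "\<dots> \<le> ennreal (A * exp (- ((norm x)\<^sup>2 / 5)))"
    proof (intro ennreal_leI)
      have tn: "0 < t n" "t n \<le> 1" using t(1) t1 by auto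
      have "(4 * pi * (t n + 1 / 4)) powr (- (D / 2)) \<le> pi powr (- (D / 2))"
        using tn by (intro powr_mono2') (auto simp: D_def algebra_simps)
      moreover have "exp (- ((norm x)\<^sup>2 / (4 * (t n + 1 / 4)))) \<le> exp (- ((norm x)\<^sup>2 / 5))"
      proof -
        have "(norm x)\<^sup>2 / 5 \<le> (norm x)\<^sup>2 / (4 * (t n + 1 / 4))"
          using tn by (intro divide_left_mono) auto
        then show ?thesis by (simp only: exp_le_cancel_iff neg_le_iff_le)
      qed
      ultimately have "heat_kernel (t n + 1 / 4) x \<le> pi powr (- (D / 2)) * exp (- ((norm x)\<^sup>2 / 5))"
        unfolding heat_kernel_def D_def[symmetric] by (intro mult_mono) auto
      then have "A * pi powr (D / 2) * heat_kernel (t n + 1 / 4) x \<le> A * pi powr (D / 2) * (pi powr (- (D / 2)) * exp (- ((norm x)\<^sup>2 / 5)))"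
        using A by (intro mult_left_mono) auto
      also have "\<dots> = A * exp (- ((norm x)\<^sup>2 / 5))" by (simp add: powr_minus)
      finally show "A * pi powr (D / 2) * heat_kernel (t n + 1 / 4) x \<le> A * exp (- ((norm x)\<^sup>2 / 5))" .
    qed
    finally show ?thesis .
  qed
  obtain B where B: "0 \<le> B" "bnd r s (\<lambda>x::'a. ennreal (exp (- ((norm x)\<^sup>2 / 5)))) B"
    using bnd_gaussian[OF r(1) s] by blast
  have B2: "bnd r s (\<lambda>x::'a. ennreal (2 * A) * ennreal (exp (- ((norm x)\<^sup>2 / 5)))) (2 * A * B)"
    using A B by (intro bnd_scale) auto
  have "\<exists>n0. \<forall>n\<ge>n0. bnd r s (nrm (\<lambda>x. heat (t n) g x - g x)) e"
  proof (rule bnd_dominated_convergence[OF r(1) _ _ B2])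
    show "AE x in lborel. nrm (\<lambda>x. heat (t n) g x - g x) x \<le> ennreal (2 * A) * ennreal (exp (- ((norm x)\<^sup>2 / 5)))" for n
    proof (intro AE_I2)
      fix x
      have 1: "norm (heat (t n) g x) \<le> A * exp (- ((norm x)\<^sup>2 / 5))" using hA[of n x] A by simp
      have 2: "norm (g x) \<le> A * exp (- ((norm x)\<^sup>2 / 5))"
        using gA[of x] mult_left_mono[OF e5[of x] A] by simp
      have "norm (heat (t n) g x - g x) \<le> 2 * A * exp (- ((norm x)\<^sup>2 / 5))"
        using 1 2 norm_triangle_ineq4[of "heat (t n) g x" "g x"] by simp
      then show "nrm (\<lambda>x. heat (t n) g x - g x) x \<le> ennreal (2 * A) * ennreal (exp (- ((norm x)\<^sup>2 / 5)))"
        using A by (simp flip: ennreal_mult add: ennreal_leI)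
    qed
    show "AE x in lborel. (\<lambda>n. heat (t n) g x - g x) \<longlonglongrightarrow> 0"
    proof (intro AE_I2)
      fix x
      have "t \<longlonglongrightarrow> 0"
        by (rule tendsto_sandwich[OF _ _ tendsto_const LIMSEQ_Suc[OF lim_1_over_n]]) (use t in \<open>auto intro!: always_eventually less_imp_le\<close>)
      then have "filterlim t (at_right 0) sequentially"
        using t(1) by (auto simp: filterlim_at less_imp_neq[symmetric] intro!: always_eventually)
      from filterlim_compose[OF heat_tendsto_pointwise[OF g m] this]
      show "(\<lambda>n. heat (t n) g x - g x) \<longlonglongrightarrow> 0" by (simp add: LIM_zero_iff)
    qed
  qed (use e in auto)
  with t(3) show False by blast
qed

text \<open>Density argument with three terms; the semigroup is uniformly bounded by
  \<open>hop_bnd\<close> with equal exponents and equal weights.\<close>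

lemma heat_strong_continuity:
  fixes f :: "'a::euclidean_space \<Rightarrow> 'k::euclidean_space"
  assumes r: "0 < r" "r \<le> 1" and s: "- real DIM('a) * r < s" "s < real DIM('a) * (1 - r)"
    and f[measurable]: "f \<in> borel_measurable lborel" and B: "bnd r s (nrm f) B" "0 \<le> B" and e: "0 < e"
  shows "eventually (\<lambda>t. bnd r s (nrm (\<lambda>x. heat t f x - f x)) e) (at_right 0)"
proof -
  obtain C where C: "0 < C" "\<And>t F B. 0 < t \<Longrightarrow> F \<in> borel_measurable lborel \<Longrightarrow> 0 \<le> B \<Longrightarrow> bnd r s F B \<Longrightarrow>
        bnd r s (hop t F :: 'a \<Rightarrow> ennreal) (C * B)"
    using hop_bnd[of r r s s, where ?'a='a] r s by auto
  \<comment> \<open>Makes (C + 1) \<eta> = e / 2, the share of the two terms that contain f -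
    g.\<close>
  define \<eta> where "\<eta> = e / 2 / (C + 1)"
  have "C + 1 \<noteq> 0" using C(1) by simp
  from iffD1[OF nonzero_eq_divide_eq[OF this] \<eta>_def] have "\<eta> * (C + 1) = e / 2" .
  then have \<eta>: "C * \<eta> + \<eta> = e / 2" by (simp only: distrib_left mult_1_right mult.commute)
  have \<eta>0: "0 < \<eta>" using e C(1) by (simp add: \<eta>_def)
  obtain g n where g: "0 < n" "continuous_on UNIV g" "\<And>x. norm (g x) \<le> n" "\<And>x. g x \<noteq> 0 \<Longrightarrow> norm x \<le> n"
    and fg: "bnd r s (nrm (\<lambda>x. f x - g x)) \<eta>"
    using continuous_dense[OF r f B(1) \<eta>0] by blast
  have [measurable]: "g \<in> borel_measurable lborel" using borel_measurable_continuous_onI[OF g(2)] by simp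
  have ev: "eventually (\<lambda>t. bnd r s (nrm (\<lambda>x. heat t g x - g x)) (e / 2)) (at_right 0)"
    using heat_strong_continuity_dense[OF r s(1) g(2) g(3) g(4)] e by simp
  have gb: "bnd r s (nrm g) (B + \<eta>)"
  proof (rule bnd_mono)
    show "bnd r s (\<lambda>x. nrm f x + nrm (\<lambda>x. f x - g x) x) (B + \<eta>)"
      using B fg \<eta>0 r by (intro bnd_add) auto
    show "AE x in lborel. nrm g x \<le> nrm f x + nrm (\<lambda>x. f x - g x) x"
      by (intro AE_I2 ennreal_norm_le_add)
  qed (use B \<eta>0 r in auto)
  from ev eventually_at_right_less[of "0::real"] show ?thesis
  proof eventually_elim
    case (elim t)
    have [measurable]: "heat t f \<in> borel_measurable lborel" "heat t g \<in> borel_measurable lborel"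
      by (intro borel_measurable_heat; measurable)+
    have finf: "AE x in lborel. hop t (nrm f) x < top"
      using C(2)[OF elim(2) _ B(2,1)] by (intro bnd_imp_AE_finite) auto
    have fing: "AE x in lborel. hop t (nrm g) x < top"
      using C(2)[OF elim(2) _ _ gb] B \<eta>0 by (intro bnd_imp_AE_finite) auto
    have "bnd r s (\<lambda>x. (hop t (nrm (\<lambda>x. f x - g x)) x + nrm (\<lambda>x. f x - g x) x) + nrm (\<lambda>x. heat t g x - g x) x) ((C * \<eta> + \<eta>) + e / 2)"
      using elim \<eta>0 C(1) e r fg by (intro bnd_add C(2)) auto
    then show ?case
    proof (rule bnd_mono)
      show "AE x in lborel. nrm (\<lambda>x. heat t f x - f x) x
          \<le> (hop t (nrm (\<lambda>x. f x - g x)) x + nrm (\<lambda>x. f x - g x) x) + nrm (\<lambda>x. heat t g x - g x) x"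
        using finf fing
      proof eventually_elim
        case (elim x)
        have d: "heat t (\<lambda>y. f y - g y) x = heat t f x - heat t g x"
          using \<open>0 < t\<close> elim by (intro heat_diff) auto
        have 1: "nrm (heat t (\<lambda>y. f y - g y)) x \<le> hop t (nrm (\<lambda>x. f x - g x)) x"
          using \<open>0 < t\<close> by (intro norm_heat_le) auto
        have "heat t f x - f x = (heat t (\<lambda>y. f y - g y) x - (f x - g x)) + (heat t g x - g x)"
          by (simp add: d)
        then have "norm (heat t f x - f x) \<le> (norm (heat t (\<lambda>y. f y - g y) x) + norm (f x - g x)) + norm (heat t g x - g x)"
          by (simp only:) (intro order_trans[OF norm_triangle_ineq] add_right_mono norm_triangle_ineq4)
        then have "nrm (\<lambda>x. heat t f x - f x) x \<le> ennreal ((norm (heat t (\<lambda>y. f y - g y) x) + norm (f x - g x)) + norm (heat t g x - g x))"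
          by (rule ennreal_leI)
        also have "\<dots> = (nrm (heat t (\<lambda>y. f y - g y)) x + nrm (\<lambda>x. f x - g x) x) + nrm (\<lambda>x. heat t g x - g x) x"
          by (simp add: ennreal_plus)
        finally show ?case using 1 by (meson add_right_mono order_trans)
      qed
    qed (use \<eta> \<eta>0 e C(1) r in auto)
  qed
qed

text \<open>The kernel is symmetric, so the semigroup can be moved to the test function, which lies
  in L^1 with weight -s. There strong continuity is available: its two conditions on the weight
  become s < d and 0 < s.\<close>

lemma heat_weak_star:
  fixes f :: "'a::euclidean_space \<Rightarrow> 'k::euclidean_space" and \<phi> :: "'a \<Rightarrow> real"
  assumes s: "0 < s" "s < real DIM('a)"
    and f[measurable]: "f \<in> borel_measurable lborel" and B: "bnd 0 s (nrm f) B" "0 \<le> B"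
    and \<phi>[measurable]: "\<phi> \<in> borel_measurable lborel" and P: "bnd 1 (- s) (nrm \<phi>) P" "0 \<le> P"
  shows "((\<lambda>t. LINT x|lborel. \<phi> x *\<^sub>R heat t f x) \<longlongrightarrow> (LINT x|lborel. \<phi> x *\<^sub>R f x)) (at_right 0)"
proof (rule tendstoI)
  fix e :: real assume e: "0 < e"
  define \<eta> where "\<eta> = e / 2 / (B + 1)"
  have \<eta>: "0 < \<eta>" "\<eta> * B < e"
  proof -
    show "0 < \<eta>" using e B by (simp add: \<eta>_def)
    have "B + 1 \<noteq> 0" using B by simp
    from iffD1[OF nonzero_eq_divide_eq[OF this] \<eta>_def] have "\<eta> * (B + 1) = e / 2" .
    with \<open>0 < \<eta>\<close> e show "\<eta> * B < e" by (simp add: algebra_simps)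
  qed
  obtain C where C: "0 < C" "\<And>t F B. 0 < t \<Longrightarrow> F \<in> borel_measurable lborel \<Longrightarrow> 0 \<le> B \<Longrightarrow> bnd 0 s F B \<Longrightarrow>
        bnd 0 s (hop t F :: 'a \<Rightarrow> ennreal) (C * B)"
    using hop_bnd[of 0 0 s s, where ?'a='a] s by auto
  have "eventually (\<lambda>t. bnd 1 (- s) (nrm (\<lambda>x. heat t \<phi> x - \<phi> x)) \<eta>) (at_right 0)"
    using s P \<eta> by (intro heat_strong_continuity[where B=P]) auto
  with eventually_at_right_less[of "0::real"]
  show "eventually (\<lambda>t. dist (LINT x|lborel. \<phi> x *\<^sub>R heat t f x) (LINT x|lborel. \<phi> x *\<^sub>R f x) < e) (at_right 0)"
  proof eventually_elim
    case (elim t)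
    have [measurable]: "heat t f \<in> borel_measurable lborel" "heat t \<phi> \<in> borel_measurable lborel"
      by (intro borel_measurable_heat; measurable)+
    have pair: "(\<integral>\<^sup>+x. nrm \<psi> x * nrm f x \<partial>lborel) \<le> ennreal (Q * B)" if "bnd 1 (- s) (nrm \<psi>) Q" "0 \<le> Q" "\<psi> \<in> borel_measurable lborel"
      for \<psi> :: "'a \<Rightarrow> real" and Q
      using that B by (intro bnd_pairing[where s=s]) auto
    have int: "integrable lborel (\<lambda>x. \<psi> x *\<^sub>R f x)" if "bnd 1 (- s) (nrm \<psi>) Q" "0 \<le> Q" and [measurable]: "\<psi> \<in> borel_measurable lborel"
      for \<psi> :: "'a \<Rightarrow> real" and Q
      using pair[OF that] by (intro integrableI_bounded) (auto simp: ennreal_mult intro: le_less_trans)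
    have i1: "integrable lborel (\<lambda>x. \<phi> x *\<^sub>R f x)" using P by (intro int) auto
    have i2: "integrable lborel (\<lambda>x. (heat t \<phi> x - \<phi> x) *\<^sub>R f x)" using elim \<eta> by (intro int[of _ \<eta>]) auto
    have "- s < real DIM('a) * (1 - 1)" using s by simp
    from hop_pointwise_bnd[OF zero_le_one order_refl this] obtain C1 where "\<And>t F x B. 0 < t \<Longrightarrow> F \<in> borel_measurable lborel \<Longrightarrow>
        0 \<le> B \<Longrightarrow> bnd 1 (- s) F B \<Longrightarrow> hop t F (x::'a) \<le> ennreal (C1 * t powr (- (real DIM('a) * 1 / 2)) * (sqrt t + norm x) powr (- (- s)) * B)"
      by blast
    from this[OF elim(1) _ P(2,1)] have fin\<phi>: "hop t (nrm \<phi>) y < top" for y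
      by (rule le_less_trans[OF _ ennreal_less_top]) measurable
    have fub: "(LINT x|lborel. \<phi> x *\<^sub>R heat t f x) = (LINT y|lborel. heat t \<phi> y *\<^sub>R f y)"
    proof -
      have "(LINT x|lborel. \<phi> x *\<^sub>R heat t f x) = (LINT x|lborel. (LINT y|lborel. \<phi> x *\<^sub>R heat_kernel t (x - y) *\<^sub>R f y))"
        using elim by (simp only: heat_eq_lborel[OF f less_imp_neq[symmetric]] integral_scaleR_right)
      also have "\<dots> = (LINT y|lborel. (LINT x|lborel. \<phi> x *\<^sub>R heat_kernel t (x - y) *\<^sub>R f y))"
      proof (rule lborel_pair.Fubini_integral[symmetric])
        have "(\<integral>\<^sup>+p. ennreal (norm (case p of (x, y) \<Rightarrow> \<phi> x *\<^sub>R heat_kernel t (x - y) *\<^sub>R f y)) \<partial>(lborel \<Otimes>\<^sub>M lborel))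
          = (\<integral>\<^sup>+x. (\<integral>\<^sup>+y. nrm \<phi> x * (ennreal (heat_kernel t (x - y)) * nrm f y) \<partial>lborel) \<partial>lborel)"
          by (subst lborel.nn_integral_fst[symmetric]) (auto simp: ennreal_mult abs_mult mult.assoc)
        also have "\<dots> = (\<integral>\<^sup>+x. nrm \<phi> x * hop t (nrm f) x \<partial>lborel)"
          unfolding hop_def by (intro nn_integral_cong nn_integral_cmult) measurable
        also have "\<dots> \<le> ennreal (P * (C * B))"
          using P B C(1) elim by (intro bnd_pairing[where s=s] C(2)) auto
        finally show "integrable (lborel \<Otimes>\<^sub>M lborel) (\<lambda>(x, y). \<phi> x *\<^sub>R heat_kernel t (x - y) *\<^sub>R f y)"
          by (intro integrableI_bounded) (auto intro: le_less_trans)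
      qed
      also have "\<dots> = (LINT y|lborel. heat t \<phi> y *\<^sub>R f y)"
      proof (intro Bochner_Integration.integral_cong refl)
        fix y
        have "(LINT x|lborel. \<phi> x *\<^sub>R heat_kernel t (x - y) *\<^sub>R f y) = (LINT x|lborel. (heat_kernel t (y - x) *\<^sub>R \<phi> x) *\<^sub>R f y)"
          by (intro Bochner_Integration.integral_cong refl) (simp add: heat_kernel_minus_commute mult.commute)
        also have "\<dots> = (LINT x|lborel. heat_kernel t (y - x) *\<^sub>R \<phi> x) *\<^sub>R f y"
          by (rule integral_scaleR_left) (rule integrable_heat[OF \<phi> fin\<phi>])
        finally show "(LINT x|lborel. \<phi> x *\<^sub>R heat_kernel t (x - y) *\<^sub>R f y) = heat t \<phi> y *\<^sub>R f y"
          using elim by (simp only: heat_eq_lborel[OF \<phi> less_imp_neq[symmetric]])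
      qed
      finally show ?thesis .
    qed
    have "(LINT x|lborel. \<phi> x *\<^sub>R heat t f x) - (LINT x|lborel. \<phi> x *\<^sub>R f x) = (LINT x|lborel. (heat t \<phi> x - \<phi> x) *\<^sub>R f x)"
    proof -
      have "heat t \<phi> x *\<^sub>R f x = (heat t \<phi> x - \<phi> x) *\<^sub>R f x + \<phi> x *\<^sub>R f x" for x by (simp flip: scaleR_add_left)
      then have "(LINT x|lborel. heat t \<phi> x *\<^sub>R f x) = (LINT x|lborel. (heat t \<phi> x - \<phi> x) *\<^sub>R f x) + (LINT x|lborel. \<phi> x *\<^sub>R f x)"
        using i1 i2 by simp
      then show ?thesis by (simp add: fub)
    qed
    then have "ennreal (norm ((LINT x|lborel. \<phi> x *\<^sub>R heat t f x) - (LINT x|lborel. \<phi> x *\<^sub>R f x)))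
      \<le> (\<integral>\<^sup>+x. ennreal (norm ((heat t \<phi> x - \<phi> x) *\<^sub>R f x)) \<partial>lborel)"
      using i2 by (simp only: integral_norm_bound_ennreal)
    also have "\<dots> = (\<integral>\<^sup>+x. nrm (\<lambda>x. heat t \<phi> x - \<phi> x) x * nrm f x \<partial>lborel)" by (simp add: ennreal_mult)
    also have "\<dots> \<le> ennreal (\<eta> * B)" using elim \<eta> by (intro pair) auto
    finally have "norm ((LINT x|lborel. \<phi> x *\<^sub>R heat t f x) - (LINT x|lborel. \<phi> x *\<^sub>R f x)) \<le> \<eta> * B"
      using \<eta> B by simp
    with \<eta> show ?case by (simp add: dist_norm)
  qed
qed

section \<open>Mild solutions and their Borel representatives\<close>

lemma recip_infinity [simp]: "recip \<infinity> = 0"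
  by (simp add: recip_def)

lemma recip_ereal [simp]: "recip (ereal p) = 1 / p"
  by (cases "p = 0") (auto simp: recip_def divide_ereal_def zero_ereal_def[symmetric] one_ereal_def inverse_eq_divide)

lemma recip_cases:
  assumes "1 \<le> q"
  obtains "q = \<infinity>" "recip q = 0" | p where "q = ereal p" "1 \<le> p" "recip q = 1 / p" "0 < recip q" "recip q \<le> 1"
  using assms by (cases q) auto

lemma borel_measurable_lebesgue_weight:
  fixes f :: "'a::euclidean_space \<Rightarrow> 'k::euclidean_space"
  assumes [measurable]: "f \<in> borel_measurable lebesgue"
  shows "(\<lambda>x. ennreal (norm x powr s * norm (f x))) \<in> borel_measurable lebesgue"
proof -
  have "(\<lambda>x::'a. norm x powr s) \<in> borel_measurable lborel" by measurable
  from measurable_completion[OF this] have [measurable]: "(\<lambda>x::'a. norm x powr s) \<in> borel_measurable lebesgue" .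
  show ?thesis by measurable
qed

text \<open>The bridge between the norms of the theorem, taken over Lebesgue measure, and the bounds
  over \<open>lborel\<close>; completion changes neither integrals nor null sets here.\<close>

lemma wnorm_le_iff:
  fixes f :: "'a::euclidean_space \<Rightarrow> 'k::euclidean_space"
  assumes q: "1 \<le> q" and f: "f \<in> borel_measurable lebesgue" and B: "0 \<le> B"
  shows "wnorm q s f \<le> ennreal B \<longleftrightarrow> bnd (recip q) s (nrm f) B"
proof (cases rule: recip_cases[OF q])
  case 1
  have m: "(\<lambda>x. ennreal (norm x powr s * norm (f x))) \<in> borel_measurable lebesgue"
    using f by (rule borel_measurable_lebesgue_weight)
  have "esssup lebesgue (\<lambda>x. ennreal (norm x powr s * norm (f x))) \<le> ennreal B
    \<longleftrightarrow> (AE x in lebesgue. ennreal (norm x powr s * norm (f x)) \<le> ennreal B)"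
  proof
    assume le: "esssup lebesgue (\<lambda>x. ennreal (norm x powr s * norm (f x))) \<le> ennreal B"
    from esssup_AE[of "\<lambda>x. ennreal (norm x powr s * norm (f x))" lebesgue]
    show "AE x in lebesgue. ennreal (norm x powr s * norm (f x)) \<le> ennreal B"
      by eventually_elim (use le in \<open>auto intro: order_trans\<close>)
  qed (rule esssup_I[OF m])
  with 1 show ?thesis by (simp add: wnorm_def bnd_def AE_completion_iff ennreal_mult)
next
  case (2 p)
  define I where "I = (\<integral>\<^sup>+ x. ennreal ((norm x powr s * norm (f x)) powr p) \<partial>lborel)"
  have w: "wnorm q s f = (if I = \<infinity> then \<infinity> else ennreal (enn2real I powr (1 / p)))"
    using 2 by (simp add: wnorm_def I_def nn_integral_completion Let_def)
  have b: "bnd (recip q) s (nrm f) B \<longleftrightarrow> I \<le> ennreal (B powr p)"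
    using 2 by (simp add: bnd_def I_def flip: ennreal_mult)
  show ?thesis unfolding w b
  proof (cases I)
    case (real i)
    have "i powr (1 / p) \<le> B \<longleftrightarrow> i \<le> B powr p"
    proof
      assume "i powr (1 / p) \<le> B"
      then have "(i powr (1 / p)) powr p \<le> B powr p" using 2 by (intro powr_mono2) auto
      then show "i \<le> B powr p" using real 2 by (simp add: powr_powr)
    next
      assume "i \<le> B powr p"
      then have "i powr (1 / p) \<le> (B powr p) powr (1 / p)" using 2 real by (intro powr_mono2) auto
      then show "i powr (1 / p) \<le> B" using B 2 by (simp add: powr_powr)
    qed
    with real B show "(if I = \<infinity> then \<infinity> else ennreal (enn2real I powr (1 / p))) \<le> ennreal B \<longleftrightarrow> I \<le> ennreal (B powr p)"
      by (simp add: ennreal_le_iff)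
  qed (auto simp: top_unique)
qed

lemma bnd_wnorm:
  fixes f :: "'a::euclidean_space \<Rightarrow> 'k::euclidean_space"
  assumes q: "1 \<le> q" and f: "f \<in> wLq q s"
  shows "bnd (recip q) s (nrm f) (enn2real (wnorm q s f))"
  using f wnorm_le_iff[OF q, of f "enn2real (wnorm q s f)" s]
  by (auto simp: wLq_def)

lemma AE_eq_imp_lebesgue_measurable:
  fixes f g :: "'a::euclidean_space \<Rightarrow> 'k::euclidean_space"
  assumes "g \<in> borel_measurable lborel" "AE x in lborel. f x = g x"
  shows "f \<in> borel_measurable lebesgue"
  using assms(2)
  by (intro borel_measurable_AE[OF measurable_completion[OF assms(1)]])
    (auto simp: AE_completion_iff elim: eventually_mono)

lemma wnorm_cong_AE:
  fixes f g :: "'a::euclidean_space \<Rightarrow> 'k::euclidean_space"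
  assumes q: "1 \<le> q" and g: "g \<in> borel_measurable lborel" and fg: "AE x in lborel. f x = g x"
  shows "wnorm q s f = wnorm q s g"
proof -
  have f: "f \<in> borel_measurable lebesgue" using g fg by (rule AE_eq_imp_lebesgue_measurable)
  have g': "g \<in> borel_measurable lebesgue" using g by (rule measurable_completion)
  have ae: "AE x in lborel. nrm f x = nrm g x" using fg by eventually_elim simp
  have "wnorm q s f \<le> ennreal B \<longleftrightarrow> wnorm q s g \<le> ennreal B" if "0 \<le> B" for B
    using that q f g' bnd_cong_AE[OF ae] by (simp add: wnorm_le_iff)
  then have *: "wnorm q s f \<le> c \<longleftrightarrow> wnorm q s g \<le> c" for c by (cases c) auto
  show ?thesis using *[of "wnorm q s f"] *[of "wnorm q s g"] by (auto intro: antisym)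
qed

text \<open>Coordinate by coordinate in the finite basis of the target space.\<close>

lemma completion_ex_borel_measurable_euclidean:
  fixes f :: "'i \<Rightarrow> 'k::euclidean_space"
  assumes f: "f \<in> borel_measurable (completion M)"
  shows "\<exists>g\<in>borel_measurable M. AE x in M. f x = g x"
proof -
  have "\<exists>g\<in>borel_measurable M. AE x in M. f x \<bullet> b = g x" if "b \<in> Basis" for b
    using f by (intro completion_ex_borel_measurable_real borel_measurable_inner) auto
  then obtain g where g: "\<And>b. b \<in> Basis \<Longrightarrow> g b \<in> borel_measurable M" "\<And>b. b \<in> Basis \<Longrightarrow> AE x in M. f x \<bullet> b = g b x"
    by metis
  show ?thesis
  proof
    show "(\<lambda>x. \<Sum>b\<in>Basis. g b x *\<^sub>R b) \<in> borel_measurable M"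
      using g(1) by (intro borel_measurable_sum borel_measurable_scaleR) auto
    have "AE x in M. \<forall>b\<in>Basis. f x \<bullet> b = g b x"
      using g(2) by (intro AE_finite_allI) auto
    then show "AE x in M. f x = (\<Sum>b\<in>Basis. g b x *\<^sub>R b)"
    proof eventually_elim
      case (elim x)
      have "f x = (\<Sum>b\<in>Basis. (f x \<bullet> b) *\<^sub>R b)" by (simp add: euclidean_representation)
      also have "\<dots> = (\<Sum>b\<in>Basis. g b x *\<^sub>R b)" using elim by (intro sum.cong) auto
      finally show ?case .
    qed
  qed
qed

text \<open>Everything under an integral may be replaced by Borel representatives, and this at every
  x; only the value \<open>u t x\<close> on the left of the equation still refers to u.\<close>

lemma integral_equation_at_iff:
  fixes u0 u0' :: "'a::euclidean_space \<Rightarrow> 'k::euclidean_space"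
  assumes u0': "u0' \<in> borel_measurable lborel" and eq: "AE x in lborel. u0 x = u0' x" and t: "0 < t"
    and v: "jmeas v" and uv: "AE \<tau> in lborel. 0 < \<tau> \<longrightarrow> \<tau> < t \<longrightarrow> (AE y in lborel. u \<tau> y = v \<tau> y)"
  shows "integral_equation_at \<gamma> \<alpha> u0 u t x \<longleftrightarrow>
    integrable lborel (\<lambda>y. heat_kernel t (x - y) *\<^sub>R u0' y) \<and>
    (AE \<tau> in lborel. \<tau> \<in> {0<..<t} \<longrightarrow>
       integrable lborel (\<lambda>y. heat_kernel (t - \<tau>) (x - y) *\<^sub>R nonlinearity \<gamma> \<alpha> (v \<tau>) y)) \<and>
    integrable lborel (\<lambda>\<tau>. indicator {0..t} \<tau> *\<^sub>R heat (t - \<tau>) (nonlinearity \<gamma> \<alpha> (v \<tau>)) x) \<and>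
    u t x = Phi \<gamma> \<alpha> u0' v t x"
proof -
  have icong: "integrable lebesgue (\<lambda>y. heat_kernel s (x - y) *\<^sub>R f y) \<longleftrightarrow> integrable lborel (\<lambda>y. heat_kernel s (x - y) *\<^sub>R g y)"
    if fg: "AE y in lborel. f y = g y" and [measurable]: "g \<in> borel_measurable lborel" for s and f g :: "'a \<Rightarrow> 'k"
  proof -
    have f: "(\<lambda>y. heat_kernel s (x - y) *\<^sub>R f y) \<in> borel_measurable lebesgue"
      using fg by (intro AE_eq_imp_lebesgue_measurable[of "\<lambda>y. heat_kernel s (x - y) *\<^sub>R g y"]) (auto elim: eventually_mono)
    have g: "(\<lambda>y. heat_kernel s (x - y) *\<^sub>R g y) \<in> borel_measurable lborel" by measurable
    have "integrable lebesgue (\<lambda>y. heat_kernel s (x - y) *\<^sub>R f y) \<longleftrightarrow> integrable lebesgue (\<lambda>y. heat_kernel s (x - y) *\<^sub>R g y)"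
      using fg f measurable_completion[OF g] by (intro integrable_cong_AE) (auto simp: AE_completion_iff elim: eventually_mono)
    also have "\<dots> \<longleftrightarrow> integrable lborel (\<lambda>y. heat_kernel s (x - y) *\<^sub>R g y)" using g by (rule integrable_completion)
    finally show ?thesis .
  qed
  have nN: "AE \<tau> in lborel. 0 < \<tau> \<longrightarrow> \<tau> < t \<longrightarrow> (AE y in lborel. nonlinearity \<gamma> \<alpha> (u \<tau>) y = nonlinearity \<gamma> \<alpha> (v \<tau>) y)"
    using uv by (auto simp: nonlinearity_def elim!: eventually_mono)
  have N: "jmeas (\<lambda>\<tau>. nonlinearity \<gamma> \<alpha> (v \<tau>))" using v by (rule jmeas_nonlinearity)
  have Ns: "nonlinearity \<gamma> \<alpha> (v \<tau>) \<in> borel_measurable lborel" for \<tau>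
    using borel_measurable_slice[OF v] by (rule borel_measurable_nonlinearity)
  have 1: "integrable lebesgue (\<lambda>y. heat_kernel t (x - y) *\<^sub>R u0 y) \<longleftrightarrow> integrable lborel (\<lambda>y. heat_kernel t (x - y) *\<^sub>R u0' y)"
    using eq u0' by (rule icong)
  have ae: "AE \<tau> in lborel. (\<tau> \<in> {0<..<t} \<longrightarrow> integrable lebesgue (\<lambda>y. heat_kernel (t - \<tau>) (x - y) *\<^sub>R nonlinearity \<gamma> \<alpha> (u \<tau>) y))
     \<longleftrightarrow> (\<tau> \<in> {0<..<t} \<longrightarrow> integrable lborel (\<lambda>y. heat_kernel (t - \<tau>) (x - y) *\<^sub>R nonlinearity \<gamma> \<alpha> (v \<tau>) y))"
    using nN by eventually_elim (use icong[OF _ Ns] in auto)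
  have 2: "(AE \<tau> in lebesgue. \<tau> \<in> {0<..<t} \<longrightarrow> integrable lebesgue (\<lambda>y. heat_kernel (t - \<tau>) (x - y) *\<^sub>R nonlinearity \<gamma> \<alpha> (u \<tau>) y))
     \<longleftrightarrow> (AE \<tau> in lborel. \<tau> \<in> {0<..<t} \<longrightarrow> integrable lborel (\<lambda>y. heat_kernel (t - \<tau>) (x - y) *\<^sub>R nonlinearity \<gamma> \<alpha> (v \<tau>) y))"
    unfolding AE_completion_iff
  proof
    assume "AE \<tau> in lborel. \<tau> \<in> {0<..<t} \<longrightarrow> integrable lebesgue (\<lambda>y. heat_kernel (t - \<tau>) (x - y) *\<^sub>R nonlinearity \<gamma> \<alpha> (u \<tau>) y)"
    with ae show "AE \<tau> in lborel. \<tau> \<in> {0<..<t} \<longrightarrow> integrable lborel (\<lambda>y. heat_kernel (t - \<tau>) (x - y) *\<^sub>R nonlinearity \<gamma> \<alpha> (v \<tau>) y)"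
      by eventually_elim blast
  next
    assume "AE \<tau> in lborel. \<tau> \<in> {0<..<t} \<longrightarrow> integrable lborel (\<lambda>y. heat_kernel (t - \<tau>) (x - y) *\<^sub>R nonlinearity \<gamma> \<alpha> (v \<tau>) y)"
    with ae show "AE \<tau> in lborel. \<tau> \<in> {0<..<t} \<longrightarrow> integrable lebesgue (\<lambda>y. heat_kernel (t - \<tau>) (x - y) *\<^sub>R nonlinearity \<gamma> \<alpha> (u \<tau>) y)"
      by eventually_elim blast
  qed
  have hm: "(\<lambda>\<tau>. heat (t - \<tau>) (nonlinearity \<gamma> \<alpha> (v \<tau>)) x) \<in> borel_measurable lborel"
    using borel_measurable_heat[OF N, of "\<lambda>\<tau>. t - \<tau>" "\<lambda>_. x"] by simp
  have 3: "set_integrable lebesgue {0..t} (\<lambda>\<tau>. heat (t - \<tau>) (nonlinearity \<gamma> \<alpha> (u \<tau>)) x)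
    \<longleftrightarrow> integrable lborel (\<lambda>\<tau>. indicator {0..t} \<tau> *\<^sub>R heat (t - \<tau>) (nonlinearity \<gamma> \<alpha> (v \<tau>)) x)"
    using duhamel_cong(1)[OF N nN] set_integrable_lebesgue_iff(1)[OF hm] by simp
  have 4: "heat t u0 x + (LINT \<tau>:{0..t}|lebesgue. heat (t - \<tau>) (nonlinearity \<gamma> \<alpha> (u \<tau>)) x) = Phi \<gamma> \<alpha> u0' v t x"
    using duhamel_cong(2)[OF N nN, of x] heat_cong_AE[OF eq _ u0', of t x] t by (simp add: Phi_def duhamel_def)
  show ?thesis unfolding integral_equation_at_def 1 2 3 4 using t by simp
qed

text \<open>The time integral runs over a single point, and \<open>heat 0\<close> is the
  identity.\<close>

lemma integral_equation_at_0: "integral_equation_at \<gamma> \<alpha> u0 u 0 x \<longleftrightarrow> u 0 x = u0 x"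
proof -
  have "AE \<tau> in lebesgue. indicat_real {0..0} \<tau> *\<^sub>R heat (0 - \<tau>) (nonlinearity \<gamma> \<alpha> (u \<tau>)) x = 0"
    unfolding AE_completion_iff by (intro AE_I[of _ _ "{0}"]) (auto split: split_indicator_asm)
  then have ae: "AE \<tau> in lebesgue. 0 = indicat_real {0..0} \<tau> *\<^sub>R heat (0 - \<tau>) (nonlinearity \<gamma> \<alpha> (u \<tau>)) x"
    by eventually_elim simp
  have "set_integrable lebesgue {0..0} (\<lambda>\<tau>. heat (0 - \<tau>) (nonlinearity \<gamma> \<alpha> (u \<tau>)) x)"
    unfolding set_integrable_def
    by (rule integrable_cong_AE_imp[OF integrable_zero[of lebesgue] borel_measurable_AE[OF borel_measurable_const ae] ae])
  moreover have "(LINT \<tau>:{0..0}|lebesgue. heat (0 - \<tau>) (nonlinearity \<gamma> \<alpha> (u \<tau>)) x) = 0"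
    using duhamel_zero_time[of "\<lambda>\<tau>. nonlinearity \<gamma> \<alpha> (u \<tau>)" x] by (simp add: duhamel_def)
  ultimately show ?thesis by (simp add: integral_equation_at_def heat_def)
qed

text \<open>Adds the exponent q itself and the range of s' in which the semigroup is continuous at
  time zero, strongly for q < \<infinity> and weakly-* for q = \<infinity>.\<close>

locale kato_data = kato_setting \<gamma> \<alpha> r s s' a a' C0 e E
  for \<gamma> \<alpha> r s s' a a' C0 e and E :: "'a::euclidean_space itself" +
  fixes q :: ereal
  assumes q: "1 \<le> q" and rq: "r = recip q"
    and s'_lower: "- real DIM('a) * r < s'" and s'_upper: "s' < real DIM('a) * (1 - r)"
begin

text \<open>Every solution agrees at every time almost everywhere with a jointly Borel measurable solution,
  namely with the right-hand side of the integral equation.\<close>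

definition bsol :: "real \<Rightarrow> ('a \<Rightarrow> 'k::euclidean_space) \<Rightarrow> (real \<Rightarrow> 'a \<Rightarrow> 'k) \<Rightarrow> real \<Rightarrow> bool"
  where "bsol T u0 u M \<longleftrightarrow> 0 < M \<and> jmeas u \<and> (\<forall>t. 0 < t \<longrightarrow> t \<le> T \<longrightarrow> bnd r s (nrm (u t)) (M * t powr (- \<sigma>)))
    \<and> (\<forall>t. 0 \<le> t \<longrightarrow> t \<le> T \<longrightarrow> (AE x in lborel. u t x = Phi \<gamma> \<alpha> u0 u t x))"

lemma bsolD:
  assumes "bsol T u0 u M"
  shows "0 < M" "jmeas u" "\<And>t. 0 < t \<Longrightarrow> t \<le> T \<Longrightarrow> bnd r s (nrm (u t)) (M * t powr (- \<sigma>))"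
    "\<And>t. 0 \<le> t \<Longrightarrow> t \<le> T \<Longrightarrow> AE x in lborel. u t x = Phi \<gamma> \<alpha> u0 u t x" "kato_on u T M"
  using assms by (auto simp: bsol_def kato_on_def)

lemma wnorm_le: "f \<in> borel_measurable lborel \<Longrightarrow> 0 \<le> B \<Longrightarrow> wnorm q z f \<le> ennreal B \<longleftrightarrow> bnd r z (nrm f) B"
  for f :: "'a \<Rightarrow> 'k::euclidean_space"
  using wnorm_le_iff[OF q, of f] by (simp add: rq measurable_completion)

lemma kato_norm_le_iff:
  fixes u :: "real \<Rightarrow> 'a \<Rightarrow> 'k::euclidean_space"
  assumes u: "\<And>t. 0 < t \<Longrightarrow> t \<le> T \<Longrightarrow> u t \<in> borel_measurable lebesgue" and M: "0 \<le> M"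
  shows "kato_norm q s s' T u \<le> ennreal M \<longleftrightarrow> (\<forall>t. 0 < t \<longrightarrow> t \<le> T \<longrightarrow> bnd r s (nrm (u t)) (M * t powr (- \<sigma>)))"
proof -
  have "ennreal (t powr \<sigma>) * wnorm q s (u t) \<le> ennreal M \<longleftrightarrow> bnd r s (nrm (u t)) (M * t powr (- \<sigma>))"
    if t: "0 < t" "t \<le> T" for t
  proof -
    have 1: "t powr (- \<sigma>) * t powr \<sigma> = 1" using t by (simp flip: powr_add)
    have "ennreal (t powr \<sigma>) * wnorm q s (u t) \<le> ennreal M \<longleftrightarrow> wnorm q s (u t) \<le> ennreal (M * t powr (- \<sigma>))"
    proof
      assume "ennreal (t powr \<sigma>) * wnorm q s (u t) \<le> ennreal M"
      then have "ennreal (t powr (- \<sigma>)) * (ennreal (t powr \<sigma>) * wnorm q s (u t)) \<le> ennreal (t powr (- \<sigma>)) * ennreal M"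
        by (rule mult_left_mono) simp
      then show "wnorm q s (u t) \<le> ennreal (M * t powr (- \<sigma>))"
        using M 1 ennreal_mult'[of "t powr (- \<sigma>)" M] by (simp add: ennreal_mult_left_assoc mult.commute[of _ "t powr (- \<sigma>)"])
    next
      assume "wnorm q s (u t) \<le> ennreal (M * t powr (- \<sigma>))"
      then have "ennreal (t powr \<sigma>) * wnorm q s (u t) \<le> ennreal (t powr \<sigma>) * ennreal (M * t powr (- \<sigma>))"
        by (rule mult_left_mono) simp
      also have "\<dots> = ennreal (M * (t powr (- \<sigma>) * t powr \<sigma>))" using M by (simp add: mult_ac flip: ennreal_mult)
      finally show "ennreal (t powr \<sigma>) * wnorm q s (u t) \<le> ennreal M" using 1 by simp
    qed
    also have "\<dots> \<longleftrightarrow> bnd r s (nrm (u t)) (M * t powr (- \<sigma>))"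
      using wnorm_le_iff[OF q u[OF t], of "M * t powr (- \<sigma>)" s] M by (simp add: rq)
    finally show ?thesis .
  qed
  then show ?thesis by (auto simp: kato_norm_def SUP_le_iff)
qed

text \<open>The Kato bounds give uniqueness at the inner times; at the end points Phi depends on
  inner times alone, so the equation transfers the equality.\<close>

lemma bsol_unique:
  fixes u v :: "real \<Rightarrow> 'a \<Rightarrow> 'k::euclidean_space"
  assumes u: "bsol T u0 u M" and v: "bsol T u0 v M'" and t: "0 \<le> t" "t \<le> T"
  shows "AE x in lborel. u t x = v t x"
proof -
  have lt: "AE x in lborel. u t x = v t x" if t: "0 < t" "t < T" for t
  proof (rule uniqueness[where M="max M M'" and ?u0.0=u0])
    show "kato_on u T (max M M')" "kato_on v T (max M M')"
      using bsolD(1,5)[OF u] bsolD(1,5)[OF v] by (auto intro: kato_on_mono)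
  qed (use bsolD[OF u] bsolD[OF v] t in auto)
  have "Phi \<gamma> \<alpha> u0 u t x = Phi \<gamma> \<alpha> u0 v t x" for x
    using t lt by (intro Phi_cong bsolD(2)[OF v]) auto
  note eq = this
  from bsolD(4)[OF u t] bsolD(4)[OF v t] show ?thesis by eventually_elim (simp add: eq)
qed

lemma bsol_restrict: "bsol T u0 u M \<Longrightarrow> T' \<le> T \<Longrightarrow> bsol T' u0 u M"
  by (auto simp: bsol_def)

lemma Phi_bnd':
  fixes u :: "real \<Rightarrow> 'a \<Rightarrow> 'k::euclidean_space"
  assumes u0: "u0 \<in> borel_measurable lborel" "bnd r s' (nrm u0) B" "0 \<le> B"
    and u: "jmeas u" "kato_on u t M" "0 \<le> M" and t: "0 < t"
  shows "bnd r s' (nrm (Phi \<gamma> \<alpha> u0 u t)) (C0 * B + C0 * M powr \<alpha> * t powr \<delta>)"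
    "AE x in lborel. nrm (\<lambda>x. Phi \<gamma> \<alpha> u0 u t x - heat t u0 x) x \<le> duh (\<lambda>\<tau>. nrm (nonlinearity \<gamma> \<alpha> (u \<tau>))) t x"
proof -
  note [measurable] = u0(1)
  have N[measurable]: "jmeas (\<lambda>\<tau>. nonlinearity \<gamma> \<alpha> (u \<tau>))" using u(1) by (rule jmeas_nonlinearity)
  show 2: "AE x in lborel. nrm (\<lambda>x. Phi \<gamma> \<alpha> u0 u t x - heat t u0 x) x \<le> duh (\<lambda>\<tau>. nrm (nonlinearity \<gamma> \<alpha> (u \<tau>))) t x"
    using bnd_duh_nonlinearity(3)[OF u(1,2) t u(3)]
    by eventually_elim (simp add: Phi_def duhamel_converges(4)[OF N])
  have "bnd r s' (\<lambda>x. hop t (nrm u0) x + duh (\<lambda>\<tau>. nrm (nonlinearity \<gamma> \<alpha> (u \<tau>))) t x) (C0 * B + C0 * M powr \<alpha> * t powr \<delta>)"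
    using t u0 C0 r r_le_1 bnd_duh_nonlinearity(2)[OF u(1,2) t u(3)] by (intro bnd_add hop_data') auto
  then show "bnd r s' (nrm (Phi \<gamma> \<alpha> u0 u t)) (C0 * B + C0 * M powr \<alpha> * t powr \<delta>)"
  proof (rule bnd_mono)
    show "AE x in lborel. nrm (Phi \<gamma> \<alpha> u0 u t) x \<le> hop t (nrm u0) x + duh (\<lambda>\<tau>. nrm (nonlinearity \<gamma> \<alpha> (u \<tau>))) t x"
      using 2
    proof eventually_elim
      case (elim x)
      have "nrm (Phi \<gamma> \<alpha> u0 u t) x \<le> nrm (heat t u0) x + nrm (\<lambda>x. heat t u0 x - Phi \<gamma> \<alpha> u0 u t x) x"
        by (rule ennreal_norm_le_add)
      also have "\<dots> \<le> hop t (nrm u0) x + duh (\<lambda>\<tau>. nrm (nonlinearity \<gamma> \<alpha> (u \<tau>))) t x"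
        using elim t u0(1) by (intro add_mono norm_heat_le) (auto simp: norm_minus_commute)
      finally show ?case .
    qed
  qed (use C0 u0 r in auto)
qed

text \<open>The extra B covers t = 0, where u is u0 itself and the estimate by C0 for positive times
  does not apply.\<close>

lemma bsol_bnd':
  fixes u :: "real \<Rightarrow> 'a \<Rightarrow> 'k::euclidean_space"
  assumes u0: "u0 \<in> borel_measurable lborel" "bnd r s' (nrm u0) B" "0 \<le> B"
    and u: "bsol T u0 u M" and t: "0 \<le> t" "t \<le> T"
  shows "bnd r s' (nrm (u t)) (C0 * B + C0 * M powr \<alpha> * t powr \<delta> + B)"
proof -
  have ae: "AE x in lborel. nrm (u t) x = nrm (Phi \<gamma> \<alpha> u0 u t) x" using bsolD(4)[OF u t] by eventually_elim simp
  have nn: "0 \<le> C0 * B + C0 * M powr \<alpha> * t powr \<delta>" using C0 u0 by simp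
  show ?thesis
  proof (cases "t = 0")
    case True
    show ?thesis unfolding bnd_cong_AE[OF ae]
      by (rule bnd_mono[OF u0(2)]) (use True nn u0 r in auto)
  next
    case False
    have k: "kato_on u t M" using bsolD(1)[OF u] t by (intro kato_on_mono[OF bsolD(5)[OF u]]) auto
    have "bnd r s' (nrm (Phi \<gamma> \<alpha> u0 u t)) (C0 * B + C0 * M powr \<alpha> * t powr \<delta>)"
      using False t bsolD(1)[OF u] by (intro Phi_bnd' u0 bsolD(2)[OF u] k) auto
    then show ?thesis unfolding bnd_cong_AE[OF ae]
      by (rule bnd_mono) (use nn u0 r in auto)
  qed
qed

text \<open>For times at least t0 / 2 the bound of \<open>Phi_time_diff\<close> becomes a modulus of
  continuity g that depends on the increment alone; it serves for approach from the left and from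
  the right.\<close>

lemma bsol_tendsto_pos:
  fixes u :: "real \<Rightarrow> 'a \<Rightarrow> 'k::euclidean_space"
  assumes u0: "u0 \<in> borel_measurable lborel" "bnd r s' (nrm u0) B" "0 \<le> B"
    and u: "bsol T u0 u M" and t0: "0 < t0" "t0 \<le> T"
  shows "wLq_tendsto q s' u (u t0) (at t0 within {0..T})"
proof -
  obtain C where C: "0 < C" "\<And>(u0 :: 'a \<Rightarrow> 'k) B u M t h. u0 \<in> borel_measurable lborel \<Longrightarrow> bnd r s' (nrm u0) B \<Longrightarrow> 0 \<le> B \<Longrightarrow>
    jmeas u \<Longrightarrow> kato_on u (t + h) M \<Longrightarrow> 0 < M \<Longrightarrow> 0 < t \<Longrightarrow> 0 < h \<Longrightarrow>
    bnd r s' (nrm (\<lambda>x. Phi \<gamma> \<alpha> u0 u (t + h) x - Phi \<gamma> \<alpha> u0 u t x))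
      (C * (B * (h / t) + M powr \<alpha> * t powr (- (\<alpha> * \<sigma>)) * h powr (1 - a') + M powr \<alpha> * h powr e * t powr (\<delta> - e)))"
    using Phi_time_diff[where ?'k='k] by blast
  define g where "g h = C * (B * (h / (t0 / 2)) + M powr \<alpha> * (t0 / 2) powr (- (\<alpha> * \<sigma>)) * h powr (1 - a') + M powr \<alpha> * h powr e * T powr (\<delta> - e))" for h
  have M: "0 < M" using bsolD(1)[OF u] .
  have T0: "0 < T" using t0 by simp
  have us: "u t \<in> borel_measurable lborel" for t using bsolD(2)[OF u] by (rule borel_measurable_slice)
  have as: "0 \<le> \<alpha> * \<sigma>" using \<alpha> ss' by simp
  have main: "bnd r s' (nrm (\<lambda>x. u (t + h) x - u t x)) (g h)" if t: "t0 / 2 \<le> t" "0 < h" "t + h \<le> T" for t h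
  proof -
    have tp: "0 < t" using t t0 by simp
    have k: "kato_on u (t + h) M" using M t by (intro kato_on_mono[OF bsolD(5)[OF u]]) auto
    have ae: "AE x in lborel. nrm (\<lambda>x. u (t + h) x - u t x) x = nrm (\<lambda>x. Phi \<gamma> \<alpha> u0 u (t + h) x - Phi \<gamma> \<alpha> u0 u t x) x"
      using bsolD(4)[OF u, of "t + h"] bsolD(4)[OF u, of t] t tp by (auto elim: AE_mp)
    have 1: "h / t \<le> h / (t0 / 2)" using t t0 by (intro divide_left_mono) auto
    have 2: "t powr (- (\<alpha> * \<sigma>)) \<le> (t0 / 2) powr (- (\<alpha> * \<sigma>))" using t t0 as by (intro powr_mono2') auto
    have 3: "t powr (\<delta> - e) \<le> T powr (\<delta> - e)" using t tp \<delta>_ge by (intro powr_mono2) auto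
    show ?thesis unfolding bnd_cong_AE[OF ae]
    proof (rule bnd_mono[OF C(2)[OF u0 bsolD(2)[OF u] k M tp t(2)]])
      show "C * (B * (h / t) + M powr \<alpha> * t powr (- (\<alpha> * \<sigma>)) * h powr (1 - a') + M powr \<alpha> * h powr e * t powr (\<delta> - e)) \<le> g h"
        unfolding g_def using C(1) u0 1 2 3 by (intro mult_left_mono add_mono mult_right_mono) auto
      show "0 \<le> C * (B * (h / t) + M powr \<alpha> * t powr (- (\<alpha> * \<sigma>)) * h powr (1 - a') + M powr \<alpha> * h powr e * t powr (\<delta> - e))"
        using C(1) u0 t tp by (intro mult_nonneg_nonneg add_nonneg_nonneg) auto
    qed (use r in auto)
  qed
  have g0: "0 \<le> g h" if "0 \<le> h" for h
    unfolding g_def using C(1) u0 that t0 by (intro mult_nonneg_nonneg add_nonneg_nonneg) auto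
  have le: "wnorm q s' (\<lambda>x. u t x - u t0 x) \<le> ennreal (g \<bar>t - t0\<bar>)" if t: "t0 / 2 < t" "t \<le> T" "t \<noteq> t0" for t
  proof -
    have "bnd r s' (nrm (\<lambda>x. u t x - u t0 x)) (g \<bar>t - t0\<bar>)"
    proof (cases "t0 < t")
      case True
      then show ?thesis using main[of t0 "t - t0"] t t0 by simp
    next
      case False
      then show ?thesis using main[of t "t0 - t"] t t0 by (simp add: norm_minus_commute)
    qed
    then show ?thesis using us g0[of "\<bar>t - t0\<bar>"] by (subst wnorm_le) auto
  qed
  have abs0: "((\<lambda>t. \<bar>t - t0\<bar>) \<longlongrightarrow> 0) (at t0 within {0..T})"
    by (intro tendsto_rabs_zero LIM_zero tendsto_ident_at)
  have "((\<lambda>t. g \<bar>t - t0\<bar>) \<longlongrightarrow> C * (B * (0 / (t0 / 2)) + M powr \<alpha> * (t0 / 2) powr (- (\<alpha> * \<sigma>)) * 0 powr (1 - a') + M powr \<alpha> * 0 powr e * T powr (\<delta> - e))) (at t0 within {0..T})"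
    unfolding g_def using t0 a' e by (intro tendsto_mult tendsto_add tendsto_divide tendsto_const tendsto_powr' abs0) auto
  then have "((\<lambda>t. ennreal (g \<bar>t - t0\<bar>)) \<longlongrightarrow> ennreal 0) (at t0 within {0..T})"
    using a' e by (intro tendsto_ennrealI) simp
  moreover have "eventually (\<lambda>t. wnorm q s' (\<lambda>x. u t x - u t0 x) \<le> ennreal (g \<bar>t - t0\<bar>)) (at t0 within {0..T})"
  proof -
    have "eventually (\<lambda>t. t0 / 2 < t) (at t0 within {0..T})"
      using t0 by (intro order_tendstoD(1)[OF tendsto_ident_at]) auto
    moreover have "eventually (\<lambda>t. t \<noteq> t0 \<and> t \<in> {0..T}) (at t0 within {0..T})"
      by (simp add: eventually_at_filter)
    ultimately show ?thesis by eventually_elim (simp add: le)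
  qed
  ultimately have ev: "eventually (\<lambda>t. wnorm q s' (\<lambda>x. u t x - u t0 x) \<le> ennreal (g \<bar>t - t0\<bar>)) (at t0 within {0..T})"
    and lim: "((\<lambda>t. ennreal (g \<bar>t - t0\<bar>)) \<longlongrightarrow> 0) (at t0 within {0..T})" by simp_all
  have "((\<lambda>t. wnorm q s' (\<lambda>x. u t x - u t0 x)) \<longlongrightarrow> 0) (at t0 within {0..T})"
    by (rule tendsto_sandwich[OF _ ev tendsto_const lim]) simp
  then show ?thesis unfolding wLq_tendsto_def .
qed

lemma bsol_heat_diff_bnd:
  fixes u :: "real \<Rightarrow> 'a \<Rightarrow> 'k::euclidean_space"
  assumes u0: "u0 \<in> borel_measurable lborel" "bnd r s' (nrm u0) B" "0 \<le> B"
    and u: "bsol T u0 u M" and t: "0 < t" "t \<le> T"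
  shows "bnd r s' (nrm (\<lambda>x. u t x - heat t u0 x)) (C0 * M powr \<alpha> * t powr \<delta>)"
proof -
  have k: "kato_on u t M" using bsolD(1)[OF u] t by (intro kato_on_mono[OF bsolD(5)[OF u]]) auto
  have M: "0 \<le> M" using bsolD(1)[OF u] by simp
  show ?thesis
  proof (rule bnd_mono[OF bnd_duh_nonlinearity(2)[OF bsolD(2)[OF u] k t(1) M]])
    show "AE x in lborel. nrm (\<lambda>x. u t x - heat t u0 x) x \<le> duh (\<lambda>\<tau>. nrm (nonlinearity \<gamma> \<alpha> (u \<tau>))) t x"
      using Phi_bnd'(2)[OF u0 bsolD(2)[OF u] k M t(1)] bsolD(4)[OF u less_imp_le[OF t(1)] t(2)] by eventually_elim simp
  qed (use C0 r in auto)
qed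

lemma ennreal_tendsto_0I:
  fixes f :: "'i \<Rightarrow> ennreal"
  assumes "\<And>c. 0 < c \<Longrightarrow> eventually (\<lambda>x. f x \<le> ennreal c) F"
  shows "(f \<longlongrightarrow> 0) F"
proof (rule order_tendstoI)
  fix c :: ennreal assume "0 < c"
  then obtain d where d: "0 < d" "d < c" using dense by blast
  then obtain d' where d': "d = ennreal d'" "0 < d'" by (cases d) auto
  from assms[OF d'(2)] show "eventually (\<lambda>x. f x < c) F"
    by eventually_elim (use d d' in auto)
qed auto

text \<open>The Duhamel term tends to 0 in norm like t^\<delta> for every q, so the linear evolution
  alone decides in which topology the initial value is attained.\<close>

lemma bsol_initial_tendsto:
  fixes u :: "real \<Rightarrow> 'a \<Rightarrow> 'k::euclidean_space"
  assumes u0[measurable]: "u0 \<in> borel_measurable lborel" and B: "bnd r s' (nrm u0) B" "0 \<le> B"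
    and u: "bsol T u0 u M" and T: "0 < T"
  shows "if q = \<infinity> then weak_star_tendsto s' u (u 0) (at_right 0) else wLq_tendsto q s' u (u 0) (at_right 0)"
proof -
  have us[measurable]: "u t \<in> borel_measurable lborel" for t using bsolD(2)[OF u] by (rule borel_measurable_slice)
  have [measurable]: "heat t u0 \<in> borel_measurable lborel" for t by (intro borel_measurable_heat) measurable
  have u00: "AE x in lborel. u 0 x = u0 x" using bsolD(4)[OF u, of 0] T by simp
  have evT: "eventually (\<lambda>t. t \<le> T) (at_right 0)" using T by (auto simp: eventually_at_right_field intro: less_imp_le)
  have ev0: "eventually (\<lambda>t::real. 0 < t) (at_right 0)" by (rule eventually_at_right_less)
  have td: "((\<lambda>t. K * t powr \<delta>) \<longlongrightarrow> 0) (at_right 0)" for K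
  proof -
    have "((\<lambda>t. K * t powr \<delta>) \<longlongrightarrow> K * 0 powr \<delta>) (at_right 0)"
      using \<delta>_pos by (intro tendsto_mult tendsto_const tendsto_powr' tendsto_ident_at) (auto intro: eventually_mono[OF ev0])
    then show ?thesis by simp
  qed
  have hd: "bnd r s' (nrm (\<lambda>x. u t x - heat t u0 x)) (C0 * M powr \<alpha> * t powr \<delta>)" if "0 < t" "t \<le> T" for t
    using bsol_heat_diff_bnd[OF u0 B u that] .
  show ?thesis
  proof (cases "q = \<infinity>")
    case True
    then have r0: "r = 0" using rq by simp
    have s'0: "0 < s'" "s' < real DIM('a)" using s'_lower s'_upper r0 by auto
    have "((\<lambda>t. LINT x|lebesgue. \<phi> x *\<^sub>R u t x) \<longlongrightarrow> (LINT x|lebesgue. \<phi> x *\<^sub>R u 0 x)) (at_right 0)"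
      if \<phi>: "\<phi> \<in> wLq 1 (- s')" for \<phi> :: "'a \<Rightarrow> real"
    proof -
      have "\<phi> \<in> borel_measurable lebesgue" using \<phi> by (simp add: wLq_def)
      from completion_ex_borel_measurable_euclidean[OF this]
      obtain \<psi> where \<psi>[measurable]: "\<psi> \<in> borel_measurable lborel" and eq: "AE x in lborel. \<phi> x = \<psi> x" by blast
      define P where "P = enn2real (wnorm 1 (- s') \<phi>)"
      have P0: "0 \<le> P" by (simp add: P_def)
      have "bnd (recip 1) (- s') (nrm \<phi>) P" unfolding P_def using \<phi> by (intro bnd_wnorm) auto
      moreover have "recip 1 = 1" using recip_ereal[of 1] by (simp add: one_ereal_def)
      moreover have "AE x in lborel. nrm \<phi> x = nrm \<psi> x" using eq by eventually_elim simp
      ultimately have P: "bnd 1 (- s') (nrm \<psi>) P" using bnd_cong_AE by metis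
      have eqI: "(LINT x|lebesgue. \<phi> x *\<^sub>R v x) = (LINT x|lborel. \<psi> x *\<^sub>R w x)"
        if [measurable]: "w \<in> borel_measurable lborel" and vw: "AE x in lborel. v x = w x" for v w :: "'a \<Rightarrow> 'k"
      proof -
        have ae: "AE x in lborel. \<phi> x *\<^sub>R v x = \<psi> x *\<^sub>R w x" using eq vw by eventually_elim simp
        have m: "(\<lambda>x. \<psi> x *\<^sub>R w x) \<in> borel_measurable lborel" by measurable
        have "(LINT x|lebesgue. \<phi> x *\<^sub>R v x) = (LINT x|lebesgue. \<psi> x *\<^sub>R w x)"
          using ae by (intro integral_cong_AE AE_eq_imp_lebesgue_measurable[OF m ae] measurable_completion[OF m]) (simp add: AE_completion_iff)
        then show ?thesis by (simp add: integral_completion)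
      qed
      have pair: "(\<integral>\<^sup>+x. nrm \<psi> x * nrm w x \<partial>lborel) \<le> ennreal (P * Q)" if "bnd r s' (nrm w) Q" "0 \<le> Q" for w :: "'a \<Rightarrow> 'k" and Q
        using that P P0 r0 by (intro bnd_pairing[where s=s']) auto
      have int: "integrable lborel (\<lambda>x. \<psi> x *\<^sub>R w x)" if "bnd r s' (nrm w) Q" "0 \<le> Q" and [measurable]: "w \<in> borel_measurable lborel"
        for w :: "'a \<Rightarrow> 'k" and Q
        using pair[OF that(1,2)] by (intro integrableI_bounded) (auto simp: ennreal_mult intro: le_less_trans)
      have lim1: "((\<lambda>t. LINT x|lborel. \<psi> x *\<^sub>R heat t u0 x) \<longlongrightarrow> (LINT x|lborel. \<psi> x *\<^sub>R u0 x)) (at_right 0)"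
        using s'0 B P P0 r0 by (intro heat_weak_star[where s=s' and B=B and P=P]) auto
      have lim2: "((\<lambda>t. LINT x|lborel. \<psi> x *\<^sub>R (u t x - heat t u0 x)) \<longlongrightarrow> 0) (at_right 0)"
      proof (rule Lim_null_comparison[OF _ td])
        show "eventually (\<lambda>t. norm (LINT x|lborel. \<psi> x *\<^sub>R (u t x - heat t u0 x)) \<le> P * (C0 * M powr \<alpha>) * t powr \<delta>) (at_right 0)"
          using ev0 evT
        proof eventually_elim
          case (elim t)
          have Q: "0 \<le> C0 * M powr \<alpha> * t powr \<delta>" using C0 by simp
          have "ennreal (norm (LINT x|lborel. \<psi> x *\<^sub>R (u t x - heat t u0 x))) \<le> (\<integral>\<^sup>+x. ennreal (norm (\<psi> x *\<^sub>R (u t x - heat t u0 x))) \<partial>lborel)"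
            by (intro integral_norm_bound_ennreal int[OF hd[OF elim] Q]) measurable
          also have "\<dots> = (\<integral>\<^sup>+x. nrm \<psi> x * nrm (\<lambda>x. u t x - heat t u0 x) x \<partial>lborel)" by (simp add: ennreal_mult)
          also have "\<dots> \<le> ennreal (P * (C0 * M powr \<alpha> * t powr \<delta>))" by (rule pair[OF hd[OF elim] Q])
          finally show ?case using P0 Q by (simp add: mult.assoc)
        qed
      qed
      have "eventually (\<lambda>t. (LINT x|lborel. \<psi> x *\<^sub>R heat t u0 x) + (LINT x|lborel. \<psi> x *\<^sub>R (u t x - heat t u0 x)) = (LINT x|lebesgue. \<phi> x *\<^sub>R u t x)) (at_right 0)"
        using ev0 evT
      proof eventually_elim
        case (elim t)
        have i1: "integrable lborel (\<lambda>x. \<psi> x *\<^sub>R heat t u0 x)"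
        proof (rule int)
          show "bnd r s' (nrm (heat t u0)) (C0 * B)"
            by (rule bnd_mono[OF hop_data'[OF elim(1) _ B(2,1)]]) (use B C0 r elim u0 in \<open>auto intro!: AE_I2 norm_heat_le\<close>)
        qed (use C0 B in auto)
        have i2: "integrable lborel (\<lambda>x. \<psi> x *\<^sub>R (u t x - heat t u0 x))"
          by (rule int[OF hd[OF elim]]) (use C0 in auto)
        have "(LINT x|lebesgue. \<phi> x *\<^sub>R u t x) = (LINT x|lborel. \<psi> x *\<^sub>R heat t u0 x + \<psi> x *\<^sub>R (u t x - heat t u0 x))"
          unfolding eqI[OF us AE_I2[OF refl]] by (simp flip: scaleR_add_right)
        also have "\<dots> = (LINT x|lborel. \<psi> x *\<^sub>R heat t u0 x) + (LINT x|lborel. \<psi> x *\<^sub>R (u t x - heat t u0 x))"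
          using i1 i2 by (rule Bochner_Integration.integral_add)
        finally show ?case by simp
      qed
      from Lim_transform_eventually[OF tendsto_add[OF lim1 lim2] this]
      show ?thesis unfolding eqI[OF u0 u00] by simp
    qed
    with True show ?thesis by (simp add: weak_star_tendsto_def)
  next
    case False
    then have r0: "0 < r" using recip_cases[OF q] rq by metis
    have "((\<lambda>t. wnorm q s' (\<lambda>x. u t x - u 0 x)) \<longlongrightarrow> 0) (at_right 0)"
    proof (rule ennreal_tendsto_0I)
      fix c :: real assume c: "0 < c"
      have "eventually (\<lambda>t. bnd r s' (nrm (\<lambda>x. heat t u0 x - u0 x)) (c / 2)) (at_right 0)"
        using c r0 r_le_1 s'_lower s'_upper B u0 by (intro heat_strong_continuity) auto
      moreover have "eventually (\<lambda>t. C0 * M powr \<alpha> * t powr \<delta> < c / 2) (at_right 0)"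
        using c by (intro order_tendstoD(2)[OF td]) auto
      ultimately show "eventually (\<lambda>t. wnorm q s' (\<lambda>x. u t x - u 0 x) \<le> ennreal c) (at_right 0)"
        using ev0 evT
      proof eventually_elim
        case (elim t)
        have "bnd r s' (\<lambda>x. nrm (\<lambda>x. u t x - heat t u0 x) x + nrm (\<lambda>x. heat t u0 x - u0 x) x) (C0 * M powr \<alpha> * t powr \<delta> + c / 2)"
          using elim hd c C0 r r_le_1 by (intro bnd_add) auto
        then have "bnd r s' (nrm (\<lambda>x. u t x - u 0 x)) c"
        proof (rule bnd_mono)
          show "AE x in lborel. nrm (\<lambda>x. u t x - u 0 x) x \<le> nrm (\<lambda>x. u t x - heat t u0 x) x + nrm (\<lambda>x. heat t u0 x - u0 x) x"
            using u00 by eventually_elim (simp add: ennreal_norm_triangle)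
        qed (use elim c C0 r in auto)
        then show ?case using c us by (subst wnorm_le) auto
      qed
    qed
    with False show ?thesis by (simp add: wLq_tendsto_def)
  qed
qed

lemma bsol_mild_solution:
  fixes u :: "real \<Rightarrow> 'a \<Rightarrow> 'k::euclidean_space"
  assumes u0: "u0 \<in> borel_measurable lborel" and B: "bnd r s' (nrm u0) B" "0 \<le> B"
    and u: "bsol T u0 u M" and T: "0 < T"
  shows "mild_solution \<gamma> \<alpha> q s s' T u0 u" "kato_norm q s s' T u \<le> ennreal M"
proof -
  have us: "u t \<in> borel_measurable lborel" for t using bsolD(2)[OF u] by (rule borel_measurable_slice)
  have M: "0 < M" using bsolD(1)[OF u] .
  show kn: "kato_norm q s s' T u \<le> ennreal M"
    using bsolD(3)[OF u] M by (subst kato_norm_le_iff) (auto intro: measurable_completion[OF us])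
  have c: "u \<in> continuous_wLq q s' T"
    unfolding continuous_wLq_def
  proof (intro CollectI conjI ballI)
    fix t assume t: "t \<in> {0..T}"
    have "wnorm q s' (u t) \<le> ennreal (C0 * B + C0 * M powr \<alpha> * t powr \<delta> + B)"
      using bsol_bnd'[OF u0 B u, of t] t B C0 us by (subst wnorm_le) auto
    then show "u t \<in> wLq q s'"
      using measurable_completion[OF us] by (auto simp: wLq_def intro: le_less_trans)
    show "if q = \<infinity> \<and> t = 0 then weak_star_tendsto s' u (u t) (at t within {0..T}) else wLq_tendsto q s' u (u t) (at t within {0..T})"
    proof (cases "t = 0")
      case True
      with bsol_initial_tendsto[OF u0 B u T] show ?thesis
        by (simp add: at_within_Icc_at_right[OF T] split: if_splits)
    next
      case False
      with bsol_tendsto_pos[OF u0 B u, of t] t show ?thesis by simp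
    qed
  qed
  have k: "u \<in> kato_space q s s' T"
    unfolding kato_space_def
  proof (intro CollectI conjI ballI)
    have "case_prod u \<in> borel_measurable (lborel :: (real \<times> 'a) measure)"
      using bsolD(2)[OF u] by (simp add: lborel_prod)
    then show "(\<lambda>(t, x). u t x) \<in> borel_measurable (lebesgue_on ({0..<T} \<times> UNIV))"
      by (intro measurable_restrict_space1 measurable_completion)
    show "u t \<in> borel_measurable lebesgue" for t by (rule measurable_completion[OF us])
    fix T' assume "T' \<in> {0<..<T}"
    then have "kato_norm q s s' T' u \<le> kato_norm q s s' T u"
      unfolding kato_norm_def by (intro SUP_subset_mono) auto
    from le_less_trans[OF order_trans[OF this kn] ennreal_less_top]
    show "kato_norm q s s' T' u < \<infinity>" by simp
  qed
  have i: "solves_integral_equation \<gamma> \<alpha> T u0 u"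
    unfolding solves_integral_equation_def AE_completion_iff
  proof
    fix t assume t: "t \<in> {0..T}"
    show "AE x in lborel. integral_equation_at \<gamma> \<alpha> u0 u t x"
    proof (cases "t = 0")
      case True
      with bsolD(4)[OF u, of 0] T show ?thesis by (simp add: integral_equation_at_0)
    next
      case False
      with t have t0: "0 < t" "t \<le> T" by auto
      have k: "kato_on u t M" using M t by (intro kato_on_mono[OF bsolD(5)[OF u]]) auto
      have N: "jmeas (\<lambda>\<tau>. nonlinearity \<gamma> \<alpha> (u \<tau>))" using bsolD(2)[OF u] by (rule jmeas_nonlinearity)
      have "AE x in lborel. hop t (nrm u0) x < top"
        using t0 B u0 by (intro bnd_imp_AE_finite[OF hop_data'[OF _ _ _ B(1)]]) auto
      with bnd_duh_nonlinearity(3)[OF bsolD(2)[OF u] k t0(1) less_imp_le[OF M]] bsolD(4)[OF u less_imp_le[OF t0(1)] t0(2)]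
      show ?thesis
      proof eventually_elim
        case (elim x)
        show ?case
          unfolding integral_equation_at_iff[OF u0 AE_I2[OF refl] t0(1) bsolD(2)[OF u] AE_I2[OF impI[OF impI[OF AE_I2[OF refl]]]]]
          using elim duhamel_converges(2,3)[OF N elim(1)] integrable_heat[OF u0 elim(3)] by blast
      qed
    qed
  qed
  have "AE x in lborel. u 0 x = u0 x" using bsolD(4)[OF u, of 0] T by simp
  with c k i show "mild_solution \<gamma> \<alpha> q s s' T u0 u" by (simp add: mild_solution_def AE_completion_iff)
qed

text \<open>A Lebesgue measurable u has a jointly Borel version g', but Fubini gives agreement of
  slices only at almost every time. The right-hand side of the equation sees no more than that, so v
  = Phi of g' agrees with u at every time. Bounds are available on [0, T'] for T' < T, as in the
  definition of the Kato space.\<close>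

lemma kato_solution_representative:
  fixes u :: "real \<Rightarrow> 'a \<Rightarrow> 'k::euclidean_space"
  assumes u0': "u0' \<in> borel_measurable lborel" and u0: "AE x in lborel. u0 x = u0' x"
    and u: "u \<in> kato_space q s s' T" and ie: "solves_integral_equation \<gamma> \<alpha> T u0 u" and T: "0 < T"
  shows "\<exists>v. (\<forall>t\<in>{0..T}. AE x in lborel. u t x = v t x) \<and> (\<forall>t x. t \<le> T \<longrightarrow> v t x = Phi \<gamma> \<alpha> u0' v t x)
    \<and> (\<forall>T'. 0 < T' \<longrightarrow> T' < T \<longrightarrow> (\<exists>M. bsol T' u0' v M))"
proof -
  define S where "S = {0..<T} \<times> (UNIV :: 'a set)"
  have "S \<in> sets borel" unfolding S_def by (intro borel_Times) auto
  then have S: "S \<in> sets lebesgue" by simp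
  have "(\<lambda>p. if p \<in> S then case_prod u p else 0) \<in> borel_measurable lebesgue"
    using u S unfolding borel_measurable_if[OF S] by (simp add: kato_space_def S_def)
  from completion_ex_borel_measurable_euclidean[OF this] obtain g where g: "g \<in> borel_measurable lborel"
    and ug: "AE p in lborel. (if p \<in> S then case_prod u p else 0) = g p" by blast
  define g' where "g' t x = g (t, x)" for t x
  have "case_prod g' = g" by (auto simp: g'_def)
  with g have g'm: "jmeas g'" by (simp add: lborel_prod)
  have "AE p in lborel \<Otimes>\<^sub>M lborel. (if p \<in> S then case_prod u p else 0) = g p"
    unfolding lborel_prod by (rule ug)
  from lborel_pair.AE_pair[OF this]
  have ug': "AE \<tau> in lborel. AE x in lborel. (if (\<tau>, x) \<in> S then u \<tau> x else 0) = g' \<tau> x" by (simp only: g'_def case_prod_conv)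
  have ae: "AE \<tau> in lborel. 0 < \<tau> \<longrightarrow> \<tau> < t \<longrightarrow> (AE x in lborel. u \<tau> x = g' \<tau> x)" if "t \<le> T" for t
    using ug' by eventually_elim (use that in \<open>auto simp: S_def elim!: eventually_mono\<close>)
  define v where "v = Phi \<gamma> \<alpha> u0' g'"
  have vm: "jmeas v" unfolding v_def by (intro jmeas_Phi u0' g'm)
  have uv: "AE x in lborel. u t x = v t x" if t: "t \<in> {0..T}" for t
  proof -
    have i: "AE x in lborel. integral_equation_at \<gamma> \<alpha> u0 u t x"
      using ie t by (simp add: solves_integral_equation_def AE_completion_iff)
    show ?thesis
    proof (cases "t = 0")
      case True
      with i u0 show ?thesis by (auto simp: integral_equation_at_0 v_def elim: AE_mp)
    next
      case False
      then have t0: "0 < t" "t \<le> T" using t by auto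
      from i show ?thesis
        by eventually_elim (simp add: integral_equation_at_iff[OF u0' u0 t0(1) g'm ae[OF t0(2)]] v_def)
    qed
  qed
  have vg: "AE \<tau> in lborel. 0 < \<tau> \<longrightarrow> \<tau> < t \<longrightarrow> (AE x in lborel. v \<tau> x = g' \<tau> x)" if "t \<le> T" for t
    using ae[OF that]
  proof eventually_elim
    case (elim \<tau>)
    show ?case
    proof (intro impI)
      assume "0 < \<tau>" "\<tau> < t"
      with elim uv[of \<tau>] that have "AE x in lborel. u \<tau> x = g' \<tau> x" "AE x in lborel. u \<tau> x = v \<tau> x" by auto
      then show "AE x in lborel. v \<tau> x = g' \<tau> x" by eventually_elim simp
    qed
  qed
  have vP: "v t x = Phi \<gamma> \<alpha> u0' v t x" if "t \<le> T" for t x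
    using Phi_cong[OF g'm vg[OF that], of \<gamma> \<alpha> u0' x] by (simp add: v_def)
  have "\<exists>M. bsol T' u0' v M" if T': "0 < T'" "T' < T" for T'
  proof -
    have fin: "kato_norm q s s' T' u < \<infinity>" using u T' by (simp add: kato_space_def)
    define M where "M = enn2real (kato_norm q s s' T' u)"
    have M: "kato_norm q s s' T' u = ennreal M" "0 \<le> M" using fin by (auto simp: M_def)
    \<comment> \<open>M + 1, since \<open>bsol\<close> asks for a positive bound and the Kato norm
      may be 0.\<close>
    have "bnd r s (nrm (v t)) ((M + 1) * t powr (- \<sigma>))" if t: "0 < t" "t \<le> T'" for t
    proof -
      have "\<And>t. 0 < t \<Longrightarrow> t \<le> T' \<Longrightarrow> u t \<in> borel_measurable lebesgue" using u T' by (simp add: kato_space_def)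
      from iffD1[OF kato_norm_le_iff[OF this M(2)] eq_refl[OF M(1)]]
      have "bnd r s (nrm (u t)) (M * t powr (- \<sigma>))" using t by blast
      moreover have "AE x in lborel. nrm (u t) x = nrm (v t) x"
        using uv[of t] t T' by (auto elim: eventually_mono)
      ultimately have "bnd r s (nrm (v t)) (M * t powr (- \<sigma>))" using bnd_cong_AE by metis
      then show ?thesis by (rule bnd_mono) (use M(2) r in \<open>auto simp: distrib_right\<close>)
    qed
    then have "bsol T' u0' v (M + 1)"
      using M(2) vm vP T' by (auto simp: bsol_def intro!: AE_I2)
    then show ?thesis by blast
  qed
  with uv vP show ?thesis by blast
qed

end

section \<open>Gluing, local solutions and their differences\<close>

text \<open>Needed to estimate an essential supremum over time. For q = \<infinity> a condition on
  almost all x is turned into the vanishing of the integral of a truncated difference, which is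
  measurable in t.\<close>

lemma borel_measurable_wnorm_slice:
  fixes w :: "real \<Rightarrow> 'a::euclidean_space \<Rightarrow> 'k::euclidean_space"
  assumes q: "1 \<le> q" and w[measurable]: "jmeas w"
  shows "(\<lambda>t. wnorm q z (w t)) \<in> borel_measurable lborel"
proof (rule borel_measurableI_le)
  fix c :: ennreal
  show "{t \<in> space lborel. wnorm q z (w t) \<le> c} \<in> sets lborel"
  proof (cases c)
    case (real b)
    have "wnorm q z (w t) \<le> c \<longleftrightarrow> bnd (recip q) z (nrm (w t)) b" for t
      using wnorm_le_iff[OF q measurable_completion[OF borel_measurable_slice[OF w]] real(1)] real(2) by simp
    moreover have "{t \<in> space lborel. bnd (recip q) z (nrm (w t)) b} \<in> sets lborel"
    proof (cases "recip q = 0")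
      case True
      have "(AE x in lborel. ennreal (norm x powr z) * nrm (w t) x \<le> ennreal b) \<longleftrightarrow>
        (\<integral>\<^sup>+x. ennreal (norm x powr z) * nrm (w t) x - ennreal b \<partial>lborel) = 0" for t
        using borel_measurable_slice[OF w, of t] by (subst nn_integral_0_iff_AE) (auto simp: diff_eq_0_iff_ennreal ennreal_mult_less_top)
      moreover have "{t \<in> space lborel. (\<integral>\<^sup>+x. ennreal (norm x powr z) * nrm (w t) x - ennreal b \<partial>lborel) = 0} \<in> sets lborel"
        by measurable
      ultimately show ?thesis using True by (simp add: bnd_def)
    next
      case False
      have "{t \<in> space lborel. (\<integral>\<^sup>+x. epow (ennreal (norm x powr z) * nrm (w t) x) (1 / recip q) \<partial>lborel) \<le> ennreal (b powr (1 / recip q))} \<in> sets lborel"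
        by measurable
      with False show ?thesis by (simp add: bnd_def)
    qed
    ultimately show ?thesis by simp
  qed simp
qed

text \<open>Data are given as Lebesgue measurable functions; this permits a Borel representative
  from the outset.\<close>

lemma mild_solution_cong_data:
  fixes u0 u0' :: "'a::euclidean_space \<Rightarrow> 'k::euclidean_space"
  assumes u0': "u0' \<in> borel_measurable lborel" and eq: "AE x in lborel. u0 x = u0' x"
  shows "mild_solution \<gamma> \<alpha> q s s' T u0 u \<longleftrightarrow> mild_solution \<gamma> \<alpha> q s s' T u0' u"
proof -
  have m: "u0 \<in> borel_measurable lebesgue" using u0' eq by (rule AE_eq_imp_lebesgue_measurable)
  have "(AE x in lebesgue. integral_equation_at \<gamma> \<alpha> u0 u t x) \<longleftrightarrow> (AE x in lebesgue. integral_equation_at \<gamma> \<alpha> u0' u t x)" for t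
  proof (cases "t = 0")
    case True
    have "(AE x in lborel. u 0 x = u0 x) \<longleftrightarrow> (AE x in lborel. u 0 x = u0' x)"
      using eq by (auto elim: AE_mp)
    with True show ?thesis by (simp add: integral_equation_at_0 AE_completion_iff)
  next
    case False
    have "integral_equation_at \<gamma> \<alpha> u0 u t x \<longleftrightarrow> integral_equation_at \<gamma> \<alpha> u0' u t x" for x
    proof -
      have [measurable]: "(\<lambda>y::'a. heat_kernel t (x - y)) \<in> borel_measurable lborel" by measurable
      have "(\<lambda>y::'a. heat_kernel t (x - y)) \<in> borel_measurable lebesgue" by (rule measurable_completion) measurable
      then have "integrable lebesgue (\<lambda>y. heat_kernel t (x - y) *\<^sub>R u0 y) \<longleftrightarrow> integrable lebesgue (\<lambda>y. heat_kernel t (x - y) *\<^sub>R u0' y)"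
        using eq m measurable_completion[OF u0']
        by (intro integrable_cong_AE borel_measurable_scaleR) (auto simp: AE_completion_iff elim: eventually_mono)
      moreover have "heat t u0 x = heat t u0' x" using eq False u0' by (rule heat_cong_AE)
      ultimately show ?thesis by (simp add: integral_equation_at_def)
    qed
    then show ?thesis by simp
  qed
  moreover have "(AE x in lebesgue. u 0 x = u0 x) \<longleftrightarrow> (AE x in lebesgue. u 0 x = u0' x)"
    using eq by (auto simp: AE_completion_iff elim: AE_mp)
  ultimately show ?thesis by (simp add: mild_solution_def solves_integral_equation_def)
qed

context kato_data
begin

section \<open>Restarting and gluing of solutions\<close>

lemma bsol_cong:
  fixes u w :: "real \<Rightarrow> 'a \<Rightarrow> 'k::euclidean_space"
  assumes u: "bsol T u0 u M" and w: "jmeas w" and eq: "\<And>t. 0 \<le> t \<Longrightarrow> t \<le> T \<Longrightarrow> AE x in lborel. w t x = u t x"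
  shows "bsol T u0 w M"
  unfolding bsol_def
proof (intro conjI allI impI)
  fix t assume t: "0 < t" "t \<le> T"
  have "AE x in lborel. nrm (w t) x = nrm (u t) x" using eq[of t] t by (auto elim: eventually_mono)
  then show "bnd r s (nrm (w t)) (M * t powr (- \<sigma>))" using bsolD(3)[OF u t] bnd_cong_AE by metis
next
  fix t assume t: "0 \<le> t" "t \<le> T"
  have "Phi \<gamma> \<alpha> u0 w t x = Phi \<gamma> \<alpha> u0 u t x" for x
    using t eq by (intro Phi_cong bsolD(2)[OF u]) auto
  with eq[OF t] bsolD(4)[OF u t] show "AE x in lborel. w t x = Phi \<gamma> \<alpha> u0 w t x" by (auto elim: AE_mp)
qed (use bsolD(1)[OF u] w in auto)

text \<open>The bound M survives because (t0 + t)^(-\<sigma>) \<le> t^(-\<sigma>).\<close>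

lemma bsol_shift:
  fixes u :: "real \<Rightarrow> 'a \<Rightarrow> 'k::euclidean_space"
  assumes u0: "u0 \<in> borel_measurable lborel" "bnd r s' (nrm u0) B" "0 \<le> B"
    and u: "bsol T u0 u M" and t0: "0 < t0" "t0 \<le> T"
  shows "bsol (T - t0) (Phi \<gamma> \<alpha> u0 u t0) (\<lambda>\<tau>. u (t0 + \<tau>)) M"
  unfolding bsol_def
proof (intro conjI allI impI)
  show "0 < M" using bsolD(1)[OF u] .
  show "jmeas (\<lambda>\<tau>. u (t0 + \<tau>))"
    using measurable_compose[OF _ bsolD(2)[OF u], of "\<lambda>p. (t0 + fst p, snd p)" "lborel \<Otimes>\<^sub>M lborel"]
    by (simp add: split_beta')
  fix t assume t: "0 < t" "t \<le> T - t0"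
  show "bnd r s (nrm (u (t0 + t))) (M * t powr (- \<sigma>))"
  proof (rule bnd_mono[OF bsolD(3)[OF u, of "t0 + t"]])
    show "M * (t0 + t) powr (- \<sigma>) \<le> M * t powr (- \<sigma>)"
      using t t0 ss' \<open>0 < M\<close> by (intro mult_left_mono powr_mono2') auto
  qed (use t t0 \<open>0 < M\<close> r in auto)
next
  fix t assume t: "0 \<le> t" "t \<le> T - t0"
  show "AE x in lborel. u (t0 + t) x = Phi \<gamma> \<alpha> (Phi \<gamma> \<alpha> u0 u t0) (\<lambda>\<tau>. u (t0 + \<tau>)) t x"
  proof (cases "t = 0")
    case True
    with bsolD(4)[OF u, of t0] t0 show ?thesis by simp
  next
    case False
    have "kato_on u (t0 + t) M" using bsolD(1)[OF u] t by (intro kato_on_mono[OF bsolD(5)[OF u]]) auto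
    from Phi_shift[OF u0 bsolD(2)[OF u] this less_imp_le[OF bsolD(1)[OF u]]] bsolD(4)[OF u, of "t0 + t"]
    show ?thesis using False t t0 by (auto elim: AE_mp)
  qed
qed

text \<open>The two solutions are glued at a time after the restarting time \<open>t0\<close>: they agree on the overlap
  by uniqueness, and so the singularity of the restarted solution at \<open>t0\<close> does not enter the Kato
  norm.\<close>

lemma bsol_extend:
  fixes u v :: "real \<Rightarrow> 'a \<Rightarrow> 'k::euclidean_space"
  assumes u0: "u0 \<in> borel_measurable lborel" "bnd r s' (nrm u0) B" "0 \<le> B"
    and u: "bsol T u0 u M" and v: "bsol T1 (Phi \<gamma> \<alpha> u0 u t0) v M1" and t0: "0 < t0" "t0 < T" and T1: "T \<le> t0 + T1"
  shows "\<exists>w M. bsol (t0 + T1) u0 w M"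
proof -
  define w where "w t = (if t \<le> T then u t else v (t - t0))" for t
  note M = bsolD(1)[OF u] and M1 = bsolD(1)[OF v]
  note [measurable] = bsolD(2)[OF u] bsolD(2)[OF v]
  have wm: "jmeas w"
  proof -
    have "(\<lambda>p. case_prod v (fst p - t0, snd p)) \<in> borel_measurable (lborel \<Otimes>\<^sub>M lborel)" by measurable
    moreover have "case_prod w = (\<lambda>p. if fst p \<le> T then case_prod u p else case_prod v (fst p - t0, snd p))"
      by (auto simp: w_def)
    ultimately show ?thesis by (simp only:) measurable
  qed
  have overlap: "AE x in lborel. w (t0 + t) x = v t x" if t: "0 \<le> t" "t \<le> T1" for t
  proof (cases "t0 + t \<le> T")
    case True
    have "AE x in lborel. u (t0 + t) x = v t x"
      using bsol_unique[OF bsol_shift[OF u0 u t0(1)] bsol_restrict[OF v], of t] t0 T1 t True by simp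
    with True show ?thesis by (simp add: w_def)
  qed (use t in \<open>simp add: w_def\<close>)
  have vm1: "jmeas (\<lambda>\<tau>. w (t0 + \<tau>))"
    using measurable_compose[OF _ wm, of "\<lambda>p. (t0 + fst p, snd p)" "lborel \<Otimes>\<^sub>M lborel"]
    by (simp add: split_beta')
  \<comment> \<open>For t \<ge> T one has t - t0 \<ge> c t, so the time weight centred at t0 is
    comparable with the one centred at 0.\<close>
  define c where "c = (T - t0) / T"
  have c: "0 < c" using t0 by (simp add: c_def)
  define M' where "M' = max M (M1 * c powr (- \<sigma>))"
  have M': "0 < M'" "M \<le> M'" "M1 * c powr (- \<sigma>) \<le> M'" using M by (auto simp: M'_def)
  have wb: "bnd r s (nrm (w t)) (M' * t powr (- \<sigma>))" if t: "0 < t" "t \<le> t0 + T1" for t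
  proof (cases "t \<le> T")
    case True
    show ?thesis unfolding w_def if_P[OF True]
      by (rule bnd_mono[OF bsolD(3)[OF u t(1) True]]) (use M M' r in \<open>auto intro!: mult_right_mono\<close>)
  next
    case False
    have "c * t \<le> t - t0"
    proof -
      have "t0 * T \<le> t0 * t" using False t0 by (intro mult_left_mono) auto
      then show ?thesis using t0 by (simp add: c_def field_simps)
    qed
    moreover have "0 < c * t" using c t by simp
    ultimately have "(t - t0) powr (- \<sigma>) \<le> (c * t) powr (- \<sigma>)" using ss' by (intro powr_mono2') auto
    also have "\<dots> = c powr (- \<sigma>) * t powr (- \<sigma>)" by (rule powr_mult)
    finally have "M1 * (t - t0) powr (- \<sigma>) \<le> M1 * c powr (- \<sigma>) * t powr (- \<sigma>)" using M1 by (simp add: mult.assoc)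
    also have "\<dots> \<le> M' * t powr (- \<sigma>)" using M' by (intro mult_right_mono) auto
    finally have le: "M1 * (t - t0) powr (- \<sigma>) \<le> M' * t powr (- \<sigma>)" .
    have "bnd r s (nrm (v (t - t0))) (M1 * (t - t0) powr (- \<sigma>))"
      using False t t0 by (intro bsolD(3)[OF v]) auto
    from bnd_mono[OF this _ _ le r(1)] show ?thesis unfolding w_def if_not_P[OF False] using M1 by simp
  qed
  have wu: "Phi \<gamma> \<alpha> u0 w t = Phi \<gamma> \<alpha> u0 u t" if "t \<le> T" for t
    using that by (intro ext Phi_cong bsolD(2)[OF u]) (auto simp: w_def)
  have "AE x in lborel. w t x = Phi \<gamma> \<alpha> u0 w t x" if t: "0 \<le> t" "t \<le> t0 + T1" for t
  proof (cases "t \<le> T")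
    case True
    with bsolD(4)[OF u t(1) True] show ?thesis by (simp add: wu) (simp add: w_def)
  next
    case False
    define \<tau> where "\<tau> = t - t0"
    have \<tau>: "0 < \<tau>" "\<tau> \<le> T1" "t = t0 + \<tau>" using False t0 t by (auto simp: \<tau>_def)
    have "kato_on w (t0 + \<tau>) M'" using wb \<tau> by (auto simp: kato_on_def)
    from Phi_shift[OF u0 wm this less_imp_le[OF M'(1)] \<tau>(1) t0(1)]
    have "AE x in lborel. Phi \<gamma> \<alpha> u0 w t x = Phi \<gamma> \<alpha> (Phi \<gamma> \<alpha> u0 u t0) (\<lambda>\<tau>. w (t0 + \<tau>)) \<tau> x"
      using t0 by (simp add: \<tau>(3) wu)
    moreover have "Phi \<gamma> \<alpha> (Phi \<gamma> \<alpha> u0 u t0) (\<lambda>\<tau>. w (t0 + \<tau>)) \<tau> x = Phi \<gamma> \<alpha> (Phi \<gamma> \<alpha> u0 u t0) v \<tau> x" for x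
      using \<tau> overlap by (intro Phi_cong bsolD(2)[OF v]) auto
    moreover note bsolD(4)[OF v, of \<tau>] overlap[of \<tau>]
    ultimately show ?thesis using \<tau> by (auto elim: AE_mp)
  qed
  with wb wm M' have "bsol (t0 + T1) u0 w M'" by (simp add: bsol_def)
  then show ?thesis by blast
qed

text \<open>The smallness condition of \<open>picard\<close> with C0 * B for L, stripped of the
  factors \<open>B powr (\<alpha> - 1)\<close> and \<open>T powr \<delta>\<close>.\<close>

definition existence_const :: real
  where "existence_const = 4 * \<alpha> * C0 * (2 * C0) powr (\<alpha> - 1)"

lemma existence_const_pos: "0 < existence_const"
  using \<alpha> C0 by (simp add: existence_const_def)

lemma bnd_heat:
  fixes u0 :: "'a \<Rightarrow> 'k::euclidean_space"
  assumes u0: "u0 \<in> borel_measurable lborel" "bnd r s' (nrm u0) B" "0 \<le> B" and t: "0 < t"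
  shows "bnd r s (nrm (heat t u0)) (C0 * B * t powr (- \<sigma>))" "bnd r s' (nrm (heat t u0)) (C0 * B)"
    "AE x in lborel. hop t (nrm u0) x < top"
proof -
  have 1: "bnd r s (hop t (nrm u0)) (C0 * t powr (- \<sigma>) * B)" and 2: "bnd r s' (hop t (nrm u0)) (C0 * B)"
    using u0 t by (auto intro!: hop_data hop_data')
  have le: "AE x in lborel. nrm (heat t u0) x \<le> hop t (nrm u0) x"
    using u0(1) t by (intro AE_I2 norm_heat_le)
  show "bnd r s (nrm (heat t u0)) (C0 * B * t powr (- \<sigma>))"
    by (rule bnd_mono[OF 1 le]) (use C0 u0 r in \<open>auto simp: mult_ac\<close>)
  show "bnd r s' (nrm (heat t u0)) (C0 * B)"
    by (rule bnd_mono[OF 2 le]) (use C0 u0 r in auto)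
  show "AE x in lborel. hop t (nrm u0) x < top"
    by (rule bnd_imp_AE_finite[OF 2]) (use u0 r in auto)
qed

text \<open>The iteration is run with the exact Kato norm L of the linear evolution, which gives the
  factor 2 in the norm comparison; L \<le> C0 * B expresses the smallness condition and the explicit
  bound through the data.\<close>

lemma local_solution:
  fixes u0 :: "'a \<Rightarrow> 'k::euclidean_space"
  assumes u0: "u0 \<in> borel_measurable lborel" "bnd r s' (nrm u0) B" "0 \<le> B" and T: "0 < T"
    and small: "existence_const * B powr (\<alpha> - 1) * T powr \<delta> \<le> 1"
  shows "\<exists>u. bsol T u0 u (2 * C0 * B + 1) \<and> (\<forall>t. 0 < t \<longrightarrow> t \<le> T \<longrightarrow> bnd r s (nrm (u t)) (2 * C0 * B * t powr (- \<sigma>)))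
    \<and> kato_norm q s s' T u \<le> 2 * kato_norm q s s' T (\<lambda>t. heat t u0)
    \<and> (\<forall>t x. t \<le> T \<longrightarrow> u t x = Phi \<gamma> \<alpha> u0 u t x)"
proof -
  note [measurable] = u0(1)
  have hm: "heat t u0 \<in> borel_measurable lborel" for t
    by (intro borel_measurable_heat) measurable
  have CB: "0 \<le> C0 * B" using C0 u0 by simp
  define L where "L = enn2real (kato_norm q s s' T (\<lambda>t. heat t u0))"
  have le: "kato_norm q s s' T (\<lambda>t. heat t u0) \<le> ennreal (C0 * B)"
    using bnd_heat(1)[OF u0] CB by (subst kato_norm_le_iff) (auto intro: measurable_completion[OF hm])
  from le_less_trans[OF this ennreal_less_top] have eq: "kato_norm q s s' T (\<lambda>t. heat t u0) = ennreal L"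
    by (simp add: L_def)
  have L: "0 \<le> L" "L \<le> C0 * B" using le CB by (auto simp: eq L_def[symmetric] ennreal_le_iff) (simp add: L_def)
  have lin: "bnd r s (nrm (heat t u0)) (L * t powr (- \<sigma>))" if "0 < t" "t \<le> T" for t
    using iffD1[OF kato_norm_le_iff[OF measurable_completion[OF hm] L(1)] eq_refl[OF eq]] that by blast
  have "4 * \<alpha> * C0 * (2 * L) powr (\<alpha> - 1) * T powr \<delta> \<le> existence_const * B powr (\<alpha> - 1) * T powr \<delta>"
  proof -
    have "(2 * L) powr (\<alpha> - 1) \<le> (2 * C0 * B) powr (\<alpha> - 1)" using L \<alpha> by (intro powr_mono2) auto
    then have "(2 * L) powr (\<alpha> - 1) \<le> (2 * C0) powr (\<alpha> - 1) * B powr (\<alpha> - 1)" by (simp only: powr_mult)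
    then have "4 * \<alpha> * C0 * (2 * L) powr (\<alpha> - 1) \<le> 4 * \<alpha> * C0 * ((2 * C0) powr (\<alpha> - 1) * B powr (\<alpha> - 1))"
      using \<alpha> C0 by (intro mult_left_mono) auto
    then show ?thesis by (intro mult_right_mono) (simp_all add: existence_const_def mult_ac)
  qed
  from picard[OF u0(1) L(1) T lin order_trans[OF this small]]
  obtain u where u: "jmeas u" "\<And>t. 0 < t \<Longrightarrow> t \<le> T \<Longrightarrow> bnd r s (nrm (u t)) (2 * L * t powr (- \<sigma>))"
    "\<And>t x. t \<le> T \<Longrightarrow> u t x = Phi \<gamma> \<alpha> u0 u t x" by blast
  have b: "bnd r s (nrm (u t)) (2 * C0 * B * t powr (- \<sigma>))" if "0 < t" "t \<le> T" for t
    by (rule bnd_mono[OF u(2)[OF that]]) (use L r mult_right_mono[OF L(2), of "t powr (- \<sigma>)"] in \<open>auto simp: mult.assoc\<close>)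
  have "bnd r s (nrm (u t)) ((2 * C0 * B + 1) * t powr (- \<sigma>))" if "0 < t" "t \<le> T" for t
    by (rule bnd_mono[OF b[OF that]]) (use u0 C0 r in \<open>auto simp: distrib_right\<close>)
  then have "bsol T u0 u (2 * C0 * B + 1)"
    using u(1,3) u0 C0 by (auto simp: bsol_def add_nonneg_pos intro!: AE_I2)
  moreover have "kato_norm q s s' T u \<le> ennreal (2 * L)"
    using u(2) L by (subst kato_norm_le_iff) (auto intro: measurable_completion[OF borel_measurable_slice[OF u(1)]])
  ultimately show ?thesis using b u(3) L by (auto simp: eq ennreal_mult)
qed

text \<open>A bound \<open>W\<close> for the difference in the Kato norm improves itself to \<open>C0 * b + W / 2\<close>.\<close>

lemma solution_difference:
  fixes u v :: "real \<Rightarrow> 'a \<Rightarrow> 'k::euclidean_space"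
  assumes u0: "u0 \<in> borel_measurable lborel" "bnd r s' (nrm u0) Bu" "0 \<le> Bu"
    and v0: "v0 \<in> borel_measurable lborel" "bnd r s' (nrm v0) Bv" "0 \<le> Bv"
    and d: "bnd r s' (nrm (\<lambda>x. u0 x - v0 x)) b" "0 \<le> b"
    and u: "jmeas u" "\<And>t. 0 < t \<Longrightarrow> t \<le> T \<Longrightarrow> bnd r s (nrm (u t)) (2 * C0 * Bu * t powr (- \<sigma>))"
      "\<And>t x. t \<le> T \<Longrightarrow> u t x = Phi \<gamma> \<alpha> u0 u t x"
    and v: "jmeas v" "\<And>t. 0 < t \<Longrightarrow> t \<le> T \<Longrightarrow> bnd r s (nrm (v t)) (2 * C0 * Bv * t powr (- \<sigma>))"
      "\<And>t x. t \<le> T \<Longrightarrow> v t x = Phi \<gamma> \<alpha> v0 v t x"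
    and small: "existence_const * Bu powr (\<alpha> - 1) * T powr \<delta> \<le> 1" "existence_const * Bv powr (\<alpha> - 1) * T powr \<delta> \<le> 1"
    and t: "0 < t" "t \<le> T"
  shows "bnd r s (nrm (\<lambda>x. u t x - v t x)) (2 * C0 * b * t powr (- \<sigma>))"
    "bnd r s' (nrm (\<lambda>x. u t x - v t x)) (2 * C0 * b)"
proof -
  note [measurable] = u(1) v(1) u0(1) v0(1)
  have us[measurable]: "u t \<in> borel_measurable lborel" "v t \<in> borel_measurable lborel" for t
    using borel_measurable_slice[OF u(1)] borel_measurable_slice[OF v(1)] by auto
  define Mu where "Mu = 2 * C0 * Bu"
  define Mv where "Mv = 2 * C0 * Bv"
  have M: "0 \<le> Mu" "0 \<le> Mv" using C0 u0 v0 by (auto simp: Mu_def Mv_def)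
  have ku: "kato_on u t Mu" and kv: "kato_on v t Mv" if "t \<le> T" for t
    using u(2) v(2) that by (auto simp: kato_on_def Mu_def Mv_def)
  define k where "k = C0 * (\<alpha> * (Mu powr (\<alpha> - 1) + Mv powr (\<alpha> - 1)))"
  have k0: "0 \<le> k" using C0 \<alpha> by (simp add: k_def)
  \<comment> \<open>A quarter of each smallness quantity enters, so k T^\<delta> \<le> 1/2.\<close>
  have "k = (existence_const * Bu powr (\<alpha> - 1) + existence_const * Bv powr (\<alpha> - 1)) / 4"
    by (simp add: k_def Mu_def Mv_def existence_const_def powr_mult field_simps)
  moreover have "(x + y) / 4 * z \<le> 1 / 2" if "x * z \<le> 1" "y * z \<le> 1" for x y z :: real
    using that by (simp add: distrib_right)
  ultimately have "k * T powr \<delta> \<le> 1 / 2" using small by metis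
  moreover have "k * t powr \<delta> \<le> k * T powr \<delta>" if "0 < t" "t \<le> T" for t
    using that k0 \<delta>_pos by (intro mult_left_mono powr_mono2) auto
  ultimately have k: "k * t powr \<delta> \<le> 1 / 2" if "0 < t" "t \<le> T" for t using that by fastforce
  have step: "bnd r s (nrm (\<lambda>x. u t x - v t x)) ((C0 * b + W / 2) * t powr (- \<sigma>))"
    "bnd r s' (nrm (\<lambda>x. u t x - v t x)) (C0 * b + W / 2)"
    if t: "0 < t" "t \<le> T" and W: "0 \<le> W" "kato_on (\<lambda>\<tau> x. u \<tau> x - v \<tau> x) t W" for t W
  proof -
    let ?D = "duh (\<lambda>\<tau>. nrm (\<lambda>y. N (u \<tau>) y - N (v \<tau>) y)) t"
    have Dm: "?D \<in> borel_measurable lborel"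
    proof -
      have "jmeas (\<lambda>\<tau>. nrm (\<lambda>y. N (u \<tau>) y - N (v \<tau>) y))"
        using jmeas_nonlinearity[OF u(1)] jmeas_nonlinearity[OF v(1)] by measurable
      then show ?thesis by measurable
    qed
    have dm: "(\<lambda>x. u0 x - v0 x) \<in> borel_measurable lborel" by measurable
    have hd[measurable]: "heat t (\<lambda>x. u0 x - v0 x) \<in> borel_measurable lborel"
      by (intro borel_measurable_heat) measurable
    have le: "AE x in lborel. nrm (\<lambda>x. u t x - v t x) x \<le> nrm (heat t (\<lambda>x. u0 x - v0 x)) x + ?D x"
      using Phi_diff_AE[OF u(1) ku[OF t(2)] v(1) kv[OF t(2)] t(1) M, of u0 v0] bnd_heat(3)[OF u0 t(1)] bnd_heat(3)[OF v0 t(1)]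
    proof eventually_elim
      case (elim x)
      then show ?case using u(3)[OF t(2)] v(3)[OF t(2)] heat_diff[OF u0(1) v0(1) t(1) elim(2,3)] by simp
    qed
    note D = bnd_duh_nonlinearity_diff[OF u(1) ku[OF t(2)] v(1) kv[OF t(2)] W(2) t(1) M W(1)]
    have eW: "C0 * (\<alpha> * (Mu powr (\<alpha> - 1) + Mv powr (\<alpha> - 1)) * W) = k * W" by (simp add: k_def)
    have Wk: "k * W * t powr \<delta> \<le> W / 2"
      using mult_left_mono[OF k[OF t] W(1)] by (simp add: mult_ac)
    have D1: "bnd r s ?D (k * W * t powr \<delta> * t powr (- \<sigma>))" using D(1) unfolding eW powr_add by (simp add: mult.assoc)
    have D2: "bnd r s' ?D (k * W * t powr \<delta>)" using D(2) unfolding eW .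
    have kW: "0 \<le> k * W * t powr \<delta>" using k0 W by simp
    have cb: "0 \<le> C0 * b" using C0 d by simp
    have "bnd r s (\<lambda>x. nrm (heat t (\<lambda>x. u0 x - v0 x)) x + ?D x) (C0 * b * t powr (- \<sigma>) + k * W * t powr \<delta> * t powr (- \<sigma>))"
      using kW cb by (intro bnd_add bnd_heat(1)[OF dm d t(1)] D1 Dm r r_le_1) auto
    then show "bnd r s (nrm (\<lambda>x. u t x - v t x)) ((C0 * b + W / 2) * t powr (- \<sigma>))"
    proof (rule bnd_mono)
      show "C0 * b * t powr (- \<sigma>) + k * W * t powr \<delta> * t powr (- \<sigma>) \<le> (C0 * b + W / 2) * t powr (- \<sigma>)"
        unfolding distrib_right[symmetric] using Wk by (intro mult_right_mono) auto
    qed (use kW cb le r in auto)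
    have "bnd r s' (\<lambda>x. nrm (heat t (\<lambda>x. u0 x - v0 x)) x + ?D x) (C0 * b + k * W * t powr \<delta>)"
      using kW cb by (intro bnd_add bnd_heat(2)[OF dm d t(1)] D2 Dm r r_le_1) auto
    then show "bnd r s' (nrm (\<lambda>x. u t x - v t x)) (C0 * b + W / 2)"
      by (rule bnd_mono) (use Wk kW cb le r in auto)
  qed
  \<comment> \<open>Solves W (n + 1) = C0 b + W n / 2, whose fixed point is 2 C0 b; W 0 dominates
    the trivial bound Mu + Mv.\<close>
  define W where "W n = 2 * C0 * b + (Mu + Mv) / 2 ^ n" for n :: nat
  have W0: "0 \<le> W n" for n using M C0 d by (simp add: W_def)
  have W: "bnd r s (nrm (\<lambda>x. u t x - v t x)) (W n * t powr (- \<sigma>))" if t: "0 < t" "t \<le> T" for t n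
    using t
  proof (induction n arbitrary: t)
    case 0
    have "bnd r s (\<lambda>x. nrm (u t) x + nrm (v t) x) (Mu * t powr (- \<sigma>) + Mv * t powr (- \<sigma>))"
      using u(2)[OF 0] v(2)[OF 0] M by (intro bnd_add r r_le_1) (auto simp: Mu_def Mv_def)
    then show ?case
    proof (rule bnd_mono)
      have "0 \<le> C0 * b" using C0 d by simp
      then show "Mu * t powr (- \<sigma>) + Mv * t powr (- \<sigma>) \<le> W 0 * t powr (- \<sigma>)"
        unfolding distrib_right[symmetric] by (intro mult_right_mono) (auto simp: W_def)
      show "AE x in lborel. nrm (\<lambda>x. u t x - v t x) x \<le> nrm (u t) x + nrm (v t) x"
        by (auto intro!: AE_I2 ennreal_leI norm_triangle_ineq4 simp flip: ennreal_plus)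
    qed (use M r in auto)
  next
    case (Suc n)
    have "kato_on (\<lambda>\<tau> x. u \<tau> x - v \<tau> x) t (W n)" using Suc by (auto simp: kato_on_def)
    from step(1)[OF Suc.prems W0 this] show ?case by (simp add: W_def field_simps)
  qed
  have lim: "\<exists>n. W n < C" if C: "2 * C0 * b < C" for C
  proof -
    have "(\<lambda>n. W n) \<longlonglongrightarrow> 2 * C0 * b + (Mu + Mv) * 0"
      unfolding W_def divide_inverse power_inverse[symmetric]
      by (intro tendsto_add tendsto_const tendsto_mult LIMSEQ_power_zero) simp
    with C have "eventually (\<lambda>n. W n < C) sequentially" by (auto dest: order_tendstoD(2))
    then show ?thesis by (auto dest: eventually_happens)
  qed
  have cb: "0 \<le> C0 * b" using C0 d by simp
  have kato: "bnd r s (nrm (\<lambda>x. u t x - v t x)) (2 * C0 * b * t powr (- \<sigma>))" if t: "0 < t" "t \<le> T" for t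
  proof (rule bnd_closed)
    fix C assume C: "2 * C0 * b * t powr (- \<sigma>) < C"
    then have "2 * C0 * b < C / t powr (- \<sigma>)" using t by (simp add: field_simps del: powr_minus)
    from lim[OF this] obtain n where "W n < C / t powr (- \<sigma>)" by blast
    then have "W n * t powr (- \<sigma>) \<le> C" using t by (simp add: field_simps)
    then show "bnd r s (nrm (\<lambda>x. u t x - v t x)) C"
      using W0 by (intro bnd_mono[OF W[OF t] _ _ _ r(1)]) auto
  qed (use cb r in auto)
  show "bnd r s (nrm (\<lambda>x. u t x - v t x)) (2 * C0 * b * t powr (- \<sigma>))" by (rule kato[OF t])
  have "kato_on (\<lambda>\<tau> x. u \<tau> x - v \<tau> x) t (2 * C0 * b)" using kato t by (auto simp: kato_on_def)
  from step(2)[OF t _ this] cb show "bnd r s' (nrm (\<lambda>x. u t x - v t x)) (2 * C0 * b)" by (simp add: mult.assoc)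
qed

end

section \<open>Maximal solutions and blow-up\<close>

context kato_data
begin

text \<open>Borel representatives agree before T by \<open>bsol_unique\<close>. At T, where the Kato
  bound may degenerate, the equation itself transfers the equality.\<close>

lemma solution_unique:
  fixes u v :: "real \<Rightarrow> 'a \<Rightarrow> 'k::euclidean_space"
  assumes u0: "u0' \<in> borel_measurable lborel" "AE x in lborel. u0 x = u0' x"
    and u: "u \<in> kato_space q s s' T" "solves_integral_equation \<gamma> \<alpha> T u0 u"
    and v: "v \<in> kato_space q s s' T" "solves_integral_equation \<gamma> \<alpha> T u0 v" and t: "t \<in> {0..T}"
  shows "AE x in lborel. u t x = v t x"
proof (cases "T = 0")
  case True
  have "AE x in lborel. u 0 x = u0 x" "AE x in lborel. v 0 x = u0 x"
    using u(2) v(2) t by (auto simp: solves_integral_equation_def AE_completion_iff integral_equation_at_0 True)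
  then show ?thesis using t True by (auto elim: AE_mp)
next
  case False
  then have T: "0 < T" using t by auto
  obtain u' where u': "\<forall>t\<in>{0..T}. AE x in lborel. u t x = u' t x" "\<forall>t x. t \<le> T \<longrightarrow> u' t x = Phi \<gamma> \<alpha> u0' u' t x"
    "\<forall>T'. 0 < T' \<longrightarrow> T' < T \<longrightarrow> (\<exists>M. bsol T' u0' u' M)"
    using kato_solution_representative[OF u0 u T] by blast
  obtain v' where v': "\<forall>t\<in>{0..T}. AE x in lborel. v t x = v' t x" "\<forall>t x. t \<le> T \<longrightarrow> v' t x = Phi \<gamma> \<alpha> u0' v' t x"
    "\<forall>T'. 0 < T' \<longrightarrow> T' < T \<longrightarrow> (\<exists>M. bsol T' u0' v' M)"
    using kato_solution_representative[OF u0 v T] by blast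
  have eq: "AE x in lborel. u' \<tau> x = v' \<tau> x" if \<tau>: "0 < \<tau>" "\<tau> < T" for \<tau>
    using u'(3) v'(3) \<tau> bsol_unique[of \<tau> u0' u' _ v' _ \<tau>] by auto
  have "0 < T / 2" "T / 2 < T" using T by auto
  then have "jmeas v'" using v'(3) bsolD(2) by blast
  then have "Phi \<gamma> \<alpha> u0' u' t x = Phi \<gamma> \<alpha> u0' v' t x" for x
    using t eq by (intro Phi_cong) auto
  then have "u' t x = v' t x" for x using u'(2) v'(2) t by simp
  then show ?thesis using bspec[OF u'(1) t] bspec[OF v'(1) t] by (auto elim: AE_mp)
qed

text \<open>The uniqueness clause in \<open>max_time\<close> is supplied by
  \<open>solution_unique\<close>, so every mild solution on [0, T] counts.\<close>

lemma mild_le_max_time: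
  fixes u :: "real \<Rightarrow> 'a \<Rightarrow> 'k::euclidean_space"
  assumes u0: "u0 \<in> borel_measurable lborel" and u: "mild_solution \<gamma> \<alpha> q s s' T u0 u" and T: "0 < T"
  shows "ereal T \<le> max_time \<gamma> \<alpha> q s s' u0"
  unfolding max_time_def
proof (rule Sup_upper, intro CollectI exI conjI allI impI ballI)
  fix v t assume v: "mild_solution \<gamma> \<alpha> q s s' T u0 v" and t: "t \<in> {0..T}"
  show "AE x in lebesgue. v t x = u t x"
    unfolding AE_completion_iff
    using u v by (intro solution_unique[OF u0 AE_I2[OF refl] _ _ _ _ t]) (auto simp: mild_solution_def)
qed (use u T in auto)

lemma bsol_of_mild_solution:
  fixes u :: "real \<Rightarrow> 'a \<Rightarrow> 'k::euclidean_space"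
  assumes u0: "u0 \<in> borel_measurable lborel" and u: "mild_solution \<gamma> \<alpha> q s s' T u0 u" and T: "0 < T'" "T' < T"
  shows "\<exists>v M. bsol T' u0 v M \<and> (\<forall>t\<in>{0..T'}. AE x in lborel. u t x = v t x)"
proof -
  have "u \<in> kato_space q s s' T" "solves_integral_equation \<gamma> \<alpha> T u0 u" "0 < T" using u T by (auto simp: mild_solution_def)
  from kato_solution_representative[OF u0 AE_I2[OF refl] this]
  obtain v where v: "\<forall>t\<in>{0..T}. AE x in lborel. u t x = v t x" "\<forall>T'. 0 < T' \<longrightarrow> T' < T \<longrightarrow> (\<exists>M. bsol T' u0 v M)" by blast
  moreover have "{0..T'} \<subseteq> {0..T}" using T by auto
  ultimately show ?thesis using T by blast
qed

lemma bsol_before_max_time: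
  fixes u0 :: "'a \<Rightarrow> 'k::euclidean_space"
  assumes u0: "u0 \<in> borel_measurable lborel" and T: "0 < T" "ereal T < max_time \<gamma> \<alpha> q s s' u0"
  shows "\<exists>v M. bsol T u0 v M"
proof -
  obtain T' u where "T < T'" "mild_solution \<gamma> \<alpha> q s s' T' u0 u"
    using T(2) by (auto simp: max_time_def less_Sup_iff)
  from bsol_of_mild_solution[OF u0 this(2) T(1) this(1)] show ?thesis by blast
qed

text \<open>One jointly measurable function has to be selected from solutions on uncountably many
  intervals. A solution is chosen for each positive rational time below the maximal one, and U takes
  at t the slice of the first one in an enumeration that reaches t; uniqueness makes this consistent
  up to null sets.\<close>

lemma global_bsol:
  fixes u0 :: "'a \<Rightarrow> 'k::euclidean_space"
  assumes u0: "u0 \<in> borel_measurable lborel"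
  shows "\<exists>U. \<forall>T. 0 < T \<longrightarrow> ereal T < max_time \<gamma> \<alpha> q s s' u0 \<longrightarrow> (\<exists>M. bsol T u0 U M)"
proof -
  let ?m = "max_time \<gamma> \<alpha> q s s' u0"
  define Q where "Q = {p :: rat. 0 < p \<and> ereal (of_rat p) < ?m}"
  define v where "v p = (SOME v. \<exists>M. bsol (of_rat p) u0 v M)" for p :: rat
  have v: "\<exists>M. bsol (of_rat p) u0 (v p) M" if "p \<in> Q" for p
  proof -
    have "\<exists>v M. bsol (of_rat p) u0 v M" using that by (intro bsol_before_max_time u0) (auto simp: Q_def)
    then show ?thesis unfolding v_def by (rule someI_ex)
  qed
  define V where "V n = (if from_nat n \<in> Q then v (from_nat n) else (\<lambda>t x. 0))" for n
  have Vm: "jmeas (V n)" for n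
    using v[of "from_nat n"] bsolD(2) by (auto simp: V_def)
  define P where "P n t \<longleftrightarrow> from_nat n \<in> Q \<and> t \<le> real_of_rat (from_nat n)" for n t
  define U where "U t = V (LEAST n. P n t) t" for t
  have Um: "jmeas U"
  proof -
    have "(\<lambda>p::real \<times> 'a. LEAST n. P n (fst p)) \<in> measurable (lborel \<Otimes>\<^sub>M lborel) (count_space UNIV)"
      unfolding P_def by measurable
    from measurable_compose_countable[OF Vm this] show ?thesis by (simp add: U_def split_beta')
  qed
  have "\<exists>M. bsol T u0 U M" if T: "0 < T" "ereal T < ?m" for T
  proof -
    obtain p where p: "T < of_rat p" "ereal (of_rat p) < ?m"
    proof -
      obtain y where y: "T < y" "ereal y < ?m"
        using ereal_dense2[OF T(2)] by auto
      from of_rat_dense[OF y(1)] obtain p where "T < of_rat p" "of_rat p < y" by blast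
      with y that show ?thesis by (metis less_ereal.simps(1) order_less_trans)
    qed
    have "0 < real_of_rat p" using p T by linarith
    then have pQ: "p \<in> Q" using p by (simp add: Q_def)
    from v[OF pQ] obtain M where M: "bsol (of_rat p) u0 (v p) M" by blast
    have "AE x in lborel. U t x = v p t x" if t: "0 \<le> t" "t \<le> T" for t
    proof -
      have "P (to_nat p) t" using pQ p t by (simp add: P_def)
      then have "P (LEAST n. P n t) t" by (rule LeastI)
      then obtain p' where p': "p' \<in> Q" "t \<le> of_rat p'" "U t = v p' t"
        by (auto simp: U_def P_def V_def)
      from v[OF p'(1)] obtain M' where M': "bsol (of_rat p') u0 (v p') M'" by blast
      show ?thesis unfolding p'(3)
        by (rule bsol_unique[OF bsol_restrict[OF M' p'(2)] bsol_restrict[OF M]]) (use t p in auto)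
    qed
    then have "bsol T u0 U M" using Um p by (intro bsol_cong[OF bsol_restrict[OF M]]) auto
    then show ?thesis by blast
  qed
  then show ?thesis by blast
qed

lemma wLq_representative:
  fixes u0 :: "'a \<Rightarrow> 'k::euclidean_space"
  assumes u0: "u0 \<in> wLq q z"
  shows "\<exists>u0'. u0' \<in> borel_measurable lborel \<and> (AE x in lborel. u0 x = u0' x) \<and> bnd r z (nrm u0') (enn2real (wnorm q z u0))"
proof -
  obtain u0' where u0': "u0' \<in> borel_measurable lborel" "AE x in lborel. u0 x = u0' x"
    using completion_ex_borel_measurable_euclidean[of u0 lborel] u0 by (auto simp: wLq_def)
  have "AE x in lborel. nrm u0 x = nrm u0' x" using u0'(2) by eventually_elim simp
  with bnd_wnorm[OF q u0] have "bnd r z (nrm u0') (enn2real (wnorm q z u0))"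
    unfolding rq using bnd_cong_AE by metis
  with u0' show ?thesis by blast
qed

lemma max_time_cong_data:
  fixes u0 u0' :: "'a \<Rightarrow> 'k::euclidean_space"
  assumes "u0' \<in> borel_measurable lborel" "AE x in lborel. u0 x = u0' x"
  shows "max_time \<gamma> \<alpha> q s s' u0 = max_time \<gamma> \<alpha> q s s' u0'"
    "maximal_solution \<gamma> \<alpha> q s s' u0 u = maximal_solution \<gamma> \<alpha> q s s' u0' u"
  unfolding maximal_solution_def max_time_def mild_solution_cong_data[OF assms] by auto

text \<open>The smallness condition at 2 T provides a solution beyond T, hence a maximal time
  strictly above T and agreement with the maximal solution up to and including T.\<close>

lemma local_existence:
  fixes u0 :: "'a \<Rightarrow> 'k::euclidean_space"
  assumes u0: "u0 \<in> wLq q s'" and T: "0 < T"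
    and small: "existence_const * enn2real (wnorm q s' u0) powr (\<alpha> - 1) * (2 * T) powr \<delta> \<le> 1"
  shows "\<exists>u. mild_solution \<gamma> \<alpha> q s s' T u0 u \<and>
    kato_norm q s s' T u \<le> 2 * kato_norm q s s' T (\<lambda>t. heat t u0) \<and>
    ereal T < max_time \<gamma> \<alpha> q s s' u0 \<and>
    (\<exists>U. maximal_solution \<gamma> \<alpha> q s s' u0 U \<and> (\<forall>t\<in>{0..T}. AE x in lebesgue. U t x = u t x))"
proof -
  define B where "B = enn2real (wnorm q s' u0)"
  have B0: "0 \<le> B" by (simp add: B_def)
  obtain u0' where u0': "u0' \<in> borel_measurable lborel" "AE x in lborel. u0 x = u0' x" "bnd r s' (nrm u0') B"
    unfolding B_def using wLq_representative[OF u0] by blast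
  note data = u0'(1,3) B0
  have mild: "\<exists>u M. bsol S u0' u M \<and> mild_solution \<gamma> \<alpha> q s s' S u0' u \<and> kato_norm q s s' S u \<le> 2 * kato_norm q s s' S (\<lambda>t. heat t u0')"
    if S: "0 < S" "existence_const * B powr (\<alpha> - 1) * S powr \<delta> \<le> 1" for S
  proof -
    obtain u where "bsol S u0' u (2 * C0 * B + 1)" "kato_norm q s s' S u \<le> 2 * kato_norm q s s' S (\<lambda>t. heat t u0')"
      using local_solution[OF data S] by blast
    with bsol_mild_solution(1)[OF data this(1) S(1)] show ?thesis by blast
  qed
  have "existence_const * B powr (\<alpha> - 1) * T powr \<delta> \<le> existence_const * B powr (\<alpha> - 1) * (2 * T) powr \<delta>"
    using existence_const_pos T \<delta>_pos by (intro mult_left_mono powr_mono2) auto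
  with small have "existence_const * B powr (\<alpha> - 1) * T powr \<delta> \<le> 1" by (simp add: B_def)
  from mild[OF T this] obtain u M where u: "bsol T u0' u M" "mild_solution \<gamma> \<alpha> q s s' T u0' u"
    "kato_norm q s s' T u \<le> 2 * kato_norm q s s' T (\<lambda>t. heat t u0')" by blast
  have "0 < 2 * T" using T by simp
  from mild[OF this small[folded B_def]] obtain u2 where "mild_solution \<gamma> \<alpha> q s s' (2 * T) u0' u2" by blast
  from mild_le_max_time[OF u0'(1) this] T have "ereal (2 * T) \<le> max_time \<gamma> \<alpha> q s s' u0'" by simp
  moreover have "ereal T < ereal (2 * T)" using T by simp
  ultimately have Tm: "ereal T < max_time \<gamma> \<alpha> q s s' u0'" by (rule less_le_trans[rotated])
  obtain U where U: "\<And>S. 0 < S \<Longrightarrow> ereal S < max_time \<gamma> \<alpha> q s s' u0' \<Longrightarrow> \<exists>M. bsol S u0' U M"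
    using global_bsol[OF u0'(1)] by blast
  have "maximal_solution \<gamma> \<alpha> q s s' u0' U"
    unfolding maximal_solution_def using U bsol_mild_solution(1)[OF data] by blast
  moreover have "AE x in lborel. U t x = u t x" if "t \<in> {0..T}" for t
    using U[OF T Tm] u(1) that bsol_unique by (auto simp: Ball_def)
  moreover have "kato_norm q s s' T (\<lambda>t. heat t u0) = kato_norm q s s' T (\<lambda>t. heat t u0')"
  proof -
    have "heat t u0 = heat t u0'" if "0 < t" for t
      using that u0' by (intro ext heat_cong_AE) auto
    then show ?thesis unfolding kato_norm_def by (intro SUP_cong) auto
  qed
  ultimately show ?thesis
    unfolding mild_solution_cong_data[OF u0'(1,2)] max_time_cong_data[OF u0'(1,2)] AE_completion_iff
    using u(2,3) Tm by (intro exI[of _ u] conjI exI[of _ U] ballI) simp_all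
qed

text \<open>Uniqueness identifies the given mild solutions with those of
  \<open>local_solution\<close>, which carry the quantitative bounds that
  \<open>solution_difference\<close> needs.\<close>

lemma continuous_dependence:
  fixes u0 v0 :: "'a \<Rightarrow> 'k::euclidean_space"
  assumes u0: "u0 \<in> wLq q s'" and v0: "v0 \<in> wLq q s'" and T: "0 < T" "T \<le> Tu" "T \<le> Tv"
    and small: "existence_const * enn2real (wnorm q s' u0) powr (\<alpha> - 1) * Tu powr \<delta> \<le> 1"
      "existence_const * enn2real (wnorm q s' v0) powr (\<alpha> - 1) * Tv powr \<delta> \<le> 1"
    and u: "mild_solution \<gamma> \<alpha> q s s' Tu u0 u" and v: "mild_solution \<gamma> \<alpha> q s s' Tv v0 v"
  shows "Linf_wnorm q s' T (\<lambda>t x. u t x - v t x) \<le> ennreal (2 * C0) * wnorm q s' (\<lambda>x. u0 x - v0 x)"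
    "kato_norm q s s' T (\<lambda>t x. u t x - v t x) \<le> ennreal (2 * C0) * wnorm q s' (\<lambda>x. u0 x - v0 x)"
proof -
  have rep: "\<exists>w0 w. w0 \<in> borel_measurable lborel \<and> (AE x in lborel. u0 x = w0 x) \<and> bnd r s' (nrm w0) (enn2real (wnorm q s' u0))
      \<and> jmeas w \<and> (\<forall>t. 0 < t \<longrightarrow> t \<le> Tu \<longrightarrow> bnd r s (nrm (w t)) (2 * C0 * enn2real (wnorm q s' u0) * t powr (- \<sigma>)))
      \<and> (\<forall>t x. t \<le> Tu \<longrightarrow> w t x = Phi \<gamma> \<alpha> w0 w t x) \<and> (\<forall>t\<in>{0..Tu}. AE x in lborel. u t x = w t x)"
    if u0: "u0 \<in> wLq q s'" and Tu: "0 < Tu" and small: "existence_const * enn2real (wnorm q s' u0) powr (\<alpha> - 1) * Tu powr \<delta> \<le> 1"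
      and u: "mild_solution \<gamma> \<alpha> q s s' Tu u0 u" for u0 :: "'a \<Rightarrow> 'k" and Tu u
  proof -
    obtain w0 where w0: "w0 \<in> borel_measurable lborel" "AE x in lborel. u0 x = w0 x" "bnd r s' (nrm w0) (enn2real (wnorm q s' u0))"
      using wLq_representative[OF u0] by blast
    note data = w0(1,3) enn2real_nonneg
    obtain w where w: "bsol Tu w0 w (2 * C0 * enn2real (wnorm q s' u0) + 1)"
      "\<forall>t. 0 < t \<longrightarrow> t \<le> Tu \<longrightarrow> bnd r s (nrm (w t)) (2 * C0 * enn2real (wnorm q s' u0) * t powr (- \<sigma>))"
      "\<forall>t x. t \<le> Tu \<longrightarrow> w t x = Phi \<gamma> \<alpha> w0 w t x"
      using local_solution[OF data Tu small] by blast
    from bsol_mild_solution(1)[OF data w(1) Tu] u[unfolded mild_solution_cong_data[OF w0(1,2)]]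
    have "\<forall>t\<in>{0..Tu}. AE x in lborel. u t x = w t x"
      by (intro ballI solution_unique[OF w0(1) AE_I2[OF refl]]) (auto simp: mild_solution_def)
    with w0 w(2,3) bsolD(2)[OF w(1)] show ?thesis by (intro exI[of _ w0] exI[of _ w]) simp
  qed
  have "0 < Tu" "0 < Tv" using T by auto
  from rep[OF u0 this(1) small(1) u] obtain u0' u' where u': "u0' \<in> borel_measurable lborel" "AE x in lborel. u0 x = u0' x"
      "bnd r s' (nrm u0') (enn2real (wnorm q s' u0))" "jmeas u'"
      "\<forall>t. 0 < t \<longrightarrow> t \<le> Tu \<longrightarrow> bnd r s (nrm (u' t)) (2 * C0 * enn2real (wnorm q s' u0) * t powr (- \<sigma>))"
      "\<forall>t x. t \<le> Tu \<longrightarrow> u' t x = Phi \<gamma> \<alpha> u0' u' t x" "\<forall>t\<in>{0..Tu}. AE x in lborel. u t x = u' t x"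
    by (elim exE conjE)
  from rep[OF v0 \<open>0 < Tv\<close> small(2) v] obtain v0' v' where v': "v0' \<in> borel_measurable lborel" "AE x in lborel. v0 x = v0' x"
      "bnd r s' (nrm v0') (enn2real (wnorm q s' v0))" "jmeas v'"
      "\<forall>t. 0 < t \<longrightarrow> t \<le> Tv \<longrightarrow> bnd r s (nrm (v' t)) (2 * C0 * enn2real (wnorm q s' v0) * t powr (- \<sigma>))"
      "\<forall>t x. t \<le> Tv \<longrightarrow> v' t x = Phi \<gamma> \<alpha> v0' v' t x" "\<forall>t\<in>{0..Tv}. AE x in lborel. v t x = v' t x"
    by (elim exE conjE)
  note [measurable] = u'(1,4) v'(1,4)
  define b where "b = enn2real (wnorm q s' (\<lambda>x. u0 x - v0 x))"
  have b0: "0 \<le> b" by (simp add: b_def)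
  have ae0: "AE x in lborel. u0 x - v0 x = u0' x - v0' x" using u'(2) v'(2) by eventually_elim simp
  have eq0: "wnorm q s' (\<lambda>x. u0 x - v0 x) = wnorm q s' (\<lambda>x. u0' x - v0' x)"
    by (rule wnorm_cong_AE[OF q _ ae0]) measurable
  have "bnd r s' (\<lambda>x. nrm u0' x + nrm v0' x) (enn2real (wnorm q s' u0) + enn2real (wnorm q s' v0))"
    using u'(3) v'(3) by (intro bnd_add r r_le_1) auto
  then have "bnd r s' (nrm (\<lambda>x. u0' x - v0' x)) (enn2real (wnorm q s' u0) + enn2real (wnorm q s' v0))"
    by (rule bnd_mono) (use r in \<open>auto intro!: AE_I2 ennreal_leI norm_triangle_ineq4 simp flip: ennreal_plus\<close>)
  then have "wnorm q s' (\<lambda>x. u0' x - v0' x) \<le> ennreal (enn2real (wnorm q s' u0) + enn2real (wnorm q s' v0))"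
    by (subst wnorm_le) auto
  from le_less_trans[OF this ennreal_less_top]
  have eqb: "wnorm q s' (\<lambda>x. u0' x - v0' x) = ennreal b" by (simp add: b_def eq0)
  have d: "bnd r s' (nrm (\<lambda>x. u0' x - v0' x)) b"
    using eq_refl[OF eqb] b0 by (subst (asm) wnorm_le) auto
  have mono: "existence_const * x powr (\<alpha> - 1) * T powr \<delta> \<le> existence_const * x powr (\<alpha> - 1) * T' powr \<delta>" if "T \<le> T'" for x T'
    using that T \<delta>_pos existence_const_pos by (intro mult_left_mono powr_mono2) auto
  note small' = order_trans[OF mono[OF T(2)] small(1)] order_trans[OF mono[OF T(3)] small(2)]
  have diff: "bnd r s (nrm (\<lambda>x. u' t x - v' t x)) (2 * C0 * b * t powr (- \<sigma>))"
      "bnd r s' (nrm (\<lambda>x. u' t x - v' t x)) (2 * C0 * b)" if t: "0 < t" "t \<le> T" for t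
    by (rule solution_difference[OF u'(1,3) enn2real_nonneg v'(1,3) enn2real_nonneg d b0 u'(4) _ _ v'(4) _ _ small' t];
      use u'(5,6) v'(5,6) T in auto)+
  have cb: "0 \<le> 2 * C0 * b" using C0 b0 by simp
  have rhs: "ennreal (2 * C0) * wnorm q s' (\<lambda>x. u0 x - v0 x) = ennreal (2 * C0 * b)"
    using C0 b0 by (simp add: eq0 eqb ennreal_mult)
  have ms: "(\<lambda>x. u' t x - v' t x) \<in> borel_measurable lborel" for t
    using borel_measurable_slice[OF u'(4)] borel_measurable_slice[OF v'(4)] by measurable
  have weq: "wnorm q z (\<lambda>x. u t x - v t x) = wnorm q z (\<lambda>x. u' t x - v' t x)" if t: "0 < t" "t \<le> T" for t z
  proof (rule wnorm_cong_AE[OF q ms])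
    show "AE x in lborel. u t x - v t x = u' t x - v' t x"
      using bspec[OF u'(7), of t] bspec[OF v'(7), of t] t T by (auto elim: AE_mp)
  qed
  have "kato_norm q s s' T (\<lambda>t x. u t x - v t x) = kato_norm q s s' T (\<lambda>t x. u' t x - v' t x)"
    unfolding kato_norm_def by (intro SUP_cong refl) (simp add: weq)
  also have "\<dots> \<le> ennreal (2 * C0 * b)"
    using diff(1) cb by (subst kato_norm_le_iff) (auto intro: measurable_completion[OF ms])
  finally show "kato_norm q s s' T (\<lambda>t x. u t x - v t x) \<le> ennreal (2 * C0) * wnorm q s' (\<lambda>x. u0 x - v0 x)"
    unfolding rhs .
  show "Linf_wnorm q s' T (\<lambda>t x. u t x - v t x) \<le> ennreal (2 * C0) * wnorm q s' (\<lambda>x. u0 x - v0 x)"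
    unfolding Linf_wnorm_def rhs
  proof (rule esssup_I)
    have "(\<lambda>t. wnorm q s' (\<lambda>x. u' t x - v' t x)) \<in> borel_measurable lborel"
      by (intro borel_measurable_wnorm_slice[OF q]) measurable
    then have "(\<lambda>t. wnorm q s' (\<lambda>x. u' t x - v' t x)) \<in> borel_measurable (lebesgue_on {0<..<T})"
      by (intro measurable_restrict_space1 measurable_completion)
    then show "(\<lambda>t. wnorm q s' (\<lambda>x. u t x - v t x)) \<in> borel_measurable (lebesgue_on {0<..<T})"
      by (subst measurable_cong[OF weq]) auto
    show "AE t in lebesgue_on {0<..<T}. wnorm q s' (\<lambda>x. u t x - v t x) \<le> ennreal (2 * C0 * b)"
    proof (rule AE_I2)
      fix t assume "t \<in> space (lebesgue_on {0<..<T})"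
      then have t: "0 < t" "t \<le> T" by auto
      show "wnorm q s' (\<lambda>x. u t x - v t x) \<le> ennreal (2 * C0 * b)"
        unfolding weq[OF t] using diff(2)[OF t] cb ms by (subst wnorm_le) auto
    qed
  qed
qed

text \<open>Otherwise restart at t: the datum u(t) admits a solution for time T1, and gluing yields
  a solution on [0, t + T1], beyond Tm.\<close>

lemma lifespan_ge:
  fixes u :: "real \<Rightarrow> 'a \<Rightarrow> 'k::euclidean_space"
  assumes u0: "u0 \<in> wLq q s'" and u: "maximal_solution \<gamma> \<alpha> q s s' u0 u" and Tm: "max_time \<gamma> \<alpha> q s s' u0 = ereal Tm"
    and t: "0 < t" "t < Tm" and T1: "0 < T1"
    and small: "existence_const * enn2real (wnorm q s' (u t)) powr (\<alpha> - 1) * T1 powr \<delta> \<le> 1"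
  shows "t + T1 \<le> Tm"
proof (rule ccontr)
  assume "\<not> t + T1 \<le> Tm"
  obtain u0' where u0': "u0' \<in> borel_measurable lborel" "AE x in lborel. u0 x = u0' x" "bnd r s' (nrm u0') (enn2real (wnorm q s' u0))"
    using wLq_representative[OF u0] by blast
  note data = u0'(1,3) enn2real_nonneg
  \<comment> \<open>The gluing takes place at T'. A Borel representative with a Kato bound is
    available strictly inside an interval of existence, hence the second time T'' between T' and
    Tm.\<close>
  define T' where "T' = (t + Tm) / 2"
  define T'' where "T'' = (T' + Tm) / 2"
  have T': "t < T'" "T' < T''" "T'' < Tm" using t by (auto simp: T'_def T''_def)
  have "mild_solution \<gamma> \<alpha> q s s' T'' u0' u"
    using u T' t unfolding maximal_solution_def mild_solution_cong_data[OF u0'(1,2)] by (auto simp: Tm)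
  then obtain v M where v: "bsol T' u0' v M" "\<forall>t\<in>{0..T'}. AE x in lborel. u t x = v t x"
    using bsol_of_mild_solution[OF u0'(1), of T'' u T'] T' t by auto
  define u1 where "u1 = Phi \<gamma> \<alpha> u0' v t"
  have u1m: "u1 \<in> borel_measurable lborel"
    unfolding u1_def using jmeas_Phi[OF u0'(1) bsolD(2)[OF v(1)]] by (rule borel_measurable_slice)
  have uu1: "AE x in lborel. u t x = u1 x"
    using bspec[OF v(2), of t] bsolD(4)[OF v(1), of t] t T' by (auto simp: u1_def elim: AE_mp)
  have u1eq: "wnorm q s' (u t) = wnorm q s' u1"
    using wnorm_cong_AE[OF q u1m uu1] .
  \<comment> \<open>Finiteness of the norm at time t: for an infinite norm \<open>enn2real\<close>
    would return 0, and B would not be a bound.\<close>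
  have "wnorm q s' (v t) \<le> ennreal (C0 * enn2real (wnorm q s' u0) + C0 * M powr \<alpha> * t powr \<delta> + enn2real (wnorm q s' u0))"
    using bsol_bnd'[OF data v(1), of t] t T' C0 borel_measurable_slice[OF bsolD(2)[OF v(1)]] by (subst wnorm_le) auto
  from le_less_trans[OF this ennreal_less_top]
  have fin: "wnorm q s' u1 < top"
    using wnorm_cong_AE[OF q u1m, of "v t"] bsolD(4)[OF v(1), of t] t T' by (simp add: u1_def)
  define B where "B = enn2real (wnorm q s' (u t))"
  have B: "bnd r s' (nrm u1) B" "0 \<le> B"
    using wnorm_le[OF u1m, of B s'] fin by (auto simp: B_def u1eq)
  obtain w where "bsol T1 u1 w (2 * C0 * B + 1)"
    using local_solution[OF u1m B T1 small[folded B_def]] by blast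
  from bsol_extend[OF data v(1) this[unfolded u1_def] t(1) T'(1)] T' \<open>\<not> t + T1 \<le> Tm\<close>
  obtain U M' where "bsol (t + T1) u0' U M'" by auto
  from bsol_mild_solution(1)[OF data this] t T1 have "mild_solution \<gamma> \<alpha> q s s' (t + T1) u0' U" by simp
  from mild_le_max_time[OF u0'(1) this] t T1 have "ereal (t + T1) \<le> max_time \<gamma> \<alpha> q s s' u0'" by simp
  with Tm max_time_cong_data(1)[OF u0'(1,2)] \<open>\<not> t + T1 \<le> Tm\<close> show False by simp
qed

text \<open>The contrapositive of \<open>lifespan_ge\<close> with T1 = 2 (Tm - t), which would carry
  the solution past Tm; the constant results from solving the violated smallness condition for the
  norm of u(t).\<close>

lemma blow_up_rate:
  fixes u :: "real \<Rightarrow> 'a \<Rightarrow> 'k::euclidean_space"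
  assumes u0: "u0 \<in> wLq q s'" and u: "maximal_solution \<gamma> \<alpha> q s s' u0 u" and Tm: "max_time \<gamma> \<alpha> q s s' u0 = ereal Tm"
    and t: "0 < t" "t < Tm"
  shows "ennreal ((existence_const * 2 powr \<delta>) powr (- 1 / (\<alpha> - 1)) / (Tm - t) powr (\<delta> / (\<alpha> - 1))) \<le> wnorm q s' (u t)"
proof -
  define B where "B = enn2real (wnorm q s' (u t))"
  have "\<not> existence_const * B powr (\<alpha> - 1) * (2 * (Tm - t)) powr \<delta> \<le> 1"
    using lifespan_ge[OF u0 u Tm t, of "2 * (Tm - t)"] t by (auto simp: B_def)
  then have gt: "1 < existence_const * B powr (\<alpha> - 1) * (2 * (Tm - t)) powr \<delta>" by simp
  define K where "K = existence_const * 2 powr \<delta> * (Tm - t) powr \<delta>"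
  have K: "0 < K" using existence_const_pos t by (simp add: K_def)
  from gt[unfolded powr_mult] have "1 < K * B powr (\<alpha> - 1)" by (simp only: K_def mult_ac)
  then have "1 / K \<le> B powr (\<alpha> - 1)" using K by (simp add: field_simps)
  then have "(1 / K) powr (1 / (\<alpha> - 1)) \<le> (B powr (\<alpha> - 1)) powr (1 / (\<alpha> - 1))"
    using K \<alpha> by (intro powr_mono2) auto
  also have "\<dots> = B" using \<alpha> by (simp add: powr_powr B_def)
  also have "(1 / K) powr (1 / (\<alpha> - 1)) = (existence_const * 2 powr \<delta>) powr (- 1 / (\<alpha> - 1)) / (Tm - t) powr (\<delta> / (\<alpha> - 1))"
    using existence_const_pos t
    by (simp add: K_def powr_divide powr_mult powr_powr powr_minus_divide divide_minus_left)
  finally have le: "(existence_const * 2 powr \<delta>) powr (- 1 / (\<alpha> - 1)) / (Tm - t) powr (\<delta> / (\<alpha> - 1)) \<le> B" .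
  have "mild_solution \<gamma> \<alpha> q s s' t u0 u" using u t by (simp add: maximal_solution_def Tm)
  then have "wnorm q s' (u t) < \<infinity>" using t by (simp add: mild_solution_def continuous_wLq_def wLq_def)
  then have "wnorm q s' (u t) = ennreal B" by (simp add: B_def)
  with le show ?thesis by (simp add: ennreal_leI)
qed

end

theorem theorem1p10:
  fixes d \<gamma> \<alpha> s' s s_c :: real and q :: ereal
  assumes d: "d = real DIM('a::euclidean_space)"
    and gamma: "\<gamma> > - min 2 d"
    and alpha: "\<alpha> > 1 + (2 + \<gamma>) / d"
    and s'_lower: "max (- d / \<alpha>) (\<gamma> / (\<alpha> - 1)) < s'"
    and s'_upper: "s' < (2 + \<gamma>) / (\<alpha> - 1)"
    and q: "1 \<le> q" "ereal \<alpha> \<le> q"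
    and q_lower: "- s' / d < recip q"
    and q_upper: "recip q < min (2 / (d * (\<alpha> - 1)))
                     (min (1 / \<alpha> * (1 - s' / d)) (1 / d * ((2 + \<gamma>) / (\<alpha> - 1) - s')))"
    and s: "(s' + \<gamma>) / \<alpha> \<le> s"
    and s_lower: "- d * recip q < s"
    and s_upper: "s < min ((d + \<gamma>) / \<alpha> - d * recip q) s'"
    and s_c: "s_c = (2 + \<gamma>) / (\<alpha> - 1) - d * recip q"
  shows
    "(\<exists>existence_time :: real \<Rightarrow> real.
        \<comment> \<open>(i) existence and extension\<close>
        (\<forall>u0 :: 'a \<Rightarrow> 'k::{euclidean_space, real_normed_field}. u0 \<in> wLq q s' \<longrightarrow>
          (let T = existence_time (enn2real (wnorm q s' u0)) in
            T > 0 \<and>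
            (\<exists>u. mild_solution \<gamma> \<alpha> q s s' T u0 u \<and>
                 kato_norm q s s' T u \<le> 2 * kato_norm q s s' T (\<lambda>t. heat t u0) \<and>
                 ereal T < max_time \<gamma> \<alpha> q s s' u0 \<and>
                 (\<exists>U. maximal_solution \<gamma> \<alpha> q s s' u0 U \<and>
                      (\<forall>t\<in>{0..T}. AE x in lebesgue. U t x = u t x))))) \<and>
        \<comment> \<open>(iii) continuous dependence\<close>
        (\<forall>(u0 :: 'a \<Rightarrow> 'k) (v0 :: 'a \<Rightarrow> 'k). u0 \<in> wLq q s' \<and> v0 \<in> wLq q s' \<longrightarrow>
          (let Tu = existence_time (enn2real (wnorm q s' u0));
               Tv = existence_time (enn2real (wnorm q s' v0)) in
            \<exists>C>0. \<exists>T>0. T \<le> min Tu Tv \<and>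
              (\<forall>u v. mild_solution \<gamma> \<alpha> q s s' Tu u0 u \<and> mild_solution \<gamma> \<alpha> q s s' Tv v0 v \<longrightarrow>
                max (Linf_wnorm q s' T (\<lambda>t x. u t x - v t x))
                    (kato_norm q s s' T (\<lambda>t x. u t x - v t x))
                  \<le> ennreal C * wnorm q s' (\<lambda>x. u0 x - v0 x))))) \<and>
     \<comment> \<open>(ii) uniqueness\<close>
     (\<forall>(u0 :: 'a \<Rightarrow> 'k) T u v. u0 \<in> wLq q s' \<and> T > 0 \<and>
        u \<in> kato_space q s s' T \<and> v \<in> kato_space q s s' T \<and>
        (AE x in lebesgue. u 0 x = u0 x) \<and> (AE x in lebesgue. v 0 x = u0 x) \<and>
        solves_integral_equation \<gamma> \<alpha> T u0 u \<and> solves_integral_equation \<gamma> \<alpha> T u0 v \<longrightarrow>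
        (\<forall>t\<in>{0..T}. AE x in lebesgue. u t x = v t x)) \<and>
     \<comment> \<open>(iv) blow-up criterion\<close>
     (\<forall>(u0 :: 'a \<Rightarrow> 'k) u Tm. u0 \<in> wLq q s' \<and> maximal_solution \<gamma> \<alpha> q s s' u0 u \<and>
        max_time \<gamma> \<alpha> q s s' u0 = ereal Tm \<longrightarrow>
        ((\<lambda>t. wnorm q s' (u t)) \<longlongrightarrow> \<infinity>) (at_left Tm) \<and>
        (\<exists>C>0. \<forall>t\<in>{0<..<Tm}.
           wnorm q s' (u t) \<ge> ennreal (C / (Tm - t) powr ((s_c - s') / 2))))"
proof -
  define r where "r = recip q"
  have d0: "0 < d" using d by simp
  have \<gamma>: "- 2 < \<gamma>" "- d < \<gamma>" using gamma by auto
  then have "1 < 1 + (2 + \<gamma>) / d" using d0 by simp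
  then have \<alpha>: "1 < \<alpha>" using alpha by linarith
  have r0: "0 \<le> r" and ar: "\<alpha> * r \<le> 1"
    using q \<alpha> unfolding r_def by (cases rule: recip_cases[OF q(1)]; simp add: field_simps)+
  have s'1: "- d * r < s'" using q_lower d0 by (simp add: r_def field_simps)
  have s'2: "s' < d * (1 - r)"
  proof -
    have "r < 1 / \<alpha> * (1 - s' / d)" using q_upper by (simp add: r_def)
    then have "d * (\<alpha> * r) < d - s'" using d0 \<alpha> by (simp add: field_simps)
    moreover have "d * r \<le> d * (\<alpha> * r)" using d0 \<alpha> r0 by (intro mult_left_mono) (auto intro: mult_right_mono[of 1 \<alpha> r, simplified])
    ultimately show ?thesis by (simp add: algebra_simps)
  qed
  have s'3: "(\<alpha> - 1) * s' + d * (\<alpha> - 1) * r < 2 + \<gamma>"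
  proof -
    have "r < 1 / d * ((2 + \<gamma>) / (\<alpha> - 1) - s')" using q_upper by (simp add: r_def)
    then have "d * r + s' < (2 + \<gamma>) / (\<alpha> - 1)" using d0 by (simp add: field_simps)
    then have "(d * r + s') * (\<alpha> - 1) < 2 + \<gamma>" using \<alpha> by (simp add: pos_less_divide_eq)
    then show ?thesis by (simp add: algebra_simps)
  qed
  have s1: "- d * r < s" using s_lower by (simp add: r_def)
  have s2: "s < s'" using s_upper by simp
  have s3: "s' + \<gamma> \<le> \<alpha> * s" using s \<alpha> by (simp add: field_simps)
  have s4: "\<alpha> * s - \<gamma> < d * (1 - \<alpha> * r)"
  proof -
    have "s < (d + \<gamma>) / \<alpha> - d * r" using s_upper by (simp add: r_def)
    then show ?thesis using \<alpha> by (simp add: field_simps)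
  qed
  from kato_setting_exists[OF d \<alpha> r0 ar s1 s2 s3 s4 s'2 s'3]
  obtain a a' C0 e where K: "kato_setting \<gamma> \<alpha> r s s' a a' C0 e TYPE('a)"
    and \<delta>: "1 - a' - \<alpha> * ((s' - s) / 2) = (\<alpha> - 1) / 2 * ((2 + \<gamma>) / (\<alpha> - 1) - d * r - s')" by blast
  interpret K: kato_data \<gamma> \<alpha> r s s' a a' C0 e "TYPE('a)" q
    using K q(1) s'1 s'2 by (simp add: kato_data_def kato_data_axioms_def r_def d)
  \<comment> \<open>Solving a lower bound for B^(\<alpha> - 1) (Tm - t)^\<delta> for B produces the
    exponent \<delta> / (\<alpha> - 1); this is its value in terms of the critical weight.\<close>
  have \<theta>: "K.\<delta> / (\<alpha> - 1) = (s_c - s') / 2"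
  proof -
    have "(\<alpha> - 1) / 2 * X / (\<alpha> - 1) = X / 2" for X using \<alpha> by (simp add: field_simps)
    then show ?thesis unfolding \<delta> s_c r_def[symmetric] .
  qed
  have "\<exists>T>0. K.existence_const * B powr (\<alpha> - 1) * (2 * T) powr K.\<delta> \<le> 1" for B
  proof -
    define k where "k = K.existence_const * B powr (\<alpha> - 1)"
    have k: "0 \<le> k" using K.existence_const_pos by (simp add: k_def)
    \<comment> \<open>k + 1 instead of k covers B = 0; the factor 1/2 matches the time 2 T in
      \<open>local_existence\<close>.\<close>
    define T where "T = (k + 1) powr (- 1 / K.\<delta>) / 2"
    have "2 * T = (k + 1) powr (- 1 / K.\<delta>)" by (simp add: T_def)
    then have "(2 * T) powr K.\<delta> = (k + 1) powr (- 1 / K.\<delta> * K.\<delta>)" by (simp only: powr_powr)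
    also have "- 1 / K.\<delta> * K.\<delta> = - 1" using K.\<delta>_pos nonzero_eq_divide_eq[of K.\<delta> "- 1 / K.\<delta>" "- 1"] by auto
    also have "(k + 1) powr (- 1) = 1 / (k + 1)" using k by (simp add: powr_minus_divide)
    finally have "(2 * T) powr K.\<delta> = 1 / (k + 1)" .
    then have "k * (2 * T) powr K.\<delta> \<le> 1" using k by simp
    moreover have "0 < T" using k by (simp add: T_def)
    ultimately show ?thesis unfolding k_def by blast
  qed
  \<comment> \<open>The time is a function of the norm alone, and the same function serves for
    existence and for the comparison of two solutions.\<close>
  then obtain tm where tm: "\<And>B. 0 < tm B" "\<And>B. K.existence_const * B powr (\<alpha> - 1) * (2 * tm B) powr K.\<delta> \<le> 1"
    by metis
  have tm': "K.existence_const * B powr (\<alpha> - 1) * tm B powr K.\<delta> \<le> 1" for B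
  proof (rule order_trans[OF _ tm(2)])
    show "K.existence_const * B powr (\<alpha> - 1) * tm B powr K.\<delta> \<le> K.existence_const * B powr (\<alpha> - 1) * (2 * tm B) powr K.\<delta>"
      using K.existence_const_pos K.\<delta>_pos less_imp_le[OF tm(1)[of B]] by (intro mult_left_mono powr_mono2) auto
  qed
  have i: "\<forall>u0 :: 'a \<Rightarrow> 'k. u0 \<in> wLq q s' \<longrightarrow>
          (let T = tm (enn2real (wnorm q s' u0)) in
            T > 0 \<and>
            (\<exists>u. mild_solution \<gamma> \<alpha> q s s' T u0 u \<and>
                 kato_norm q s s' T u \<le> 2 * kato_norm q s s' T (\<lambda>t. heat t u0) \<and>
                 ereal T < max_time \<gamma> \<alpha> q s s' u0 \<and>
                 (\<exists>U. maximal_solution \<gamma> \<alpha> q s s' u0 U \<and>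
                      (\<forall>t\<in>{0..T}. AE x in lebesgue. U t x = u t x))))"
    unfolding Let_def by (intro allI impI conjI tm(1) K.local_existence[OF _ tm])
  have iii: "\<forall>(u0 :: 'a \<Rightarrow> 'k) (v0 :: 'a \<Rightarrow> 'k). u0 \<in> wLq q s' \<and> v0 \<in> wLq q s' \<longrightarrow>
          (let Tu = tm (enn2real (wnorm q s' u0));
               Tv = tm (enn2real (wnorm q s' v0)) in
            \<exists>C>0. \<exists>T>0. T \<le> min Tu Tv \<and>
              (\<forall>u v. mild_solution \<gamma> \<alpha> q s s' Tu u0 u \<and> mild_solution \<gamma> \<alpha> q s s' Tv v0 v \<longrightarrow>
                max (Linf_wnorm q s' T (\<lambda>t x. u t x - v t x))
                    (kato_norm q s s' T (\<lambda>t x. u t x - v t x))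
                  \<le> ennreal C * wnorm q s' (\<lambda>x. u0 x - v0 x)))"
    unfolding Let_def
  proof (intro allI impI)
    fix u0 v0 :: "'a \<Rightarrow> 'k" assume uv: "u0 \<in> wLq q s' \<and> v0 \<in> wLq q s'"
    let ?Tu = "tm (enn2real (wnorm q s' u0))" and ?Tv = "tm (enn2real (wnorm q s' v0))"
    show "\<exists>C>0. \<exists>T>0. T \<le> min ?Tu ?Tv \<and>
              (\<forall>u v. mild_solution \<gamma> \<alpha> q s s' ?Tu u0 u \<and> mild_solution \<gamma> \<alpha> q s s' ?Tv v0 v \<longrightarrow>
                max (Linf_wnorm q s' T (\<lambda>t x. u t x - v t x))
                    (kato_norm q s s' T (\<lambda>t x. u t x - v t x))
                  \<le> ennreal C * wnorm q s' (\<lambda>x. u0 x - v0 x))"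
    proof (intro exI conjI allI impI)
      show "0 < 2 * C0" using K.C0 by simp
      show "0 < min ?Tu ?Tv" using tm(1) by simp
      show "min ?Tu ?Tv \<le> min ?Tu ?Tv" ..
      fix u v assume "mild_solution \<gamma> \<alpha> q s s' ?Tu u0 u \<and> mild_solution \<gamma> \<alpha> q s s' ?Tv v0 v"
      with K.continuous_dependence[OF conjunct1[OF uv] conjunct2[OF uv] \<open>0 < min ?Tu ?Tv\<close> _ _ tm' tm']
      show "max (Linf_wnorm q s' (min ?Tu ?Tv) (\<lambda>t x. u t x - v t x))
          (kato_norm q s s' (min ?Tu ?Tv) (\<lambda>t x. u t x - v t x)) \<le> ennreal (2 * C0) * wnorm q s' (\<lambda>x. u0 x - v0 x)"
        by simp
    qed
  qed
  have ii: "\<forall>(u0 :: 'a \<Rightarrow> 'k) T u v. u0 \<in> wLq q s' \<and> T > 0 \<and>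
        u \<in> kato_space q s s' T \<and> v \<in> kato_space q s s' T \<and>
        (AE x in lebesgue. u 0 x = u0 x) \<and> (AE x in lebesgue. v 0 x = u0 x) \<and>
        solves_integral_equation \<gamma> \<alpha> T u0 u \<and> solves_integral_equation \<gamma> \<alpha> T u0 v \<longrightarrow>
        (\<forall>t\<in>{0..T}. AE x in lebesgue. u t x = v t x)"
  proof (intro allI impI ballI)
    fix u0 :: "'a \<Rightarrow> 'k" and T u v t
    assume *: "u0 \<in> wLq q s' \<and> T > 0 \<and>
        u \<in> kato_space q s s' T \<and> v \<in> kato_space q s s' T \<and>
        (AE x in lebesgue. u 0 x = u0 x) \<and> (AE x in lebesgue. v 0 x = u0 x) \<and>
        solves_integral_equation \<gamma> \<alpha> T u0 u \<and> solves_integral_equation \<gamma> \<alpha> T u0 v" and t: "t \<in> {0..T}"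
    then obtain u0' where "u0' \<in> borel_measurable lborel" "AE x in lborel. u0 x = u0' x"
      using K.wLq_representative by blast
    from K.solution_unique[OF this, of u T v t] * t show "AE x in lebesgue. u t x = v t x"
      by (simp add: AE_completion_iff)
  qed
  have iv: "\<forall>(u0 :: 'a \<Rightarrow> 'k) u Tm. u0 \<in> wLq q s' \<and> maximal_solution \<gamma> \<alpha> q s s' u0 u \<and>
        max_time \<gamma> \<alpha> q s s' u0 = ereal Tm \<longrightarrow>
        ((\<lambda>t. wnorm q s' (u t)) \<longlongrightarrow> \<infinity>) (at_left Tm) \<and>
        (\<exists>C>0. \<forall>t\<in>{0<..<Tm}.
           wnorm q s' (u t) \<ge> ennreal (C / (Tm - t) powr ((s_c - s') / 2)))"
  proof (intro allI impI conjI)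
    fix u0 :: "'a \<Rightarrow> 'k" and u Tm
    assume *: "u0 \<in> wLq q s' \<and> maximal_solution \<gamma> \<alpha> q s s' u0 u \<and> max_time \<gamma> \<alpha> q s s' u0 = ereal Tm"
    define C where "C = (K.existence_const * 2 powr K.\<delta>) powr (- 1 / (\<alpha> - 1))"
    have C: "0 < C" using K.existence_const_pos by (simp add: C_def)
    define \<theta> where "\<theta> = (s_c - s') / 2"
    have \<theta>0: "0 < \<theta>" unfolding \<theta>_def \<theta>[symmetric] using K.\<delta>_pos \<alpha> by simp
    have rate: "ennreal (C / (Tm - t) powr \<theta>) \<le> wnorm q s' (u t)" if "0 < t" "t < Tm" for t
      using K.blow_up_rate[of u0 u Tm t] * that unfolding \<theta> C_def \<theta>_def by blast
    then show "\<exists>C>0. \<forall>t\<in>{0<..<Tm}. wnorm q s' (u t) \<ge> ennreal (C / (Tm - t) powr ((s_c - s') / 2))"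
      using C unfolding \<theta>_def by (intro exI[of _ C]) auto
    \<comment> \<open>The maximal time exceeds a positive existence time, so (0, Tm), where the rate
      holds, is a left neighbourhood of Tm.\<close>
    have "ereal (tm (enn2real (wnorm q s' u0))) < ereal Tm" using i * by (metis)
    then have Tm: "0 < Tm" using tm(1)[of "enn2real (wnorm q s' u0)"] by simp
    have "filterlim (\<lambda>t. C / (Tm - t) powr \<theta>) at_top (at_left Tm)"
      using C \<theta>0 by real_asymp
    then have lim: "((\<lambda>t. ennreal (C / (Tm - t) powr \<theta>)) \<longlongrightarrow> \<infinity>) (at_left Tm)"
      by (simp add: ennreal_tendsto_top_eq_at_top)
    show "((\<lambda>t. wnorm q s' (u t)) \<longlongrightarrow> \<infinity>) (at_left Tm)"
    proof (rule tendsto_sandwich[OF _ _ lim tendsto_const])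
      show "eventually (\<lambda>t. ennreal (C / (Tm - t) powr \<theta>) \<le> wnorm q s' (u t)) (at_left Tm)"
        using eventually_at_left_real[OF Tm] by eventually_elim (use rate in auto)
    qed simp
  qed
  show ?thesis using i iii ii iv by blast
qed

end
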